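(* Let $(X,g)$ be a compact connected Riemannian manifold, let $d$ be its geodesic metric, and let $\rho$ be a faithful isometric action of a reduced compact quantum group $A$ on the compact metric space $(X,d)$. If $(X,g)$ has (strictly) negative sectional curvature everywhere, then $\rho$ has finite orbits, i.e. $\mathrm{Orb}_x$ is finite for every $x\in X$.
   Context: All $C^*$-algebras and homomorphisms are unital, and $\otimes$ between $C^*$-algebras is the minimal tensor product. $S(A)$ denotes the set of states of $A$; $C(X)$ is the algebra of continuous functions on $X$; $\mathrm{Prob}(X)=S(C(X))$ is the set of probability measures on $X$; points $x\in X$ are identified with Dirac measures $\delta_x$. Compact quantum group: a unital $C^*$-algebra $A$ with a $C^*$-homomorphism $\Delta:A\to A\otimes A$ such that $(\Delta\otimes\mathrm{id})\Delta=(\mathrm{id}\otimes\Delta)\Delta$ and the linear spans of $\{(a\otimes 1)\Delta(b): a,b\in A\}$ and of $\{(1\otimes a)\Delta(b): a,b\in A\}$ are norm-dense in $A\otimes A$. It has a unique Haar state $h\in S(A)$, satisfying $(h\otimes\varphi)\Delta=(\varphi\otimes h)\Delta=h$ for all $\varphi\in S(A)$. $A$ is reduced if $h$ is faithful. Action on a compact Hausdorff space $X$: a $C^*$-homomorphism $\rho:C(X)\to C(X)\otimes A$ with $(\rho\otimes\mathrm{id})\rho=(\mathrm{id}\otimes\Delta)\rho$ and such that the linear span of $\{(1\otimes a)\rho(f): a\in A, f\in C(X)\}$ is dense in $C(X)\otimes A$. The action is faithful if $\{(\mu\otimes\mathrm{id})(\rho(f)): f\in C(X),\ \mu\in S(C(X))\}$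 generates $A$ as a $C^*$-algebra. For $\mu\in\mathrm{Prob}(X)$ and $\varphi\in S(A)$, let $\mu\triangleleft\varphi=(\mu\otimes\varphi)\circ\rho\in\mathrm{Prob}(X)$. A reduced quantum group acting faithfully on a compact space is of Kac type: it has an antipode $\kappa$, i.e. the antipode of its dense Hopf $*$-subalgebra of representative functions extends to a bounded, involutive, multiplication-reversing map $\kappa:A\to A$. Isometric action: let $(X,d)$ be a compact metric space and let $d_x\in C(X)$ be given by $d_x(y)=d(x,y)$. For $f\in C(X)$ and $x\in X$ let $\rho(f)(x)\in A$ be the evaluation at $x$ of the left tensorand of $\rho(f)$. A faithful action $\rho$ of a reduced quantum group $A$ is isometric if $\rho(d_y)(x)=\kappa(\rho(d_x)(y))$ for all $x,y\in X$. Orbits: $\mathrm{Orb}_x=\{y\in X: y\triangleleft h=x\triangleleft h\}$; for isometric actions this coincides with the support of $x\triangleleft h$ and with $\{y\in X:\exists\varphi\in S(A),\ x\triangleleft\varphi=y\}$.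
   Formalization: The manifold is assumed to have dimension at least 2: in dimension 1 negative sectional curvature is vacuous and the claim fails (the circle group rotating the circle has an infinite orbit); the trivial one-point manifold is also excluded. *)

theory Defs
  imports "HOL-Analysis.Analysis"
begin

section \<open>C*-algebras\<close>

text \<open>
  The zero algebra is not excluded; it has no states.
\<close>

class star_algebra = real_algebra + monoid_mult +
  fixes scaleC :: "complex \<Rightarrow> 'a \<Rightarrow> 'a" (infixr \<open>*\<^sub>C\<close> 75)
    and star :: "'a \<Rightarrow> 'a"
  assumes scaleC_add_right: "c *\<^sub>C (x + y) = c *\<^sub>C x + c *\<^sub>C y"
    and scaleC_add_left: "(c + d) *\<^sub>C x = c *\<^sub>C x + d *\<^sub>C x"
    and scaleC_scaleC: "c *\<^sub>C d *\<^sub>C x = (c * d) *\<^sub>C x"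
    and scaleR_scaleC: "r *\<^sub>R x = complex_of_real r *\<^sub>C x"
    and mult_scaleC_left: "(c *\<^sub>C x) * y = c *\<^sub>C (x * y)"
    and mult_scaleC_right: "x * (c *\<^sub>C y) = c *\<^sub>C (x * y)"
    and star_add: "star (x + y) = star x + star y"
    and star_scaleC: "star (c *\<^sub>C x) = cnj c *\<^sub>C star x"
    and star_mult: "star (x * y) = star y * star x"
    and star_star [simp]: "star (star x) = x"

class cstar_algebra = star_algebra + real_normed_algebra + banach +
  assumes norm_scaleC: "norm (c *\<^sub>C x) = cmod c * norm x"
    and cstar_identity: "norm (star x * x) = (norm x)\<^sup>2"

class cstar_seminormed_algebra = star_algebra +
  fixes cstar_seminorm :: "'a \<Rightarrow> real"
  assumes cstar_seminorm_add: "cstar_seminorm (x + y) \<le> cstar_seminorm x + cstar_seminorm y"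
    and cstar_seminorm_scaleC: "cstar_seminorm (c *\<^sub>C x) = cmod c * cstar_seminorm x"
    and cstar_seminorm_mult: "cstar_seminorm (x * y) \<le> cstar_seminorm x * cstar_seminorm y"
    and cstar_seminorm_star_mult: "cstar_seminorm (star x * x) = (cstar_seminorm x)\<^sup>2"

definition clinear :: "('a::star_algebra \<Rightarrow> 'b::star_algebra) \<Rightarrow> bool"
  where "clinear f \<longleftrightarrow> (\<forall>x y. f (x + y) = f x + f y) \<and> (\<forall>c x. f (c *\<^sub>C x) = c *\<^sub>C f x)"

instantiation complex :: cstar_algebra
begin
definition scaleC_complex :: "complex \<Rightarrow> complex \<Rightarrow> complex" where [simp]: "scaleC_complex = (*)"
definition star_complex :: "complex \<Rightarrow> complex" where [simp]: "star_complex = cnj"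
instance
  by standard (auto simp: algebra_simps scaleR_conv_of_real norm_mult power2_eq_square)
end

lemma scaleC_one [simp]: "1 *\<^sub>C x = (x :: 'a::star_algebra)"
  using scaleR_scaleC[of 1 x] by simp
lemma scaleC_zero_left [simp]: "0 *\<^sub>C x = (0 :: 'a::star_algebra)"
  using scaleR_scaleC[of 0 x] by simp
lemma scaleC_zero_right [simp]: "c *\<^sub>C 0 = (0 :: 'a::star_algebra)"
  using scaleC_add_right[of c 0 0] by simp
lemma scaleC_minus_one [simp]: "(-1) *\<^sub>C x = - (x :: 'a::star_algebra)"
  using scaleR_scaleC[of "-1" x] by simp
lemma scaleC_minus_left: "(- c) *\<^sub>C x = - (c *\<^sub>C x :: 'a::star_algebra)"
  using scaleC_scaleC[of "-1" c x] by simp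
lemma scaleC_minus_right: "c *\<^sub>C (- x) = - (c *\<^sub>C x :: 'a::star_algebra)"
  using scaleC_scaleC[of c "-1" x] scaleC_minus_left[of c x] by (metis mult.commute mult_minus1 scaleC_minus_one scaleC_scaleC)
lemma scaleC_diff_right: "c *\<^sub>C (x - y) = c *\<^sub>C x - (c *\<^sub>C y :: 'a::star_algebra)"
  using scaleC_add_right[of c x "- y"] by (simp add: scaleC_minus_right)
lemma star_zero [simp]: "star 0 = (0 :: 'a::star_algebra)"
  using star_scaleC[of 0 "0::'a"] by simp
lemma star_minus: "star (- x) = - star (x :: 'a::star_algebra)"
  using star_scaleC[of "-1" x] by simp
lemma star_one [simp]: "star 1 = (1 :: 'a::star_algebra)"
  using star_mult[of "star (1::'a)" 1] by simp

definition positive_functional :: "('a::star_algebra \<Rightarrow> complex) \<Rightarrow> bool"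
  where "positive_functional \<phi> \<longleftrightarrow> clinear \<phi> \<and> (\<forall>x. \<phi> (star x * x) \<in> \<real>\<^sub>\<ge>\<^sub>0)"

definition state :: "('a::cstar_algebra \<Rightarrow> complex) \<Rightarrow> bool"
  where "state \<phi> \<longleftrightarrow> positive_functional \<phi> \<and> bounded_linear \<phi> \<and> \<phi> 1 = 1"

definition functional_seminorm :: "('a::star_algebra \<Rightarrow> complex) \<Rightarrow> 'a \<Rightarrow> real"
  where "functional_seminorm \<phi> x = sqrt (Re (\<phi> (star x * x)))"

lemma clinear_add: "clinear f \<Longrightarrow> f (x + y) = f x + f y"
  and clinear_scaleC: "clinear f \<Longrightarrow> f (c *\<^sub>C x) = c *\<^sub>C f x"
  by (auto simp: clinear_def)
lemma clinear_zero: "clinear f \<Longrightarrow> f 0 = 0"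
  using clinear_scaleC[of f 0 0] by simp
lemma clinear_minus: "clinear f \<Longrightarrow> f (- x) = - f x"
  using clinear_scaleC[of f "-1" x] by simp
lemma clinear_sum: "clinear f \<Longrightarrow> f (sum g A) = (\<Sum>i\<in>A. f (g i))"
  by (induction A rule: infinite_finite_induct) (auto simp: clinear_zero clinear_add)

lemma pos_fun_clinear: "positive_functional \<phi> \<Longrightarrow> clinear \<phi>"
  by (simp add: positive_functional_def)
lemma pos_fun_real: "positive_functional \<phi> \<Longrightarrow> \<phi> (star x * x) = of_real (Re (\<phi> (star x * x)))"
  by (auto simp: positive_functional_def complex_nonneg_Reals_iff complex_eq_iff)
lemma pos_fun_nonneg: "positive_functional \<phi> \<Longrightarrow> 0 \<le> Re (\<phi> (star x * x))"
  by (auto simp: positive_functional_def complex_nonneg_Reals_iff)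

lemma positive_functional_star:
  assumes "positive_functional \<phi>"
  shows "\<phi> (star x) = cnj (\<phi> x)"
proof -
  note cl = pos_fun_clinear[OF assms]
  have im: "Im (\<phi> (star z * z)) = 0" for z
    using assms by (auto simp: positive_functional_def complex_nonneg_Reals_iff)
  have "star (1 + x) * (1 + x) = 1 + x + star x + star x * x"
    by (simp add: star_add algebra_simps)
  with im[of "1 + x"] im[of 1] im[of x] have 1: "Im (\<phi> x) + Im (\<phi> (star x)) = 0"
    by (simp add: clinear_add[OF cl])
  have "star (1 + \<i> *\<^sub>C x) * (1 + \<i> *\<^sub>C x)
      = 1 + \<i> *\<^sub>C x + (-\<i>) *\<^sub>C star x + star x * x"
    by (simp add: star_add star_scaleC algebra_simps mult_scaleC_left mult_scaleC_right scaleC_scaleC scaleC_diff_right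
        scaleC_minus_left scaleC_minus_right)
  with im[of "1 + \<i> *\<^sub>C x"] im[of 1] im[of x] have 2: "Re (\<phi> x) - Re (\<phi> (star x)) = 0"
    by (simp add: clinear_add[OF cl] clinear_scaleC[OF cl])
  from 1 2 show ?thesis by (simp add: complex_eq_iff)
qed

lemma functional_seminorm_nonneg: "positive_functional \<phi> \<Longrightarrow> 0 \<le> functional_seminorm \<phi> x"
  by (simp add: functional_seminorm_def pos_fun_nonneg)

lemma functional_seminorm_sq:
  "positive_functional \<phi> \<Longrightarrow> \<phi> (star x * x) = of_real ((functional_seminorm \<phi> x)\<^sup>2)"
  using pos_fun_real[of \<phi> x] pos_fun_nonneg[of \<phi> x]
  by (metis functional_seminorm_def real_sqrt_pow2)

lemma positive_functional_Cauchy_Schwarz: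
  assumes pos: "positive_functional \<phi>"
  shows "cmod (\<phi> (star y * x)) \<le> functional_seminorm \<phi> y * functional_seminorm \<phi> x"
proof -
  note cl = pos_fun_clinear[OF pos]
  define a where "a = functional_seminorm \<phi> x"
  define b where "b = functional_seminorm \<phi> y"
  define w where "w = \<phi> (star y * x)"
  have w': "\<phi> (star x * y) = cnj w"
    using positive_functional_star[OF pos, of "star y * x"] by (simp add: w_def star_mult)
  have ab: "0 \<le> a" "0 \<le> b" using functional_seminorm_nonneg[OF pos] by (auto simp: a_def b_def)
  have expand: "0 \<le> t\<^sup>2 * a\<^sup>2 - 2 * t * (cmod w)\<^sup>2 + (cmod w)\<^sup>2 * b\<^sup>2" for t :: real
  proof -
    let ?z = "complex_of_real t *\<^sub>C x + (- w) *\<^sub>C y"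
    have "\<phi> (star ?z * ?z) = (of_real t)\<^sup>2 * \<phi> (star x * x) - of_real t * w * \<phi> (star x * y)
        - of_real t * cnj w * \<phi> (star y * x) + cnj w * w * \<phi> (star y * y)"
      by (simp add: star_add star_scaleC distrib_left distrib_right mult_scaleC_left mult_scaleC_right
          scaleC_scaleC clinear_add[OF cl] clinear_scaleC[OF cl] power2_eq_square algebra_simps)
    also have "\<dots> = of_real (t\<^sup>2 * a\<^sup>2 - 2 * t * (cmod w)\<^sup>2 + (cmod w)\<^sup>2 * b\<^sup>2)"
      unfolding w' w_def[symmetric] functional_seminorm_sq[OF pos] a_def[symmetric] b_def[symmetric]
      using complex_norm_square[of w] by (simp add: algebra_simps)
    finally show ?thesis using pos_fun_nonneg[OF pos, of ?z] by simp
  qed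
  show ?thesis
  proof (cases "a = 0")
    case True
    have "cmod w = 0"
    proof (rule ccontr)
      assume "cmod w \<noteq> 0"
      then have p: "(cmod w)\<^sup>2 > 0" by simp
      have "2 * ((b\<^sup>2 + 1)/2) * (cmod w)\<^sup>2 \<le> (cmod w)\<^sup>2 * b\<^sup>2"
        using expand[of "(b\<^sup>2 + 1) / 2"] True by simp
      with p show False by (simp add: algebra_simps)
    qed
    with True ab show ?thesis by (simp add: a_def b_def w_def)
  next
    case False
    with ab have "a > 0" by simp
    have "0 \<le> ((cmod w)\<^sup>2 / a\<^sup>2)\<^sup>2 * a\<^sup>2 - 2 * ((cmod w)\<^sup>2 / a\<^sup>2) * (cmod w)\<^sup>2 + (cmod w)\<^sup>2 * b\<^sup>2"
      by (rule expand)
    also have "\<dots> = (cmod w)\<^sup>2 * (b\<^sup>2 - (cmod w)\<^sup>2 / a\<^sup>2)"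
      using \<open>a > 0\<close> by (simp add: field_simps power2_eq_square)
    finally have "cmod w = 0 \<or> (cmod w)\<^sup>2 / a\<^sup>2 \<le> b\<^sup>2"
      by (auto simp: zero_le_mult_iff)
    then have "(cmod w)\<^sup>2 \<le> (b * a)\<^sup>2"
    proof
      assume "(cmod w)\<^sup>2 / a\<^sup>2 \<le> b\<^sup>2"
      then show ?thesis using \<open>a > 0\<close> by (simp add: divide_simps power_mult_distrib split: if_splits)
    qed simp
    then have "cmod w \<le> b * a" using ab by (meson mult_nonneg_nonneg power2_le_imp_le)
    then show ?thesis by (simp add: a_def b_def w_def)
  qed
qed

lemma functional_seminorm_triangle:
  assumes pos: "positive_functional \<phi>"
  shows "functional_seminorm \<phi> (x + y) \<le> functional_seminorm \<phi> x + functional_seminorm \<phi> y"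
proof -
  note cl = pos_fun_clinear[OF pos]
  let ?N = "functional_seminorm \<phi>"
  have "of_real ((?N (x + y))\<^sup>2) = \<phi> (star x * x) + \<phi> (star x * y) + \<phi> (star y * x) + \<phi> (star y * y)"
    unfolding functional_seminorm_sq[OF pos, symmetric]
    by (simp add: star_add distrib_left distrib_right clinear_add[OF cl])
  then have "(?N (x + y))\<^sup>2 = Re (\<phi> (star x * x) + \<phi> (star x * y) + \<phi> (star y * x) + \<phi> (star y * y))"
    by (metis Re_complex_of_real)
  also have "\<dots> = (?N x)\<^sup>2 + Re (\<phi> (star x * y)) + Re (\<phi> (star y * x)) + (?N y)\<^sup>2"
    by (simp add: functional_seminorm_sq[OF pos])
  also have "\<dots> \<le> (?N x)\<^sup>2 + ?N x * ?N y + ?N y * ?N x + (?N y)\<^sup>2"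
    using positive_functional_Cauchy_Schwarz[OF pos, of x y] positive_functional_Cauchy_Schwarz[OF pos, of y x]
      complex_Re_le_cmod[of "\<phi> (star x * y)"] complex_Re_le_cmod[of "\<phi> (star y * x)"] by linarith
  also have "\<dots> = (?N x + ?N y)\<^sup>2" by (simp add: power2_eq_square algebra_simps)
  finally show ?thesis
    using functional_seminorm_nonneg[OF pos] by (meson add_nonneg_nonneg power2_le_imp_le)
qed

lemma functional_seminorm_scaleC:
  assumes pos: "positive_functional \<phi>"
  shows "functional_seminorm \<phi> (c *\<^sub>C x) = cmod c * functional_seminorm \<phi> x"
proof -
  note cl = pos_fun_clinear[OF pos]
  let ?N = "functional_seminorm \<phi>"
  have "\<phi> (star (c *\<^sub>C x) * (c *\<^sub>C x)) = of_real ((cmod c * ?N x)\<^sup>2)"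
    using complex_norm_square[of c]
    by (simp add: star_scaleC mult_scaleC_left mult_scaleC_right scaleC_scaleC clinear_scaleC[OF cl]
        functional_seminorm_sq[OF pos] power_mult_distrib mult_ac)
  then have "(?N (c *\<^sub>C x))\<^sup>2 = (cmod c * ?N x)\<^sup>2"
    unfolding functional_seminorm_sq[OF pos] by (simp only: of_real_eq_iff)
  then show ?thesis using functional_seminorm_nonneg[OF pos]
    by (metis mult_nonneg_nonneg norm_ge_zero power2_eq_iff_nonneg)
qed

lemma positive_functional_power_bound:
  assumes pos: "positive_functional \<phi>" and h: "star h = h" and r: "r > 0"
    and bd: "\<And>m. cmod (\<phi> (star y * h ^ m * y)) \<le> M * r ^ m"
  shows "cmod (\<phi> (star y * h * y)) \<le> r * (functional_seminorm \<phi> y)\<^sup>2"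
proof -
  let ?f = "\<lambda>m. cmod (\<phi> (star y * h ^ m * y))"
  define s where "s = functional_seminorm \<phi> y"
  have s0: "s \<ge> 0" using functional_seminorm_nonneg[OF pos] by (simp add: s_def)
  have hm: "star (h ^ m) = h ^ m" for m
    by (induction m) (auto simp: star_mult h power_commutes)
  have step: "(?f m)\<^sup>2 \<le> s\<^sup>2 * ?f (2 * m)" for m
  proof -
    have "?f m \<le> s * functional_seminorm \<phi> (h ^ m * y)"
      using positive_functional_Cauchy_Schwarz[OF pos, of y "h ^ m * y"] by (simp add: s_def mult.assoc)
    then have "(?f m)\<^sup>2 \<le> (s * functional_seminorm \<phi> (h ^ m * y))\<^sup>2"
      by (intro power_mono) auto
    also have "\<dots> = s\<^sup>2 * cmod (\<phi> (star (h ^ m * y) * (h ^ m * y)))"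
      by (simp add: functional_seminorm_sq[OF pos] power_mult_distrib norm_power)
    also have "star (h ^ m * y) * (h ^ m * y) = star y * h ^ (2 * m) * y"
      by (simp add: star_mult hm mult.assoc power_add mult_2)
    finally show ?thesis .
  qed
  show ?thesis
  proof (cases "s = 0")
    case True
    then show ?thesis using step[of 1] by (simp add: s_def)
  next
    case False
    with s0 have sp: "s\<^sup>2 > 0" by simp
    have it: "(?f 1 / s\<^sup>2) ^ (2 ^ n) \<le> ?f (2 ^ n) / s\<^sup>2" for n
    proof (induction n)
      case (Suc n)
      have "(?f 1 / s\<^sup>2) ^ (2 ^ Suc n) = ((?f 1 / s\<^sup>2) ^ (2 ^ n))\<^sup>2"
        by (simp add: power_mult[symmetric] mult.commute)
      also have "\<dots> \<le> (?f (2 ^ n) / s\<^sup>2)\<^sup>2"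
        by (intro power_mono Suc) auto
      also have "\<dots> \<le> (s\<^sup>2 * ?f (2 * 2 ^ n)) / (s\<^sup>2)\<^sup>2"
        using step[of "2 ^ n"] by (simp add: power_divide divide_right_mono)
      also have "\<dots> = ?f (2 ^ Suc n) / s\<^sup>2" using sp by (simp add: power2_eq_square)
      finally show ?case .
    qed simp
    define q where "q = ?f 1 / s\<^sup>2 / r"
    have q0: "q \<ge> 0" using r by (simp add: q_def)
    have qb: "q ^ (2 ^ n) \<le> M / s\<^sup>2" for n
    proof -
      have "q ^ (2 ^ n) = (?f 1 / s\<^sup>2) ^ (2 ^ n) / r ^ (2 ^ n)"
        by (simp add: q_def power_divide power_mult_distrib)
      also have "\<dots> \<le> (?f (2 ^ n) / s\<^sup>2) / r ^ (2 ^ n)"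
        using it[of n] r by (intro divide_right_mono) auto
      also have "\<dots> \<le> (M * r ^ (2 ^ n) / s\<^sup>2) / r ^ (2 ^ n)"
        using bd[of "2 ^ n"] r sp by (intro divide_right_mono) auto
      also have "\<dots> = M / s\<^sup>2" using r by simp
      finally show ?thesis .
    qed
    have "q \<le> 1"
    proof (rule ccontr)
      assume "\<not> q \<le> 1"
      then have "q > 1" by simp
      then obtain n where n: "M / s\<^sup>2 < q ^ n" using real_arch_pow by blast
      have "q ^ n \<le> q ^ (2 ^ n)" using \<open>q > 1\<close> by (intro power_increasing) (auto simp: less_imp_le)
      with n qb[of n] show False by linarith
    qed
    then show ?thesis using r sp by (simp add: q_def field_simps s_def)
  qed
qed

section \<open>The algebraic tensor product\<close>

text \<open>
  A list of pairs stands for the sum of the corresponding elementary tensors; two sums are equal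
  if all scalar-valued bilinear maps agree on them.
\<close>

definition cbilinear :: "('a::star_algebra \<Rightarrow> 'b::star_algebra \<Rightarrow> complex) \<Rightarrow> bool"
  where "cbilinear \<beta> \<longleftrightarrow> (\<forall>a. clinear (\<beta> a)) \<and> (\<forall>b. clinear (\<lambda>a. \<beta> a b))"

definition bilin_eval :: "('a \<Rightarrow> 'b \<Rightarrow> complex) \<Rightarrow> ('a \<times> 'b) list \<Rightarrow> complex"
  where "bilin_eval \<beta> xs = (\<Sum>(a, b)\<leftarrow>xs. \<beta> a b)"

quotient_type (overloaded) ('a, 'b) alg_tensor = "('a::star_algebra \<times> 'b::star_algebra) list" /
  "\<lambda>xs ys. \<forall>\<beta>. cbilinear \<beta> \<longrightarrow> bilin_eval \<beta> xs = bilin_eval \<beta> ys"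
  by (rule equivpI) (auto simp: reflp_def symp_def transp_def)

lemma bilin_eval_simps [simp]:
  "bilin_eval \<beta> [] = 0" "bilin_eval \<beta> ((a, b) # xs) = \<beta> a b + bilin_eval \<beta> xs"
  "bilin_eval \<beta> (xs @ ys) = bilin_eval \<beta> xs + bilin_eval \<beta> ys"
  by (auto simp: bilin_eval_def)

lemma bilin_eval_concat:
  "bilin_eval \<beta> (concat xss) = (\<Sum>xs\<leftarrow>xss. bilin_eval \<beta> xs)"
  by (induction xss) auto

lemma cbilinearD:
  assumes "cbilinear \<beta>"
  shows "\<beta> (a + a') b = \<beta> a b + \<beta> a' b" "\<beta> a (b + b') = \<beta> a b + \<beta> a b'"
    "\<beta> (c *\<^sub>C a) b = c * \<beta> a b" "\<beta> a (c *\<^sub>C b) = c * \<beta> a b"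
    "\<beta> 0 b = 0" "\<beta> a 0 = 0" "\<beta> (- a) b = - \<beta> a b" "\<beta> a (- b) = - \<beta> a b"
proof -
  have 1: "clinear (\<beta> a)" "clinear (\<lambda>a. \<beta> a b)" for a b using assms by (auto simp: cbilinear_def)
  show "\<beta> (a + a') b = \<beta> a b + \<beta> a' b" "\<beta> a (b + b') = \<beta> a b + \<beta> a b'"
    "\<beta> (c *\<^sub>C a) b = c * \<beta> a b" "\<beta> a (c *\<^sub>C b) = c * \<beta> a b"
    "\<beta> 0 b = 0" "\<beta> a 0 = 0" "\<beta> (- a) b = - \<beta> a b" "\<beta> a (- b) = - \<beta> a b"
    using clinear_add[OF 1(1)] clinear_add[OF 1(2)] clinear_scaleC[OF 1(1)] clinear_scaleC[OF 1(2)]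
      clinear_zero[OF 1(1)] clinear_zero[OF 1(2)] clinear_minus[OF 1(1)] clinear_minus[OF 1(2)]
    by auto
qed

lemma cbilinearI:
  assumes "\<And>a a' b. \<beta> (a + a') b = \<beta> a b + \<beta> a' b" "\<And>a b b'. \<beta> a (b + b') = \<beta> a b + \<beta> a b'"
    "\<And>a b c. \<beta> (c *\<^sub>C a) b = c * \<beta> a b" "\<And>a b c. \<beta> a (c *\<^sub>C b) = c * \<beta> a b"
  shows "cbilinear \<beta>"
  using assms by (auto simp: cbilinear_def clinear_def)

lemma bilin_eval_map_scale:
  "cbilinear \<beta> \<Longrightarrow> bilin_eval \<beta> (map (\<lambda>(a, b). (c *\<^sub>C a, b)) xs) = c * bilin_eval \<beta> xs"
  by (induction xs) (auto simp: cbilinearD algebra_simps)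

lemma bilin_eval_map_star:
  "bilin_eval \<beta> (map (\<lambda>(a, b). (star a, star b)) xs) = cnj (bilin_eval (\<lambda>a b. cnj (\<beta> (star a) (star b))) xs)"
  by (induction xs) auto

lemma bilin_eval_map_star': "bilin_eval \<beta> (map (\<lambda>(a, b). (star a, star b)) xs) = bilin_eval (\<lambda>a b. \<beta> (star a) (star b)) xs"
  by (induction xs) auto

lemma cbilinear_star: "cbilinear \<beta> \<Longrightarrow> cbilinear (\<lambda>a b. cnj (\<beta> (star a) (star b)))"
  by (rule cbilinearI) (auto simp: cbilinearD star_add star_scaleC)

definition list_times :: "('a::star_algebra \<times> 'b::star_algebra) list \<Rightarrow> ('a \<times> 'b) list \<Rightarrow> ('a \<times> 'b) list"
  where "list_times xs ys = concat (map (\<lambda>(a, b). map (\<lambda>(a', b'). (a * a', b * b')) ys) xs)"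

lemma bilin_eval_map_mult:
  "bilin_eval \<beta> (map (\<lambda>(a', b'). (a * a', b * b')) ys) = bilin_eval (\<lambda>a' b'. \<beta> (a * a') (b * b')) ys"
  by (induction ys) auto

lemma bilin_eval_list_times:
  "bilin_eval \<beta> (list_times xs ys) = bilin_eval (\<lambda>a b. bilin_eval (\<lambda>a' b'. \<beta> (a * a') (b * b')) ys) xs"
  by (induction xs) (auto simp: list_times_def bilin_eval_map_mult)

lemma bilin_eval_add_fun: "bilin_eval (\<lambda>a b. \<beta> a b + \<gamma> a b) xs = bilin_eval \<beta> xs + bilin_eval \<gamma> xs"
  by (induction xs) auto
lemma bilin_eval_mult_fun: "bilin_eval (\<lambda>a b. c * \<beta> a b) xs = c * bilin_eval \<beta> xs"
  by (induction xs) (auto simp: algebra_simps)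
lemma bilin_eval_zero_fun: "bilin_eval (\<lambda>a b. 0) xs = 0"
  by (induction xs) auto

lemma bilin_eval_swap:
  "bilin_eval (\<lambda>a b. bilin_eval (\<lambda>a' b'. \<beta> a b a' b') ys) xs
    = bilin_eval (\<lambda>a' b'. bilin_eval (\<lambda>a b. \<beta> a b a' b') xs) ys"
  by (induction xs) (auto simp: bilin_eval_add_fun bilin_eval_zero_fun)

lemma cbilinear_mult_left: "cbilinear \<beta> \<Longrightarrow> cbilinear (\<lambda>a' b'. \<beta> (a * a') (b * b'))"
  by (rule cbilinearI) (auto simp: cbilinearD distrib_left mult_scaleC_right)

lemma cbilinear_mult_right: "cbilinear \<beta> \<Longrightarrow> cbilinear (\<lambda>a' b'. \<beta> (a' * a) (b' * b))"
  by (rule cbilinearI) (auto simp: cbilinearD distrib_right mult_scaleC_left)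

lemma cbilinear_bilin_eval:
  "(\<And>a' b'. cbilinear (\<lambda>a b. \<beta> a b a' b')) \<Longrightarrow> cbilinear (\<lambda>a b. bilin_eval (\<lambda>a' b'. \<beta> a b a' b') ys)"
  by (rule cbilinearI) (auto simp: cbilinearD[of "\<lambda>a b. \<beta> a b _ _"] bilin_eval_add_fun bilin_eval_mult_fun)

lemma list_times_cong:
  assumes "\<forall>\<beta>. cbilinear \<beta> \<longrightarrow> bilin_eval \<beta> xs = bilin_eval \<beta> xs'"
    and "\<forall>\<beta>. cbilinear \<beta> \<longrightarrow> bilin_eval \<beta> ys = bilin_eval \<beta> ys'" and "cbilinear \<beta>"
  shows "bilin_eval \<beta> (list_times xs ys) = bilin_eval \<beta> (list_times xs' ys')"
proof -
  have "bilin_eval \<beta> (list_times xs ys) = bilin_eval \<beta> (list_times xs' ys)"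
    unfolding bilin_eval_list_times
    using cbilinear_bilin_eval[of "\<lambda>a b a' b'. \<beta> (a * a') (b * b')" ys] cbilinear_mult_right[OF assms(3)] assms(1) by blast
  also have "\<dots> = bilin_eval \<beta> (list_times xs' ys')"
    unfolding bilin_eval_list_times
    using cbilinear_mult_left[OF assms(3)] assms(2) by (metis (no_types, lifting))
  finally show ?thesis .
qed

lemma list_times_assoc: "list_times (list_times xs ys) zs = list_times xs (list_times ys zs)"
  unfolding list_times_def
  by (induction xs) (auto simp: map_concat comp_def case_prod_unfold mult.assoc)

instantiation alg_tensor :: (star_algebra, star_algebra) star_algebra
begin

lift_definition zero_alg_tensor :: "('a, 'b) alg_tensor" is "[]" .
lift_definition one_alg_tensor :: "('a, 'b) alg_tensor" is "[(1, 1)]" .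
lift_definition plus_alg_tensor :: "('a, 'b) alg_tensor \<Rightarrow> ('a, 'b) alg_tensor \<Rightarrow> ('a, 'b) alg_tensor"
  is "(@)" by simp
lift_definition scaleC_alg_tensor :: "complex \<Rightarrow> ('a, 'b) alg_tensor \<Rightarrow> ('a, 'b) alg_tensor"
  is "\<lambda>c. map (\<lambda>(a, b). (c *\<^sub>C a, b))" by (simp add: bilin_eval_map_scale)
lift_definition times_alg_tensor :: "('a, 'b) alg_tensor \<Rightarrow> ('a, 'b) alg_tensor \<Rightarrow> ('a, 'b) alg_tensor"
  is "\<lambda>xs ys. [(a * a', b * b'). (a, b) \<leftarrow> xs, (a', b') \<leftarrow> ys]"
  using list_times_cong unfolding list_times_def by blast
lift_definition star_alg_tensor :: "('a, 'b) alg_tensor \<Rightarrow> ('a, 'b) alg_tensor"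
  is "map (\<lambda>(a, b). (star a, star b))"
  by (simp only: bilin_eval_map_star cbilinear_star)
definition uminus_alg_tensor :: "('a, 'b) alg_tensor \<Rightarrow> ('a, 'b) alg_tensor"
  where "uminus_alg_tensor x = (-1) *\<^sub>C x"
definition minus_alg_tensor :: "('a, 'b) alg_tensor \<Rightarrow> ('a, 'b) alg_tensor \<Rightarrow> ('a, 'b) alg_tensor"
  where "minus_alg_tensor x y = x + (- y)"
definition scaleR_alg_tensor :: "real \<Rightarrow> ('a, 'b) alg_tensor \<Rightarrow> ('a, 'b) alg_tensor"
  where "scaleR_alg_tensor r x = complex_of_real r *\<^sub>C x"

instance
proof
  fix x y z :: "('a, 'b) alg_tensor" and r s :: real and c d :: complex
  show addassoc: "x + y + z = x + (y + z)" for x y z :: "('a, 'b) alg_tensor" by transfer simp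
  show addcomm: "x + y = y + x" for x y :: "('a, 'b) alg_tensor" by transfer simp
  show "0 + x = x" by transfer simp
  show "- x + x = 0" unfolding uminus_alg_tensor_def
    by transfer (simp add: bilin_eval_map_scale del: scaleC_minus_one)
  show "x - y = x + - y" by (simp add: minus_alg_tensor_def)
  show sadd: "c *\<^sub>C (x + y) = c *\<^sub>C x + c *\<^sub>C y" for c by transfer (simp add: bilin_eval_map_scale algebra_simps)
  show sadd2: "(c + d) *\<^sub>C x = c *\<^sub>C x + d *\<^sub>C x" for c d by transfer (simp add: bilin_eval_map_scale algebra_simps)
  show ss: "c *\<^sub>C d *\<^sub>C x = (c * d) *\<^sub>C x" for c d
    by transfer (simp add: bilin_eval_map_scale algebra_simps del: map_map)
  show s1: "(c *\<^sub>C x) * y = c *\<^sub>C (x * y)" for c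
    by transfer (simp add: bilin_eval_map_scale list_times_def[symmetric] bilin_eval_list_times cbilinear_mult_right cbilinear_bilin_eval
        del: map_map)
  show s2: "x * (c *\<^sub>C y) = c *\<^sub>C (x * y)" for c
    by transfer (simp add: bilin_eval_map_scale list_times_def[symmetric] bilin_eval_list_times cbilinear_mult_left bilin_eval_mult_fun
        del: map_map)
  show "r *\<^sub>R x = complex_of_real r *\<^sub>C x" by (simp add: scaleR_alg_tensor_def)
  show "r *\<^sub>R (x + y) = r *\<^sub>R x + r *\<^sub>R y" "(r + s) *\<^sub>R x = r *\<^sub>R x + s *\<^sub>R x"
    "r *\<^sub>R s *\<^sub>R x = (r * s) *\<^sub>R x"
    by (simp_all add: scaleR_alg_tensor_def sadd sadd2 ss)
  show "1 *\<^sub>R x = x" unfolding scaleR_alg_tensor_def by transfer (simp add: bilin_eval_map_scale)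
  show "(r *\<^sub>R x) * y = r *\<^sub>R (x * y)" "x * (r *\<^sub>R y) = r *\<^sub>R (x * y)"
    by (simp_all add: scaleR_alg_tensor_def s1 s2)
  show "x * y * z = x * (y * z)"
    by transfer (simp add: list_times_def[symmetric] list_times_assoc)
  show "(x + y) * z = x * z + y * z"
    by transfer (simp add: list_times_def[symmetric] bilin_eval_list_times)
  show "x * (y + z) = x * y + x * z"
    by transfer (simp only: list_times_def[symmetric] bilin_eval_list_times bilin_eval_simps bilin_eval_add_fun, simp)
  show "1 * x = x" by transfer (simp only: list_times_def[symmetric] bilin_eval_list_times, simp)
  show "x * 1 = x" by transfer (simp only: list_times_def[symmetric] bilin_eval_list_times, simp)
  show "star (x + y) = star x + star y" by transfer simp
  show "star (c *\<^sub>C x) = cnj c *\<^sub>C star x"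
    
  proof (transfer, intro allI impI)
    fix c and xs :: "('a \<times> 'b) list" and \<beta> :: "'a \<Rightarrow> 'b \<Rightarrow> complex"
    assume b: "cbilinear \<beta>"
    show "bilin_eval \<beta> (map (\<lambda>(a, b). (star a, star b)) (map (\<lambda>(a, b). (c *\<^sub>C a, b)) xs))
       = bilin_eval \<beta> (map (\<lambda>(a, b). (cnj c *\<^sub>C a, b)) (map (\<lambda>(a, b). (star a, star b)) xs))"
      unfolding bilin_eval_map_scale[OF b] bilin_eval_map_star bilin_eval_map_scale[OF cbilinear_star[OF b]]
      by simp
  qed
  show "star (x * y) = star y * star x"
  proof (transfer, intro allI impI)
    fix xs ys :: "('a \<times> 'b) list" and \<beta> :: "'a \<Rightarrow> 'b \<Rightarrow> complex"
    have "bilin_eval \<beta> (map (\<lambda>(a, b). (star a, star b)) (list_times xs ys))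
       = bilin_eval \<beta> (list_times (map (\<lambda>(a, b). (star a, star b)) ys) (map (\<lambda>(a, b). (star a, star b)) xs))"
      unfolding bilin_eval_map_star' bilin_eval_list_times star_mult by (rule bilin_eval_swap)
    then show "bilin_eval \<beta> (map (\<lambda>(a, b). (star a, star b)) [(a * a', b * b'). (a, b) \<leftarrow> xs, (a', b') \<leftarrow> ys])
       = bilin_eval \<beta> [(a * a', b * b'). (a, b) \<leftarrow> map (\<lambda>(a, b). (star a, star b)) ys, (a', b') \<leftarrow> map (\<lambda>(a, b). (star a, star b)) xs]"
      by (simp only: list_times_def)
  qed
  show "star (star x) = x" by transfer (simp add: comp_def case_prod_unfold)
qed

end


lift_definition pure_tensor :: "'a::star_algebra \<Rightarrow> 'b::star_algebra \<Rightarrow> ('a, 'b) alg_tensor"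
  is "\<lambda>a b. [(a, b)]" .

lift_definition alg_tensor_eval ::
  "('a::star_algebra \<Rightarrow> 'b::star_algebra \<Rightarrow> complex) \<Rightarrow> ('a, 'b) alg_tensor \<Rightarrow> complex"
  is "\<lambda>\<beta> xs. if cbilinear \<beta> then bilin_eval \<beta> xs else 0" by auto

definition product_functional ::
  "('a::star_algebra \<Rightarrow> complex) \<Rightarrow> ('b::star_algebra \<Rightarrow> complex) \<Rightarrow> ('a, 'b) alg_tensor \<Rightarrow> complex"
  where "product_functional \<phi> \<psi> = alg_tensor_eval (\<lambda>a b. \<phi> a * \<psi> b)"

lemma alg_tensor_induct [case_names zero pure_add]:
  assumes "P 0" "\<And>a b x. P x \<Longrightarrow> P (pure_tensor a b + x)"
  shows "P x"
proof -
  have eq: "abs_alg_tensor (z # zs) = pure_tensor (fst z) (snd z) + abs_alg_tensor zs" for z :: "'a \<times> 'b" and zs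
    by (simp add: pure_tensor.abs_eq plus_alg_tensor.abs_eq)
  have "P (abs_alg_tensor xs)" for xs :: "('a \<times> 'b) list"
  proof (induction xs)
    case Nil
    show ?case using assms(1) by (simp only: zero_alg_tensor_def)
  next
    case (Cons z zs)
    show ?case unfolding eq by (rule assms(2)[OF Cons])
  qed
  then show ?thesis by (induction x rule: alg_tensor.abs_induct) blast
qed

lemma pure_tensor_mult: "pure_tensor a b * pure_tensor a' b' = pure_tensor (a * a') (b * b')"
  by transfer simp
lemma pure_tensor_one: "pure_tensor 1 1 = 1"
  by transfer simp
lemma pure_tensor_star: "star (pure_tensor a b) = pure_tensor (star a) (star b)"
  by transfer simp
lemma pure_tensor_power: "pure_tensor a b ^ m = pure_tensor (a ^ m) (b ^ m)"
  by (induction m) (auto simp: pure_tensor_mult pure_tensor_one)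

lemma cbilinear_product: "clinear \<phi> \<Longrightarrow> clinear \<psi> \<Longrightarrow> cbilinear (\<lambda>a b. \<phi> a * \<psi> b)"
  by (rule cbilinearI) (auto simp: clinear_def algebra_simps)

lemma clinear_alg_tensor_eval: "clinear (alg_tensor_eval \<beta>)"
  unfolding clinear_def
proof (intro conjI allI)
  fix x y :: "('a, 'b) alg_tensor" and c
  show "alg_tensor_eval \<beta> (x + y) = alg_tensor_eval \<beta> x + alg_tensor_eval \<beta> y"
    by transfer simp
  show "alg_tensor_eval \<beta> (c *\<^sub>C x) = c *\<^sub>C alg_tensor_eval \<beta> x"
    by transfer (simp add: bilin_eval_map_scale)
qed

lemma product_functional_pure:
  "clinear \<phi> \<Longrightarrow> clinear \<psi> \<Longrightarrow> product_functional \<phi> \<psi> (pure_tensor a b) = \<phi> a * \<psi> b"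
  unfolding product_functional_def using cbilinear_product[of \<phi> \<psi>] by transfer simp

subsection \<open>Positivity of product functionals\<close>

definition quad_form :: "nat \<Rightarrow> (nat \<Rightarrow> nat \<Rightarrow> complex) \<Rightarrow> (nat \<Rightarrow> complex) \<Rightarrow> complex"
  where "quad_form n M c = (\<Sum>i<n. \<Sum>j<n. cnj (c i) * c j * M i j)"

lemma quad_form_Suc:
  "quad_form (Suc n) M c = quad_form n M c + c n * (\<Sum>i<n. cnj (c i) * M i n)
     + cnj (c n) * (\<Sum>j<n. c j * M n j) + cnj (c n) * c n * M n n"
  by (simp add: quad_form_def sum.distrib sum_distrib_left algebra_simps)

lemma quad_form_cong: "(\<And>i. i < n \<Longrightarrow> c i = d i) \<Longrightarrow> quad_form n M c = quad_form n M d"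
  by (auto simp: quad_form_def intro!: sum.cong)

lemma psd_gram:
  assumes "\<And>c. quad_form n M c \<in> \<real>\<^sub>\<ge>\<^sub>0"
    and "\<And>i j. M j i = cnj (M i j)"
  shows "\<exists>v. \<forall>i<n. \<forall>j<n. M i j = (\<Sum>k<n. v k i * cnj (v k j))"
  using assms
proof (induction n arbitrary: M)
  case (Suc n)
  note herm = Suc.prems(2)
  have "quad_form (Suc n) M (\<lambda>i. if i = n then 1 else 0) = M n n"
    by (simp add: quad_form_Suc) (simp add: quad_form_def)
  with Suc.prems(1) have "M n n \<in> \<real>\<^sub>\<ge>\<^sub>0" by metis
  then obtain p where p: "M n n = of_real p" "p \<ge> 0" by (auto simp: nonneg_Reals_def)
  have p0: "M i n = 0" if "p = 0" "i < n" for i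
  proof (rule ccontr)
    assume nz: "M i n \<noteq> 0"
    define t where "t = (Re (M i i) + 1) / (2 * (cmod (M i n))\<^sup>2)"
    define w where "w = - of_real t * cnj (M i n)"
    let ?c = "\<lambda>k. if k = i then 1 else if k = n then w else 0"
    have e: "quad_form n M ?c = M i i"
    proof -
      have "quad_form n M ?c = quad_form n M (\<lambda>k. if k = i then 1 else 0)"
        by (rule quad_form_cong) auto
      also have "\<dots> = (\<Sum>j<n. if j = i then M i i else 0)"
        unfolding quad_form_def using that(2)
        by (subst sum.swap) (auto intro!: sum.cong simp: if_distrib[of cnj] if_distrib[of "\<lambda>x. x * _"] cong: if_cong)
      also have "\<dots> = M i i" using that(2) by simp
      finally show ?thesis .
    qed
    have s1: "(\<Sum>k<n. cnj (?c k) * M k n) = M i n"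
    proof -
      have "(\<Sum>k<n. cnj (?c k) * M k n) = (\<Sum>k<n. if k = i then M i n else 0)"
        by (intro sum.cong) auto
      then show ?thesis using that(2) by simp
    qed
    have s2: "(\<Sum>k<n. ?c k * M n k) = M n i"
    proof -
      have "(\<Sum>k<n. ?c k * M n k) = (\<Sum>k<n. if k = i then M n i else 0)"
        by (intro sum.cong) auto
      then show ?thesis using that(2) by simp
    qed
    have cn: "?c n = w" using that(2) by simp
    have "quad_form (Suc n) M ?c = M i i + w * M i n + cnj w * M n i + cnj w * w * M n n"
      unfolding quad_form_Suc s1 s2 e cn ..
    also have "\<dots> = M i i - 2 * of_real (t * (cmod (M i n))\<^sup>2)"
      using p(1) that(1) herm[of n i] complex_norm_square[of "M i n"]
      by (simp add: w_def algebra_simps)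
    finally have "0 \<le> Re (M i i) - 2 * (t * (cmod (M i n))\<^sup>2)"
      using Suc.prems(1)[of ?c] by (simp add: complex_nonneg_Reals_iff)
    moreover have "2 * (t * (cmod (M i n))\<^sup>2) = Re (M i i) + 1"
      using nz by (simp add: t_def)
    ultimately show False by simp
  qed
  define M' where "M' = (\<lambda>i j. M i j - M i n * M n j / M n n)"
  have "quad_form n M' c \<in> \<real>\<^sub>\<ge>\<^sub>0" for c
  proof -
    define S where "S = (\<Sum>j<n. c j * M n j)"
    have S': "(\<Sum>i<n. cnj (c i) * M i n) = cnj S"
    proof -
      have h: "cnj (M n i) = M i n" for i by (rule Suc.prems(2)[symmetric])
      show ?thesis unfolding S_def cnj_sum complex_cnj_mult h ..
    qed
    define d where "d = c(n := - S / M n n)"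
    have "quad_form n M' c = quad_form n M c - cnj S * S / M n n"
    proof -
      have "quad_form n M' c = quad_form n M c - (\<Sum>i<n. \<Sum>j<n. (cnj (c i) * M i n) * (c j * M n j) / M n n)"
        unfolding quad_form_def M'_def sum_subtractf[symmetric]
        by (intro sum.cong refl) (simp add: algebra_simps)
      also have "(\<Sum>i<n. \<Sum>j<n. (cnj (c i) * M i n) * (c j * M n j) / M n n) = cnj S * S / M n n"
        by (simp only: S'[symmetric]) (simp add: S_def sum_product sum_divide_distrib)
      finally show ?thesis .
    qed
    also have "\<dots> = quad_form (Suc n) M d"
    proof -
      have 1: "quad_form n M d = quad_form n M c" by (rule quad_form_cong) (simp add: d_def)
      have 2: "(\<Sum>i<n. cnj (d i) * M i n) = cnj S" "(\<Sum>j<n. d j * M n j) = S"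
        by (simp_all only: S'[symmetric]) (auto simp: S_def d_def)
      have 3: "d n = - S / M n n" by (simp add: d_def)
      show ?thesis unfolding quad_form_Suc 1 2 3
        by (cases "p = 0") (auto simp: p field_simps)
    qed
    finally show ?thesis using Suc.prems(1) by simp
  qed
  moreover have "M' j i = cnj (M' i j)" for i j
    using herm[of n i] herm[of j n] herm[of i j] by (simp add: M'_def p)
  ultimately obtain v where v: "\<forall>i<n. \<forall>j<n. M' i j = (\<Sum>k<n. v k i * cnj (v k j))"
    using Suc.IH[of M'] by blast
  define u where "u = (\<lambda>k i. if k = n then M i n / of_real (sqrt p) else if i = n then 0 else v k i)"
  have "M i j = (\<Sum>k<Suc n. u k i * cnj (u k j))" if "i < Suc n" "j < Suc n" for i j
  proof -
    have last: "u n i * cnj (u n j) = M i n * M n j / M n n"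
    proof -
      have "u n i * cnj (u n j) = M i n * cnj (M j n) / (of_real (sqrt p) * of_real (sqrt p))"
        by (simp add: u_def)
      also have "of_real (sqrt p) * of_real (sqrt p) = M n n"
        using p by (simp add: of_real_mult[symmetric] del: of_real_mult)
      finally show ?thesis by (simp add: herm[of n j, symmetric])
    qed
    show ?thesis
    proof (cases "i < n \<and> j < n")
      case True
      then have "(\<Sum>k<n. u k i * cnj (u k j)) = M' i j" using v by (auto simp: u_def intro!: sum.cong)
      then show ?thesis using last by (simp add: M'_def)
    next
      case False
      then have z: "(\<Sum>k<n. u k i * cnj (u k j)) = 0"
        using that by (intro sum.neutral) (auto simp: u_def)
      have "M i j = M i n * M n j / M n n"
      proof (cases "p = 0")
        case False
        then show ?thesis using \<open>\<not> (i < n \<and> j < n)\<close> that p by (cases "i = n"; cases "j = n") auto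
      next
        case True
        have "M n k = 0" if "k < n" for k using p0[OF True that] herm[of n k] by simp
        then show ?thesis using \<open>\<not> (i < n \<and> j < n)\<close> that p p0[OF True] True
          by (cases "i = n"; cases "j = n") auto
      qed
      then show ?thesis using z last by simp
    qed
  qed
  then show ?case by blast
next
  case 0
  show ?case by simp
qed

lemma schur_product:
  assumes "\<And>c. quad_form n M c \<in> \<real>\<^sub>\<ge>\<^sub>0" "\<And>i j. M j i = cnj (M i j)"
    and "\<And>c. quad_form n N c \<in> \<real>\<^sub>\<ge>\<^sub>0"
  shows "(\<Sum>i<n. \<Sum>j<n. M i j * N i j) \<in> \<real>\<^sub>\<ge>\<^sub>0"
proof -
  obtain v where v: "\<And>i j. i < n \<Longrightarrow> j < n \<Longrightarrow> M i j = (\<Sum>k<n. v k i * cnj (v k j))"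
    using psd_gram[OF assms(1,2)] by blast
  have "(\<Sum>i<n. \<Sum>j<n. M i j * N i j) = (\<Sum>i<n. \<Sum>j<n. \<Sum>k<n. v k i * cnj (v k j) * N i j)"
    by (intro sum.cong refl) (simp add: v sum_distrib_right)
  also have "\<dots> = (\<Sum>k<n. quad_form n N (\<lambda>i. cnj (v k i)))"
  proof -
    have "(\<Sum>i<n. \<Sum>j<n. \<Sum>k<n. v k i * cnj (v k j) * N i j) = (\<Sum>i<n. \<Sum>k<n. \<Sum>j<n. v k i * cnj (v k j) * N i j)"
      by (intro sum.cong refl sum.swap)
    also have "\<dots> = (\<Sum>k<n. \<Sum>i<n. \<Sum>j<n. v k i * cnj (v k j) * N i j)"
      by (rule sum.swap)
    finally show ?thesis by (simp add: quad_form_def)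
  qed
  also have "\<dots> \<in> \<real>\<^sub>\<ge>\<^sub>0"
    using assms(3) by (auto simp: complex_nonneg_Reals_iff intro!: sum_nonneg sum.neutral)
  finally show ?thesis .
qed

lemma quad_form_gram:
  assumes "positive_functional \<phi>"
  shows "quad_form n (\<lambda>i j. \<phi> (star (a i) * a j)) c \<in> \<real>\<^sub>\<ge>\<^sub>0"
proof -
  note cl = pos_fun_clinear[OF assms]
  let ?y = "\<Sum>j<n. c j *\<^sub>C a j"
  have st: "star (sum f A) = (\<Sum>i\<in>A. star (f i))" for f :: "nat \<Rightarrow> 'a" and A
    by (induction A rule: infinite_finite_induct) (auto simp: star_add)
  have "\<phi> (star ?y * ?y) = quad_form n (\<lambda>i j. \<phi> (star (a i) * a j)) c"
    unfolding quad_form_def st sum_product clinear_sum[OF cl]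
    by (simp add: star_scaleC mult_scaleC_left mult_scaleC_right clinear_scaleC[OF cl] mult_ac)
  then show ?thesis using assms by (metis positive_functional_def)
qed

lemma bilin_eval_nth: "bilin_eval \<beta> xs = (\<Sum>i<length xs. \<beta> (fst (xs ! i)) (snd (xs ! i)))"
  unfolding bilin_eval_def by (simp add: sum_list_sum_nth case_prod_unfold atLeast0LessThan)

lemma positive_product_functional:
  assumes "positive_functional \<phi>" "positive_functional \<psi>"
  shows "positive_functional (product_functional \<phi> \<psi>)"
  unfolding positive_functional_def
proof (intro conjI allI)
  show "clinear (product_functional \<phi> \<psi>)"
    by (simp add: product_functional_def clinear_alg_tensor_eval)
  fix x :: "('a, 'b) alg_tensor"
  have bl: "cbilinear (\<lambda>a b. \<phi> a * \<psi> b)"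
    using assms by (intro cbilinear_product pos_fun_clinear)
  have key: "bilin_eval (\<lambda>a b. \<phi> a * \<psi> b) (list_times (map (\<lambda>(a, b). (star a, star b)) xs) xs) \<in> \<real>\<^sub>\<ge>\<^sub>0" for xs
  proof -
    let ?a = "\<lambda>i. fst (xs ! i)" and ?b = "\<lambda>i. snd (xs ! i)"
    have "bilin_eval (\<lambda>a b. \<phi> a * \<psi> b) (list_times (map (\<lambda>(a, b). (star a, star b)) xs) xs)
      = (\<Sum>i<length xs. \<Sum>j<length xs. \<phi> (star (?a i) * ?a j) * \<psi> (star (?b i) * ?b j))"
      by (simp only: bilin_eval_list_times) (simp add: bilin_eval_nth case_prod_unfold)
    also have "\<dots> \<in> \<real>\<^sub>\<ge>\<^sub>0"
    proof (rule schur_product)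
      show "\<phi> (star (?a j) * ?a i) = cnj (\<phi> (star (?a i) * ?a j))" for i j
        using positive_functional_star[OF assms(1), of "star (?a i) * ?a j"] by (simp add: star_mult)
    qed (rule quad_form_gram assms)+
    finally show ?thesis .
  qed
  show "product_functional \<phi> \<psi> (star x * x) \<in> \<real>\<^sub>\<ge>\<^sub>0"
    unfolding product_functional_def
    using bl key by transfer (simp only: list_times_def[symmetric] if_True)
qed

subsection \<open>The spatial seminorm\<close>

text \<open>
  With \<open>\<omega>\<close> the product functional of states \<open>\<phi>\<close>, \<open>\<psi>\<close>, the vectors \<open>y\<close> with the seminorm
  \<open>functional_seminorm \<omega>\<close> are dense in the tensor product of the GNS spaces of \<open>\<phi>\<close> and \<open>\<psi>\<close>.
\<close>

definition min_tensor_norm :: "('a::cstar_algebra, 'b::cstar_algebra) alg_tensor \<Rightarrow> real"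
  where "min_tensor_norm x = Sup (insert 0
    {functional_seminorm (product_functional \<phi> \<psi>) (x * y) | \<phi> \<psi> y.
       state \<phi> \<and> state \<psi> \<and> functional_seminorm (product_functional \<phi> \<psi>) y \<le> 1})"

lemma state_pos: "state \<phi> \<Longrightarrow> positive_functional \<phi>" by (simp add: state_def)

lemma norm_star: "norm (star x) = norm (x :: 'a::cstar_algebra)"
proof -
  have le: "norm x \<le> norm (star x)" for x :: 'a
  proof (cases "norm x = 0")
    case False
    have "norm x * norm x \<le> norm (star x) * norm x"
      using norm_mult_ineq[of "star x" x] by (simp add: cstar_identity power2_eq_square)
    with False show ?thesis by simp
  qed simp
  from le[of x] le[of "star x"] show ?thesis by simp
qed

lemma norm_power_Suc_le: "norm (x ^ Suc m) \<le> norm (x :: 'a::cstar_algebra) ^ Suc m"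
proof (induction m)
  case (Suc m)
  have "norm (x ^ Suc (Suc m)) \<le> norm x * norm (x ^ Suc m)" using norm_mult_ineq[of x "x ^ Suc m"] by simp
  also have "\<dots> \<le> norm x * norm x ^ Suc m" by (intro mult_left_mono Suc) auto
  finally show ?case by simp
qed simp

lemma norm_power_le: "norm (x ^ m) \<le> (norm (1 :: 'a) + 1) * norm (x :: 'a::cstar_algebra) ^ m"
proof (cases m)
  case (Suc k)
  have "norm x ^ m \<le> (norm (1 :: 'a) + 1) * norm x ^ m" by (simp add: mult_le_cancel_right1)
  then show ?thesis using norm_power_Suc_le[of x k] Suc by (meson order_trans)
qed auto

lemma product_functional_clinear: "clinear (product_functional \<phi> \<psi>)"
  by (simp add: product_functional_def clinear_alg_tensor_eval)

lemma norm_mult3_le: "norm (x * y * z) \<le> norm x * norm y * norm (z :: 'a::real_normed_algebra)"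
  using norm_mult_ineq[of "x * y" z] mult_right_mono[OF norm_mult_ineq[of x y] norm_ge_zero[of z]]
  by linarith

lemma product_functional_slice_bound:
  fixes y :: "('a::cstar_algebra, 'b::cstar_algebra) alg_tensor"
  assumes "state \<phi>" "state \<psi>"
  shows "\<exists>M. \<forall>a b. cmod (product_functional \<phi> \<psi> (star z * pure_tensor a b * y)) \<le> M * norm a * norm b"
proof -
  let ?w = "product_functional \<phi> \<psi>"
  note cl = product_functional_clinear[of \<phi> \<psi>]
  have c: "clinear \<phi>" "clinear \<psi>" using assms by (auto simp: state_def positive_functional_def)
  obtain K where K: "\<And>a. cmod (\<phi> a) \<le> norm a * K" "K \<ge> 0"
    using assms(1) bounded_linear.nonneg_bounded[of \<phi>] unfolding state_def by blast
  obtain L where L: "\<And>a. cmod (\<psi> a) \<le> norm a * L" "L \<ge> 0"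
    using assms(2) bounded_linear.nonneg_bounded[of \<psi>] unfolding state_def by blast
  have one: "\<exists>M. \<forall>a b. cmod (?w (pure_tensor c d * pure_tensor a b * y)) \<le> M * norm a * norm b" for c d
  proof (induction y rule: alg_tensor_induct)
    case zero
    show ?case by (intro exI[of _ 0]) (simp add: clinear_zero[OF cl])
  next
    case (pure_add e f y)
    then obtain M where M: "\<And>a b. cmod (?w (pure_tensor c d * pure_tensor a b * y)) \<le> M * norm a * norm b" by blast
    have "cmod (?w (pure_tensor c d * pure_tensor a b * (pure_tensor e f + y)))
       \<le> (norm c * norm e * K * (norm d * norm f * L) + M) * norm a * norm b" for a b
    proof -
      have "cmod (\<phi> (c * a * e)) \<le> norm (c * a * e) * K" by (rule K)
      also have "\<dots> \<le> (norm c * norm a * norm e) * K"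
        by (intro mult_right_mono norm_mult3_le K(2))
      finally have 1: "cmod (\<phi> (c * a * e)) \<le> norm c * norm a * norm e * K" .
      have "cmod (\<psi> (d * b * f)) \<le> norm (d * b * f) * L" by (rule L)
      also have "\<dots> \<le> (norm d * norm b * norm f) * L"
        by (intro mult_right_mono norm_mult3_le L(2))
      finally have 2: "cmod (\<psi> (d * b * f)) \<le> norm d * norm b * norm f * L" .
      have "?w (pure_tensor c d * pure_tensor a b * (pure_tensor e f + y))
         = \<phi> (c * a * e) * \<psi> (d * b * f) + ?w (pure_tensor c d * pure_tensor a b * y)"
        by (simp add: distrib_left clinear_add[OF cl] pure_tensor_mult product_functional_pure[OF c])
      then have "cmod (?w (pure_tensor c d * pure_tensor a b * (pure_tensor e f + y)))
         \<le> cmod (\<phi> (c * a * e)) * cmod (\<psi> (d * b * f)) + M * norm a * norm b"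
        using M[of a b] norm_triangle_ineq[of "\<phi> (c * a * e) * \<psi> (d * b * f)" "?w (pure_tensor c d * pure_tensor a b * y)"]
        by (simp add: norm_mult)
      also have "cmod (\<phi> (c * a * e)) * cmod (\<psi> (d * b * f))
          \<le> (norm c * norm a * norm e * K) * (norm d * norm b * norm f * L)"
        using K(2) by (intro mult_mono 1 2) auto
      finally show ?thesis by (simp add: algebra_simps)
    qed
    then show ?case by blast
  qed
  have "\<exists>M. \<forall>a b. cmod (?w (z * pure_tensor a b * y)) \<le> M * norm a * norm b" for z
  proof (induction z rule: alg_tensor_induct)
    case zero
    show ?case by (intro exI[of _ 0]) (simp add: clinear_zero[OF cl])
  next
    case (pure_add e f z)
    then obtain M where M: "\<And>a b. cmod (?w (z * pure_tensor a b * y)) \<le> M * norm a * norm b" by blast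
    obtain N where N: "\<And>a b. cmod (?w (pure_tensor e f * pure_tensor a b * y)) \<le> N * norm a * norm b"
      using one by blast
    have "cmod (?w ((pure_tensor e f + z) * pure_tensor a b * y)) \<le> (N + M) * norm a * norm b" for a b
    proof -
      have "?w ((pure_tensor e f + z) * pure_tensor a b * y) = ?w (pure_tensor e f * pure_tensor a b * y) + ?w (z * pure_tensor a b * y)"
        by (simp add: distrib_right clinear_add[OF cl])
      then show ?thesis
        using N[of a b] M[of a b] norm_triangle_ineq[of "?w (pure_tensor e f * pure_tensor a b * y)" "?w (z * pure_tensor a b * y)"]
        by (simp add: algebra_simps)
    qed
    then show ?case by blast
  qed
  then show ?thesis .
qed

lemma functional_seminorm_pure_bound:
  fixes y :: "('a::cstar_algebra, 'b::cstar_algebra) alg_tensor"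
  assumes st: "state \<phi>" "state \<psi>"
  shows "functional_seminorm (product_functional \<phi> \<psi>) (pure_tensor a b * y)
     \<le> (norm a + 1) * (norm b + 1) * functional_seminorm (product_functional \<phi> \<psi>) y"
proof -
  let ?w = "product_functional \<phi> \<psi>"
  let ?N = "functional_seminorm ?w"
  have pos: "positive_functional ?w" using st by (intro positive_product_functional state_pos)
  define p :: "('a, 'b) alg_tensor" where "p = pure_tensor a b"
  define h where "h = star p * p"
  define r where "r = ((norm a + 1) * (norm b + 1))\<^sup>2"
  have "(norm a + 1) * (norm b + 1) > 0" by (simp add: add_nonneg_pos)
  then have r: "r > 0" unfolding r_def by (rule zero_less_power)
  obtain M where M: "\<And>c d. cmod (?w (star y * pure_tensor c d * y)) \<le> M * norm c * norm d"
    using product_functional_slice_bound[OF st] by blast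
  have bd: "cmod (?w (star y * h ^ m * y)) \<le> (\<bar>M\<bar> * (norm (1::'a) + 1) * (norm (1::'b) + 1)) * r ^ m" for m
  proof -
    have "h ^ m = pure_tensor ((star a * a) ^ m) ((star b * b) ^ m)"
      by (simp add: h_def p_def pure_tensor_star pure_tensor_mult pure_tensor_power)
    then have "cmod (?w (star y * h ^ m * y)) \<le> M * norm ((star a * a) ^ m) * norm ((star b * b) ^ m)"
      using M by simp
    also have "\<dots> \<le> \<bar>M\<bar> * norm ((star a * a) ^ m) * norm ((star b * b) ^ m)"
      by (intro mult_right_mono) auto
    also have "\<dots> \<le> \<bar>M\<bar> * ((norm (1::'a) + 1) * norm (star a * a) ^ m) * ((norm (1::'b) + 1) * norm (star b * b) ^ m)"
      by (intro mult_mono norm_power_le) auto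
    also have "\<dots> = (\<bar>M\<bar> * (norm (1::'a) + 1) * (norm (1::'b) + 1)) * ((norm a)\<^sup>2 * (norm b)\<^sup>2) ^ m"
      by (simp add: cstar_identity power_mult_distrib)
    also have "\<dots> \<le> (\<bar>M\<bar> * (norm (1::'a) + 1) * (norm (1::'b) + 1)) * r ^ m"
      unfolding r_def power_mult_distrib[of "norm a + 1"]
      by (intro mult_left_mono power_mono mult_mono) auto
    finally show ?thesis .
  qed
  have "cmod (?w (star y * h * y)) \<le> r * (?N y)\<^sup>2"
    by (rule positive_functional_power_bound[OF pos _ r bd]) (simp add: h_def star_mult)
  also have "star y * h * y = star (p * y) * (p * y)"
    by (simp add: h_def star_mult mult.assoc)
  finally have "(?N (p * y))\<^sup>2 \<le> ((norm a + 1) * (norm b + 1) * ?N y)\<^sup>2"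
    by (simp add: functional_seminorm_sq[OF pos] norm_power r_def power_mult_distrib)
  moreover have "0 \<le> (norm a + 1) * (norm b + 1) * ?N y"
    using functional_seminorm_nonneg[OF pos] by simp
  ultimately show ?thesis unfolding p_def by (rule power2_le_imp_le)
qed

lemma functional_seminorm_mult_bound:
  fixes x :: "('a::cstar_algebra, 'b::cstar_algebra) alg_tensor"
  shows "\<exists>C\<ge>0. \<forall>\<phi> \<psi> y. state \<phi> \<longrightarrow> state \<psi> \<longrightarrow>
    functional_seminorm (product_functional \<phi> \<psi>) (x * y) \<le> C * functional_seminorm (product_functional \<phi> \<psi>) y"
proof (induction x rule: alg_tensor_induct)
  case zero
  show ?case by (intro exI[of _ 0]) (simp add: functional_seminorm_def clinear_zero[OF product_functional_clinear])
next
  case (pure_add a b x)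
  then obtain C where C: "C \<ge> 0" "\<And>\<phi> \<psi> y. state \<phi> \<Longrightarrow> state \<psi> \<Longrightarrow>
    functional_seminorm (product_functional \<phi> \<psi>) (x * y) \<le> C * functional_seminorm (product_functional \<phi> \<psi>) y"
    by blast
  have "functional_seminorm (product_functional \<phi> \<psi>) ((pure_tensor a b + x) * y)
     \<le> ((norm a + 1) * (norm b + 1) + C) * functional_seminorm (product_functional \<phi> \<psi>) y"
    if st: "state \<phi>" "state \<psi>" for \<phi> \<psi> y
    using functional_seminorm_triangle[OF positive_product_functional[OF st[THEN state_pos]], of "pure_tensor a b * y" "x * y"]
      C(2)[OF st, of y] functional_seminorm_pure_bound[OF st, of a b y]
    by (simp add: distrib_right)
  moreover have "(norm a + 1) * (norm b + 1) + C \<ge> 0" using C(1) by (simp add: add_nonneg_nonneg)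
  ultimately show ?case by blast
qed

lemma min_tensor_norm_bdd:
  fixes x :: "('a::cstar_algebra, 'b::cstar_algebra) alg_tensor"
  shows "bdd_above (insert 0
    {functional_seminorm (product_functional \<phi> \<psi>) (x * y) | \<phi> \<psi> y.
       state \<phi> \<and> state \<psi> \<and> functional_seminorm (product_functional \<phi> \<psi>) y \<le> 1})"
proof -
  obtain C where C: "C \<ge> 0" "\<And>\<phi> \<psi> y. state \<phi> \<Longrightarrow> state \<psi> \<Longrightarrow>
    functional_seminorm (product_functional \<phi> \<psi>) (x * y) \<le> C * functional_seminorm (product_functional \<phi> \<psi>) y"
    using functional_seminorm_mult_bound[of x] by blast
  have "t \<le> C" if "t \<in> insert 0
    {functional_seminorm (product_functional \<phi> \<psi>) (x * y) | \<phi> \<psi> y.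
       state \<phi> \<and> state \<psi> \<and> functional_seminorm (product_functional \<phi> \<psi>) y \<le> 1}" for t
    using that C(1) by (auto intro: order_trans[OF C(2)] mult_left_le)
  then show ?thesis by (rule bdd_aboveI)
qed

lemma min_tensor_norm_nonneg: "0 \<le> min_tensor_norm x"
  unfolding min_tensor_norm_def by (rule cSup_upper[OF _ min_tensor_norm_bdd]) simp

lemma min_tensor_norm_least:
  assumes "0 \<le> C" "\<And>\<phi> \<psi> y. state \<phi> \<Longrightarrow> state \<psi> \<Longrightarrow> functional_seminorm (product_functional \<phi> \<psi>) y \<le> 1
     \<Longrightarrow> functional_seminorm (product_functional \<phi> \<psi>) (x * y) \<le> C"
  shows "min_tensor_norm x \<le> C"
  unfolding min_tensor_norm_def by (rule cSup_least) (use assms in auto)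

lemma functional_seminorm_mult_le:
  assumes st: "state \<phi>" "state \<psi>"
  shows "functional_seminorm (product_functional \<phi> \<psi>) (x * y)
     \<le> min_tensor_norm x * functional_seminorm (product_functional \<phi> \<psi>) y"
proof -
  let ?N = "functional_seminorm (product_functional \<phi> \<psi>)"
  have pos: "positive_functional (product_functional \<phi> \<psi>)"
    using st by (intro positive_product_functional state_pos)
  show ?thesis
  proof (cases "?N y = 0")
    case True
    obtain C where "?N (x * y) \<le> C * ?N y" using functional_seminorm_mult_bound[of x] st by blast
    with True show ?thesis by simp
  next
    case False
    with functional_seminorm_nonneg[OF pos, of y] have p: "?N y > 0" by simp
    let ?y = "complex_of_real (inverse (?N y)) *\<^sub>C y"
    have "?N (x * ?y) \<le> min_tensor_norm x"
      unfolding min_tensor_norm_def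
    proof (rule cSup_upper[OF _ min_tensor_norm_bdd])
      have "?N ?y = 1" using p by (simp only: functional_seminorm_scaleC[OF pos]) (simp add: norm_inverse)
      then have "?N ?y \<le> 1" by simp
      then show "?N (x * ?y) \<in> insert 0
        {functional_seminorm (product_functional \<phi> \<psi>) (x * y) | \<phi> \<psi> y.
         state \<phi> \<and> state \<psi> \<and> functional_seminorm (product_functional \<phi> \<psi>) y \<le> 1}"
        using st by blast
    qed
    moreover have "?N (x * ?y) = inverse (?N y) * ?N (x * y)"
      using p by (simp only: mult_scaleC_right functional_seminorm_scaleC[OF pos]) (simp add: norm_inverse)
    ultimately have "inverse (?N y) * ?N (x * y) \<le> min_tensor_norm x" by (simp only:)
    then show ?thesis using p by (simp add: field_simps)
  qed
qed

instantiation alg_tensor :: (cstar_algebra, cstar_algebra) cstar_seminormed_algebra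
begin

definition cstar_seminorm_alg_tensor :: "('a, 'b) alg_tensor \<Rightarrow> real"
  where "cstar_seminorm_alg_tensor = min_tensor_norm"

instance
proof
  fix x y :: "('a, 'b) alg_tensor" and c :: complex
  note pos = positive_product_functional[OF state_pos state_pos]
  let ?n = "min_tensor_norm :: ('a, 'b) alg_tensor \<Rightarrow> real"
  have le1: "functional_seminorm (product_functional \<phi> \<psi>) (x * y) \<le> ?n x"
    if "state \<phi>" "state \<psi>" "functional_seminorm (product_functional \<phi> \<psi>) y \<le> 1" for \<phi> \<psi> and x y :: "('a, 'b) alg_tensor"
    using functional_seminorm_mult_le[OF that(1,2), of x y] that(3) min_tensor_norm_nonneg[of x]
    by (meson mult_left_le order_trans)
  have add: "?n (x + y) \<le> ?n x + ?n y" for x y :: "('a, 'b) alg_tensor"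
  proof (rule min_tensor_norm_least)
    fix \<phi> \<psi> and z :: "('a, 'b) alg_tensor" assume st: "state \<phi>" "state \<psi>" "functional_seminorm (product_functional \<phi> \<psi>) z \<le> 1"
    show "functional_seminorm (product_functional \<phi> \<psi>) ((x + y) * z) \<le> ?n x + ?n y"
      using functional_seminorm_triangle[OF pos[OF st(1,2)], of "x * z" "y * z"] le1[OF st, of x] le1[OF st, of y]
      by (simp add: distrib_right)
  qed (simp add: min_tensor_norm_nonneg)
  have scale_le: "?n (c *\<^sub>C x) \<le> cmod c * ?n x" for c and x :: "('a, 'b) alg_tensor"
  proof (rule min_tensor_norm_least)
    fix \<phi> \<psi> and z :: "('a, 'b) alg_tensor" assume st: "state \<phi>" "state \<psi>" "functional_seminorm (product_functional \<phi> \<psi>) z \<le> 1"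
    show "functional_seminorm (product_functional \<phi> \<psi>) ((c *\<^sub>C x) * z) \<le> cmod c * ?n x"
      using le1[OF st, of x] by (simp add: mult_scaleC_left functional_seminorm_scaleC[OF pos[OF st(1,2)]] mult_left_mono)
  qed (simp add: min_tensor_norm_nonneg)
  have mult: "?n (x * y) \<le> ?n x * ?n y" for x y :: "('a, 'b) alg_tensor"
  proof (rule min_tensor_norm_least)
    fix \<phi> \<psi> and z :: "('a, 'b) alg_tensor" assume st: "state \<phi>" "state \<psi>" "functional_seminorm (product_functional \<phi> \<psi>) z \<le> 1"
    have "functional_seminorm (product_functional \<phi> \<psi>) (x * (y * z)) \<le> ?n x * functional_seminorm (product_functional \<phi> \<psi>) (y * z)"
      by (rule functional_seminorm_mult_le[OF st(1,2)])
    also have "\<dots> \<le> ?n x * ?n y" by (intro mult_left_mono le1[OF st] min_tensor_norm_nonneg)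
    finally show "functional_seminorm (product_functional \<phi> \<psi>) (x * y * z) \<le> ?n x * ?n y" by (simp add: mult.assoc)
  qed (simp add: min_tensor_norm_nonneg)
  have sq: "(?n x)\<^sup>2 \<le> ?n (star x * x)" for x :: "('a, 'b) alg_tensor"
  proof -
    have "?n x \<le> sqrt (?n (star x * x))"
    proof (rule min_tensor_norm_least)
      fix \<phi> \<psi> and z :: "('a, 'b) alg_tensor" assume st: "state \<phi>" "state \<psi>" and z: "functional_seminorm (product_functional \<phi> \<psi>) z \<le> 1"
      let ?w = "product_functional \<phi> \<psi>"
      let ?N = "functional_seminorm ?w"
      have z0: "?N z \<ge> 0" by (rule functional_seminorm_nonneg[OF pos[OF st]])
      have "(?N (x * z))\<^sup>2 = cmod (?w (star (x * z) * (x * z)))"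
        by (simp add: functional_seminorm_sq[OF pos[OF st]] norm_power)
      also have "star (x * z) * (x * z) = star z * (star x * x * z)" by (simp add: star_mult mult.assoc)
      also have "cmod (?w \<dots>) \<le> ?N z * ?N (star x * x * z)"
        by (rule positive_functional_Cauchy_Schwarz[OF pos[OF st]])
      also have "\<dots> \<le> 1 * ?n (star x * x)"
        using z0 z by (intro mult_mono le1[OF st z]) (auto simp: functional_seminorm_nonneg[OF pos[OF st]])
      finally show "?N (x * z) \<le> sqrt (?n (star x * x))"
        by (simp add: real_le_rsqrt)
    qed (simp add: min_tensor_norm_nonneg)
    then show ?thesis
      by (metis min_tensor_norm_nonneg power_mono real_sqrt_pow2)
  qed
  have star_le: "?n x \<le> ?n (star x)" for x :: "('a, 'b) alg_tensor"
  proof (cases "?n x = 0")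
    case False
    have "?n x * ?n x \<le> ?n (star x) * ?n x" using sq[of x] mult[of "star x" x] by (simp add: power2_eq_square)
    then show ?thesis using False min_tensor_norm_nonneg[of x] by simp
  qed (simp add: min_tensor_norm_nonneg)
  then have star_eq: "?n (star x) = ?n x" for x :: "('a, 'b) alg_tensor" by (metis order_antisym star_star)
  show "cstar_seminorm (x + y) \<le> cstar_seminorm x + cstar_seminorm y"
    "cstar_seminorm (x * y) \<le> cstar_seminorm x * cstar_seminorm y"
    by (simp_all add: cstar_seminorm_alg_tensor_def add mult)
  show "cstar_seminorm (star x * x) = (cstar_seminorm x)\<^sup>2"
    using sq[of x] mult[of "star x" x] by (simp add: cstar_seminorm_alg_tensor_def star_eq power2_eq_square)
  show "cstar_seminorm (c *\<^sub>C x) = cmod c * cstar_seminorm x"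
  proof (cases "c = 0")
    case False
    have "?n x \<le> inverse (cmod c) * ?n (c *\<^sub>C x)"
      unfolding norm_inverse[symmetric] using scale_le[of "inverse c" "c *\<^sub>C x"] False by (simp add: scaleC_scaleC)
    then have "cmod c * ?n x \<le> ?n (c *\<^sub>C x)" using False by (simp add: field_simps)
    with scale_le[of c x] show ?thesis by (simp add: cstar_seminorm_alg_tensor_def)
  qed (use scale_le[of 0 x] min_tensor_norm_nonneg[of "0 :: ('a, 'b) alg_tensor"] in \<open>simp add: cstar_seminorm_alg_tensor_def order_antisym\<close>)
qed

end

section \<open>Completion with respect to a C*-seminorm\<close>

lemma cstar_seminorm_zero: "cstar_seminorm (0::'a::cstar_seminormed_algebra) = 0"
  using cstar_seminorm_scaleC[of 0 "0::'a"] by simp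
lemma cstar_seminorm_minus: "cstar_seminorm (- x) = cstar_seminorm (x::'a::cstar_seminormed_algebra)"
  using cstar_seminorm_scaleC[of "-1" x] by simp
lemma cstar_seminorm_nonneg: "0 \<le> cstar_seminorm (x::'a::cstar_seminormed_algebra)"
  using cstar_seminorm_add[of x "- x"] by (simp add: cstar_seminorm_zero cstar_seminorm_minus)
lemma cstar_seminorm_diff_commute: "cstar_seminorm (x - y) = cstar_seminorm (y - x :: 'a::cstar_seminormed_algebra)"
  using cstar_seminorm_minus[of "x - y"] by simp
lemma cstar_seminorm_triangle3: "cstar_seminorm (x - z) \<le> cstar_seminorm (x - y) + cstar_seminorm (y - z :: 'a::cstar_seminormed_algebra)"
  using cstar_seminorm_add[of "x - y" "y - z"] by simp
lemma cstar_seminorm_diff_le: "\<bar>cstar_seminorm x - cstar_seminorm y\<bar> \<le> cstar_seminorm (x - y :: 'a::cstar_seminormed_algebra)"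
  using cstar_seminorm_add[of "x - y" y] cstar_seminorm_add[of "y - x" x] cstar_seminorm_diff_commute[of x y] by simp
lemma cstar_seminorm_star: "cstar_seminorm (star x) = cstar_seminorm (x::'a::cstar_seminormed_algebra)"
proof -
  have le: "cstar_seminorm x \<le> cstar_seminorm (star x)" for x :: 'a
  proof (cases "cstar_seminorm x = 0")
    case False
    have "cstar_seminorm x * cstar_seminorm x \<le> cstar_seminorm (star x) * cstar_seminorm x"
      using cstar_seminorm_mult[of "star x" x] by (simp add: cstar_seminorm_star_mult power2_eq_square)
    with False cstar_seminorm_nonneg[of x] show ?thesis by simp
  qed (simp add: cstar_seminorm_nonneg)
  from le[of x] le[of "star x"] show ?thesis by simp
qed


definition seminorm_Cauchy :: "(nat \<Rightarrow> 'a::cstar_seminormed_algebra) \<Rightarrow> bool"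
  where "seminorm_Cauchy X \<longleftrightarrow> (\<forall>e>0. \<exists>N. \<forall>m\<ge>N. \<forall>n\<ge>N. cstar_seminorm (X m - X n) < e)"

lemma seminorm_Cauchy_bounded:
  assumes "seminorm_Cauchy X"
  shows "\<exists>B>0. \<forall>n. cstar_seminorm (X n) \<le> B"
proof -
  obtain N where N: "\<And>m n. m \<ge> N \<Longrightarrow> n \<ge> N \<Longrightarrow> cstar_seminorm (X m - X n) < 1"
    using assms unfolding seminorm_Cauchy_def by (meson zero_less_one)
  define B where "B = (\<Sum>k\<le>N. cstar_seminorm (X k)) + 1"
  have s: "cstar_seminorm (X k) \<le> B - 1" if "k \<le> N" for k
    unfolding B_def using that by (simp, intro member_le_sum) (auto simp: cstar_seminorm_nonneg)
  have "cstar_seminorm (X n) \<le> B" for n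
  proof (cases "n \<le> N")
    case False
    then show ?thesis using N[of n N] s[of N] cstar_seminorm_diff_le[of "X n" "X N"] by simp
  qed (use s[of n] in simp)
  moreover have "B > 0" unfolding B_def by (intro add_nonneg_pos sum_nonneg) (auto simp: cstar_seminorm_nonneg)
  ultimately show ?thesis by blast
qed

lemma seminorm_Cauchy_const: "seminorm_Cauchy (\<lambda>n. x)"
  by (auto simp: seminorm_Cauchy_def cstar_seminorm_zero)

lemma seminorm_Cauchy_dominated:
  assumes "seminorm_Cauchy X" "K > 0" "\<And>m n. cstar_seminorm (Y m - Y n) \<le> K * cstar_seminorm (X m - X n)"
  shows "seminorm_Cauchy Y"
  unfolding seminorm_Cauchy_def
proof (intro allI impI)
  fix e :: real assume "e > 0"
  then have "e / K > 0" using assms(2) by simp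
  then obtain N where N: "\<And>m n. m \<ge> N \<Longrightarrow> n \<ge> N \<Longrightarrow> cstar_seminorm (X m - X n) < e / K"
    using assms(1) unfolding seminorm_Cauchy_def by meson
  have "cstar_seminorm (Y m - Y n) < e" if "m \<ge> N" "n \<ge> N" for m n
    using assms(3)[of m n] N[OF that] assms(2) by (simp add: field_simps)
  then show "\<exists>N. \<forall>m\<ge>N. \<forall>n\<ge>N. cstar_seminorm (Y m - Y n) < e" by blast
qed

lemma seminorm_Cauchy_dominated2:
  assumes X: "seminorm_Cauchy X" and Y: "seminorm_Cauchy Y" and K: "K > 0" "L > 0"
    and le: "\<And>m n. cstar_seminorm (Z m - Z n) \<le> K * cstar_seminorm (X m - X n) + L * cstar_seminorm (Y m - Y n)"
  shows "seminorm_Cauchy Z"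
  unfolding seminorm_Cauchy_def
proof (intro allI impI)
  fix e :: real assume "e > 0"
  then have e: "e / 2 / K > 0" "e / 2 / L > 0" using K by simp_all
  obtain N where N: "\<And>m n. m \<ge> N \<Longrightarrow> n \<ge> N \<Longrightarrow> cstar_seminorm (X m - X n) < e / 2 / K"
    using X e(1) unfolding seminorm_Cauchy_def by meson
  obtain M where M: "\<And>m n. m \<ge> M \<Longrightarrow> n \<ge> M \<Longrightarrow> cstar_seminorm (Y m - Y n) < e / 2 / L"
    using Y e(2) unfolding seminorm_Cauchy_def by meson
  have "cstar_seminorm (Z m - Z n) < e" if "m \<ge> max N M" "n \<ge> max N M" for m n
  proof -
    have "K * cstar_seminorm (X m - X n) < e / 2" "L * cstar_seminorm (Y m - Y n) < e / 2"
      using N[of m n] M[of m n] that K by (simp_all add: field_simps)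
    then show ?thesis using le[of m n] by simp
  qed
  then show "\<exists>N. \<forall>m\<ge>N. \<forall>n\<ge>N. cstar_seminorm (Z m - Z n) < e" by blast
qed

definition seminorm_rel :: "(nat \<Rightarrow> 'a::cstar_seminormed_algebra) \<Rightarrow> (nat \<Rightarrow> 'a) \<Rightarrow> bool"
  where "seminorm_rel X Y \<longleftrightarrow> seminorm_Cauchy X \<and> seminorm_Cauchy Y \<and>
    (\<lambda>n. cstar_seminorm (X n - Y n)) \<longlonglongrightarrow> 0"

lemma seminorm_rel_refl: "seminorm_Cauchy X \<Longrightarrow> seminorm_rel X X"
  by (simp add: seminorm_rel_def cstar_seminorm_zero)

lemma seminorm_squeeze:
  assumes "f \<longlonglongrightarrow> (0::real)" "\<And>n. cstar_seminorm (Z n) \<le> f n"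
  shows "(\<lambda>n. cstar_seminorm (Z n)) \<longlonglongrightarrow> 0"
  by (rule tendsto_sandwich[OF _ _ tendsto_const assms(1)]) (auto simp: cstar_seminorm_nonneg assms(2))

lemma seminorm_rel_part_equivp: "part_equivp seminorm_rel"
proof (rule part_equivpI)
  show "\<exists>X::nat \<Rightarrow> 'a. seminorm_rel X X" using seminorm_rel_refl seminorm_Cauchy_const by blast
  show "symp (seminorm_rel :: (nat \<Rightarrow> 'a) \<Rightarrow> _)"
    by (auto simp: symp_def seminorm_rel_def cstar_seminorm_diff_commute)
  show "transp (seminorm_rel :: (nat \<Rightarrow> 'a) \<Rightarrow> _)"
  proof (rule transpI)
    fix X Y Z :: "nat \<Rightarrow> 'a"
    assume a: "seminorm_rel X Y" "seminorm_rel Y Z"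
    have "(\<lambda>n. cstar_seminorm (X n - Y n) + cstar_seminorm (Y n - Z n)) \<longlonglongrightarrow> 0"
      using a unfolding seminorm_rel_def by (intro tendsto_add_zero) auto
    then have "(\<lambda>n. cstar_seminorm (X n - Z n)) \<longlonglongrightarrow> 0"
      by (rule seminorm_squeeze) (rule cstar_seminorm_triangle3)
    with a show "seminorm_rel X Z" by (simp add: seminorm_rel_def)
  qed
qed

quotient_type (overloaded) 'a cstar_completion = "nat \<Rightarrow> 'a::cstar_seminormed_algebra" / partial: seminorm_rel
  by (rule seminorm_rel_part_equivp)

lemma seminorm_rel_dominated2:
  assumes "seminorm_rel X X'" "seminorm_rel Y Y'" "seminorm_Cauchy Z" "seminorm_Cauchy Z'"
    and "\<And>n. cstar_seminorm (Z n - Z' n) \<le> K * cstar_seminorm (X n - X' n) + L * cstar_seminorm (Y n - Y' n)"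
  shows "seminorm_rel Z Z'"
proof -
  have "(\<lambda>n. K * cstar_seminorm (X n - X' n) + L * cstar_seminorm (Y n - Y' n)) \<longlonglongrightarrow> 0"
    using assms(1,2) unfolding seminorm_rel_def by (intro tendsto_add_zero tendsto_mult_right_zero) auto
  from seminorm_squeeze[OF this assms(5)] show ?thesis using assms(3,4) by (simp add: seminorm_rel_def)
qed

lemma cstar_seminorm_diff_add_le: "cstar_seminorm ((a + b) - (a' + b') :: 'a::cstar_seminormed_algebra)
   \<le> 1 * cstar_seminorm (a - a') + 1 * cstar_seminorm (b - b')"
  using cstar_seminorm_add[of "a - a'" "b - b'"] by (simp add: algebra_simps)
lemma cstar_seminorm_diff_scale_le: "cstar_seminorm (c *\<^sub>C a - c *\<^sub>C a' :: 'a::cstar_seminormed_algebra)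
   \<le> (cmod c + 1) * cstar_seminorm (a - a')"
  using cstar_seminorm_scaleC[of c "a - a'"] cstar_seminorm_nonneg[of "a - a'"]
  by (simp add: scaleC_diff_right algebra_simps)
lemma cstar_seminorm_diff_star_le: "cstar_seminorm (star a - star a' :: 'a::cstar_seminormed_algebra) \<le> 1 * cstar_seminorm (a - a')"
  using cstar_seminorm_star[of "a - a'"] star_add[of a "- a'"] by (simp add: star_minus)
lemma cstar_seminorm_diff_mult_le:
  assumes "cstar_seminorm a' \<le> A" "cstar_seminorm b \<le> B"
  shows "cstar_seminorm (a * b - a' * b' :: 'a::cstar_seminormed_algebra)
     \<le> B * cstar_seminorm (a - a') + A * cstar_seminorm (b - b')"
proof -
  have "a * b - a' * b' = (a - a') * b + a' * (b - b')" by (simp add: algebra_simps)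
  then have "cstar_seminorm (a * b - a' * b') \<le> cstar_seminorm (a - a') * cstar_seminorm b + cstar_seminorm a' * cstar_seminorm (b - b')"
    using cstar_seminorm_add[of "(a - a') * b" "a' * (b - b')"]
      cstar_seminorm_mult[of "a - a'" b] cstar_seminorm_mult[of a' "b - b'"] by simp
  also have "\<dots> \<le> cstar_seminorm (a - a') * B + A * cstar_seminorm (b - b')"
    by (intro add_mono mult_left_mono mult_right_mono assms cstar_seminorm_nonneg)
  finally show ?thesis by (simp add: mult.commute)
qed

lemma seminorm_Cauchy_add:
  assumes "seminorm_Cauchy X" "seminorm_Cauchy Y" shows "seminorm_Cauchy (\<lambda>n. X n + Y n)"
  by (rule seminorm_Cauchy_dominated2[OF assms zero_less_one zero_less_one cstar_seminorm_diff_add_le])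
lemma seminorm_Cauchy_scaleC:
  assumes "seminorm_Cauchy X" shows "seminorm_Cauchy (\<lambda>n. c *\<^sub>C X n)"
proof (rule seminorm_Cauchy_dominated[OF assms _ cstar_seminorm_diff_scale_le])
  show "cmod c + 1 > 0" using norm_ge_zero[of c] by linarith
qed
lemma seminorm_Cauchy_star:
  assumes "seminorm_Cauchy X" shows "seminorm_Cauchy (\<lambda>n. star (X n))"
  by (rule seminorm_Cauchy_dominated[OF assms zero_less_one cstar_seminorm_diff_star_le])
lemma seminorm_Cauchy_mult:
  assumes "seminorm_Cauchy X" "seminorm_Cauchy Y" shows "seminorm_Cauchy (\<lambda>n. X n * Y n)"
proof -
  obtain A where A: "A > 0" "\<And>n. cstar_seminorm (X n) \<le> A" using seminorm_Cauchy_bounded[OF assms(1)] by blast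
  obtain B where B: "B > 0" "\<And>n. cstar_seminorm (Y n) \<le> B" using seminorm_Cauchy_bounded[OF assms(2)] by blast
  show ?thesis by (rule seminorm_Cauchy_dominated2[OF assms B(1) A(1)]) (rule cstar_seminorm_diff_mult_le[OF A(2) B(2)])
qed

lemma seminorm_relD: "seminorm_rel X Y \<Longrightarrow> seminorm_Cauchy X" "seminorm_rel X Y \<Longrightarrow> seminorm_Cauchy Y"
  by (auto simp: seminorm_rel_def)

lemma seminorm_rel_add:
  assumes "seminorm_rel X X'" "seminorm_rel Y Y'" shows "seminorm_rel (\<lambda>n. X n + Y n) (\<lambda>n. X' n + Y' n)"
  by (rule seminorm_rel_dominated2[OF assms _ _ cstar_seminorm_diff_add_le]; intro seminorm_Cauchy_add seminorm_relD[OF assms(1)] seminorm_relD[OF assms(2)])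
lemma seminorm_rel_scaleC:
  assumes "seminorm_rel X X'" shows "seminorm_rel (\<lambda>n. c *\<^sub>C X n) (\<lambda>n. c *\<^sub>C X' n)"
proof (rule seminorm_rel_dominated2[where K = "cmod c + 1" and L = 0, OF assms assms])
  show "seminorm_Cauchy (\<lambda>n. c *\<^sub>C X n)" "seminorm_Cauchy (\<lambda>n. c *\<^sub>C X' n)"
    by (intro seminorm_Cauchy_scaleC seminorm_relD[OF assms])+
  show "cstar_seminorm (c *\<^sub>C X n - c *\<^sub>C X' n)
      \<le> (cmod c + 1) * cstar_seminorm (X n - X' n) + 0 * cstar_seminorm (X n - X' n)" for n
    using cstar_seminorm_diff_scale_le[of c "X n" "X' n"] by simp
qed
lemma seminorm_rel_star:
  assumes "seminorm_rel X X'" shows "seminorm_rel (\<lambda>n. star (X n)) (\<lambda>n. star (X' n))"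
proof (rule seminorm_rel_dominated2[where K = 1 and L = 0, OF assms assms])
  show "seminorm_Cauchy (\<lambda>n. star (X n))" "seminorm_Cauchy (\<lambda>n. star (X' n))"
    by (intro seminorm_Cauchy_star seminorm_relD[OF assms])+
  show "cstar_seminorm (star (X n) - star (X' n))
      \<le> 1 * cstar_seminorm (X n - X' n) + 0 * cstar_seminorm (X n - X' n)" for n
    using cstar_seminorm_diff_star_le[of "X n" "X' n"] by simp
qed
lemma seminorm_rel_mult:
  assumes "seminorm_rel X X'" "seminorm_rel Y Y'" shows "seminorm_rel (\<lambda>n. X n * Y n) (\<lambda>n. X' n * Y' n)"
proof -
  obtain A where A: "A > 0" "\<And>n. cstar_seminorm (X' n) \<le> A"
    using seminorm_Cauchy_bounded[OF seminorm_relD(2)[OF assms(1)]] by blast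
  obtain B where B: "B > 0" "\<And>n. cstar_seminorm (Y n) \<le> B"
    using seminorm_Cauchy_bounded[OF seminorm_relD(1)[OF assms(2)]] by blast
  show ?thesis
    by (rule seminorm_rel_dominated2[OF assms _ _ cstar_seminorm_diff_mult_le[OF A(2) B(2)]];
        intro seminorm_Cauchy_mult seminorm_relD[OF assms(1)] seminorm_relD[OF assms(2)])
qed

lemma seminorm_Cauchy_convergent:
  assumes "seminorm_Cauchy X" shows "convergent (\<lambda>n. cstar_seminorm (X n))"
proof -
  have "Cauchy (\<lambda>n. cstar_seminorm (X n))"
  proof (rule CauchyI)
    fix e :: real assume "e > 0"
    with assms obtain N where N: "\<And>m n. m \<ge> N \<Longrightarrow> n \<ge> N \<Longrightarrow> cstar_seminorm (X m - X n) < e"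
      unfolding seminorm_Cauchy_def by meson
    have "norm (cstar_seminorm (X m) - cstar_seminorm (X n)) < e" if "m \<ge> N" "n \<ge> N" for m n
      using N[OF that] cstar_seminorm_diff_le[of "X m" "X n"] by simp
    then show "\<exists>M. \<forall>m\<ge>M. \<forall>n\<ge>M. norm (cstar_seminorm (X m) - cstar_seminorm (X n)) < e" by blast
  qed
  then show ?thesis by (simp add: Cauchy_convergent_iff)
qed

lemma norm_completion_lim:
  assumes "seminorm_Cauchy X"
  shows "(\<lambda>n. cstar_seminorm (X n)) \<longlonglongrightarrow> lim (\<lambda>n. cstar_seminorm (X n))"
  using seminorm_Cauchy_convergent[OF assms] convergent_LIMSEQ_iff by blast

lemma seminorm_rel_eqI: "seminorm_Cauchy X \<Longrightarrow> (\<And>n. X n = Y n) \<Longrightarrow> seminorm_rel X Y"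
proof -
  assume a: "seminorm_Cauchy X" "\<And>n. X n = Y n"
  then have "X = Y" by (intro ext)
  with seminorm_rel_refl[OF a(1)] show "seminorm_rel X Y" by simp
qed

lemma seminorm_rel_lim:
  assumes "seminorm_rel X Y"
  shows "lim (\<lambda>n. cstar_seminorm (X n)) = lim (\<lambda>n. cstar_seminorm (Y n))"
proof -
  have "(\<lambda>n. cstar_seminorm (X n) - cstar_seminorm (Y n)) \<longlonglongrightarrow> 0"
  proof (rule Lim_null_comparison)
    show "\<forall>\<^sub>F n in sequentially. norm (cstar_seminorm (X n) - cstar_seminorm (Y n)) \<le> cstar_seminorm (X n - Y n)"
      by (rule always_eventually) (simp add: cstar_seminorm_diff_le)
    show "(\<lambda>n. cstar_seminorm (X n - Y n)) \<longlonglongrightarrow> 0"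
      using assms unfolding seminorm_rel_def by blast
  qed
  moreover have "(\<lambda>n. cstar_seminorm (X n) - cstar_seminorm (Y n)) \<longlonglongrightarrow>
      lim (\<lambda>n. cstar_seminorm (X n)) - lim (\<lambda>n. cstar_seminorm (Y n))"
    using seminorm_relD[OF assms] by (intro tendsto_diff norm_completion_lim)
  ultimately have "lim (\<lambda>n. cstar_seminorm (X n)) - lim (\<lambda>n. cstar_seminorm (Y n)) = 0"
    by (rule LIMSEQ_unique[symmetric])
  then show ?thesis by simp
qed

instantiation cstar_completion :: (cstar_seminormed_algebra) star_algebra
begin

lift_definition zero_cstar_completion :: "'a cstar_completion" is "\<lambda>n. 0"
  by (rule seminorm_rel_refl[OF seminorm_Cauchy_const])
lift_definition one_cstar_completion :: "'a cstar_completion" is "\<lambda>n. 1"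
  by (rule seminorm_rel_refl[OF seminorm_Cauchy_const])
lift_definition plus_cstar_completion :: "'a cstar_completion \<Rightarrow> 'a cstar_completion \<Rightarrow> 'a cstar_completion"
  is "\<lambda>X Y n. X n + Y n" by (rule seminorm_rel_add)
lift_definition times_cstar_completion :: "'a cstar_completion \<Rightarrow> 'a cstar_completion \<Rightarrow> 'a cstar_completion"
  is "\<lambda>X Y n. X n * Y n" by (rule seminorm_rel_mult)
lift_definition scaleC_cstar_completion :: "complex \<Rightarrow> 'a cstar_completion \<Rightarrow> 'a cstar_completion"
  is "\<lambda>c X n. c *\<^sub>C X n" by (rule seminorm_rel_scaleC)
lift_definition star_cstar_completion :: "'a cstar_completion \<Rightarrow> 'a cstar_completion"
  is "\<lambda>X n. star (X n)" by (rule seminorm_rel_star)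
definition uminus_cstar_completion :: "'a cstar_completion \<Rightarrow> 'a cstar_completion"
  where "uminus_cstar_completion x = (-1) *\<^sub>C x"
definition minus_cstar_completion :: "'a cstar_completion \<Rightarrow> 'a cstar_completion \<Rightarrow> 'a cstar_completion"
  where "minus_cstar_completion x y = x + (- y)"
definition scaleR_cstar_completion :: "real \<Rightarrow> 'a cstar_completion \<Rightarrow> 'a cstar_completion"
  where "scaleR_cstar_completion r x = complex_of_real r *\<^sub>C x"

instance
proof
  note C = seminorm_Cauchy_add seminorm_Cauchy_mult seminorm_Cauchy_scaleC seminorm_Cauchy_star
    seminorm_Cauchy_const
  fix x y z :: "'a cstar_completion" and r s :: real and c d :: complex
  show "x + y + z = x + (y + z)"
    by transfer (rule seminorm_rel_eqI, (intro C | erule seminorm_relD(1))+, simp add: add.assoc)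
  show "x + y = y + x" by transfer (rule seminorm_rel_eqI, (intro C | erule seminorm_relD(1))+, simp add: add.commute)
  show "0 + x = x" by transfer (rule seminorm_rel_eqI, (intro C | erule seminorm_relD(1))+, simp)
  show "- x + x = 0" unfolding uminus_cstar_completion_def
    by transfer (rule seminorm_rel_eqI, (intro C | erule seminorm_relD(1))+, simp)
  show "x - y = x + - y" by (simp add: minus_cstar_completion_def)
  show sadd: "c *\<^sub>C (x + y) = c *\<^sub>C x + c *\<^sub>C y" for c
    by transfer (rule seminorm_rel_eqI, (intro C | erule seminorm_relD(1))+, simp add: scaleC_add_right)
  show sadd2: "(c + d) *\<^sub>C x = c *\<^sub>C x + d *\<^sub>C x" for c d
    by transfer (rule seminorm_rel_eqI, (intro C | erule seminorm_relD(1))+, simp add: scaleC_add_left)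
  show ss: "c *\<^sub>C d *\<^sub>C x = (c * d) *\<^sub>C x" for c d
    by transfer (rule seminorm_rel_eqI, (intro C | erule seminorm_relD(1))+, simp add: scaleC_scaleC)
  show s1: "(c *\<^sub>C x) * y = c *\<^sub>C (x * y)" for c
    by transfer (rule seminorm_rel_eqI, (intro C | erule seminorm_relD(1))+, simp add: mult_scaleC_left)
  show s2: "x * (c *\<^sub>C y) = c *\<^sub>C (x * y)" for c
    by transfer (rule seminorm_rel_eqI, (intro C | erule seminorm_relD(1))+, simp add: mult_scaleC_right)
  show "r *\<^sub>R x = complex_of_real r *\<^sub>C x" by (simp add: scaleR_cstar_completion_def)
  show "r *\<^sub>R (x + y) = r *\<^sub>R x + r *\<^sub>R y" "(r + s) *\<^sub>R x = r *\<^sub>R x + s *\<^sub>R x"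
    "r *\<^sub>R s *\<^sub>R x = (r * s) *\<^sub>R x"
    by (simp_all add: scaleR_cstar_completion_def sadd sadd2 ss)
  show "1 *\<^sub>R x = x" unfolding scaleR_cstar_completion_def by transfer simp
  show "(r *\<^sub>R x) * y = r *\<^sub>R (x * y)" "x * (r *\<^sub>R y) = r *\<^sub>R (x * y)"
    by (simp_all add: scaleR_cstar_completion_def s1 s2)
  show "x * y * z = x * (y * z)" by transfer (rule seminorm_rel_eqI, (intro C | erule seminorm_relD(1))+, simp add: mult.assoc)
  show "(x + y) * z = x * z + y * z" by transfer (rule seminorm_rel_eqI, (intro C | erule seminorm_relD(1))+, simp add: distrib_right)
  show "x * (y + z) = x * y + x * z" by transfer (rule seminorm_rel_eqI, (intro C | erule seminorm_relD(1))+, simp add: distrib_left)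
  show "1 * x = x" by transfer simp
  show "x * 1 = x" by transfer simp
  show "star (x + y) = star x + star y" by transfer (rule seminorm_rel_eqI, (intro C | erule seminorm_relD(1))+, simp add: star_add)
  show "star (c *\<^sub>C x) = cnj c *\<^sub>C star x" by transfer (rule seminorm_rel_eqI, (intro C | erule seminorm_relD(1))+, simp add: star_scaleC)
  show "star (x * y) = star y * star x" by transfer (rule seminorm_rel_eqI, (intro C | erule seminorm_relD(1))+, simp add: star_mult)
  show "star (star x) = x" by transfer simp
qed

end

lift_definition to_completion :: "'a::cstar_seminormed_algebra \<Rightarrow> 'a cstar_completion" is "\<lambda>x n. x"
  by (rule seminorm_rel_refl[OF seminorm_Cauchy_const])

instantiation cstar_completion :: (cstar_seminormed_algebra) real_normed_algebra
begin

lift_definition norm_cstar_completion :: "'a cstar_completion \<Rightarrow> real"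
  is "\<lambda>X. lim (\<lambda>n. cstar_seminorm (X n))" by (rule seminorm_rel_lim)
definition dist_cstar_completion :: "'a cstar_completion \<Rightarrow> 'a cstar_completion \<Rightarrow> real"
  where "dist_cstar_completion x y = norm (x - y)"
definition sgn_cstar_completion :: "'a cstar_completion \<Rightarrow> 'a cstar_completion"
  where "sgn_cstar_completion x = x /\<^sub>R norm x"
definition uniformity_cstar_completion :: "('a cstar_completion \<times> 'a cstar_completion) filter"
  where "uniformity_cstar_completion = (INF e\<in>{0 <..}. principal {(x, y). dist x y < e})"
definition open_cstar_completion :: "'a cstar_completion set \<Rightarrow> bool"
  where "open_cstar_completion S \<longleftrightarrow> (\<forall>x\<in>S. \<forall>\<^sub>F (x', y) in uniformity. x' = x \<longrightarrow> y \<in> S)"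

instance
proof
  fix x y :: "'a cstar_completion" and r :: real
  show "dist x y = norm (x - y)" by (simp add: dist_cstar_completion_def)
  show "sgn x = x /\<^sub>R norm x" by (simp add: sgn_cstar_completion_def)
  show "uniformity = (INF e\<in>{0 <..}. principal {(x::'a cstar_completion, y). dist x y < e})"
    by (simp add: uniformity_cstar_completion_def)
  show "open U \<longleftrightarrow> (\<forall>x\<in>U. \<forall>\<^sub>F (x', y) in uniformity. x' = x \<longrightarrow> y \<in> U)" for U :: "'a cstar_completion set"
    by (simp add: open_cstar_completion_def)
  show "norm x = 0 \<longleftrightarrow> x = 0"
  proof (transfer, rule iffI)
    fix X :: "nat \<Rightarrow> 'a" assume X: "seminorm_rel X X" and "lim (\<lambda>n. cstar_seminorm (X n)) = 0"
    then show "seminorm_rel X (\<lambda>n. 0)"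
      using norm_completion_lim[of X] seminorm_relD(1)[OF X] seminorm_Cauchy_const[of 0]
      by (simp add: seminorm_rel_def)
  next
    fix X :: "nat \<Rightarrow> 'a" assume "seminorm_rel X (\<lambda>n. 0)"
    then show "lim (\<lambda>n. cstar_seminorm (X n)) = 0"
      by (auto simp: seminorm_rel_def intro: limI)
  qed
  show "norm (x + y) \<le> norm x + norm y"
  proof transfer
    fix X Y :: "nat \<Rightarrow> 'a" assume "seminorm_rel X X" "seminorm_rel Y Y"
    then have c: "seminorm_Cauchy X" "seminorm_Cauchy Y" by (auto dest: seminorm_relD)
    show "lim (\<lambda>n. cstar_seminorm (X n + Y n)) \<le> lim (\<lambda>n. cstar_seminorm (X n)) + lim (\<lambda>n. cstar_seminorm (Y n))"
      by (rule LIMSEQ_le[OF norm_completion_lim[OF seminorm_Cauchy_add[OF c]]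
          tendsto_add[OF norm_completion_lim[OF c(1)] norm_completion_lim[OF c(2)]]])
        (auto intro: cstar_seminorm_add)
  qed
  show "norm (x * y) \<le> norm x * norm y"
  proof transfer
    fix X Y :: "nat \<Rightarrow> 'a" assume "seminorm_rel X X" "seminorm_rel Y Y"
    then have c: "seminorm_Cauchy X" "seminorm_Cauchy Y" by (auto dest: seminorm_relD)
    show "lim (\<lambda>n. cstar_seminorm (X n * Y n)) \<le> lim (\<lambda>n. cstar_seminorm (X n)) * lim (\<lambda>n. cstar_seminorm (Y n))"
      by (rule LIMSEQ_le[OF norm_completion_lim[OF seminorm_Cauchy_mult[OF c]]
          tendsto_mult[OF norm_completion_lim[OF c(1)] norm_completion_lim[OF c(2)]]])
        (auto intro: cstar_seminorm_mult)
  qed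
  show "norm (r *\<^sub>R x) = \<bar>r\<bar> * norm x"
    unfolding scaleR_scaleC
  proof transfer
    fix X :: "nat \<Rightarrow> 'a" and r :: real assume "seminorm_rel X X"
    then have c: "seminorm_Cauchy X" by (auto dest: seminorm_relD)
    show "lim (\<lambda>n. cstar_seminorm (complex_of_real r *\<^sub>C X n)) = \<bar>r\<bar> * lim (\<lambda>n. cstar_seminorm (X n))"
      unfolding cstar_seminorm_scaleC norm_of_real
      by (rule limI[OF tendsto_mult_left[OF norm_completion_lim[OF c]]])
  qed
qed

end

lemma norm_to_completion: "norm (to_completion x) = cstar_seminorm x"
  by transfer simp

lemma to_completion_diff: "to_completion (x - y) = to_completion x - to_completion y"
proof -
  have m: "x - y = x + (-1) *\<^sub>C y" for x y :: "'b::star_algebra" by simp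
  show ?thesis unfolding m
    by transfer (rule seminorm_rel_refl, rule seminorm_Cauchy_const)
qed

lemma to_completion_dense:
  fixes x :: "'a::cstar_seminormed_algebra cstar_completion"
  assumes "e > 0"
  shows "\<exists>a. norm (x - to_completion a) < e"
proof -
  have m: "x - to_completion a = x + (-1) *\<^sub>C to_completion a" for a by simp
  show ?thesis unfolding m using assms
  proof (transfer)
    fix X :: "nat \<Rightarrow> 'a" and e :: real assume "seminorm_rel X X" and e: "e > 0"
    then have c: "seminorm_Cauchy X" by (auto dest: seminorm_relD)
    obtain N where N: "\<And>m n. m \<ge> N \<Longrightarrow> n \<ge> N \<Longrightarrow> cstar_seminorm (X m - X n) < e / 2"
      using c e unfolding seminorm_Cauchy_def by (meson half_gt_zero)
    have "lim (\<lambda>n. cstar_seminorm (X n + (- 1) *\<^sub>C X N)) \<le> e / 2"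
    proof (rule LIMSEQ_le_const2[OF norm_completion_lim])
      show "seminorm_Cauchy (\<lambda>n. X n + (- 1) *\<^sub>C X N)"
        by (intro seminorm_Cauchy_add c seminorm_Cauchy_const)
      show "\<exists>M. \<forall>n\<ge>M. cstar_seminorm (X n + (- 1) *\<^sub>C X N) \<le> e / 2"
        using N[of _ N] by (auto intro!: exI[of _ N] less_imp_le)
    qed
    then show "\<exists>a. lim (\<lambda>n. cstar_seminorm (X n + (- 1) *\<^sub>C a)) < e"
      using e by (intro exI[of _ "X N"]) simp
  qed
qed

instance cstar_completion :: (cstar_seminormed_algebra) cstar_algebra
proof
  fix x :: "'a cstar_completion" and c :: complex
  show "norm (c *\<^sub>C x) = cmod c * norm x"
  proof transfer
    fix X :: "nat \<Rightarrow> 'a" and c assume "seminorm_rel X X"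
    then have C: "seminorm_Cauchy X" by (auto dest: seminorm_relD)
    show "lim (\<lambda>n. cstar_seminorm (c *\<^sub>C X n)) = cmod c * lim (\<lambda>n. cstar_seminorm (X n))"
      unfolding cstar_seminorm_scaleC
      by (rule limI[OF tendsto_mult_left[OF norm_completion_lim[OF C]]])
  qed
  show "norm (star x * x) = (norm x)\<^sup>2"
  proof transfer
    fix X :: "nat \<Rightarrow> 'a" assume "seminorm_rel X X"
    then have C: "seminorm_Cauchy X" by (auto dest: seminorm_relD)
    show "lim (\<lambda>n. cstar_seminorm (star (X n) * X n)) = (lim (\<lambda>n. cstar_seminorm (X n)))\<^sup>2"
      unfolding cstar_seminorm_star_mult
      by (rule limI[OF tendsto_power[OF norm_completion_lim[OF C]]])
  qed
next
  fix F :: "nat \<Rightarrow> 'a cstar_completion" assume F: "Cauchy F"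
  have "\<forall>n. \<exists>a. norm (F n - to_completion a) < inverse (real (Suc n))"
    by (intro allI to_completion_dense) simp
  then obtain a where a: "\<And>n. norm (F n - to_completion (a n)) < inverse (real (Suc n))" by metis
  have small: "\<exists>N. \<forall>n\<ge>N. norm (F n - to_completion (a n)) < e" if e: "e > 0" for e
  proof -
    obtain N where "inverse (real (Suc N)) < e" using reals_Archimedean[OF e] by blast
    moreover have "inverse (real (Suc n)) \<le> inverse (real (Suc N))" if "n \<ge> N" for n using that by simp
    ultimately show ?thesis using a by (meson less_trans order_less_le_trans le_less_trans)
  qed
  have cau: "seminorm_Cauchy a"
    unfolding seminorm_Cauchy_def
  proof (intro allI impI)
    fix e :: real assume "e > 0"
    then have e: "e / 3 > 0" by simp
    obtain N where N: "\<forall>n\<ge>N. norm (F n - to_completion (a n)) < e / 3" using small[OF e] by blast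
    obtain M where M: "\<forall>m\<ge>M. \<forall>n\<ge>M. norm (F m - F n) < e / 3" using CauchyD[OF F e] by blast
    have "cstar_seminorm (a m - a n) < e" if "m \<ge> max N M" "n \<ge> max N M" for m n
    proof -
      have "norm (to_completion (a m) - to_completion (a n))
         = norm ((F m - F n) - (F m - to_completion (a m)) + (F n - to_completion (a n)))" by simp
      also have "\<dots> \<le> norm (F m - F n) + norm (F m - to_completion (a m)) + norm (F n - to_completion (a n))"
        by (meson add_right_mono norm_triangle_ineq norm_triangle_ineq4 order_trans)
      also have "\<dots> < e / 3 + e / 3 + e / 3" using that N M by (intro add_strict_mono) auto
      finally show ?thesis by (simp add: to_completion_diff[symmetric] norm_to_completion)
    qed
    then show "\<exists>N. \<forall>m\<ge>N. \<forall>n\<ge>N. cstar_seminorm (a m - a n) < e" by blast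
  qed
  define L where "L = abs_cstar_completion a"
  have close: "\<exists>N. \<forall>n\<ge>N. norm (L - to_completion (a n)) < e" if e: "e > 0" for e
  proof -
    obtain N where N: "\<And>m n. m \<ge> N \<Longrightarrow> n \<ge> N \<Longrightarrow> cstar_seminorm (a m - a n) < e / 2"
      using cau e unfolding seminorm_Cauchy_def by (meson half_gt_zero)
    have "norm (L - to_completion (a n)) < e" if "n \<ge> N" for n
    proof -
      have cd: "seminorm_Cauchy (\<lambda>m. a m + (- 1) *\<^sub>C a n)"
        by (intro seminorm_Cauchy_add cau seminorm_Cauchy_const)
      have "L - to_completion (a n) = L + (-1) *\<^sub>C to_completion (a n)" by simp
      also have "\<dots> = abs_cstar_completion (\<lambda>m. a m + (- 1) *\<^sub>C a n)"
        unfolding L_def to_completion.abs_eq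
        unfolding scaleC_cstar_completion.abs_eq[OF seminorm_rel_refl[OF seminorm_Cauchy_const]]
        by (rule plus_cstar_completion.abs_eq) (intro seminorm_rel_refl seminorm_Cauchy_const cau)+
      finally have "norm (L - to_completion (a n)) = lim (\<lambda>m. cstar_seminorm (a m + (- 1) *\<^sub>C a n))"
        using norm_cstar_completion.abs_eq[OF seminorm_rel_refl[OF cd]] by (simp only:)
      also have "\<dots> \<le> e / 2"
      proof (rule LIMSEQ_le_const2[OF norm_completion_lim[OF cd]])
        show "\<exists>M. \<forall>m\<ge>M. cstar_seminorm (a m + (- 1) *\<^sub>C a n) \<le> e / 2"
          using N[OF _ that] by (auto intro!: exI[of _ N] less_imp_le)
      qed
      finally show ?thesis using e by simp
    qed
    then show ?thesis by blast
  qed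
  have "F \<longlonglongrightarrow> L"
  proof (rule LIMSEQ_I)
    fix e :: real assume "e > 0"
    then have e: "e / 2 > 0" by simp
    obtain N where N: "\<forall>n\<ge>N. norm (F n - to_completion (a n)) < e / 2" using small[OF e] by blast
    obtain M where M: "\<forall>n\<ge>M. norm (L - to_completion (a n)) < e / 2" using close[OF e] by blast
    have "norm (F n - L) < e" if "n \<ge> max N M" for n
    proof -
      have "norm (F n - L) = norm ((F n - to_completion (a n)) - (L - to_completion (a n)))" by simp
      also have "\<dots> \<le> norm (F n - to_completion (a n)) + norm (L - to_completion (a n))"
        by (rule norm_triangle_ineq4)
      finally show ?thesis using that N M by (smt (verit, best) field_sum_of_halves max.boundedE)
    qed
    then show "\<exists>no. \<forall>n\<ge>no. norm (F n - L) < e" by blast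
  qed
  then show "convergent F" by (rule convergentI)
qed


section \<open>Bounded continuous functions\<close>

setup_lifting type_definition_bcontfun

instantiation bcontfun :: (metric_space, cstar_algebra) cstar_algebra
begin

lift_definition one_bcontfun :: "'a \<Rightarrow>\<^sub>C 'b" is "\<lambda>_. 1"
  by (rule const_bcontfun)
lift_definition times_bcontfun :: "('a \<Rightarrow>\<^sub>C 'b) \<Rightarrow> ('a \<Rightarrow>\<^sub>C 'b) \<Rightarrow> 'a \<Rightarrow>\<^sub>C 'b" is "\<lambda>f g x. f x * g x"
proof -
  fix f g :: "'a \<Rightarrow> 'b" assume "f \<in> bcontfun" "g \<in> bcontfun"
  then have c: "continuous_on UNIV f" "continuous_on UNIV g" and "bounded (range f)" "bounded (range g)"
    by (auto simp: bcontfun_def)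
  then obtain A B where "\<And>x. norm (f x) \<le> A" "\<And>x. norm (g x) \<le> B"
    unfolding bounded_iff by auto
  then have "norm (f x * g x) \<le> A * B" for x
    by (meson mult_mono norm_ge_zero norm_mult_ineq order_trans)
  then show "(\<lambda>x. f x * g x) \<in> bcontfun"
    using c by (intro bcontfun_normI continuous_on_mult)
qed
lift_definition scaleC_bcontfun :: "complex \<Rightarrow> ('a \<Rightarrow>\<^sub>C 'b) \<Rightarrow> 'a \<Rightarrow>\<^sub>C 'b" is "\<lambda>c f x. c *\<^sub>C f x"
proof -
  fix c and f :: "'a \<Rightarrow> 'b" assume "f \<in> bcontfun"
  then have c: "continuous_on UNIV f" and "bounded (range f)"
    by (auto simp: bcontfun_def)
  then obtain A where A: "\<And>x. norm (f x) \<le> A"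
    unfolding bounded_iff by auto
  have "bounded_linear (\<lambda>y::'b. c *\<^sub>C y)"
    by (rule bounded_linear_intro[of _ "cmod c"])
      (auto simp: scaleC_add_right scaleR_scaleC scaleC_scaleC norm_scaleC mult.commute)
  then show "(\<lambda>x. c *\<^sub>C f x) \<in> bcontfun"
    using c A by (intro bcontfun_normI[of _ "cmod c * A"])
      (auto intro: bounded_linear.continuous_on simp: norm_scaleC mult_left_mono)
qed
lift_definition star_bcontfun :: "('a \<Rightarrow>\<^sub>C 'b) \<Rightarrow> 'a \<Rightarrow>\<^sub>C 'b" is "\<lambda>f x. star (f x)"
proof -
  fix f :: "'a \<Rightarrow> 'b" assume "f \<in> bcontfun"
  then have c: "continuous_on UNIV f" and "bounded (range f)"
    by (auto simp: bcontfun_def)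
  then obtain A where A: "\<And>x. norm (f x) \<le> A"
    unfolding bounded_iff by auto
  have "bounded_linear (star :: 'b \<Rightarrow> 'b)"
    by (rule bounded_linear_intro[of _ 1])
      (auto simp: star_add scaleR_scaleC star_scaleC norm_star)
  then show "(\<lambda>x. star (f x)) \<in> bcontfun"
    using c A by (intro bcontfun_normI[of _ A])
      (auto intro: bounded_linear.continuous_on simp: norm_star)
qed

instance
proof
  fix f g h :: "'a \<Rightarrow>\<^sub>C 'b" and c d :: complex and r :: real
  note rep = times_bcontfun.rep_eq one_bcontfun.rep_eq scaleC_bcontfun.rep_eq star_bcontfun.rep_eq
  show "f * g * h = f * (g * h)" by (rule bcontfun_eqI) (simp add: rep mult.assoc)
  show "(f + g) * h = f * h + g * h" by (rule bcontfun_eqI) (simp add: rep distrib_right)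
  show "f * (g + h) = f * g + f * h" by (rule bcontfun_eqI) (simp add: rep distrib_left)
  show "1 * f = f" "f * 1 = f" by (rule bcontfun_eqI, simp add: rep)+
  show "(r *\<^sub>R f) * g = r *\<^sub>R (f * g)" "f * (r *\<^sub>R g) = r *\<^sub>R (f * g)"
    by (rule bcontfun_eqI, simp add: rep)+
  show "c *\<^sub>C (f + g) = c *\<^sub>C f + c *\<^sub>C g" by (rule bcontfun_eqI) (simp add: rep scaleC_add_right)
  show "(c + d) *\<^sub>C f = c *\<^sub>C f + d *\<^sub>C f" by (rule bcontfun_eqI) (simp add: rep scaleC_add_left)
  show "c *\<^sub>C d *\<^sub>C f = (c * d) *\<^sub>C f" by (rule bcontfun_eqI) (simp add: rep scaleC_scaleC)
  show "r *\<^sub>R f = complex_of_real r *\<^sub>C f" by (rule bcontfun_eqI) (simp add: rep scaleR_scaleC)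
  show "(c *\<^sub>C f) * g = c *\<^sub>C (f * g)" by (rule bcontfun_eqI) (simp add: rep mult_scaleC_left)
  show "f * (c *\<^sub>C g) = c *\<^sub>C (f * g)" by (rule bcontfun_eqI) (simp add: rep mult_scaleC_right)
  show "star (f + g) = star f + star g" by (rule bcontfun_eqI) (simp add: rep star_add)
  show "star (c *\<^sub>C f) = cnj c *\<^sub>C star f" by (rule bcontfun_eqI) (simp add: rep star_scaleC)
  show "star (f * g) = star g * star f" by (rule bcontfun_eqI) (simp add: rep star_mult)
  show "star (star f) = f" by (rule bcontfun_eqI) (simp add: rep)
  show mult: "norm (f * g) \<le> norm f * norm g" for f g :: "'a \<Rightarrow>\<^sub>C 'b"
    by (rule norm_bound) (simp add: rep, meson mult_mono norm_bounded norm_ge_zero norm_mult_ineq order_trans)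
  have scale_le: "norm (c *\<^sub>C f) \<le> cmod c * norm f" for c and f :: "'a \<Rightarrow>\<^sub>C 'b"
    by (rule norm_bound) (simp add: rep norm_scaleC norm_bounded mult_left_mono)
  show "norm (c *\<^sub>C f) = cmod c * norm f"
  proof (cases "c = 0")
    case True
    then show ?thesis using scale_le[of 0 f] by simp
  next
    case False
    have "inverse c *\<^sub>C c *\<^sub>C f = f" using False
      by (intro bcontfun_eqI) (simp add: rep scaleC_scaleC)
    then have "norm f \<le> inverse (cmod c) * norm (c *\<^sub>C f)"
      using scale_le[of "inverse c" "c *\<^sub>C f"] by (simp add: norm_inverse)
    then have "cmod c * norm f \<le> norm (c *\<^sub>C f)" using False by (simp add: field_simps)
    with scale_le[of c f] show ?thesis by simp
  qed
  have "norm (star f * f) \<le> (norm f)\<^sup>2"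
    by (rule norm_bound) (simp add: rep cstar_identity norm_bounded power_mono)
  moreover have "norm f \<le> sqrt (norm (star f * f))"
  proof (rule norm_bound)
    fix x
    have "(norm (f x))\<^sup>2 \<le> norm (star f * f)"
      using norm_bounded[of "star f * f" x] by (simp add: rep cstar_identity)
    then show "norm (f x) \<le> sqrt (norm (star f * f))" by (rule real_le_rsqrt)
  qed
  then have "(norm f)\<^sup>2 \<le> (sqrt (norm (star f * f)))\<^sup>2" by (intro power_mono) auto
  then have "(norm f)\<^sup>2 \<le> norm (star f * f)" by simp
  ultimately show "norm (star f * f) = (norm f)\<^sup>2" by simp
qed

end

section \<open>The minimal tensor product\<close>

text \<open>
  The completion of the algebraic tensor product in the spatial norm; \<open>min_tensor_norm\<close> is the
  supremum of the operator norms in the product GNS representations of all pairs of states.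
\<close>

type_synonym ('a, 'b) min_tensor = "('a, 'b) alg_tensor cstar_completion"

definition tensor :: "'a::cstar_algebra \<Rightarrow> 'b::cstar_algebra \<Rightarrow> ('a, 'b) min_tensor" (infixr \<open>\<otimes>\<close> 76)
  where "a \<otimes> b = to_completion (pure_tensor a b)"

lemma to_completion_add: "to_completion (x + y) = to_completion x + to_completion y"
  by transfer (rule seminorm_rel_refl, rule seminorm_Cauchy_const)

lemma to_completion_zero: "to_completion 0 = 0"
  by transfer (rule seminorm_rel_refl, rule seminorm_Cauchy_const)

lemma tensor_mult: "(a \<otimes> b) * (c \<otimes> d) = (a * c) \<otimes> (b * d)"
proof -
  have "to_completion x * to_completion y = to_completion (x * y)" for x y :: "('a, 'b) alg_tensor"
    by transfer (rule seminorm_rel_refl, rule seminorm_Cauchy_const)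
  then show ?thesis by (simp add: tensor_def pure_tensor_mult)
qed

lemma closure_span_tensor: "closure (span {a \<otimes> b | a b. True}) = (UNIV :: ('a::cstar_algebra, 'b::cstar_algebra) min_tensor set)"
proof -
  let ?S = "span {a \<otimes> b | a b. True} :: ('a, 'b) min_tensor set"
  have "to_completion x \<in> ?S" for x :: "('a, 'b) alg_tensor"
  proof (induction x rule: alg_tensor_induct)
    case zero
    show ?case by (simp add: to_completion_zero span_zero)
  next
    case (pure_add a b x)
    have "a \<otimes> b \<in> ?S" by (rule span_base) blast
    with pure_add show ?case by (simp add: to_completion_add tensor_def[symmetric] span_add)
  qed
  then have "x \<in> closure ?S" for x
    unfolding closure_approachable
    by (metis dist_commute dist_norm to_completion_dense)
  then show ?thesis by blast
qed

text \<open>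
  The bounded linear map out of a tensor product with prescribed values on elementary tensors.
  It is unique by density; it exists for all the \<open>\<beta>\<close> used below, which are built from
  homomorphisms and states.
\<close>

definition tensor_ext ::
  "('a::cstar_algebra \<Rightarrow> 'b::cstar_algebra \<Rightarrow> 'c::cstar_algebra) \<Rightarrow> ('a, 'b) min_tensor \<Rightarrow> 'c"
  where "tensor_ext \<beta> = (THE T. bounded_linear T \<and> (\<forall>a b. T (a \<otimes> b) = \<beta> a b))"

lemma tensor_ext_eqI:
  assumes T: "bounded_linear T" "\<And>a b. T (a \<otimes> b) = \<beta> a b"
  shows "tensor_ext \<beta> = T"
  unfolding tensor_ext_def
proof (rule the_equality)
  fix T' assume T': "bounded_linear T' \<and> (\<forall>a b. T' (a \<otimes> b) = \<beta> a b)"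
  let ?D = "\<lambda>x. T' x - T x"
  have D: "bounded_linear ?D" using T T' by (intro bounded_linear_sub) auto
  have "?D x = 0" if "x \<in> span {a \<otimes> b | a b. True}" for x
    using that by (rule linear_eq_0_on_span[OF bounded_linear.linear[OF D], rotated]) (use T T' in auto)
  then have "\<forall>x\<in>closure (span {a \<otimes> b | a b. True}). ?D x = 0"
    using continuous_constant_on_closure[of "span {a \<otimes> b | a b. True}" ?D 0]
      linear_continuous_on[OF D] by blast
  then show "T' = T" unfolding closure_span_tensor by (simp add: fun_eq_iff)
qed (use T in auto)

definition tensor_map ::
  "('a::cstar_algebra \<Rightarrow> 'c::cstar_algebra) \<Rightarrow> ('b::cstar_algebra \<Rightarrow> 'd::cstar_algebra)
     \<Rightarrow> ('a, 'b) min_tensor \<Rightarrow> ('c, 'd) min_tensor"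
  where "tensor_map F G = tensor_ext (\<lambda>a b. F a \<otimes> G b)"

definition tensor_assoc ::
  "(('a::cstar_algebra, 'b::cstar_algebra) min_tensor, 'c::cstar_algebra) min_tensor
     \<Rightarrow> ('a, ('b, 'c) min_tensor) min_tensor"
  where "tensor_assoc = tensor_ext (\<lambda>x c. tensor_ext (\<lambda>a b. a \<otimes> (b \<otimes> c)) x)"

definition tensor_functional ::
  "('a::cstar_algebra \<Rightarrow> complex) \<Rightarrow> ('b::cstar_algebra \<Rightarrow> complex) \<Rightarrow> ('a, 'b) min_tensor \<Rightarrow> complex"
  where "tensor_functional \<phi> \<psi> = tensor_ext (\<lambda>a b. \<phi> a * \<psi> b)"

text \<open>\<open>\<mu> \<otimes> id\<close>\<close>

definition slice_left ::
  "('a::cstar_algebra \<Rightarrow> complex) \<Rightarrow> ('a, 'b::cstar_algebra) min_tensor \<Rightarrow> 'b"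
  where "slice_left \<mu> = tensor_ext (\<lambda>f a. \<mu> f *\<^sub>C a)"

section \<open>Compact quantum groups\<close>

definition cstar_hom :: "('a::cstar_algebra \<Rightarrow> 'b::cstar_algebra) \<Rightarrow> bool"
  where "cstar_hom f \<longleftrightarrow> clinear f \<and> (\<forall>x y. f (x * y) = f x * f y) \<and> (\<forall>x. f (star x) = star (f x)) \<and> f 1 = 1"

definition cspan :: "'a::star_algebra set \<Rightarrow> 'a set"
  where "cspan S = {\<Sum>x\<in>F. c x *\<^sub>C x | F c. finite F \<and> F \<subseteq> S}"

definition cstar_subalgebra :: "'a::cstar_algebra set \<Rightarrow> bool"
  where "cstar_subalgebra B \<longleftrightarrow> closed B \<and> 1 \<in> B \<and> (\<forall>x\<in>B. star x \<in> B \<and> (\<forall>c. c *\<^sub>C x \<in> B)) \<and>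
    (\<forall>x\<in>B. \<forall>y\<in>B. x + y \<in> B \<and> x * y \<in> B)"

definition cstar_generated :: "'a::cstar_algebra set \<Rightarrow> 'a set"
  where "cstar_generated S = \<Inter>{B. cstar_subalgebra B \<and> S \<subseteq> B}"

locale compact_quantum_group =
  fixes \<Delta> :: "'a::cstar_algebra \<Rightarrow> ('a, 'a) min_tensor"
  assumes hom: "cstar_hom \<Delta>"
    and coassociative: "tensor_assoc (tensor_map \<Delta> id (\<Delta> a)) = tensor_map id \<Delta> (\<Delta> a)"
    and dense_left: "closure (cspan {(a \<otimes> 1) * \<Delta> b | a b. True}) = UNIV"
    and dense_right: "closure (cspan {(1 \<otimes> a) * \<Delta> b | a b. True}) = UNIV"

definition haar_state :: "('a::cstar_algebra \<Rightarrow> ('a, 'a) min_tensor) \<Rightarrow> ('a \<Rightarrow> complex) \<Rightarrow> bool"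
  where "haar_state \<Delta> h \<longleftrightarrow> state h \<and>
    (\<forall>\<phi>. state \<phi> \<longrightarrow> tensor_functional h \<phi> \<circ> \<Delta> = h \<and> tensor_functional \<phi> h \<circ> \<Delta> = h)"

definition haar :: "('a::cstar_algebra \<Rightarrow> ('a, 'a) min_tensor) \<Rightarrow> 'a \<Rightarrow> complex"
  where "haar \<Delta> = (THE h. haar_state \<Delta> h)"

lemma haar_eqI: "haar_state \<Delta> h \<Longrightarrow> haar \<Delta> = h"
  unfolding haar_def by (rule the_equality, assumption) (metis haar_state_def)

definition faithful_state :: "('a::cstar_algebra \<Rightarrow> complex) \<Rightarrow> bool"
  where "faithful_state h \<longleftrightarrow> (\<forall>a. h (star a * a) = 0 \<longrightarrow> a = 0)"

definition reduced_quantum_group :: "('a::cstar_algebra \<Rightarrow> ('a, 'a) min_tensor) \<Rightarrow> bool"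
  where "reduced_quantum_group \<Delta> \<longleftrightarrow> (\<exists>h. haar_state \<Delta> h \<and> faithful_state h)"

subsection \<open>Representative functions and the antipode\<close>

definition unitary_corepresentation ::
  "('a::cstar_algebra \<Rightarrow> ('a, 'a) min_tensor) \<Rightarrow> nat \<Rightarrow> (nat \<Rightarrow> nat \<Rightarrow> 'a) \<Rightarrow> bool"
  where "unitary_corepresentation \<Delta> n u \<longleftrightarrow> (\<forall>i<n. \<forall>j<n.
    \<Delta> (u i j) = (\<Sum>k<n. u i k \<otimes> u k j) \<and>
    (\<Sum>k<n. star (u k i) * u k j) = (if i = j then 1 else 0) \<and>
    (\<Sum>k<n. u i k * star (u j k)) = (if i = j then 1 else 0))"

definition representative :: "('a::cstar_algebra \<Rightarrow> ('a, 'a) min_tensor) \<Rightarrow> 'a set"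
  where "representative \<Delta> = cspan {u i j | n u i j. unitary_corepresentation \<Delta> n u \<and> i < n \<and> j < n}"

definition clinear_on :: "'a::star_algebra set \<Rightarrow> ('a \<Rightarrow> 'b::star_algebra) \<Rightarrow> bool"
  where "clinear_on S f \<longleftrightarrow> (\<forall>x\<in>S. \<forall>y\<in>S. f (x + y) = f x + f y) \<and> (\<forall>x\<in>S. \<forall>c. f (c *\<^sub>C x) = c *\<^sub>C f x)"

text \<open>
  The comultiplication maps representative functions into the algebraic tensor square of
  \<open>representative \<Delta>\<close>; the Hopf algebra axioms are stated on the expansions \<open>\<Delta> a = \<Sum>i. b i \<otimes> c i\<close>.
\<close>

definition coproduct_expansion ::
  "('a::cstar_algebra \<Rightarrow> ('a, 'a) min_tensor) \<Rightarrow> 'a \<Rightarrow> nat \<Rightarrow> (nat \<Rightarrow> 'a) \<Rightarrow> (nat \<Rightarrow> 'a) \<Rightarrow> bool"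
  where "coproduct_expansion \<Delta> a n b c \<longleftrightarrow> \<Delta> a = (\<Sum>i<n. b i \<otimes> c i) \<and>
    (\<forall>i<n. b i \<in> representative \<Delta> \<and> c i \<in> representative \<Delta>)"

definition hopf_counit :: "('a::cstar_algebra \<Rightarrow> ('a, 'a) min_tensor) \<Rightarrow> ('a \<Rightarrow> complex) \<Rightarrow> bool"
  where "hopf_counit \<Delta> \<epsilon> \<longleftrightarrow> clinear_on (representative \<Delta>) \<epsilon> \<and>
    (\<forall>a\<in>representative \<Delta>. \<forall>n b c. coproduct_expansion \<Delta> a n b c \<longrightarrow>
      (\<Sum>i<n. \<epsilon> (b i) *\<^sub>C c i) = a \<and> (\<Sum>i<n. \<epsilon> (c i) *\<^sub>C b i) = a)"

definition hopf_antipode :: "('a::cstar_algebra \<Rightarrow> ('a, 'a) min_tensor) \<Rightarrow> ('a \<Rightarrow> 'a) \<Rightarrow> bool"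
  where "hopf_antipode \<Delta> \<kappa> \<longleftrightarrow> clinear_on (representative \<Delta>) \<kappa> \<and> \<kappa> ` representative \<Delta> \<subseteq> representative \<Delta> \<and>
    (\<exists>\<epsilon>. hopf_counit \<Delta> \<epsilon> \<and>
      (\<forall>a\<in>representative \<Delta>. \<forall>n b c. coproduct_expansion \<Delta> a n b c \<longrightarrow>
        (\<Sum>i<n. \<kappa> (b i) * c i) = \<epsilon> a *\<^sub>C 1 \<and> (\<Sum>i<n. b i * \<kappa> (c i)) = \<epsilon> a *\<^sub>C 1))"

definition kac_antipode :: "('a::cstar_algebra \<Rightarrow> ('a, 'a) min_tensor) \<Rightarrow> ('a \<Rightarrow> 'a) \<Rightarrow> bool"
  where "kac_antipode \<Delta> \<kappa> \<longleftrightarrow> clinear \<kappa> \<and> bounded_linear \<kappa> \<and> (\<forall>a. \<kappa> (\<kappa> a) = a) \<and>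
    (\<forall>a b. \<kappa> (a * b) = \<kappa> b * \<kappa> a) \<and> hopf_antipode \<Delta> \<kappa>"

section \<open>Actions on compact metric spaces\<close>

text \<open>For compact \<open>'x\<close>, the type \<open>'x \<Rightarrow>\<^sub>C complex\<close> is the algebra of all continuous functions.\<close>

type_synonym 'x cfun = "'x \<Rightarrow>\<^sub>C complex"

locale quantum_action = compact_quantum_group \<Delta>
  for \<Delta> :: "'a::cstar_algebra \<Rightarrow> ('a, 'a) min_tensor" +
  fixes \<rho> :: "'x::metric_space cfun \<Rightarrow> ('x cfun, 'a) min_tensor"
  assumes compact_space: "compact (UNIV :: 'x set)"
    and action_hom: "cstar_hom \<rho>"
    and action_coassociative: "tensor_assoc (tensor_map \<rho> id (\<rho> f)) = tensor_map id \<Delta> (\<rho> f)"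
    and action_dense: "closure (cspan {(1 \<otimes> a) * \<rho> f | a f. True}) = UNIV"

definition faithful_action :: "('x::metric_space cfun \<Rightarrow> ('x cfun, 'a::cstar_algebra) min_tensor) \<Rightarrow> bool"
  where "faithful_action \<rho> \<longleftrightarrow> cstar_generated {slice_left \<mu> (\<rho> f) | f \<mu>. state \<mu>} = UNIV"

definition dirac :: "'x::metric_space \<Rightarrow> 'x cfun \<Rightarrow> complex"
  where "dirac x f = apply_bcontfun f x"

definition convolve ::
  "('x::metric_space cfun \<Rightarrow> ('x cfun, 'a::cstar_algebra) min_tensor)
     \<Rightarrow> ('x cfun \<Rightarrow> complex) \<Rightarrow> ('a \<Rightarrow> complex) \<Rightarrow> 'x cfun \<Rightarrow> complex"
  where "convolve \<rho> \<mu> \<phi> = tensor_functional \<mu> \<phi> \<circ> \<rho>"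

definition orbit ::
  "('a::cstar_algebra \<Rightarrow> ('a, 'a) min_tensor) \<Rightarrow> ('x::metric_space cfun \<Rightarrow> ('x cfun, 'a) min_tensor)
     \<Rightarrow> 'x \<Rightarrow> 'x set"
  where "orbit \<Delta> \<rho> x = {y. convolve \<rho> (dirac y) (haar \<Delta>) = convolve \<rho> (dirac x) (haar \<Delta>)}"

definition action_eval ::
  "('x::metric_space cfun \<Rightarrow> ('x cfun, 'a::cstar_algebra) min_tensor) \<Rightarrow> 'x cfun \<Rightarrow> 'x \<Rightarrow> 'a"
  where "action_eval \<rho> f x = slice_left (dirac x) (\<rho> f)"

definition dist_fun :: "'x::metric_space \<Rightarrow> 'x cfun"
  where "dist_fun x = Bcontfun (\<lambda>y. complex_of_real (dist x y))"

lemma apply_dist_fun: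
  assumes "compact (UNIV :: 'x::metric_space set)"
  shows "apply_bcontfun (dist_fun x) y = complex_of_real (dist x (y :: 'x))"
proof -
  have c: "continuous_on UNIV (\<lambda>y. complex_of_real (dist x y))" by (intro continuous_intros)
  then have "bounded (range (\<lambda>y. complex_of_real (dist x y)))"
    using assms compact_continuous_image compact_imp_bounded by blast
  with c have "(\<lambda>y. complex_of_real (dist x y)) \<in> bcontfun" by (simp add: bcontfun_def)
  then show ?thesis by (simp add: dist_fun_def Bcontfun_inverse)
qed

definition isometric_action ::
  "('a::cstar_algebra \<Rightarrow> ('a, 'a) min_tensor) \<Rightarrow> ('x::metric_space cfun \<Rightarrow> ('x cfun, 'a) min_tensor) \<Rightarrow> bool"
  where "isometric_action \<Delta> \<rho> \<longleftrightarrow> (\<exists>\<kappa>. kac_antipode \<Delta> \<kappa> \<and>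
    (\<forall>x y. action_eval \<rho> (dist_fun y) x = \<kappa> (action_eval \<rho> (dist_fun x) y)))"

section \<open>Riemannian manifolds\<close>

subsection \<open>Smooth manifolds\<close>

text \<open>\<open>Ck_on k S f\<close> is intended for open \<open>S\<close> in a finite-dimensional space.\<close>

fun Ck_on :: "nat \<Rightarrow> 'e::real_normed_vector set \<Rightarrow> ('e \<Rightarrow> 'f::real_normed_vector) \<Rightarrow> bool"
  where
    "Ck_on 0 S f \<longleftrightarrow> continuous_on S f"
  | "Ck_on (Suc k) S f \<longleftrightarrow> (\<forall>x\<in>S. f differentiable (at x)) \<and>
      (\<forall>v. Ck_on k S (\<lambda>x. frechet_derivative f (at x) v))"

definition smooth_on :: "'e::real_normed_vector set \<Rightarrow> ('e \<Rightarrow> 'f::real_normed_vector) \<Rightarrow> bool"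
  where "smooth_on S f \<longleftrightarrow> (\<forall>k. Ck_on k S f)"

text \<open>A chart \<open>(U, \<phi>)\<close>; values of \<open>\<phi>\<close> outside \<open>U\<close> are irrelevant.\<close>

type_synonym ('x, 'e) chart = "'x set \<times> ('x \<Rightarrow> 'e)"

abbreviation chart_domain :: "('x, 'e) chart \<Rightarrow> 'x set" where "chart_domain \<equiv> fst"
abbreviation chart_map :: "('x, 'e) chart \<Rightarrow> 'x \<Rightarrow> 'e" where "chart_map \<equiv> snd"

definition chart_inv :: "('x, 'e) chart \<Rightarrow> 'e \<Rightarrow> 'x"
  where "chart_inv c = inv_into (chart_domain c) (chart_map c)"

definition is_chart :: "('x::topological_space, 'e::euclidean_space) chart \<Rightarrow> bool"
  where "is_chart c \<longleftrightarrow> open (chart_domain c) \<and> open (chart_map c ` chart_domain c) \<and>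
    homeomorphism (chart_domain c) (chart_map c ` chart_domain c) (chart_map c) (chart_inv c)"

definition transition :: "('x, 'e) chart \<Rightarrow> ('x, 'e) chart \<Rightarrow> 'e \<Rightarrow> 'e"
  where "transition c c' = chart_map c' \<circ> chart_inv c"

locale smooth_manifold =
  fixes atlas :: "('x::metric_space, 'e::euclidean_space) chart set"
  assumes charts: "c \<in> atlas \<Longrightarrow> is_chart c"
    and covering: "(\<Union>c\<in>atlas. chart_domain c) = UNIV"
    and compatible: "c \<in> atlas \<Longrightarrow> c' \<in> atlas \<Longrightarrow>
      smooth_on (chart_map c ` (chart_domain c \<inter> chart_domain c')) (transition c c')"

subsection \<open>Riemannian metrics\<close>

text \<open>
  A \<open>(0,2)\<close>-tensor field is given by its local representatives: \<open>g c p v w\<close> is the value, at the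
  point with coordinates \<open>p\<close> in the chart \<open>c\<close>, on the tangent vectors with components \<open>v\<close>, \<open>w\<close>.
\<close>

type_synonym ('x, 'e) local_form = "('x, 'e) chart \<Rightarrow> 'e \<Rightarrow> 'e \<Rightarrow> 'e \<Rightarrow> real"

locale riemannian_manifold = smooth_manifold atlas
  for atlas :: "('x::metric_space, 'e::euclidean_space) chart set" +
  fixes g :: "('x, 'e) local_form"
  assumes metric_bilinear: "c \<in> atlas \<Longrightarrow> p \<in> chart_map c ` chart_domain c \<Longrightarrow> bilinear (g c p)"
    and metric_symmetric: "c \<in> atlas \<Longrightarrow> p \<in> chart_map c ` chart_domain c \<Longrightarrow> g c p v w = g c p w v"
    and metric_positive: "c \<in> atlas \<Longrightarrow> p \<in> chart_map c ` chart_domain c \<Longrightarrow> v \<noteq> 0 \<Longrightarrow> 0 < g c p v v"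
    and metric_smooth: "c \<in> atlas \<Longrightarrow> smooth_on (chart_map c ` chart_domain c) (\<lambda>p. g c p v w)"
    and metric_compatible: "c \<in> atlas \<Longrightarrow> c' \<in> atlas \<Longrightarrow> x \<in> chart_domain c \<inter> chart_domain c' \<Longrightarrow>
      D = frechet_derivative (transition c c') (at (chart_map c x)) \<Longrightarrow>
      g c (chart_map c x) v w = g c' (chart_map c' x) (D v) (D w)"

subsection \<open>The geodesic metric\<close>

text \<open>
  \<open>C\<^sup>1\<close> up to the end points between consecutive break points. The library's
  \<open>piecewise_C1_differentiable_on\<close> allows unbounded, even non-integrable, speed at the break points.
\<close>

definition piecewise_C1_curve ::
  "('x::metric_space, 'e::euclidean_space) chart set \<Rightarrow> (real \<Rightarrow> 'x) \<Rightarrow> bool"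
  where "piecewise_C1_curve atlas \<gamma> \<longleftrightarrow> path \<gamma> \<and> (\<exists>P. finite P \<and>
    (\<forall>c\<in>atlas. \<forall>s t. 0 \<le> s \<and> s < t \<and> t \<le> 1 \<and> {s<..<t} \<inter> P = {} \<and> \<gamma> ` {s..t} \<subseteq> chart_domain c \<longrightarrow>
      (\<exists>D. continuous_on {s..t} D \<and>
        (\<forall>r\<in>{s..t}. ((chart_map c \<circ> \<gamma>) has_vector_derivative D r) (at r within {s..t})))))"

text \<open>The choice of chart is immaterial by \<open>metric_compatible\<close>.\<close>

definition speed ::
  "('x::metric_space, 'e::euclidean_space) chart set \<Rightarrow> ('x, 'e) local_form \<Rightarrow> (real \<Rightarrow> 'x) \<Rightarrow> real \<Rightarrow> real"
  where "speed atlas g \<gamma> t =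
    (let c = (SOME c. c \<in> atlas \<and> \<gamma> t \<in> chart_domain c);
         v = vector_derivative (chart_map c \<circ> \<gamma>) (at t)
     in sqrt (g c (chart_map c (\<gamma> t)) v v))"

definition curve_length ::
  "('x::metric_space, 'e::euclidean_space) chart set \<Rightarrow> ('x, 'e) local_form \<Rightarrow> (real \<Rightarrow> 'x) \<Rightarrow> real"
  where "curve_length atlas g \<gamma> = integral {0..1} (speed atlas g \<gamma>)"

definition geodesic_dist ::
  "('x::metric_space, 'e::euclidean_space) chart set \<Rightarrow> ('x, 'e) local_form \<Rightarrow> 'x \<Rightarrow> 'x \<Rightarrow> real"
  where "geodesic_dist atlas g x y =
    Inf {curve_length atlas g \<gamma> | \<gamma>. piecewise_C1_curve atlas \<gamma> \<and> pathstart \<gamma> = x \<and> pathfinish \<gamma> = y}"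

subsection \<open>Sectional curvature\<close>

text \<open>
  In a chart with metric coefficients \<open>G\<close>, \<open>christoffel G p v w\<close> is the value at \<open>p\<close> of the
  Levi-Civita derivative \<open>\<nabla>\<^sub>v w\<close> of constant vector fields (Koszul formula), and
  \<open>curvature G p u v w = \<nabla>\<^sub>u \<nabla>\<^sub>v w - \<nabla>\<^sub>v \<nabla>\<^sub>u w\<close> for constant \<open>u\<close>, \<open>v\<close>, \<open>w\<close>.
\<close>

definition metric_deriv :: "('e::euclidean_space \<Rightarrow> 'e \<Rightarrow> 'e \<Rightarrow> real) \<Rightarrow> 'e \<Rightarrow> 'e \<Rightarrow> 'e \<Rightarrow> 'e \<Rightarrow> real"
  where "metric_deriv G p u v w = frechet_derivative (\<lambda>q. G q v w) (at p) u"

definition christoffel :: "('e::euclidean_space \<Rightarrow> 'e \<Rightarrow> 'e \<Rightarrow> real) \<Rightarrow> 'e \<Rightarrow> 'e \<Rightarrow> 'e \<Rightarrow> 'e"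
  where "christoffel G p v w = (THE z. \<forall>u. 2 * G p z u =
    metric_deriv G p v w u + metric_deriv G p w v u - metric_deriv G p u v w)"

definition curvature :: "('e::euclidean_space \<Rightarrow> 'e \<Rightarrow> 'e \<Rightarrow> real) \<Rightarrow> 'e \<Rightarrow> 'e \<Rightarrow> 'e \<Rightarrow> 'e \<Rightarrow> 'e"
  where "curvature G p u v w =
    frechet_derivative (\<lambda>q. christoffel G q v w) (at p) u + christoffel G p u (christoffel G p v w)
    - frechet_derivative (\<lambda>q. christoffel G q u w) (at p) v - christoffel G p v (christoffel G p u w)"

definition sectional_curvature :: "('e::euclidean_space \<Rightarrow> 'e \<Rightarrow> 'e \<Rightarrow> real) \<Rightarrow> 'e \<Rightarrow> 'e \<Rightarrow> 'e \<Rightarrow> real"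
  where "sectional_curvature G p u v =
    G p (curvature G p u v v) u / (G p u u * G p v v - (G p u v)\<^sup>2)"

definition negative_sectional_curvature ::
  "('x::metric_space, 'e::euclidean_space) chart set \<Rightarrow> ('x, 'e) local_form \<Rightarrow> bool"
  where "negative_sectional_curvature atlas g \<longleftrightarrow>
    (\<forall>c\<in>atlas. \<forall>p\<in>chart_map c ` chart_domain c. \<forall>u v. u \<noteq> v \<and> independent {u, v} \<longrightarrow>
      sectional_curvature (g c) p u v < 0)"

end

theory Submission
  imports Defs
begin

text \<open>
  Call \<open>y\<close> related to \<open>z\<close> if every bump function at \<open>y\<close> has a nonzero evaluation at \<open>z\<close>. An orbit
  consists of points related to a common \<open>z\<close>. By isometry and the antipode, products of evaluations
  of bump functions at different points vanish unless the distances match; hence a discrete geodesic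
  starting at \<open>z\<close> has a companion with the same step length starting at any point related to \<open>z\<close>.
  So the lengths of geodesic loops, which form a finite set for each number of steps, are the same at
  related points. In negative curvature the norms of Jacobi fields are convex, so the distance is
  strictly convex along pairs of short geodesics, and the length of the loop near a given one is a
  strictly convex function of the base point. It would be constant along related points that
  accumulate, so related points do not accumulate, and by compactness there are finitely many.
\<close>

text \<open>A quantum group has no points, so no isometry carries one point of an orbit to another.
  Its substitute is a state of the algebra whose law at \<open>x\<close> is a Dirac measure at some
  \<open>x'\<close>. Evaluations at different points need not commute, so conditioning such a state
  on the position of a second point can spoil its concentration at the first. But a third point is
  pinned down as soon as its distances to two concentrated points determine it, and along a geodesic
  two consecutive vertices determine all others. The one hard analytic step is therefore a state
  concentrated at two consecutive vertices, and this is why geodesics enter as chains of midpoints.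
  A sequence of related points converging to \<open>x\<close> yields an inequality for loop lengths
  in one direction only. The opposite inequality comes from dragging the sequence along a long loop:
  while the base point moves at constant loop length, the first vertex drifts straight away from
  \<open>x\<close>. All estimates take place at one scale \<open>r\<close>; the fractions of
  \<open>r\<close> only keep every compared configuration inside that scale.\<close>

notation scaleR (infixr "*R" 75)

abbreviation limseq (infixr "---->" 60) where "X ----> L \<equiv> X \<longlonglongrightarrow> L"

section \<open>Discrete geodesics in locally strictly convex metric spaces\<close>

definition frac_point :: "real => 'x::metric_space => 'x => 'x => bool"
 where "frac_point s p q z \<longleftrightarrow> dist p z = s * dist p q & dist z q = (1 - s) * dist p q"

definition collinear3 :: "'x::metric_space => 'x => 'x => bool"
 where "collinear3 x y z \<longleftrightarrow> dist x y + dist y z = dist x z \<or> dist y x + dist x z = dist y z \<or>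
  dist x z + dist z y = dist x y"

text \<open>Only consecutive triples are constrained, so a chain is locally but not globally
  minimizing and may return to its first vertex. Vertices beyond \<open>N\<close> are free.\<close>

definition chain :: "nat => (nat => 'x::metric_space) => bool"
 where "chain N a \<longleftrightarrow> (\<forall>i. Suc (Suc i) <= N --> frac_point (1/2) (a i) (a (Suc (Suc i))) (a (Suc i)))"

lemma chain_step:
 assumes "chain N a" "i < N"
 shows "dist (a i) (a (Suc i)) = dist (a 0) (a 1)" using assms(2)
proof (induction i)
 case (Suc i)
 hence "frac_point (1/2) (a i) (a (Suc (Suc i))) (a (Suc i))" using assms(1) by (auto simp: chain_def)
 with Suc show ?case by (simp add: frac_point_def)
qed simp

text \<open>The chord is lengthened one step at a time: \<open>A\<close> bounds the last interior
  value by the first and the next one, and this is inserted into the bound for the shorter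
  chord.\<close>

lemma discrete_convex:
 fixes f :: "nat => real"
 assumes "!!i. Suc (Suc i) <= N ==> 2 * f (Suc i) <= f i + f (Suc (Suc i))" and "i <= N"
 shows "real N * f i <= real (N - i) * f 0 + real i * f N"
proof -
 have A: "real (Suc j) * f j <= f 0 + real j * f (Suc j)" if "Suc j <= N" for j using that
 proof (induction j)
  case (Suc j)
  have "real (Suc j) * f j <= f 0 + real j * f (Suc j)" using Suc by simp
  moreover have "real (Suc j) * (2 * f (Suc j)) <= real (Suc j) * (f j + f (Suc (Suc j)))"
   using Suc.prems assms(1)[of j] by (intro mult_left_mono) auto
  ultimately show ?case by (simp add: algebra_simps)
 qed simp
 have B: "real N' * f i <= real (N' - i) * f 0 + real i * f N'" if "i <= N'" "N' <= N" for N' using that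
 proof (induction N' rule: dec_induct)
  case base
  show ?case by simp
 next case (step n)
  have n: "real n * f i <= real (n - i) * f 0 + real i * f n" using step by simp
  have a: "real (Suc n) * f n <= f 0 + real n * f (Suc n)" using A[of n] step by simp
  show ?case
  proof (cases "n = 0")
   case True
   thus ?thesis using step by simp
  next case False
   have "real n * (real (Suc n) * f i) <= real (Suc n) * (real (n - i) * f 0 + real i * f n)"
    using mult_left_mono[OF n, of "real (Suc n)"] by (simp add: algebra_simps)
   also have "\<dots> = real (Suc n) * real (n - i) * f 0 + real i * (real (Suc n) * f n)" by (simp add: algebra_simps)
   also have "\<dots> <= real (Suc n) * real (n - i) * f 0 + real i * (f 0 + real n * f (Suc n))" using a by (intro add_left_mono mult_left_mono) auto
   also have "\<dots> = real n * (real (Suc n - i) * f 0 + real i * f (Suc n))" using step(1) by (simp add: of_nat_diff algebra_simps)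
   finally show ?thesis using False by simp
  qed
 qed
 show ?thesis using B[of N] assms(2) by simp
qed

text \<open>These axioms are all that the argument on orbits keeps of the manifold.
  \<open>convexity\<close> is nonpositive curvature in the sense of Busemann,
  \<open>strict_convexity\<close> is the metric trace of strictly negative curvature, and
  \<open>noncollinear_exists\<close> excludes dimension one. The scale \<open>r\<close> is the same
  at all points.\<close>

locale convex_geodesic_space =
 fixes r :: real and space_type :: "'x::metric_space itself"
 assumes r_pos: "r > 0" and compact_UNIV: "compact (UNIV :: 'x set)" and connected_UNIV: "connected (UNIV :: 'x set)"
  and frac_point_exists: "!!(p::'x) q s. dist p q < r ==> 0 <= s ==> s <= 1 ==> \<exists>z. frac_point s p q z"
  and extension_exists: "!!(p::'x) q t. p ~= q ==> dist p q < r ==> 0 <= t ==> t < r ==>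
   \<exists>z. dist q z = t & dist p z = dist p q + t"
  and extension_unique: "!!(p::'x) q t z z'. p ~= q ==> dist p q < r ==> t < r ==>
   dist q z = t ==> dist p z = dist p q + t ==> dist q z' = t ==> dist p z' = dist p q + t ==> z = z'"
  and convexity: "!!(p::'x) p' q q' m n s. dist p p' < r ==> dist p q < r ==> dist p q' < r ==>
   0 <= s ==> s <= 1 ==> frac_point s p p' m ==> frac_point s q q' n ==>
   dist m n <= (1 - s) * dist p q + s * dist p' q'"
  and strict_convexity: "!!(p::'x) p' q q' m n s. dist p p' < r ==> dist p q < r ==> dist p q' < r ==>
   0 < s ==> s < 1 ==> frac_point s p p' m ==> frac_point s q q' n ==> \<not> collinear3 p p' q ==>
   dist m n < (1 - s) * dist p q + s * dist p' q'"
  and noncollinear_exists: "!!(p::'x) q e. p ~= q ==> dist p q < r ==> 0 < e ==>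
   \<exists>z. dist p z < e & \<not> collinear3 p q z"
begin

text \<open>The bound \<open>5 * r / 16\<close> is a step \<open>r / 16\<close> of a reference chain
  plus the slack \<open>r / 4\<close> of \<open>near_curve_step\<close>. Two such steps and a gap of
  \<open>r / 4\<close> stay below \<open>r\<close>, so \<open>convexity\<close> applies to every
  pair of two-step segments.\<close>

lemma chain_dist_convex:
 fixes a b :: "nat => 'x"
 assumes "chain N a" "chain N b" and a: "!!i. i <= N ==> dist (a i) (b i) <= r / 4" "dist (a 0) (a 1) <= 5 * r / 16" "dist (b 0) (b 1) <= 5 * r / 16"
  and "i <= N"
 shows "real N * dist (a i) (b i) <= real (N - i) * dist (a 0) (b 0) + real i * dist (a N) (b N)"
proof (rule discrete_convex[OF _ \<open>i <= N\<close>])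
 fix i assume i: "Suc (Suc i) <= N"
 have fa: "frac_point (1/2) (a i) (a (Suc (Suc i))) (a (Suc i))" and fb: "frac_point (1/2) (b i) (b (Suc (Suc i))) (b (Suc i))"
  using assms(1,2) i by (auto simp: chain_def)
 have s: "dist (a i) (a (Suc i)) <= 5*r/16" "dist (a (Suc i)) (a (Suc (Suc i))) <= 5*r/16"
  "dist (b i) (b (Suc i)) <= 5*r/16" "dist (b (Suc i)) (b (Suc (Suc i))) <= 5*r/16"
  using chain_step[OF assms(1), of i] chain_step[OF assms(1), of "Suc i"]
   chain_step[OF assms(2), of i] chain_step[OF assms(2), of "Suc i"] a(2,3) i by simp_all
 have "dist (a i) (a (Suc (Suc i))) < r" using s r_pos dist_triangle[of "a i" "a (Suc (Suc i))" "a (Suc i)"] by linarith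
 moreover have "dist (b i) (b (Suc (Suc i))) <= 5 * r / 8" using s dist_triangle[of "b i" "b (Suc (Suc i))" "b (Suc i)"] by linarith
 hence "dist (a i) (b (Suc (Suc i))) < r" using a(1)[of i] i r_pos dist_triangle[of "a i" "b (Suc (Suc i))" "b i"] by linarith
 moreover have "dist (a i) (b i) < r" using a(1)[of i] i r_pos by linarith
 ultimately show "2 * dist (a (Suc i)) (b (Suc i)) <= dist (a i) (b i) + dist (a (Suc (Suc i))) (b (Suc (Suc i)))"
  using convexity[of "a i" "a (Suc (Suc i))" "b i" "b (Suc (Suc i))" "1/2" "a (Suc i)" "b (Suc i)"] fa fb by simp
qed

section \<open>Energy-minimizing chains near a given chain\<close>

definition near_curves :: "nat => (nat => 'x) => 'x => 'x => (nat => 'x) set"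
 where "near_curves N a p q = {b. b 0 = p & b N = q & (\<forall>i\<le>N. dist (a i) (b i) <= r / 8)}"

text \<open>Squared steps make a minimizer equidistant; the plain length would leave the spacing of
  the vertices undetermined.\<close>

definition energy :: "nat => (nat => 'x) => real" where "energy N b = (\<Sum>i<N. (dist (b i) (b (Suc i)))\<^sup>2)"

lemma frac_point_half_unique:
 fixes p q :: 'x
 assumes "dist p q < r" "frac_point s p q m" "frac_point s p q n" "0 <= s" "s <= 1"
 shows "m = n" using convexity[of p q p q s m n] assms r_pos by auto

lemma energy_minimizer:
 assumes N: "0 < N" and p: "dist (a 0) p <= r / 8" "dist (a N) q <= r / 8"
 obtains b where "b \<in> near_curves N a p q" "!!b'. b' \<in> near_curves N a p q ==> energy N b <= energy N b'"
proof -
 \<comment> \<open>Vertices beyond \<open>N\<close> range over the whole compact space, so that the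
   admissible curves are exactly a product of compact sets.\<close>
 define K where "K = (%i. if i = 0 then {p} else if i = N then {q} else if i < N then cball (a i) (r/8) else (UNIV :: 'x set))"
 have cK: "compact (K i)" for i using compact_UNIV compact_Int_closed[of UNIV "cball (a i) (r/8)"] by (auto simp: K_def)
 have "compactin (product_topology (%i. euclidean) UNIV) (PiE UNIV K)" unfolding compactin_PiE using cK by simp
 hence cP: "compact (PiE UNIV K)" by (simp add: euclidean_product_topology)
 have ne: "(%i. if i = 0 then p else if i = N then q else a i) \<in> PiE UNIV K" using r_pos by (auto simp: K_def)
 have coord: "continuous_on (PiE UNIV K) (%b. b i)" for i by (rule continuous_on_subset[OF continuous_on_product_coordinates subset_UNIV])
 have "continuous_on (PiE UNIV K) (%b. \<Sum>i<N. (dist (b i) (b (Suc i)))\<^sup>2)"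
  by (intro continuous_on_sum continuous_on_power continuous_on_dist coord)
 hence cE: "continuous_on (PiE UNIV K) (energy N)" unfolding energy_def .
 have "PiE UNIV K ~= {}" using ne by (metis empty_iff)
 from continuous_attains_inf[OF cP this cE]
 obtain b where "b \<in> PiE UNIV K" "\<forall>y\<in>PiE UNIV K. energy N b <= energy N y" by (rule bexE)
 hence b: "b \<in> PiE UNIV K" "!!b'. b' \<in> PiE UNIV K ==> energy N b <= energy N b'" by (auto simp del: PiE_UNIV_domain)
 have eq: "PiE UNIV K = near_curves N a p q"
 proof (intro set_eqI iffI)
  fix b assume "b \<in> PiE UNIV K"
  hence h: "b i \<in> K i" for i by (rule PiE_mem) simp
  have 0: "b 0 = p" "b N = q" using h[of 0] h[of N] N by (auto simp: K_def)
  moreover have "dist (a i) (b i) <= r / 8" if "i <= N" for i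
  proof (cases "i = 0 \<or> i = N")
   case True
   thus ?thesis using 0 p by auto
  next case False
   thus ?thesis using h[of i] that by (simp add: K_def)
  qed
  ultimately show "b \<in> near_curves N a p q" by (simp add: near_curves_def)
 next
  fix b assume b: "b \<in> near_curves N a p q"
  have "b i \<in> K i" for i using b by (simp add: K_def near_curves_def)
  thus "b \<in> PiE UNIV K" by (intro PiE_I) auto
 qed
 show ?thesis by (rule that[of b]) (use b in "simp_all add: eq")
qed

lemma near_curve_step:
 assumes "b \<in> near_curves N a p q" "i < N" "dist (a i) (a (Suc i)) <= d"
 shows "dist (b i) (b (Suc i)) <= d + r / 4"
proof -
 have "dist (a i) (b i) <= r/8" "dist (a (Suc i)) (b (Suc i)) <= r/8" using assms by (auto simp: near_curves_def)
 thus ?thesis using assms(3) dist_triangle[of "b i" "b (Suc i)" "a i"]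
   dist_triangle[of "a i" "b (Suc i)" "a (Suc i)"] by (simp add: dist_commute)
qed

text \<open>Replacing one vertex of a minimizer by the midpoint of its neighbours neither leaves the
 region, by convexity of the distance to \<open>a\<close>, nor increases the energy.\<close>

lemma energy_minimizer_chain:
 assumes a: "chain N a" "dist (a 0) (a 1) <= r / 8"
  and b: "b \<in> near_curves N a p q" "!!b'. b' \<in> near_curves N a p q ==> energy N b <= energy N b'"
 shows "chain N b" unfolding chain_def
proof (intro allI impI)
 fix i assume i: "Suc (Suc i) <= N"
 let ?j = "Suc i" let ?k = "Suc (Suc i)"
 have ab: "dist (a j) (b j) <= r/8" if "j <= N" for j using b(1) that by (auto simp: near_curves_def)
 have ai: "dist (a i) (a ?j) <= r/8" "dist (a ?j) (a ?k) <= r/8" using chain_step[OF a(1), of i] chain_step[OF a(1), of "Suc i"] a(2) i by simp_all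
 have aik: "dist (a i) (a ?k) <= r / 4" using ai dist_triangle[of "a i" "a ?k" "a ?j"] by simp
 have aibk: "dist (a i) (b ?k) <= 3 * r / 8" using ab[of ?k] i aik dist_triangle[of "a i" "b ?k" "a ?k"] by simp
 have bik: "dist (b i) (b ?k) <= r / 2" using aibk ab[of i] i dist_triangle[of "b i" "b ?k" "a i"] by (simp add: dist_commute)
 have fa: "frac_point (1/2) (a i) (a ?k) (a ?j)" using a(1) i by (auto simp: chain_def)
 obtain m where m: "frac_point (1/2) (b i) (b ?k) m" using frac_point_exists[of "b i" "b ?k" "1/2"] bik r_pos by auto
 have "dist (a ?j) m <= (1 - 1/2) * dist (a i) (b i) + 1/2 * dist (a ?k) (b ?k)" by (rule convexity[of "a i" "a ?k" "b i" "b ?k" "1/2" "a ?j" m])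
   (use aik aibk ab[of i] i r_pos fa m in auto)
 also have "\<dots> <= r/8" using ab[of i] ab[of ?k] i by simp
 finally have am: "dist (a ?j) m <= r/8" .
 let ?b' = "b(?j := m)"
 have "?b' \<in> near_curves N a p q" using b(1) am i by (auto simp: near_curves_def)
 hence le: "energy N b <= energy N ?b'" by (rule b(2))
 have split: "energy N c = (\<Sum>l\<in>{..<N} - {i, ?j}. (dist (c l) (c (Suc l)))\<^sup>2)
   + ((dist (c i) (c ?j))\<^sup>2 + (dist (c ?j) (c ?k))\<^sup>2)" for c
 proof -
  have "{i, ?j} \<subseteq> {..<N}" using i by auto
  thus ?thesis unfolding energy_def using sum.subset_diff[of "{i, ?j}" "{..<N}" "%l. (dist (c l) (c (Suc l)))\<^sup>2"] by simp
 qed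
 have "(\<Sum>l\<in>{..<N} - {i, ?j}. (dist (?b' l) (?b' (Suc l)))\<^sup>2) = (\<Sum>l\<in>{..<N} - {i, ?j}. (dist (b l) (b (Suc l)))\<^sup>2)"
  by (intro sum.cong) auto
 with le have "(dist (b i) (b ?j))\<^sup>2 + (dist (b ?j) (b ?k))\<^sup>2 <= (dist (b i) m)\<^sup>2 + (dist m (b ?k))\<^sup>2"
  by (simp add: split[of b] split[of ?b'])
 also have "\<dots> = (dist (b i) (b ?k))\<^sup>2 / 2"
 proof -
  have "dist (b i) m = dist (b i) (b ?k) / 2" "dist m (b ?k) = dist (b i) (b ?k) / 2" using m by (auto simp: frac_point_def)
  thus ?thesis by (simp only: power2_eq_square)
 qed
 finally have le2: "(dist (b i) (b ?j))\<^sup>2 + (dist (b ?j) (b ?k))\<^sup>2 <= (dist (b i) (b ?k))\<^sup>2 / 2" .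
 define u where "u = dist (b i) (b ?j)"
 define v where "v = dist (b ?j) (b ?k)"
 define w where "w = dist (b i) (b ?k)"
 have tri: "w <= u + v" unfolding u_def v_def w_def by (rule dist_triangle)
 have nn: "0 <= u" "0 <= v" "0 <= w" by (auto simp: u_def v_def w_def)
 have h: "u\<^sup>2 + v\<^sup>2 <= w\<^sup>2 / 2" using le2 by (simp add: u_def v_def w_def)
 have "w\<^sup>2 <= (u + v)\<^sup>2" using tri nn by (intro power_mono)
 with h have "(u - v)\<^sup>2 <= 0" by (simp add: power2_eq_square algebra_simps)
 hence uv: "u = v" by simp
 with h have "4 * u\<^sup>2 <= w\<^sup>2" by simp
 hence "(2 * u)\<^sup>2 <= w\<^sup>2" by (simp add: power_mult_distrib)
 hence "2 * u <= w" using nn by (meson power2_le_imp_le)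
 with tri uv have "u = w / 2" "v = w / 2" by auto
 thus "frac_point (1/2) (b i) (b ?k) (b ?j)" by (simp add: frac_point_def u_def v_def w_def)
qed

lemma near_chain_dist:
 assumes a: "chain N a" "dist (a 0) (a 1) <= r / 16" "0 < N"
  and b: "b \<in> near_curves N a p q" "chain N b" and c: "c \<in> near_curves N a p' q'" "chain N c"
  and i: "i <= N"
 shows "real N * dist (b i) (c i) <= real (N - i) * dist p p' + real i * dist q q'"
proof -
 have "dist (b i) (c i) <= r / 4" if "i <= N" for i
 proof -
  have "dist (a i) (b i) <= r/8" "dist (a i) (c i) <= r/8" using b c that by (auto simp: near_curves_def)
  thus ?thesis using dist_triangle[of "b i" "c i" "a i"] r_pos by (simp add: dist_commute)
 qed
 moreover have "dist (b 0) (b 1) <= 5 * r / 16" "dist (c 0) (c 1) <= 5 * r / 16"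
  using near_curve_step[OF b(1) a(3), of "r/16"] near_curve_step[OF c(1) a(3), of "r/16"] a(2) by auto
 ultimately have "real N * dist (b i) (c i) <= real (N - i) * dist (b 0) (c 0) + real i * dist (b N) (c N)"
  by (intro chain_dist_convex[OF b(2) c(2) _ _ _ i]) auto
 thus ?thesis using b c by (simp add: near_curves_def)
qed

text \<open>By \<open>near_chain_unique\<close> the vertices up to \<open>N\<close> do not depend on
  the choice. Minimality is part of it because \<open>loop_step_convex\<close> compares
  energies.\<close>

definition near_chain :: "nat => (nat => 'x) => 'x => 'x => nat => 'x" where "near_chain N a p q = (SOME b. b \<in> near_curves N a p q & chain N b &
  (\<forall>b'\<in>near_curves N a p q. energy N b <= energy N b'))"

lemma near_chain:
 assumes "chain N a" "dist (a 0) (a 1) <= r / 16" "0 < N" "dist (a 0) p <= r / 8" "dist (a N) q <= r / 8"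
 shows "near_chain N a p q \<in> near_curves N a p q" "chain N (near_chain N a p q)"
  "b' \<in> near_curves N a p q ==> energy N (near_chain N a p q) <= energy N b'"
  "near_chain N a p q 0 = p" "near_chain N a p q N = q"
proof -
 obtain b where b: "b \<in> near_curves N a p q" "!!b'. b' \<in> near_curves N a p q ==> energy N b <= energy N b'"
  using energy_minimizer[of N a p q] assms by blast
 have "dist (a 0) (a 1) <= r / 8" using assms(2) r_pos by simp
 hence "chain N b" using energy_minimizer_chain[OF assms(1) _ b] by blast
 with b have "b \<in> near_curves N a p q & chain N b & (\<forall>b'\<in>near_curves N a p q. energy N b <= energy N b')" by blast
 hence *: "near_chain N a p q \<in> near_curves N a p q & chain N (near_chain N a p q) &
  (\<forall>b'\<in>near_curves N a p q. energy N (near_chain N a p q) <= energy N b')"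
  unfolding near_chain_def by (rule someI[where P = "%b. b \<in> near_curves N a p q & chain N b &
   (\<forall>b'\<in>near_curves N a p q. energy N b <= energy N b')"])
 hence 1: "near_chain N a p q \<in> near_curves N a p q" by (elim conjE)
 from * show "chain N (near_chain N a p q)" by (elim conjE)
 from * have "\<forall>b'\<in>near_curves N a p q. energy N (near_chain N a p q) <= energy N b'" by (elim conjE)
 thus "b' \<in> near_curves N a p q ==> energy N (near_chain N a p q) <= energy N b'" by (rule bspec)
 show "near_chain N a p q \<in> near_curves N a p q" by (rule 1)
 show "near_chain N a p q 0 = p" using 1 unfolding near_curves_def mem_Collect_eq by (elim conjE)
 show "near_chain N a p q N = q" using 1 unfolding near_curves_def mem_Collect_eq by (elim conjE)
qed

text \<open>The distance between two chains that stay near \<open>a\<close> is convex in the index,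
  and it vanishes at both ends.\<close>

lemma near_chain_unique:
 assumes "chain N a" "dist (a 0) (a 1) <= r / 16" "0 < N" "b \<in> near_curves N a p q" "chain N b" "i <= N"
 shows "near_chain N a p q i = b i"
proof -
 have "dist (a 0) p <= r/8" "dist (a N) q <= r/8" using assms(4) by (auto simp: near_curves_def)
 note nc = near_chain[OF assms(1-3) this]
 have "real N * dist (near_chain N a p q i) (b i) <= 0" using near_chain_dist[OF assms(1-3) nc(1,2) assms(4,5,6)] by simp
 hence "dist (near_chain N a p q i) (b i) <= 0" using assms(3) by (simp add: mult_le_0_iff del: dist_le_zero_iff)
 thus ?thesis by simp
qed

lemma energy_chain:
 assumes "chain N b"
 shows "energy N b = real N * (dist (b 0) (b 1))\<^sup>2"
proof -
 have "energy N b = (\<Sum>i<N. (dist (b 0) (b 1))\<^sup>2)" unfolding energy_def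
 proof (rule sum.cong)
  fix i assume "i \<in> {..<N}"
  hence "i < N" by simp
  from chain_step[OF assms this] have "dist (b i) (b (Suc i)) = dist (b 0) (b 1)" .
  thus "(dist (b i) (b (Suc i)))\<^sup>2 = (dist (b 0) (b 1))\<^sup>2" by (simp only:)
 qed simp
 thus ?thesis by simp
qed

lemma near_chain_dist':
 assumes a: "chain N a" "dist (a 0) (a 1) <= r / 16" "0 < N"
  and p: "dist (a 0) p <= r / 8" "dist (a N) q <= r / 8" "dist (a 0) p' <= r / 8" "dist (a N) q' <= r / 8"
  and i: "i <= N"
 shows "real N * dist (near_chain N a p q i) (near_chain N a p' q' i) <= real (N - i) * dist p p' + real i * dist q q'"
 by (rule near_chain_dist[OF a near_chain(1,2)[OF a p(1,2)] near_chain(1,2)[OF a p(3,4)] i])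

lemma near_chain_self:
 assumes a: "chain N a" "dist (a 0) (a 1) <= r / 16" "0 < N" and i: "i <= N"
 shows "near_chain N a (a 0) (a N) i = a i" by (rule near_chain_unique[OF a _ a(1) i]) (use r_pos in "auto simp: near_curves_def")

section \<open>Geodesic loops as functions of their base point\<close>

text \<open>The loop may have a corner at its base point, so it exists for every \<open>p\<close>
  close to \<open>a 0\<close>; its length is \<open>N\<close> times this step.\<close>

definition loop_step :: "nat => (nat => 'x) => 'x => real" where "loop_step N a p = dist (near_chain N a p p 0) (near_chain N a p p 1)"

lemma loop_step_lipschitz:
 assumes a: "chain N a" "dist (a 0) (a 1) <= r / 16" "0 < N" "a N = a 0" and p: "dist (a 0) p <= r / 8" "dist (a 0) p' <= r / 8"
 shows "\<bar>loop_step N a p - loop_step N a p'\<bar> <= 2 * dist p p'"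
  and "i <= N ==> dist (near_chain N a p p i) (near_chain N a p' p' i) <= dist p p'"
proof -
 have le: "dist (near_chain N a p p i) (near_chain N a p' p' i) <= dist p p'" if "i <= N" for i
 proof -
  have "real N * dist (near_chain N a p p i) (near_chain N a p' p' i) <= real (N - i) * dist p p' + real i * dist p p'"
   using near_chain_dist'[OF a(1-3) p(1) _ p(2) _ that, of p p'] p a(4) by simp
  also have "\<dots> = real N * dist p p'" using that by (simp add: of_nat_diff algebra_simps)
  finally show ?thesis using a(3) by simp
 qed
 thus "i <= N ==> dist (near_chain N a p p i) (near_chain N a p' p' i) <= dist p p'" .
 show "\<bar>loop_step N a p - loop_step N a p'\<bar> <= 2 * dist p p'" unfolding loop_step_def using le[of 0] le[of 1] a(3)
   dist_triangle[of "near_chain N a p p 0" "near_chain N a p p 1" "near_chain N a p' p' 0"]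
   dist_triangle[of "near_chain N a p' p' 0" "near_chain N a p p 1" "near_chain N a p' p' 1"]
   dist_triangle[of "near_chain N a p' p' 0" "near_chain N a p' p' 1" "near_chain N a p p 0"]
   dist_triangle[of "near_chain N a p p 0" "near_chain N a p' p' 1" "near_chain N a p p 1"] by (simp add: dist_commute)
qed

text \<open>The points that divide the segments between the loops at \<open>p\<close> and at
  \<open>p'\<close> in the ratio \<open>s\<close> form a competitor based at \<open>m\<close>, and
  its steps are bounded by the convex combination. Minimality of the energy passes the bound on to
  the chain at \<open>m\<close>. Since the energy is a sum, one strictly shorter step, here the
  first, makes the inequality strict.\<close>

lemma loop_step_convex:
 assumes a: "chain N a" "dist (a 0) (a 1) <= r / 16" "0 < N" "a N = a 0" and p: "dist (a 0) p <= r / 8" "dist (a 0) p' <= r / 8"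
  and m: "frac_point s p p' m" "0 <= s" "s <= 1"
 shows "loop_step N a m <= (1 - s) * loop_step N a p + s * loop_step N a p'"
  and "0 < s ==> s < 1 ==> \<not> collinear3 p p' (near_chain N a p p 1) ==>
   loop_step N a m < (1 - s) * loop_step N a p + s * loop_step N a p'"
proof -
 define b where "b = near_chain N a p p"
 define c where "c = near_chain N a p' p'"
 have b: "b \<in> near_curves N a p p" "chain N b" "b 0 = p" "b N = p" unfolding b_def using near_chain[OF a(1-3) p(1)] p a(4) by auto
 have c: "c \<in> near_curves N a p' p'" "chain N c" "c 0 = p'" "c N = p'" unfolding c_def using near_chain[OF a(1-3) p(2)] p a(4) by auto
 have ab: "dist (a i) (b i) <= r/8" and ac: "dist (a i) (c i) <= r/8" if "i <= N" for i using b(1) c(1) that by (auto simp: near_curves_def)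
 have bc: "dist (b i) (c i) <= r/4" if "i <= N" for i using ab[OF that] ac[OF that] dist_triangle[of "b i" "c i" "a i"] by (simp add: dist_commute)
 have as: "dist (a i) (a (Suc i)) <= r/16" if "i < N" for i using chain_step[OF a(1) that] a(2) by simp
 have bs: "dist (b i) (b (Suc i)) <= 5*r/16" and cs: "dist (c i) (c (Suc i)) <= 5*r/16" if "i < N" for i
  using near_curve_step[OF b(1) that as[OF that]] near_curve_step[OF c(1) that as[OF that]] by auto
 have bcs: "dist (b i) (c (Suc i)) < r" if "i < N" for i using dist_triangle[of "b i" "c (Suc i)" "c i"] bc[of i] cs[OF that] that r_pos by auto
 obtain m0 where m0: "!!i. i <= N ==> frac_point s (b i) (c i) (m0 i)"
 proof -
  have "\<exists>z. i <= N --> frac_point s (b i) (c i) z" for i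
   using frac_point_exists[OF _ m(2,3), of "b i" "c i"] bc[of i] r_pos by (cases "i <= N") auto
  thus ?thesis using that by metis
 qed
 \<comment> \<open>At both ends the given \<open>m\<close> is taken instead of a chosen dividing
   point, so that the polygon closes up.\<close>
 define M where "M = (%i. if i = 0 \<or> i = N then m else m0 i)"
 have M: "frac_point s (b i) (c i) (M i)" if "i <= N" for i using m0[OF that] m(1) b c by (auto simp: M_def)
 have aM: "dist (a i) (M i) <= r/8" if "i <= N" for i
 proof -
  have ai: "frac_point s (a i) (a i) (a i)" by (simp add: frac_point_def)
  have "dist (M i) (a i) <= (1 - s) * dist (b i) (a i) + s * dist (c i) (a i)" by (rule convexity[OF _ _ _ m(2,3) M[OF that] ai])
    (use bc[OF that] ab[OF that] r_pos in "auto simp: dist_commute")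
  also have "\<dots> <= (1 - s) * (r/8) + s * (r/8)" using m ab[OF that] ac[OF that] by (intro add_mono mult_left_mono) (auto simp: dist_commute)
  also have "\<dots> = r/8" by (simp add: field_simps)
  finally show ?thesis by (simp add: dist_commute)
 qed
 have Mnear: "M \<in> near_curves N a m m" using aM by (auto simp: near_curves_def M_def)
 have am: "dist (a 0) m <= r/8" using aM[of 0] by (simp add: M_def)
 let ?D = "(1 - s) * loop_step N a p + s * loop_step N a p'"
 have lb: "loop_step N a p = dist (b 0) (b 1)" "loop_step N a p' = dist (c 0) (c 1)" by (simp_all add: loop_step_def b_def c_def)
 have st: "dist (M i) (M (Suc i)) <= ?D" if "i < N" for i
 proof -
  have "dist (M i) (M (Suc i)) <= (1 - s) * dist (b i) (b (Suc i)) + s * dist (c i) (c (Suc i))"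
   by (rule convexity[OF _ _ _ m(2,3) M M]) (use that bc[of i] bs[of i] bcs[of i] r_pos in auto)
  thus ?thesis using chain_step[OF b(2) that] chain_step[OF c(2) that] lb by simp
 qed
 have am': "dist (a N) m <= r/8" using am a(4) by simp
 note nm = near_chain[OF a(1-3) am am']
 have lm: "energy N (near_chain N a m m) = real N * (loop_step N a m)\<^sup>2" using energy_chain[OF nm(2)] by (simp add: loop_step_def)
 have D0: "0 <= ?D" using m by (simp add: loop_step_def)
 have "energy N (near_chain N a m m) <= energy N M" by (rule nm(3)[OF Mnear])
 also have "\<dots> <= (\<Sum>i<N. ?D\<^sup>2)" unfolding energy_def using st by (intro sum_mono power_mono) auto
 finally have "real N * (loop_step N a m)\<^sup>2 <= real N * ?D\<^sup>2" by (simp add: lm)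
 hence "(loop_step N a m)\<^sup>2 <= ?D\<^sup>2" using a(3) by simp
 thus "loop_step N a m <= ?D" using D0 by (rule power2_le_imp_le)
 assume s: "0 < s" "s < 1" and nc: "\<not> collinear3 p p' (near_chain N a p p 1)"
 have st0: "dist (M 0) (M 1) < ?D"
 proof -
  have "dist (M 0) (M 1) < (1 - s) * dist (b 0) (b 1) + s * dist (c 0) (c 1)" by (rule strict_convexity[OF _ _ _ s M M])
    (use a(3) bc[of 0] bs[of 0] bcs[of 0] nc r_pos b c in "auto simp: b_def")
  thus ?thesis using lb by simp
 qed
 have "energy N M < (\<Sum>i<N. ?D\<^sup>2)" unfolding energy_def
 proof (rule sum_strict_mono_ex1)
  show "\<forall>x\<in>{..<N}. (dist (M x) (M (Suc x)))\<^sup>2 <= ?D\<^sup>2" using st by (auto intro!: power_mono)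
  show "\<exists>x\<in>{..<N}. (dist (M x) (M (Suc x)))\<^sup>2 < ?D\<^sup>2" using a(3) st0 by (intro bexI[of _ 0]) (auto intro!: power_strict_mono)
 qed simp
 with nm(3)[OF Mnear] have "real N * (loop_step N a m)\<^sup>2 < real N * ?D\<^sup>2" by (simp add: lm)
 hence "(loop_step N a m)\<^sup>2 < ?D\<^sup>2" using a(3) by simp
 thus "loop_step N a m < ?D" using D0 by (rule power2_less_imp_less)
qed

text \<open>Fixing the values beyond \<open>N\<close> makes a loop, as a function on all naturals,
  determined by its vertices; otherwise there would be no finiteness.\<close>

definition loops :: "nat => 'x => (nat => 'x) set"
 where "loops N x = {a. chain N a & a 0 = x & a N = x & dist (a 0) (a 1) <= r / 16 & (\<forall>i>N. a i = x)}"

lemma finite_net: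
 assumes "0 < e"
 obtains C :: "'x set" where "finite C" "!!y. \<exists>c\<in>C. dist c y < e"
proof -
 obtain C where C: "finite C" "(UNIV :: 'x set) \<subseteq> (\<Union>c\<in>C. ball c e)"
  using compact_UNIV assms unfolding compact_eq_totally_bounded by meson
 show ?thesis
 proof (rule that[OF C(1)])
  fix y
  have "y \<in> (\<Union>c\<in>C. ball c e)" using C(2) by blast
  thus "\<exists>c\<in>C. dist c y < e" by simp
 qed
qed

text \<open>Each vertex is encoded by a point of a finite \<open>r / 16\<close>-net. Loops with the
  same code are \<open>r / 8\<close>-close, hence equal by \<open>near_chain_unique\<close>.\<close>

lemma finite_loops:
 assumes "0 < N"
 shows "finite (loops N x)"
proof -
 obtain C :: "'x set" where C: "finite C" "!!y. \<exists>c\<in>C. dist c y < r/16" using finite_net[of "r/16"] r_pos by auto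
 then obtain f where f: "!!y. f y \<in> C" "!!y. dist (f y) y < r/16" by metis
 let ?F = "%a :: nat => 'x. restrict (%i. f (a i)) {..N}"
 have inj: "inj_on ?F (loops N x)"
 proof (rule inj_onI)
  fix a b assume ab: "a \<in> loops N x" "b \<in> loops N x" "?F a = ?F b"
  have e: "f (a i) = f (b i)" if "i <= N" for i using fun_cong[OF ab(3), of i] that by simp
  have d: "dist (a i) (b i) <= r/8" if "i <= N" for i
   using e[OF that] f(2)[of "a i"] f(2)[of "b i"] dist_triangle[of "a i" "b i" "f (a i)"] by (simp add: dist_commute)
  have an: "chain N a" "dist (a 0) (a 1) <= r/16" "chain N b" using ab by (auto simp: loops_def)
  have "b \<in> near_curves N a (a 0) (a N)" using ab d by (auto simp: loops_def near_curves_def)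
  hence "a i = b i" if "i <= N" for i using near_chain_unique[OF an(1,2) assms _ an(3) that] near_chain_self[OF an(1,2) assms that] by simp
  thus "a = b" using ab by (auto simp: loops_def fun_eq_iff) (metis not_less)
 qed
 have "?F ` loops N x \<subseteq> PiE {..N} (%_. C)" using f by (simp only: image_subset_iff restrict_PiE_iff) blast
 hence "finite (?F ` loops N x)" using C(1) by (meson finite_PiE finite_atMost finite_subset)
 thus ?thesis using inj finite_imageD by blast
qed

text \<open>The points from which \<open>x\<close> can be reached form an open and closed set.
  Compactness bounds the number of jumps, and jumps of length zero pad shorter sequences to exactly
  \<open>M\<close>.\<close>

lemma uniform_jumps:
 fixes x :: 'x
 assumes "e > 0"
 obtains M where "!!p. \<exists>f. f 0 = p & f M = x & (\<forall>i<M. dist (f i) (f (Suc i)) < e)"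
proof -
 define J where "J = (%M p. \<exists>f. f 0 = p & f M = x & (\<forall>i<M. dist (f i) (f (Suc i)) < e))"
 have J0: "J 0 x" unfolding J_def by (intro exI[of _ "%_. x"]) simp
 have JS: "J (Suc M) q" if "J M p" "dist q p < e" for M p q
 proof -
  obtain f where f: "f 0 = p" "f M = x" "\<forall>i<M. dist (f i) (f (Suc i)) < e" using \<open>J M p\<close> J_def by blast
  show ?thesis unfolding J_def by (rule exI[of _ "%i. case i of 0 => q | Suc i => f i"]) (use f that(2) in "auto split: nat.split")
 qed
 have Jmono: "J M' p" if "J M p" "M <= M'" for M M' p using that(2) by (induction M' rule: dec_induct) (use that(1) JS[of _ p p] assms in auto)
 define R where "R = {p. \<exists>M. J M p}"
 have "open R" unfolding open_dist
 proof
  fix p assume p: "p \<in> R"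
  have "q \<in> R" if "dist q p < e" for q using p JS[of _ p q] that by (auto simp: R_def)
  thus "\<exists>e>0. \<forall>y. dist y p < e --> y \<in> R" using assms by blast
 qed
 moreover have "closed R"
 proof -
  have "open (- R)" unfolding open_dist
  proof
   fix p assume p: "p \<in> - R"
   have "q \<in> - R" if "dist q p < e" for q using p JS[of _ q p] that by (auto simp: R_def dist_commute)
   thus "\<exists>e>0. \<forall>y. dist y p < e --> y \<in> - R" using assms by blast
  qed
  thus ?thesis by (simp add: closed_def)
 qed
 moreover have "R ~= {}" using J0 by (auto simp: R_def)
 ultimately have "R = UNIV" using connectedD[OF connected_UNIV, of R "- R"] by (auto simp: closed_def)
 hence "\<forall>p. \<exists>M. J M p" by (auto simp: R_def)
 then obtain m where m: "!!p. J (m p) p" by metis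
 obtain C :: "'x set" where C: "finite C" "!!y. \<exists>c\<in>C. dist c y < e" using finite_net[OF assms] by blast
 have "J (Suc (Max (m ` C))) p" for p
 proof -
  obtain c where c: "c \<in> C" "dist c p < e" using C(2) by blast
  have "m c <= Max (m ` C)" using c C(1) by simp
  thus ?thesis using JS[OF Jmono[OF m]] c(2) by (metis dist_commute)
 qed
 thus ?thesis using that unfolding J_def by blast
qed

lemma extended_chain:
 fixes x w :: 'x
 assumes "x ~= w" "dist x w < r / 2"
 obtains c where "c 0 = x" "c 1 = w" "!!N. chain N c"
proof -
 define E :: "'x \<times> 'x => 'x \<times> 'x" where "E = (%(p, q). (q, SOME z. dist q z = dist x w & dist p z = dist p q + dist x w))"
 define P where "P = (%n. (E ^^ n) (x, w))"
 define c where "c = (%n. fst (P n))"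
 have PS: "P (Suc n) = E (P n)" for n by (simp add: P_def)
 have snd: "snd (P n) = c (Suc n)" for n unfolding c_def PS by (simp add: E_def split: prod.split)
 have Pn: "P n = (c n, c (Suc n))" for n using snd[of n] by (simp add: c_def prod_eq_iff)
 have ex: "\<exists>z. dist q z = dist x w & dist p z = dist p q + dist x w" if "dist p q = dist x w" for p q :: 'x
  using extension_exists[of p q "dist x w"] that assms r_pos by fastforce
 have step: "dist (c n) (c (Suc n)) = dist x w & dist (c (Suc n)) (c (Suc (Suc n))) = dist x w
   & dist (c n) (c (Suc (Suc n))) = 2 * dist x w" for n
 proof -
  have eq: "c (Suc (Suc n)) = (SOME z. dist (c (Suc n)) z = dist x w & dist (c n) z = dist (c n) (c (Suc n)) + dist x w)" for n
   using snd[of "Suc n"] unfolding PS Pn[of n] by (simp add: E_def)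
  have s: "dist (c n) (c (Suc n)) = dist x w ==> dist (c (Suc n)) (c (Suc (Suc n))) = dist x w
   & dist (c n) (c (Suc (Suc n))) = dist (c n) (c (Suc n)) + dist x w" for n unfolding eq[of n] using someI_ex[OF ex] by blast
  have "dist (c n) (c (Suc n)) = dist x w"
  proof (induction n)
   case 0
   show ?case using Pn[of 0] by (simp add: P_def)
  qed (use s in blast)
  with s[of n] show ?thesis by simp
 qed
 show ?thesis
 proof
  show "c 0 = x" "c 1 = w" using Pn[of 0] by (simp_all add: P_def)
  show "chain N c" for N unfolding chain_def frac_point_def using step by simp
 qed
qed

text \<open>A long chain through \<open>w\<close> is bent back to \<open>x\<close> by moving its end
  point in \<open>M\<close> jumps. A jump of the end point shifts the first vertex by at most
  \<open>1 / N\<close> of its length, so for large \<open>N\<close> the first vertex stays near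
  \<open>w\<close>: loops leave \<open>x\<close> in a dense set of directions.\<close>

lemma long_loop:
 fixes x w :: 'x
 assumes xw: "x ~= w" "dist x w <= r / 32" and e: "e > 0"
 obtains N a where "N \<ge> n0" "chain N a" "a 0 = x" "a N = x" "dist (a 0) (a 1) < r / 16" "dist (a 1) w < e"
proof -
 obtain c where c: "c 0 = x" "c 1 = w" "!!N. chain N c" using extended_chain[of x w] xw r_pos by auto
 obtain M where M: "!!p. \<exists>f. f 0 = p & f M = x & (\<forall>i<M. dist (f i) (f (Suc i)) < r / 8)" using uniform_jumps[of "r / 8"] r_pos by auto
 obtain n1 :: nat where n1: "real n1 > real M * r / 8 / min e (r / 32)" using reals_Archimedean2 by blast
 define N where "N = max n1 (max n0 1)"
 have "real n1 <= real N" by (simp add: N_def)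
 with n1 have N: "N \<ge> max n0 1" "real N > real M * r / 8 / min e (r / 32)" by (auto simp: N_def)
 have mp: "min e (r/32) > 0" using e r_pos by simp
 have "real M * r / 8 / real N < m" if "real M * r / 8 / m < real N" "0 < m" for m using that N(1) by (simp add: field_simps)
 from this[OF N(2) mp] have N2: "real M * r / 8 / real N < min e (r/32)" .
 obtain f where f: "f 0 = c N" "f M = x" "!!i. i < M ==> dist (f i) (f (Suc i)) < r / 8" using M by blast
 have N0: "0 < N" using N(1) by simp
 have "\<exists>b. chain N b & b 0 = x & b N = f j & dist (b 1) w <= real j * r / 8 / real N" if "j <= M" for j using that
 proof (induction j)
  case 0
  show ?case by (intro exI[of _ c]) (use c f in auto)
 next case (Suc j)
  then obtain b where b: "chain N b" "b 0 = x" "b N = f j" "dist (b 1) w <= real j * r / 8 / real N" by auto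
  have "real j * r / 8 / real N <= real M * r / 8 / real N" using Suc r_pos by (intro divide_right_mono mult_right_mono) auto
  with b N2 have "dist (b 1) w < r/32" by linarith
  hence bs: "dist (b 0) (b 1) <= r/16" using dist_triangle[of x "b 1" w] xw b(2) by (simp add: dist_commute)
  have fj: "dist (b N) (f (Suc j)) <= r/8" using f(3)[of j] b(3) Suc by simp
  have b0: "dist (b 0) x <= r/8" using b(2) r_pos by simp
  note nc = near_chain[OF b(1) bs N0 b0 fj]
  have "real N * dist (near_chain N b x (f (Suc j)) 1) (near_chain N b x (f j) 1)
    <= real (N - 1) * dist x x + real 1 * dist (f (Suc j)) (f j)" by (rule near_chain_dist'[OF b(1) bs N0 b0 fj b0]) (use N0 b(3) r_pos in auto)
  also have "near_chain N b x (f j) 1 = b 1" using near_chain_self[OF b(1) bs N0, of 1] b N0 by simp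
  finally have "dist (near_chain N b x (f (Suc j)) 1) (b 1) <= r / 8 / real N" using f(3)[of j] Suc N0 by (simp add: field_simps dist_commute)
  hence "dist (near_chain N b x (f (Suc j)) 1) w <= real (Suc j) * r / 8 / real N"
   using b(4) dist_triangle[of "near_chain N b x (f (Suc j)) 1" w "b 1"] by (simp add: add_divide_distrib algebra_simps)
  thus ?case using nc by blast
 qed
 from this[of M] obtain a where a: "chain N a" "a 0 = x" "a N = x" "dist (a 1) w <= real M * r / 8 / real N" using f(2) by auto
 have "dist (a 1) w < min e (r/32)" using a(4) N2 by linarith
 moreover from this have "dist (a 0) (a 1) < r/16" using dist_triangle[of x "a 1" w] xw a(2) by (simp add: dist_commute)
 ultimately show ?thesis using that[of N a] a N(1) by auto
qed

end

section \<open>Accumulation of related points\<close>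

text \<open>\<open>R\<close> is not assumed to be transitive, so related points are compared with
  each other through a common point \<open>z\<close>.\<close>

locale transported_relation = convex_geodesic_space r space_type
 for r :: real and space_type :: "'x::metric_space itself" +
 fixes R :: "'x => 'x => bool"
 assumes R_sym: "R x y ==> R y x" and R_closed: "(!!k. R z (f k)) ==> f ----> l ==> R z l"
  and R_transport: "R x x' ==> chain N a ==> a 0 = x ==> dist (a 0) (a 1) <= r / 16 ==> 0 < N ==>
   \<exists>b. chain N b & b 0 = x' & (\<forall>i\<le>N. R (a i) (b i)) & dist (b 0) (b 1) = dist (a 0) (a 1) & (a N = a 0 --> b N = b 0)"
begin

definition loop_steps :: "nat => 'x => real set" where "loop_steps N x = (%a. dist (a 0) (a 1)) ` loops N x"

lemma loop_transport:
 assumes "R x x'" "0 < N" "chain N a" "a 0 = x" "a N = x" "dist (a 0) (a 1) <= r / 16"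
 obtains b where "b \<in> loops N x'" "dist (b 0) (b 1) = dist (a 0) (a 1)" "!!i. i <= N ==> R (a i) (b i)"
proof -
 obtain b where b: "chain N b" "b 0 = x'" "\<forall>i\<le>N. R (a i) (b i)" "dist (b 0) (b 1) = dist (a 0) (a 1)" "b N = b 0"
  using R_transport[OF assms(1,3,4,6,2)] assms(4,5) by auto
 define c where "c = (%i. if i <= N then b i else x')"
 have "chain N c" using b(1) by (auto simp: chain_def c_def)
 moreover have "c 0 = x'" "c N = x'" "\<forall>i>N. c i = x'" "dist (c 0) (c 1) = dist (a 0) (a 1)" using b assms(2) by (auto simp: c_def)
 ultimately have "c \<in> loops N x'" using assms(6) by (simp add: loops_def)
 moreover have "R (a i) (c i)" if "i <= N" for i using b(3) that by (simp add: c_def)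
 ultimately show ?thesis using that \<open>dist (c 0) (c 1) = dist (a 0) (a 1)\<close> by blast
qed

lemma loop_steps_subset:
 assumes "R x x'" "0 < N"
 shows "loop_steps N x \<subseteq> loop_steps N x'"
proof
 fix d assume "d \<in> loop_steps N x"
 then obtain a where a: "chain N a" "a 0 = x" "a N = x" "dist (a 0) (a 1) <= r / 16" "d = dist (a 0) (a 1)" by (auto simp: loop_steps_def loops_def)
 obtain b where b: "b \<in> loops N x'" "dist (b 0) (b 1) = dist (a 0) (a 1)" by (rule loop_transport[OF assms a(1-4)])
 show "d \<in> loop_steps N x'" unfolding loop_steps_def by (rule image_eqI[OF _ b(1)]) (simp only: a(5) b(2))
qed

lemma near_loop_in_loop_steps:
 assumes a: "chain N a" "dist (a 0) (a 1) <= r / 16" "0 < N" "a N = a 0" and p: "dist (a 0) p <= r / 8" "loop_step N a p <= r / 16"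
 shows "loop_step N a p \<in> loop_steps N p"
proof -
 note nc = near_chain[OF a(1-3) p(1)]
 have p': "dist (a N) p <= r/8" using p a(4) by simp
 define c where "c = (%i. if i <= N then near_chain N a p p i else p)"
 have "chain N c" using nc(2)[OF p'] by (auto simp: chain_def c_def)
 moreover have "c 0 = p" "c N = p" using nc(4,5)[OF p'] by (auto simp: c_def)
 moreover have d: "dist (c 0) (c 1) = loop_step N a p" using a(3) by (auto simp: c_def loop_step_def)
 ultimately have "c \<in> loops N p" using p(2) by (simp add: loops_def c_def)
 thus ?thesis unfolding loop_steps_def by (intro image_eqI[of _ _ c]) (simp only: d)
qed

text \<open>Loop lengths at related points agree, and they form a finite set, so they cannot vary along a
 convergent sequence of related points.\<close>

lemma loop_step_eventually_constant:
 assumes a: "chain N a" "dist (a 0) (a 1) <= r / 16" "0 < N" "a N = a 0" and y: "dist (a 0) y < r / 8" "loop_step N a y < r / 16"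
  and yk: "R z y" "!!k. R z (yk k)" "yk ----> y"
 shows "\<forall>\<^sub>F k in sequentially. loop_step N a (yk k) = loop_step N a y"
proof -
 have "0 < r/8 - dist (a 0) y" using y by simp
 from tendstoD[OF yk(3) this] have near: "\<forall>\<^sub>F k in sequentially. dist (a 0) (yk k) <= r / 8"
  by eventually_elim (metis add.commute dist_commute dist_triangle_lt less_diff_eq less_imp_le)
 have lim: "(%k. loop_step N a (yk k)) ----> loop_step N a y"
 proof (rule LIM_zero_cancel, rule Lim_null_comparison)
  show "\<forall>\<^sub>F k in sequentially. norm (loop_step N a (yk k) - loop_step N a y) <= 2 * dist (yk k) y"
   using near by eventually_elim (use loop_step_lipschitz(1)[OF a] y in auto)
  show "(%k. 2 * dist (yk k) y) ----> 0" using tendsto_mult_left[OF tendsto_dist[OF yk(3) tendsto_const[of y]], of 2] by simp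
 qed
 have "\<forall>\<^sub>F k in sequentially. loop_step N a (yk k) < r / 16" using order_tendstoD(2)[OF lim y(2)] .
 with near have mem: "\<forall>\<^sub>F k in sequentially. loop_step N a (yk k) \<in> loop_steps N z"
 proof eventually_elim
  case (elim k)
  hence "loop_step N a (yk k) \<in> loop_steps N (yk k)" by (intro near_loop_in_loop_steps[OF a]) auto
  thus ?case using loop_steps_subset[OF R_sym[OF yk(2)] a(3)] by blast
 qed
 have fin: "finite (loop_steps N z)" unfolding loop_steps_def using finite_loops[OF a(3)] by simp
 define S where "S = loop_steps N z - {loop_step N a y}"
 have "closed S" using fin unfolding S_def by (intro finite_imp_closed) simp
 hence "open (- S)" by (simp add: open_Compl)
 moreover have "loop_step N a y \<in> - S" by (simp add: S_def)
 ultimately have "\<forall>\<^sub>F k in sequentially. loop_step N a (yk k) \<in> - S" using lim by (metis topological_tendstoD)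
 with mem show ?thesis by eventually_elim (auto simp: S_def)
qed

text \<open>Accumulation travels along loops. Only finitely many loops start at \<open>z\<close>, so
  the \<open>i\<close>-th vertex \<open>t\<close> of one of them is related to the
  \<open>i\<close>-th vertices of the loops at infinitely many \<open>yk k\<close>, and in the limit
  to \<open>a i\<close>.\<close>

lemma related_loop_points:
 assumes a: "chain N a" "dist (a 0) (a 1) < r / 16" "0 < N" "a N = a 0" and i: "i <= N" and yk: "R z (a 0)" "!!k. R z (yk k)" "yk ----> a 0"
 obtains t where "R t (a i)" "\<exists>\<^sub>F k in sequentially. R t (near_chain N a (yk k) (yk k) i)"
proof -
 have a': "dist (a 0) (a 1) <= r/16" using a by simp
 have self: "loop_step N a (a 0) = dist (a 0) (a 1)"
  unfolding loop_step_def using near_chain_self[OF a(1) a' a(3), of 0] near_chain_self[OF a(1) a' a(3), of 1] a(3,4) by simp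
 have ls: "\<forall>\<^sub>F k in sequentially. loop_step N a (yk k) = loop_step N a (a 0)"
  by (rule loop_step_eventually_constant[OF a(1) a' a(3,4) _ _ yk]) (use a r_pos self in auto)
 have r8: "0 < r/8" using r_pos by simp
 have near: "\<forall>\<^sub>F k in sequentially. dist (a 0) (yk k) <= r / 8" using tendstoD[OF yk(3) r8] by eventually_elim (simp add: dist_commute)
 define P where "P = (%k t. t \<in> loops N z & R (near_chain N a (yk k) (yk k) i) (t i))"
 have ex: "\<forall>\<^sub>F k in sequentially. \<exists>t. P k t" using ls near
 proof eventually_elim
  case (elim k)
  have e': "dist (a N) (yk k) <= r/8" using elim a(4) by simp
  note nc = near_chain[OF a(1) a' a(3) elim(2) e']
  have "dist (near_chain N a (yk k) (yk k) 0) (near_chain N a (yk k) (yk k) 1) <= r/16" using elim(1) self a' by (simp add: loop_step_def)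
  from loop_transport[OF R_sym[OF yk(2)] a(3) nc(2,4,5) this] i show ?case unfolding P_def by metis
 qed
 define t where "t = (%k. SOME t. P k t)"
 have t: "\<forall>\<^sub>F k in sequentially. P k (t k)" using ex
 proof (rule eventually_mono)
  fix k assume "\<exists>t. P k t"
  thus "P k (t k)" unfolding t_def by (rule someI_ex)
 qed
 have fin: "finite (loops N z)" by (rule finite_loops[OF a(3)])
 have "\<exists>\<^sub>F k in sequentially. \<exists>s\<in>loops N z. t k = s"
  using eventually_frequently[OF _ t] by (auto elim: frequently_elim1 simp: P_def)
 from frequently_bex_finite[OF fin this] obtain s where s: "\<exists>\<^sub>F k in sequentially. t k = s" by (rule bexE)
 have fr: "\<exists>\<^sub>F k in sequentially. R (s i) (near_chain N a (yk k) (yk k) i)"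
  using frequently_eventually_conj[OF s t] by (rule frequently_elim1) (auto intro: R_sym simp: P_def)
 have "R (s i) (a i)"
 proof -
  have inf: "infinite {k. R (s i) (near_chain N a (yk k) (yk k) i)}" using fr by (simp add: frequently_cofinite cofinite_eq_sequentially[symmetric])
  define e where "e = enumerate {k. R (s i) (near_chain N a (yk k) (yk k) i)}"
  have e: "strict_mono e" "!!k. R (s i) (near_chain N a (yk (e k)) (yk (e k)) i)"
   using inf strict_mono_enumerate enumerate_in_set[OF inf] by (auto simp: e_def)
  have "(%k. near_chain N a (yk k) (yk k) i) ----> a i"
  proof (rule metric_tendsto_imp_tendsto[OF yk(3)])
   show "\<forall>\<^sub>F k in sequentially. dist (near_chain N a (yk k) (yk k) i) (a i) <= dist (yk k) (a 0)" using near
   proof eventually_elim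
    case (elim k)
    thus ?case using loop_step_lipschitz(2)[OF a(1) a' a(3,4) elim _ i, of "a 0"] near_chain_self[OF a(1) a' a(3) i] r_pos a(4) by simp
   qed
  qed
  from LIMSEQ_subseq_LIMSEQ[OF this e(1)]
  have lim: "(%k. near_chain N a (yk (e k)) (yk (e k)) i) ----> a i" by (simp add: o_def)
  show ?thesis by (rule R_closed[OF e(2) lim])
 qed
 thus ?thesis using that fr by blast
qed

text \<open>A convex function with equal values at \<open>y\<close> and \<open>y'\<close> is at
  least as large on the far side of \<open>y\<close>.\<close>

lemma loop_step_extension:
 assumes a: "chain N a" "dist (a 0) (a 1) <= r / 16" "0 < N" "a N = a 0"
  and p: "dist (a 0) u <= r / 8" "dist (a 0) y <= r / 8" "dist (a 0) y' <= r / 8"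
  and b: "dist u y + dist y y' = dist u y'" "u ~= y" "y ~= y'" and eq: "loop_step N a y' = loop_step N a y"
 shows "loop_step N a y <= loop_step N a u"
proof -
 have pos: "dist u y' > 0" using b by (metis add_pos_nonneg zero_le_dist zero_less_dist_iff)
 define s where "s = dist u y / dist u y'"
 have s: "0 < s" "s <= 1" using b pos zero_le_dist[of y y'] unfolding s_def by (auto simp: divide_le_eq simp del: zero_le_dist)
 have f: "frac_point s u y' y"
 proof -
  have "s * dist u y' = dist u y" using pos by (simp add: s_def)
  thus ?thesis using b(1) by (simp add: frac_point_def left_diff_distrib)
 qed
 have "loop_step N a y <= (1 - s) * loop_step N a u + s * loop_step N a y'" by (rule loop_step_convex(1)[OF a p(1,3) f]) (use s in auto)
 hence le: "(1 - s) * loop_step N a y <= (1 - s) * loop_step N a u" by (simp add: eq algebra_simps)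
 have "s ~= 1" using f b by (auto simp: frac_point_def)
 thus ?thesis using le s by simp
qed

text \<open>When the base point moves by \<epsilon> from \<open>\<sigma> 0\<close> towards
  \<open>w\<close>, with \<open>w\<close> near \<open>\<sigma> 1\<close>, and the step is unchanged,
  the first vertex recedes from \<open>\<sigma> 0\<close> by almost \<epsilon>. The new chain is
  compared with \<sigma> shifted by one index: their distance is convex in the index, equals
  \<open>dist p (\<sigma> 1)\<close> at the start and is at most
  \<open>\<delta> + \<epsilon>\<close> at the end. So \<open>b 1\<close> is as close to
  \<open>\<sigma> 2\<close> as \<open>p\<close> is to \<open>\<sigma> 1\<close>, up to
  \<open>2 * \<epsilon> / (N - 1)\<close>.\<close>

lemma advance_estimate:
 assumes \<sigma>: "chain N \<sigma>" "\<sigma> N = \<sigma> 0" "dist (\<sigma> 0) (\<sigma> 1) = \<delta>" "\<delta> < r / 16" "2 <= N"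
  and b: "b \<in> near_curves N \<sigma> p p" "chain N b" "dist (b 0) (b 1) = \<delta>"
  and w: "dist (\<sigma> 0) w = \<alpha>" "dist p w = \<alpha> - dist (\<sigma> 0) p" "\<alpha> < r / 8" "0 < \<alpha>"
 shows "\<delta> + dist (\<sigma> 0) p * (\<delta> / \<alpha> - dist w (\<sigma> 1) / \<alpha> - 2 / real (N - 1)) <= dist (\<sigma> 0) (b 1)"
proof -
 define x where "x = \<sigma> 0"
 define \<epsilon> where "\<epsilon> = dist x p"
 define s where "s = \<epsilon> / \<alpha>"
 have "0 <= \<alpha> - \<epsilon>" using w(2) zero_le_dist[of p w] by (simp add: \<epsilon>_def x_def)
 hence s: "0 <= s" "s <= 1" using w(4) by (auto simp: s_def \<epsilon>_def divide_le_eq)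
 have sa: "s * \<alpha> = \<epsilon>" using w(4) by (simp add: s_def)
 have fp: "frac_point s x w p" using w sa by (simp add: frac_point_def \<epsilon>_def x_def algebra_simps)
 obtain zp where zp: "frac_point s x (\<sigma> 1) zp" using frac_point_exists[OF _ s, of x "\<sigma> 1"] \<sigma> r_pos by (auto simp: x_def)
 have "dist p zp <= (1 - s) * dist x x + s * dist w (\<sigma> 1)" by (rule convexity[OF _ _ _ s fp zp]) (use w \<sigma> r_pos in "auto simp: x_def")
 hence g0: "dist p (\<sigma> 1) <= s * dist w (\<sigma> 1) + (1 - s) * \<delta>"
  using zp \<sigma>(3) dist_triangle[of p "\<sigma> 1" zp] by (simp add: frac_point_def x_def)
 have b0: "b 0 = p" "b N = p" and sb: "dist (\<sigma> i) (b i) <= r/8" if "i <= N" for i using b(1) that by (auto simp: near_curves_def)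
 define \<tau> where "\<tau> = (%i. \<sigma> (Suc i))"
 have c\<tau>: "chain (N - 1) \<tau>" using \<sigma>(1) \<sigma>(5) by (auto simp: chain_def \<tau>_def)
 have cb: "chain (N - 1) b" using b(2) by (auto simp: chain_def)
 have st: "dist (\<sigma> i) (\<sigma> (Suc i)) = \<delta>" "dist (b i) (b (Suc i)) = \<delta>" if "i < N" for i
  using chain_step[OF \<sigma>(1) that] chain_step[OF b(2) that] \<sigma>(3) b(3) by simp_all
 have b\<tau>: "dist (b i) (\<tau> i) <= r/4" if "i <= N - 1" for i
 proof -
  have "i < N" using that \<sigma>(5) by simp
  thus ?thesis using sb[of i] st(1)[of i] \<sigma>(4) dist_triangle[of "b i" "\<tau> i" "\<sigma> i"] r_pos by (simp add: dist_commute \<tau>_def)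
 qed
 have "real (N - 1) * dist (b 1) (\<tau> 1) <= real (N - 1 - 1) * dist (b 0) (\<tau> 0) + real 1 * dist (b (N - 1)) (\<tau> (N - 1))"
  by (rule chain_dist_convex[OF cb c\<tau> b\<tau>]) (use \<sigma>(4,5) st(1)[of 1] st(2)[of 0] r_pos in "auto simp: \<tau>_def")
 moreover have "dist (b (N - 1)) (\<tau> (N - 1)) <= \<delta> + \<epsilon>"
 proof -
  have "Suc (N - 1) = N" using \<sigma>(5) by simp
  hence "\<tau> (N - 1) = x" "dist (b (N - 1)) p = \<delta>" using st(2)[of "N - 1"] \<sigma>(2,5) b0(2)[of 0] by (auto simp: \<tau>_def x_def)
  thus ?thesis using dist_triangle[of "b (N - 1)" x p] by (simp add: \<epsilon>_def dist_commute)
 qed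
 moreover have "dist (b 0) (\<tau> 0) = dist p (\<sigma> 1)" using b0(1)[of 0] by (simp add: \<tau>_def)
 ultimately have "real (N - 1) * dist (b 1) (\<sigma> 2) <= real (N - 1 - 1) * dist p (\<sigma> 1) + (\<delta> + \<epsilon>)"
  by (simp add: \<tau>_def numeral_2_eq_2)
 also have "\<dots> = real (N - 1) * dist p (\<sigma> 1) + (\<delta> + \<epsilon> - dist p (\<sigma> 1))"
  using \<sigma>(5) by (simp add: of_nat_diff algebra_simps)
 also have "\<dots> <= real (N - 1) * dist p (\<sigma> 1) + 2 * \<epsilon>"
  using dist_triangle[of x "\<sigma> 1" p] \<sigma>(3) by (simp add: x_def \<epsilon>_def)
 finally have "dist (b 1) (\<sigma> 2) <= dist p (\<sigma> 1) + 2 * \<epsilon> / real (N - 1)" using \<sigma>(5) by (simp add: field_simps)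
 moreover have "dist x (\<sigma> 2) = 2 * \<delta>"
 proof -
  have "frac_point (1/2) (\<sigma> 0) (\<sigma> (Suc (Suc 0))) (\<sigma> (Suc 0))" using \<sigma>(1,5) unfolding chain_def by (metis numeral_2_eq_2)
  thus ?thesis using \<sigma>(3) by (simp add: frac_point_def x_def numeral_2_eq_2)
 qed
 ultimately have "dist x (b 1) \<ge> 2 * \<delta> - (s * dist w (\<sigma> 1) + (1 - s) * \<delta>) - 2 * \<epsilon> / real (N - 1)"
  using g0 dist_triangle[of x "\<sigma> 2" "b 1"] by simp
 hence "\<delta> + s * \<delta> - s * dist w (\<sigma> 1) - 2 * \<epsilon> / real (N - 1) <= dist x (b 1)" by (simp add: algebra_simps)
 thus ?thesis by (simp add: s_def x_def[symmetric] \<epsilon>_def[symmetric] algebra_simps)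
qed

text \<open>\<open>y\<close> is the first vertex of a long loop at \<open>x\<close> in the direction
  of \<open>w\<close>. As the base point runs through \<open>xk\<close>, the first vertices are
  again related points accumulating at \<open>y\<close>, and by \<open>advance_estimate\<close> they
  leave \<open>y\<close> almost radially away from \<open>x\<close>. The convexity argument at
  \<open>y\<close> then gives the inequality with \<open>u\<close> on the side of \<open>x\<close>;
  for \<open>e\<close> tending to zero, \<open>y\<close> tends to \<open>w\<close> and
  \<open>u\<close> to \<open>x\<close>.\<close>

lemma drift_quadrilateral:
 fixes x w :: 'x
 assumes a: "chain N a" "dist (a 0) (a 1) <= r / 32" "0 < N" "a N = a 0" and x: "a 0 = x" "R z x" "!!k. R z (xk k)" "!!k. xk k ~= x" "xk ----> x"
  and w: "!!k. dist x (wk k) = \<alpha>" "!!k. dist (xk k) (wk k) = \<alpha> - dist x (xk k)" "wk ----> w" "dist x w = \<alpha>"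
  and \<alpha>: "0 < \<alpha>" "\<alpha> <= r / 128" and e: "0 < e"
 obtains y u v where "dist y w < e" "dist y v = \<alpha>" "2 * \<alpha> - e <= dist x v" "dist y u = \<alpha>" "dist v u = 2 * \<alpha>"
  "loop_step N a y <= loop_step N a u" "dist x u <= r / 16" "dist x y <= r / 16"
proof -
 define e0 where "e0 = min (e / 8) (\<alpha> / 16)"
 have e0: "0 < e0" "e0 <= e / 8" "e0 <= \<alpha> / 16" using e \<alpha> by (auto simp: e0_def)
 obtain n1 :: nat where n1: "real n1 > 2 * \<alpha> / e0" using reals_Archimedean2 by blast
 have xw: "x ~= w" "dist x w <= r / 32" using w(4) \<alpha> r_pos by auto
 obtain M \<sigma> where \<sigma>: "M \<ge> n1 + 2" "chain M \<sigma>" "\<sigma> 0 = x" "\<sigma> M = x" "dist (\<sigma> 0) (\<sigma> 1) < r / 16" "dist (\<sigma> 1) w < e0"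
  by (rule long_loop[OF xw e0(1), of "n1 + 2"])
 have M: "2 <= M" "0 < M" using \<sigma>(1) by auto
 have MM: "2 * \<alpha> / real (M - 1) < e0"
 proof -
  have "real n1 < real (M - 1)" using \<sigma>(1) by simp
  hence "2 * \<alpha> / e0 < real (M - 1)" using n1 by linarith
  thus ?thesis using e0(1) M by (simp add: field_simps)
 qed
 define \<delta> where "\<delta> = dist (\<sigma> 0) (\<sigma> 1)"
 define y where "y = \<sigma> 1"
 have \<delta>: "\<alpha> - e0 <= \<delta>" "\<delta> <= \<alpha> + e0" "dist x y = \<delta>"
  using \<sigma>(3,6) w(4) dist_triangle[of x w "\<sigma> 1"] dist_triangle[of x "\<sigma> 1" w] by (auto simp: \<delta>_def y_def dist_commute)
 have \<sigma>': "dist (\<sigma> 0) (\<sigma> 1) <= r/16" "\<sigma> M = \<sigma> 0" using \<sigma> by auto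
 have x\<sigma>: "R z (\<sigma> 0)" "xk ----> \<sigma> 0" using x \<sigma> by auto
 define b where "b = (%k. near_chain M \<sigma> (xk k) (xk k))"
 obtain t where t: "R t y" "\<exists>\<^sub>F k in sequentially. R t (b k 1)"
  using related_loop_points[OF \<sigma>(2,5) M(2) \<sigma>'(2) _ x\<sigma>(1) x(3) x\<sigma>(2), of 1] M unfolding b_def y_def by auto
 have "infinite {k. R t (b k 1)}" using t(2) by (simp add: frequently_cofinite cofinite_eq_sequentially[symmetric])
 hence inf: "infinite {k. R t (b k 1)}" .
 define f where "f = enumerate {k. R t (b k 1)}"
 have fm: "strict_mono f" unfolding f_def by (rule strict_mono_enumerate[OF inf])
 have fR: "R t (b (f k) 1)" for k using enumerate_in_set[OF inf, of k] unfolding f_def[symmetric] by (rule CollectD)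
 note f = fm fR
 note sub = eventually_subseq[OF f(1)]
 have r8: "0 < r/8" using r_pos by simp
 have near: "\<forall>\<^sub>F k in sequentially. dist x (xk k) <= r / 8" using tendstoD[OF x(5) r8] by eventually_elim (simp add: dist_commute)
 have byk: "dist (b k 1) y <= dist x (xk k)" if "dist x (xk k) <= r/8" for k
 proof -
  have "dist (near_chain M \<sigma> (xk k) (xk k) 1) (near_chain M \<sigma> x x 1) <= dist (xk k) x"
   by (rule loop_step_lipschitz(2)[OF \<sigma>(2) \<sigma>'(1) M(2) \<sigma>'(2)]) (use that \<sigma>(3) M r_pos in auto)
  thus ?thesis using near_chain_self[OF \<sigma>(2) \<sigma>'(1) M(2), of 1] M \<sigma>(3,4) by (simp add: b_def y_def dist_commute)
 qed
 have ylim: "(%k. b (f k) 1) ----> y"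
 proof (rule metric_tendsto_imp_tendsto)
  show "(%k. xk (f k)) ----> x" using LIMSEQ_subseq_LIMSEQ[OF x(5) f(1)] by (simp add: o_def)
  show "\<forall>\<^sub>F k in sequentially. dist (b (f k) 1) y <= dist (xk (f k)) x"
   using sub[OF near] by eventually_elim (use byk in "auto simp: dist_commute")
 qed
 have a16: "dist (a 0) (a 1) <= r/16" using a(2) r_pos by simp
 have self: "loop_step N a x = dist (a 0) (a 1)" "loop_step M \<sigma> x = \<delta>" unfolding loop_step_def \<delta>_def
  using near_chain_self[OF a(1) a16 a(3), of 0] near_chain_self[OF a(1) a16 a(3), of 1] a(3,4) x(1)
   near_chain_self[OF \<sigma>(2) \<sigma>'(1) M(2), of 0] near_chain_self[OF \<sigma>(2) \<sigma>'(1) M(2), of 1] M \<sigma>(3,4) by simp_all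
 have ys: "dist (a 0) y < r/8" using \<delta> x(1) \<alpha> e0 r_pos by simp
 have ls: "loop_step N a y < r/16"
 proof -
  have "\<bar>loop_step N a x - loop_step N a y\<bar> <= 2 * dist x y"
   by (rule loop_step_lipschitz(1)[OF a(1) a16 a(3,4)]) (use ys x(1) r_pos in auto)
  thus ?thesis using self(1) a(2) \<delta> \<alpha> e0 r_pos by simp
 qed
 have c1: "\<forall>\<^sub>F k in sequentially. loop_step N a (b (f k) 1) = loop_step N a y"
  by (rule loop_step_eventually_constant[OF a(1) a16 a(3,4) ys ls t(1) f(2) ylim])
 have c2: "\<forall>\<^sub>F k in sequentially. loop_step M \<sigma> (xk (f k)) = \<delta>"
  using sub[OF loop_step_eventually_constant[OF \<sigma>(2) \<sigma>'(1) M(2) \<sigma>'(2) _ _ x\<sigma>(1) x(3) x\<sigma>(2)]]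
   \<sigma>(5) self(2) \<sigma>(3) r_pos by (simp add: \<delta>_def)
 have c3: "\<forall>\<^sub>F k in sequentially. dist (wk (f k)) w < e0" using sub[OF tendstoD[OF w(3) e0(1)]] .
 have c4: "\<forall>\<^sub>F k in sequentially. dist x (xk (f k)) < e0" using sub[OF tendstoD[OF x(5) e0(1)]] by (simp add: dist_commute)
 obtain k where k: "loop_step N a (b (f k) 1) = loop_step N a y" "loop_step M \<sigma> (xk (f k)) = \<delta>"
  "dist (wk (f k)) w < e0" "dist x (xk (f k)) < e0"
  using eventually_happens[OF eventually_conj[OF eventually_conj[OF c1 c2] eventually_conj[OF c3 c4]]] by auto
 define p where "p = xk (f k)"
 define y' where "y' = b (f k) 1"
 define \<epsilon> where "\<epsilon> = dist x p"
 have \<epsilon>: "0 < \<epsilon>" "\<epsilon> < e0" using k(4) x(4)[of "f k"] by (auto simp: \<epsilon>_def p_def)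
 have p8: "dist (\<sigma> 0) p <= r/8" "dist (\<sigma> M) p <= r/8" using \<epsilon> e0 \<alpha> r_pos \<sigma>(3,4) by (auto simp: \<epsilon>_def)
 note nb = near_chain[OF \<sigma>(2) \<sigma>'(1) M(2) p8]
 have est: "\<delta> + \<epsilon> * (\<delta> / \<alpha> - dist (wk (f k)) y / \<alpha> - 2 / real (M - 1)) <= dist x y'"
  using advance_estimate[OF \<sigma>(2) \<sigma>'(2) \<delta>_def[symmetric] _ M(1) nb(1,2), of "wk (f k)" \<alpha>]
   k(2) w(1,2)[of "f k"] \<sigma>(3,5) \<alpha> r_pos by (simp add: \<epsilon>_def p_def y'_def b_def y_def \<delta>_def loop_step_def)
 have "dist (wk (f k)) y <= 2 * e0" using k(3) \<sigma>(6) dist_triangle[of "wk (f k)" y w] by (simp add: y_def dist_commute)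
 hence "\<alpha> - 4 * e0 <= \<delta> - dist (wk (f k)) y - q" if "q < e0" for q using \<delta>(1) that by linarith
 from this[OF MM] have "\<alpha> - 4 * e0 <= \<delta> - dist (wk (f k)) y - 2 * \<alpha> / real (M - 1)" .
 also have "\<dots> = \<alpha> * (\<delta> / \<alpha> - dist (wk (f k)) y / \<alpha> - 2 / real (M - 1))"
  using \<alpha>(1) by (simp add: right_diff_distrib)
 finally have "(\<alpha> - 4 * e0) / \<alpha> <= \<delta> / \<alpha> - dist (wk (f k)) y / \<alpha> - 2 / real (M - 1)"
  using \<alpha>(1) by (simp add: divide_le_eq mult.commute)
 hence "\<epsilon> * ((\<alpha> - 4 * e0) / \<alpha>) <= \<epsilon> * (\<delta> / \<alpha> - dist (wk (f k)) y / \<alpha> - 2 / real (M - 1))"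
  using \<epsilon>(1) by (intro mult_left_mono) auto
 with est have est2: "\<delta> + \<epsilon> * ((\<alpha> - 4 * e0) / \<alpha>) <= dist x y'" by linarith
 define d where "d = dist y y'"
 have pos: "0 < (\<alpha> - 4 * e0) / \<alpha>" using \<alpha>(1) e0 by simp
 hence "\<delta> < dist x y'" using est2 \<epsilon>(1) by (smt (verit) mult_pos_pos)
 hence yy: "y ~= y'" using \<delta>(3) by auto
 hence d0: "0 < d" by (simp add: d_def)
 have d\<epsilon>: "d <= \<epsilon>" using byk[of "f k"] p8 \<sigma>(3) by (simp add: d_def y'_def \<epsilon>_def p_def dist_commute)
 have d\<alpha>: "d < \<alpha>" using d\<epsilon> \<epsilon>(2) e0 \<alpha>(1) by linarith
 \<comment> \<open>\<open>v\<close> prolongs the short segment from \<open>y\<close> to the related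
   point \<open>y'\<close>, and \<open>u\<close> lies opposite to \<open>v\<close>. Since
   \<open>y'\<close> is almost radially beyond \<open>y\<close> as seen from \<open>x\<close>, so is
   \<open>v\<close>.\<close>
 obtain v where v: "dist y' v = \<alpha> - d" "dist y v = \<alpha>"
  using extension_exists[OF yy, of "\<alpha> - d"] d\<alpha> d0 \<alpha> r_pos unfolding d_def by auto
 have vy: "v ~= y" using v \<alpha>(1) by auto
 obtain u where u: "dist y u = \<alpha>" "dist v u = 2 * \<alpha>"
  using extension_exists[OF vy, of \<alpha>] v \<alpha> r_pos by (auto simp: dist_commute)
 have uy': "dist u y + dist y y' = dist u y'" using dist_triangle[of u y' y] dist_triangle[of v u y'] u v by (simp add: d_def dist_commute)
 have xu: "dist x u <= r/16" "dist x y <= r/16" using dist_triangle[of x u y] \<delta> u \<alpha> e0 r_pos by linarith+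
 have le: "loop_step N a y <= loop_step N a u"
 proof (rule loop_step_extension[OF a(1) a16 a(3,4) _ _ _ uy' _ yy])
  show "loop_step N a y' = loop_step N a y" using k(1) by (simp add: y'_def)
  show "dist (a 0) y' <= r/8" using dist_triangle[of x y' y] d\<alpha> \<delta> \<alpha> e0 x(1) r_pos by (simp add: d_def)
 qed (use xu x(1) ys u \<alpha>(1) r_pos in auto)
 \<comment> \<open>Convexity of the distance from \<open>x\<close> along the segment from
   \<open>y\<close> to \<open>v\<close> extends the rate of advance observed at \<open>y'\<close> up
   to \<open>v\<close>.\<close>
 have "dist x y' <= (1 - d / \<alpha>) * dist x y + d / \<alpha> * dist x v"
 proof -
  have f1: "frac_point (d / \<alpha>) y v y'" using v \<alpha>(1) by (simp add: frac_point_def d_def[symmetric] left_diff_distrib)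
  have f2: "frac_point (d / \<alpha>) x x x" by (simp add: frac_point_def)
  have "dist y' x <= (1 - d / \<alpha>) * dist y x + d / \<alpha> * dist v x" by (rule convexity[OF _ _ _ _ _ f1 f2])
    (use v \<alpha> d0 d\<alpha> \<delta> e0 r_pos in "auto simp: dist_commute")
  thus ?thesis by (simp add: dist_commute)
 qed
 with est2 \<delta>(3) have "d / \<alpha> * \<delta> + \<epsilon> * ((\<alpha> - 4 * e0) / \<alpha>) <= d / \<alpha> * dist x v"
  by (simp add: algebra_simps)
 moreover have "d * ((\<alpha> - 4 * e0) / \<alpha>) <= \<epsilon> * ((\<alpha> - 4 * e0) / \<alpha>)"
  using pos d\<epsilon> by (intro mult_right_mono) auto
 moreover have "d / \<alpha> * (\<delta> + (\<alpha> - 4 * e0)) = d / \<alpha> * \<delta> + d * ((\<alpha> - 4 * e0) / \<alpha>)"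
  by (simp only: distrib_left) simp
 ultimately have "d / \<alpha> * (\<delta> + (\<alpha> - 4 * e0)) <= d / \<alpha> * dist x v" by linarith
 moreover have "0 < d / \<alpha>" using d0 \<alpha>(1) by simp
 ultimately have "\<delta> + (\<alpha> - 4 * e0) <= dist x v" by (simp only: mult_le_cancel_left_pos)
 hence xv: "2 * \<alpha> - e <= dist x v" using \<delta>(1) e0 by linarith
 have "dist y w < e" using \<sigma>(6) e0 e by (simp add: y_def)
 thus ?thesis by (rule that[OF _ v(2) xv u le xu])
qed

text \<open>If \<open>w\<close> is a limit direction of related points near \<open>x\<close>, then by convexity the length of each
 loop does not decrease from \<open>x\<close> towards \<open>w\<close>; the previous lemma gives the same from \<open>w\<close> back to
 \<open>x\<close>. This contradicts strict convexity for a loop that is transversal to the segment.\<close>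

lemma related_points_not_accumulating:
 fixes x :: 'x
 assumes x: "R z x" "!!k. R z (xk k)" "!!k. xk k ~= x" "xk ----> x"
 shows False
proof -
 define \<alpha> where "\<alpha> = r / 128"
 have \<alpha>: "0 < \<alpha>" "\<alpha> <= r / 128" using r_pos by (auto simp: \<alpha>_def)
 have a2: "0 < \<alpha> / 2" using \<alpha> by simp
 obtain K where K: "!!k. k \<ge> K ==> dist (xk k) x < \<alpha> / 2" using tendstoD[OF x(4) a2] unfolding eventually_sequentially by blast
 define xk' where "xk' = (%k. xk (k + K))"
 have x': "xk' k ~= x" "R z (xk' k)" "dist x (xk' k) < \<alpha> / 2" for k using x(2,3) K[of "k + K"] by (auto simp: xk'_def dist_commute)
 have xl': "xk' ----> x" unfolding xk'_def using x(4) by (rule LIMSEQ_ignore_initial_segment)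
 have "\<exists>q w. dist x q = \<alpha> / 2 & dist (xk' k) q = \<alpha> / 2 - dist x (xk' k) & dist x w = \<alpha> & dist q w = \<alpha> / 2
   & dist (xk' k) w = \<alpha> - dist x (xk' k)" for k
 proof -
  have "x ~= xk' k" using x'(1) by metis
  then obtain q where q: "dist (xk' k) q = \<alpha> / 2 - dist x (xk' k)" "dist x q = \<alpha> / 2"
   using extension_exists[of x "xk' k" "\<alpha> / 2 - dist x (xk' k)"] x'(3)[of k] \<alpha> r_pos
    zero_le_dist[of x "xk' k"] by auto
  have "x ~= q" using q \<alpha> by auto
  then obtain w where w: "dist q w = \<alpha> / 2" "dist x w = \<alpha>" using extension_exists[of x q "\<alpha> / 2"] q \<alpha> r_pos by auto
  have "dist (xk' k) w = \<alpha> - dist x (xk' k)" using q w dist_triangle[of "xk' k" w q] dist_triangle[of x w "xk' k"] by linarith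
  thus ?thesis using q w by blast
 qed
 then obtain qk wk where qw: "!!k. dist x (qk k) = \<alpha> / 2" "!!k. dist (xk' k) (qk k) = \<alpha> / 2 - dist x (xk' k)"
  "!!k. dist x (wk k) = \<alpha>" "!!k. dist (qk k) (wk k) = \<alpha> / 2"
  "!!k. dist (xk' k) (wk k) = \<alpha> - dist x (xk' k)" by metis
 have sc: "\<exists>l g. strict_mono (g :: nat => nat) & (h \<circ> g) ----> l" for h :: "nat => 'x" using compact_UNIV unfolding compact_def by auto
 obtain q g1 where g1: "strict_mono (g1 :: nat => nat)" "(qk \<circ> g1) ----> q" using sc by blast
 obtain w g2 where g2: "strict_mono (g2 :: nat => nat)" "((wk \<circ> g1) \<circ> g2) ----> w" using sc by blast
 define g where "g = g1 \<circ> g2"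
 have g: "strict_mono g" unfolding g_def using g1(1) g2(1) by (rule strict_mono_o)
 have ql: "(%k. qk (g k)) ----> q" using LIMSEQ_subseq_LIMSEQ[OF g1(2) g2(1)] by (simp add: o_def g_def)
 have wl: "(%k. wk (g k)) ----> w" using g2(2) by (simp add: o_def g_def)
 have xl: "(%k. xk' (g k)) ----> x" using LIMSEQ_subseq_LIMSEQ[OF xl' g] by (simp add: o_def)
 have xq: "dist x q = \<alpha> / 2" using tendsto_dist[OF tendsto_const[of x] ql] qw(1) by (simp add: LIMSEQ_const_iff)
 have xw: "dist x w = \<alpha>" using tendsto_dist[OF tendsto_const[of x] wl] qw(3) by (simp add: LIMSEQ_const_iff)
 have qw': "dist q w = \<alpha> / 2" using tendsto_dist[OF ql wl] qw(4) by (simp add: LIMSEQ_const_iff)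
 have xneqw: "x ~= w" using xw \<alpha> by auto
 \<comment> \<open>The loop has to leave the line through \<open>x\<close> and \<open>w\<close>;
   only then is its length strictly convex along that line.\<close>
 obtain d where d: "dist x d < r / 128" "\<not> collinear3 x w d" using noncollinear_exists[OF xneqw, of "r / 128"] xw \<alpha> r_pos by auto
 have xd: "x ~= d" using d(2) by (auto simp: collinear3_def dist_commute)
 have "\<exists>e>0. \<forall>d'. dist d' d < e --> \<not> collinear3 x w d'"
 proof -
  have "closed {d'. collinear3 x w d'}" unfolding collinear3_def by (intro closed_Collect_disj closed_Collect_eq continuous_intros)
  hence "open (- {d'. collinear3 x w d'})" by (simp add: open_Compl)
  thus ?thesis using d(2) unfolding open_dist by auto
 qed
 then obtain e1 where e1: "0 < e1" "!!d'. dist d' d < e1 ==> \<not> collinear3 x w d'" by blast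
 have xd32: "dist x d <= r / 32" "0 < min e1 (r / 128)" using d(1) r_pos e1 by auto
 obtain N a where a: "N \<ge> 1" "chain N a" "a 0 = x" "a N = x" "dist (a 0) (a 1) < r / 16" "dist (a 1) d < min e1 (r / 128)"
  by (rule long_loop[OF xd xd32, of 1])
 have a0: "0 < N" "a N = a 0" "dist (a 0) (a 1) <= r / 16" using a by auto
 have a32: "dist (a 0) (a 1) <= r / 32" using a d(1) dist_triangle[of x "a 1" d] by (simp add: dist_commute)
 let ?l = "loop_step N a"
 have self: "?l x = dist (a 0) (a 1)" unfolding loop_step_def
  using near_chain_self[OF a(2) a0(3,1), of 0] near_chain_self[OF a(2) a0(3,1), of 1] a by simp
 have lip: "\<bar>?l p - ?l p'\<bar> <= 2 * dist p p'" if "dist x p <= r/8" "dist x p' <= r/8" for p p'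
  using loop_step_lipschitz(1)[OF a(2) a0(3,1,2)] that a(3) by simp
 have cont: "(%k. ?l (h k)) ----> ?l p" if "h ----> p" "!!k. dist x (h k) <= r/8" "dist x p <= r/8" for h p
 proof (rule LIM_zero_cancel, rule Lim_null_comparison)
  show "\<forall>\<^sub>F k in sequentially. norm (?l (h k) - ?l p) <= 2 * dist (h k) p" using lip[OF that(2,3)] by simp
  show "(%k. 2 * dist (h k) p) ----> 0" using tendsto_mult_left[OF tendsto_dist[OF that(1) tendsto_const[of p]], of 2] by simp
 qed
 have up: "?l x <= ?l q"
 proof -
  have ev: "\<forall>\<^sub>F k in sequentially. ?l (xk' (g k)) = ?l x" by (rule loop_step_eventually_constant[OF a(2) a0(3,1,2) _ _ x(1) x'(2) xl])
    (use a(3,5) self r_pos in auto)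
  have "\<forall>\<^sub>F k in sequentially. ?l x <= ?l (qk (g k))" using ev
  proof eventually_elim
   case (elim k)
   have "?l (xk' (g k)) <= ?l (qk (g k))"
   proof (rule loop_step_extension[OF a(2) a0(3,1,2), of _ _ x])
    show "dist (qk (g k)) (xk' (g k)) + dist (xk' (g k)) x = dist (qk (g k)) x" using qw(1,2)[of "g k"] by (simp add: dist_commute)
    show "qk (g k) ~= xk' (g k)" using qw(1)[of "g k"] x'(3)[of "g k"] by auto
    show "xk' (g k) ~= x" by (rule x'(1))
    show "?l x = ?l (xk' (g k))" using elim by simp
   qed (use qw(1)[of "g k"] x'(3)[of "g k"] a(3) \<alpha> r_pos in auto)
   with elim show ?case by simp
  qed
  hence "\<forall>\<^sub>F k in sequentially. ?l x <= ?l (qk (g k))" .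
  moreover have "(%k. ?l (qk (g k))) ----> ?l q"
  proof (rule cont[OF ql])
   show "dist x (qk (g k)) <= r / 8" for k using qw(1)[of "g k"] \<alpha> by linarith
   show "dist x q <= r / 8" using xq \<alpha> by linarith
  qed
  ultimately show ?thesis by (intro tendsto_lowerbound[where F = sequentially]) auto
 qed
 have "\<exists>y u v. dist y w < 1 / real (Suc n) & dist y v = \<alpha> & 2 * \<alpha> - 1 / real (Suc n) <= dist x v & dist y u = \<alpha>
   & dist v u = 2 * \<alpha> & ?l y <= ?l u & dist x u <= r / 16 & dist x y <= r / 16" for n
 proof -
  have n: "0 < 1 / real (Suc n)" by simp
  show ?thesis by (rule drift_quadrilateral[OF a(2) a32 a0(1,2) a(3) x(1), of "%k. xk' (g k)" "%k. wk (g k)", OF x'(2,1) xl qw(3,5) wl xw \<alpha> n])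
    blast
 qed
 then obtain yn un vn where n: "!!n. dist (yn n) w < 1 / real (Suc n)" "!!n. dist (yn n) (vn n) = \<alpha>"
  "!!n. 2 * \<alpha> - 1 / real (Suc n) <= dist x (vn n)" "!!n. dist (yn n) (un n) = \<alpha>"
  "!!n. dist (vn n) (un n) = 2 * \<alpha>" "!!n. ?l (yn n) <= ?l (un n)" "!!n. dist x (un n) <= r / 16" "!!n. dist x (yn n) <= r / 16" by metis
 obtain v h1 where h1: "strict_mono (h1 :: nat => nat)" "(vn \<circ> h1) ----> v" using sc by blast
 obtain u h2 where h2: "strict_mono (h2 :: nat => nat)" "((un \<circ> h1) \<circ> h2) ----> u" using sc by blast
 define h where "h = h1 \<circ> h2"
 have h: "strict_mono h" unfolding h_def using h1(1) h2(1) by (rule strict_mono_o)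
 have vl: "(%k. vn (h k)) ----> v" using LIMSEQ_subseq_LIMSEQ[OF h1(2) h2(1)] by (simp add: o_def h_def)
 have ul: "(%k. un (h k)) ----> u" using h2(2) by (simp add: o_def h_def)
 have inv0: "(%n. 1 / real (Suc n)) ----> 0" using LIMSEQ_inverse_real_of_nat by (simp add: inverse_eq_divide)
 have inv: "(%k. 1 / real (Suc (h k))) ----> 0" using LIMSEQ_subseq_LIMSEQ[OF inv0 h] by (simp add: o_def)
 have yl0: "yn ----> w"
 proof (rule metric_tendsto_imp_tendsto[OF inv0])
  show "\<forall>\<^sub>F k in sequentially. dist (yn k) w <= dist (1 / real (Suc k)) 0"
   using n(1) by (intro always_eventually allI) (simp add: less_imp_le)
 qed
 have yl: "(%k. yn (h k)) ----> w" using LIMSEQ_subseq_LIMSEQ[OF yl0 h] by (simp add: o_def)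
 have wv: "dist w v = \<alpha>" using tendsto_dist[OF yl vl] n(2) by (simp add: LIMSEQ_const_iff)
 have wu: "dist w u = \<alpha>" using tendsto_dist[OF yl ul] n(4) by (simp add: LIMSEQ_const_iff)
 have vu: "dist v u = 2 * \<alpha>" using tendsto_dist[OF vl ul] n(5) by (simp add: LIMSEQ_const_iff)
 have "2 * \<alpha> - 0 <= dist x v"
 proof (rule tendsto_le[OF _ tendsto_dist[OF tendsto_const[of x] vl] tendsto_diff[OF tendsto_const[of "2 * \<alpha>"] inv]])
  show "\<forall>\<^sub>F k in sequentially. 2 * \<alpha> - 1 / real (Suc (h k)) <= dist x (vn (h k))" using n(3) by (intro always_eventually allI)
 qed simp
 hence vx: "dist v x = 2 * \<alpha>" using dist_triangle[of x v w] xw wv by (simp add: dist_commute)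
 have vneqw: "v ~= w" using wv \<alpha> by auto
 \<comment> \<open>Both \<open>u\<close> and \<open>x\<close> prolong the segment from
   \<open>v\<close> to \<open>w\<close> by \<alpha>.\<close>
 have ux: "u = x" by (rule extension_unique[OF vneqw, of \<alpha>]) (use wv wu vu vx xw \<alpha> r_pos in "auto simp: dist_commute")
 have down: "?l w <= ?l x"
 proof (rule tendsto_le[of sequentially])
  show "(%k. ?l (un (h k))) ----> ?l x"
  proof (rule cont[OF ul[unfolded ux]])
   show "dist x (un (h k)) <= r / 8" for k using n(7)[of "h k"] r_pos by simp
  qed (use r_pos in auto)
  show "(%k. ?l (yn (h k))) ----> ?l w"
  proof (rule cont[OF yl])
   show "dist x (yn (h k)) <= r / 8" for k using n(8)[of "h k"] r_pos by simp
  qed (use xw \<alpha> r_pos in auto)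
 qed (use n(6) in auto)
 have "?l q < (1 - 1/2) * ?l x + 1/2 * ?l w"
 proof (rule loop_step_convex(2)[OF a(2) a0(3,1,2)])
  show "frac_point (1/2) x w q" using xq qw' xw by (simp add: frac_point_def)
  have "near_chain N a x x 1 = a 1" using near_chain_self[OF a(2) a0(3,1), of 1] a by simp
  thus "\<not> collinear3 x w (near_chain N a x x 1)" using e1(2)[of "a 1"] a(6) by simp
 qed (use xw \<alpha> a(3) r_pos in auto)
 with up down show False by simp
qed

theorem finite_related: "finite {y. R z y}"
proof (rule ccontr)
 assume inf: "infinite {y. R z y}"
 obtain x where x: "x islimpt {y. R z y}" using Heine_Borel_imp_Bolzano_Weierstrass[OF compact_UNIV inf] by auto
 then obtain xk where xk: "!!k. xk k \<in> {y. R z y} - {x}" "xk ----> x" unfolding islimpt_sequential by blast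
 have "R z x" by (rule R_closed[OF _ xk(2)]) (use xk(1) in auto)
 thus False using related_points_not_accumulating[of z x xk] xk by auto
qed

end

section \<open>Norms and faithful functionals\<close>

lemma norm_one_le: "norm (1 :: 'a::cstar_algebra) <= 1"
proof -
 have "norm (1 :: 'a) = (norm (1 :: 'a))\<^sup>2" using cstar_identity[of "1 :: 'a"] by simp
 hence "norm (1 :: 'a) = 0 \<or> norm (1 :: 'a) = 1" by (simp add: power2_eq_square)
 thus ?thesis by auto
qed

lemma star_scaleR: "star (r *R x) = r *R star (x :: 'a::star_algebra)" by (simp add: scaleR_scaleC star_scaleC)

lemma star_diff: "star (x - y) = star x - star (y :: 'a::star_algebra)" using star_add[of x "- y"] by (simp add: star_minus)

lemma continuous_star: "continuous_on UNIV (star :: 'a::cstar_algebra => 'a)"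
proof -
 have "bounded_linear (star :: 'a => 'a)" by (rule bounded_linear_intro[of _ 1]) (auto simp: star_add star_scaleR norm_star)
 thus ?thesis by (rule linear_continuous_on)
qed

text \<open>\<open>V = x + \<i> s\<close> satisfies \<open>star V * V = t\<close>, and
  \<open>x\<close> is its real part. This replaces a spectral estimate for \<open>x\<close>.\<close>

lemma norm_sum_of_squares:
 fixes x s :: "'a::cstar_algebra"
 assumes "star x = x" "star s = s" "x * s = s * x" "x * x + s * s = t *R 1" "0 <= t"
 shows "norm x <= sqrt t"
proof -
 define V where "V = x + \<i> *\<^sub>C s"
 have sV: "star V = x + (- \<i>) *\<^sub>C s" by (simp add: V_def star_add star_scaleC assms)
 have "star V * V = x * x + s * s" unfolding sV unfolding V_def
  by (simp add: distrib_left distrib_right mult_scaleC_left mult_scaleC_right scaleC_scaleC assms(3)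
    scaleC_minus_left scaleC_diff_right algebra_simps)
 hence "(norm V)\<^sup>2 = norm (t *R (1 :: 'a))" using assms(4) cstar_identity[of V] by simp
 also have "\<dots> <= t" using norm_one_le[where 'a='a] assms(5) by (simp add: mult_left_le)
 finally have V: "norm V <= sqrt t" by (rule real_le_rsqrt)
 have "V + star V = 2 *R x" unfolding sV unfolding V_def by (simp add: scaleC_minus_left scaleR_2)
 hence "x = (1/2) *R (V + star V)" by simp
 hence "norm x <= (1/2) * (norm V + norm (star V))"
  using norm_triangle_ineq[of V "star V"] by (metis (no_types, opaque_lifting) norm_scaleR abs_of_nonneg mult_left_mono zero_le_divide_1_iff zero_le_numeral)
 thus ?thesis using V by (simp add: norm_star)
qed

text \<open>The power series of \<open>1 - \<surd>(1 - z)\<close> has nonnegative coefficients with sum \<open>1\<close>; the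
 iteration below is dominated by the same iteration for the number \<open>1\<close>.\<close>

lemma sqrt_one_minus_exists:
 fixes z :: "'a::cstar_algebra"
 assumes "norm z <= 1" "star z = z"
 obtains w where "norm w <= 1" "star w = w" "(1 - w) * (1 - w) = 1 - z" "!!u. u * z = z * u ==> u * w = w * u"
proof -
 \<comment> \<open>A fixed point of this iteration satisfies \<open>2 w = z + w * w\<close>, that is
   \<open>(1 - w) * (1 - w) = 1 - z\<close>. The iterates are polynomials in \<open>z\<close>, so
   whatever commutes with \<open>z\<close> commutes with the limit.\<close>
 define W where "W = rec_nat (0 :: 'a) (%_ w. (1/2) *R (z + w * w))"
 define \<omega> where "\<omega> = rec_nat (0 :: real) (%_ w. (1 + w * w) / 2)"
 have W: "W 0 = 0" "W (Suc n) = (1/2) *R (z + W n * W n)" for n by (simp_all add: W_def)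
 have \<omega>: "\<omega> 0 = 0" "\<omega> (Suc n) = (1 + \<omega> n * \<omega> n) / 2" for n by (simp_all add: \<omega>_def)
 have \<omega>01: "0 <= \<omega> n & \<omega> n <= 1" for n
 proof (induction n)
  case (Suc n)
  hence "\<omega> n * \<omega> n <= 1" by (meson mult_le_one)
  thus ?case by (simp add: \<omega>)
 qed (simp add: \<omega>)
 have bd: "norm (W n) <= \<omega> n" for n
 proof (induction n)
  case (Suc n)
  have "norm (W n * W n) <= \<omega> n * \<omega> n" using norm_mult_ineq[of "W n" "W n"] mult_mono[OF Suc Suc] \<omega>01[of n] by fastforce
  thus ?case using norm_triangle_ineq[of z "W n * W n"] assms(1) by (simp add: W \<omega>)
 qed (simp add: W \<omega>)
 have step: "norm (W (Suc n) - W n) <= \<omega> (Suc n) - \<omega> n" for n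
 proof (induction n)
  case 0
  show ?case using assms(1) by (simp add: W \<omega>)
 next case (Suc n)
  have "W (Suc (Suc n)) - W (Suc n) = (1/2) *R (z + W (Suc n) * W (Suc n)) - (1/2) *R (z + W n * W n)"
   by (rule arg_cong2[where f = minus, OF W(2) W(2)])
  also have "\<dots> = (1/2) *R (W (Suc n) * (W (Suc n) - W n) + (W (Suc n) - W n) * W n)" by (simp add: algebra_simps)
  finally have "W (Suc (Suc n)) - W (Suc n) = (1/2) *R (W (Suc n) * (W (Suc n) - W n) + (W (Suc n) - W n) * W n)" .
  hence "norm (W (Suc (Suc n)) - W (Suc n)) <= (1/2) * (norm (W (Suc n) * (W (Suc n) - W n)) + norm ((W (Suc n) - W n) * W n))"
   by (simp add: norm_triangle_ineq)
  also have "\<dots> <= (1/2) * (\<omega> (Suc n) * (\<omega> (Suc n) - \<omega> n) + (\<omega> (Suc n) - \<omega> n) * \<omega> n)"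
   using norm_mult_ineq[of "W (Suc n)" "W (Suc n) - W n"] mult_mono[OF bd[of "Suc n"] Suc]
    norm_mult_ineq[of "W (Suc n) - W n" "W n"] mult_mono[OF Suc bd[of n]] \<omega>01[of n] \<omega>01[of "Suc n"]
    order_trans[OF norm_ge_zero Suc] by fastforce
  also have "\<dots> = (1 + \<omega> (Suc n) * \<omega> (Suc n)) / 2 - (1 + \<omega> n * \<omega> n) / 2" by (simp add: algebra_simps)
  also have "\<dots> = \<omega> (Suc (Suc n)) - \<omega> (Suc n)"
   by (rule arg_cong2[where f = minus, OF \<omega>(2)[symmetric] \<omega>(2)[symmetric]])
  finally show ?case .
 qed
 have mono: "\<omega> n <= \<omega> (Suc n)" for n using order_trans[OF norm_ge_zero step[of n]] by simp
 hence "incseq \<omega>" by (rule incseq_SucI)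
 hence "convergent \<omega>" using \<omega>01 by (intro Bseq_monoseq_convergent) (auto simp: Bseq_def intro!: exI[of _ 1] incseq_imp_monoseq)
 hence C\<omega>: "Cauchy \<omega>" by (simp add: convergent_Cauchy)
 have diff: "norm (W m - W n) <= \<omega> m - \<omega> n" if "n <= m" for m n using that
 proof (induction m rule: dec_induct)
  case (step m)
  thus ?case using \<open>!!n. norm (W (Suc n) - W n) <= \<omega> (Suc n) - \<omega> n\<close>[of m] norm_triangle_ineq[of "W (Suc m) - W m" "W m - W n"] by simp
 qed simp
 have "Cauchy W"
 proof (rule CauchyI)
  fix e :: real assume "e > 0"
  then obtain M where M: "!!m n. m \<ge> M ==> n \<ge> M ==> norm (\<omega> m - \<omega> n) < e" using CauchyD[OF C\<omega>] by blast
  have "norm (W m - W n) < e" if "m \<ge> M" "n \<ge> M" for m n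
  proof (cases "n <= m")
   case True
   thus ?thesis using diff[OF True] M[OF that] by simp
  next case False
   thus ?thesis using diff[of m n] M[OF that(2,1)] by (simp add: norm_minus_commute)
  qed
  thus "\<exists>M. \<forall>m\<ge>M. \<forall>n\<ge>M. norm (W m - W n) < e" by blast
 qed
 then obtain w where w: "W ----> w" using Cauchy_convergent_iff convergent_def by blast
 have closed_lim: "w \<in> S" if "closed S" "!!n. W n \<in> S" for S using that w by (metis closed_sequentially)
 have wW: "w = (1/2) *R (z + w * w)"
 proof -
  have "(%n. W (Suc n)) ----> (1/2) *R (z + w * w)" unfolding W by (intro tendsto_intros w)
  moreover have "(%n. W (Suc n)) ----> w" using w by (rule LIMSEQ_Suc)
  ultimately show ?thesis by (rule LIMSEQ_unique[symmetric])
 qed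
 show ?thesis
 proof
  have "norm (W n) <= 1" for n using bd[of n] \<omega>01[of n] by linarith
  thus "norm w <= 1" using closed_lim[of "cball 0 1"] by simp
  have "star (W n) = W n" for n by (induction n) (simp_all add: W star_scaleR star_add star_mult assms)
  moreover have "closed {u :: 'a. star u = u}" by (intro closed_Collect_eq continuous_star continuous_on_id)
  ultimately show "star w = w" using closed_lim[of "{u. star u = u}"] by simp
  have "2 *R w = z + w * w" using arg_cong[OF wW, of "%u. 2 *R u"] by simp
  thus "(1 - w) * (1 - w) = 1 - z" by (simp add: algebra_simps scaleR_2)
  fix u assume u: "u * z = z * u"
  have "u * W n = W n * u" for n
  proof (induction n)
   case (Suc n)
   have "u * (W n * W n) = (W n * u) * W n" by (simp only: Suc mult.assoc[symmetric])
   also have "\<dots> = (W n * W n) * u" by (simp only: Suc mult.assoc)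
   finally show ?case by (simp add: W distrib_left distrib_right u)
  qed (simp add: W)
  moreover have "closed {v. u * v = v * u}" by (intro closed_Collect_eq continuous_intros)
  ultimately show "u * w = w * u" using closed_lim[of "{v. u * v = v * u}"] by simp
 qed
qed

text \<open>With \<open>1 - x * x = (1 - w) * (1 - w)\<close>, the squares of \<open>1 - w\<close>
  and of \<open>x\<close> add up to \<open>1\<close>.\<close>

lemma norm_one_minus_square:
 fixes x :: "'a::cstar_algebra"
 assumes "norm x <= 1" "star x = x"
 shows "norm (1 - x * x) <= 1"
proof -
 have "norm (x * x) <= 1" using norm_mult_ineq[of x x] mult_le_one[OF assms(1) norm_ge_zero assms(1)] by linarith
 then obtain w where w: "star w = w" "(1 - w) * (1 - w) = 1 - x * x" "!!u. u * (x * x) = (x * x) * u ==> u * w = w * u"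
  using sqrt_one_minus_exists[of "x * x"] by (metis star_mult assms(2))
 have "norm (1 - w) <= sqrt 1"
 proof (rule norm_sum_of_squares[where s = x])
  show "(1 - w) * (1 - w) + x * x = 1 *R 1" by (simp add: w(2))
  show "(1 - w) * x = x * (1 - w)" using w(3)[of x] by (simp add: algebra_simps mult.assoc)
 qed (auto simp: star_diff w(1) assms)
 hence "norm (1 - w) <= 1" by simp
 hence "norm ((1 - w) * (1 - w)) <= 1" using norm_mult_ineq[of "1 - w" "1 - w"] mult_le_one[OF _ norm_ge_zero, of "norm (1 - w)" "1 - w"] by linarith
 thus ?thesis by (simp add: w(2))
qed

text \<open>\<open>m\<close> is the absolute value of \<open>x\<close> and \<open>n\<close> the
  square root of \<open>m\<close>: \<open>sqrt_one_minus_exists\<close> is applied to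
  \<open>1 - x * x\<close> and then to the result.\<close>

lemma abs_and_root_exist:
 fixes x :: "'a::cstar_algebra"
 assumes "norm x <= 1" "star x = x"
 obtains m n where "star n = n" "m = n * n" "m * m = x * x" "!!u. u * x = x * u ==> u * n = n * u"
proof -
 have sx: "star (1 - x * x) = 1 - x * x" by (simp add: star_diff star_mult assms)
 obtain w where w: "norm w <= 1" "star w = w" "(1 - w) * (1 - w) = 1 - (1 - x * x)" "!!u. u * (1 - x * x) = (1 - x * x) * u ==> u * w = w * u"
  by (rule sqrt_one_minus_exists[OF norm_one_minus_square[OF assms] sx]) blast
 obtain v where v: "star v = v" "(1 - v) * (1 - v) = 1 - w" "!!u. u * w = w * u ==> u * v = v * u" by (rule sqrt_one_minus_exists[OF w(1,2)]) blast
 show ?thesis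
 proof (rule that[of "1 - v" "1 - w"])
  fix u assume "u * x = x * u"
  hence "u * (x * x) = (x * x) * u" by (metis mult.assoc)
  hence "u * (1 - x * x) = (1 - x * x) * u" by (simp add: algebra_simps)
  hence "u * v = v * u" using w(4) v(3) by blast
  thus "u * (1 - v) = (1 - v) * u" by (simp add: algebra_simps)
 qed (use v w in "auto simp: star_diff")
qed

text \<open>If the operator norm of \<open>a\<close> in the GNS representation were smaller than \<open>norm a\<close>, then the
 positive part \<open>k\<close> of \<open>(a\<^sup>*a)\<^sup>2 - t\<close>, for suitable \<open>t\<close>, would be a nonzero element in the null
 space of \<open>h\<close>.\<close>

lemma norm_le_of_faithful:
 fixes a :: "'a::cstar_algebra"
 assumes h: "positive_functional h" and faithful: "!!x. h (star x * x) = 0 ==> x = 0"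
  and bound: "!!b. functional_seminorm h (a * b) <= R * functional_seminorm h b" and "0 <= R"
 shows "norm a <= R"
proof (rule ccontr)
 assume "\<not> norm a <= R"
 hence aR: "R < norm a" by simp
 with \<open>0 <= R\<close> have na: "0 < norm a" by linarith
 let ?N = "functional_seminorm h"
 note cl = pos_fun_clinear[OF h]
 define e where "e = (1 / (norm a)\<^sup>2) *R (star a * a)"
 define \<rho> where "\<rho> = R\<^sup>2 / (norm a)\<^sup>2"
 have "R\<^sup>2 < (norm a)\<^sup>2" using aR \<open>0 <= R\<close> by (intro power_strict_mono) auto
 hence \<rho>: "0 <= \<rho>" "\<rho> < 1" using na by (auto simp: \<rho>_def)
 have ne: "norm e = 1" using na by (simp add: e_def cstar_identity)
 have se: "star e = e" by (simp add: e_def star_scaleR star_mult)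
 have Nn: "0 <= ?N b" for b by (rule functional_seminorm_nonneg[OF h])
 have scR: "?N (c *R b) = \<bar>c\<bar> * ?N b" for c b unfolding scaleR_scaleC by (simp add: functional_seminorm_scaleC[OF h])
 have Ne: "?N (e * b) <= \<rho> * ?N b" for b
 proof -
  let ?f = "star a * a"
  have "(?N (?f * b))\<^sup>2 = cmod (h (star (?f * b) * (?f * b)))" by (simp add: functional_seminorm_sq[OF h] norm_power)
  also have "star (?f * b) * (?f * b) = star (a * (?f * b)) * (a * b)" by (simp add: star_mult mult.assoc)
  also have "cmod (h \<dots>) <= ?N (a * (?f * b)) * ?N (a * b)" by (rule positive_functional_Cauchy_Schwarz[OF h])
  also have "\<dots> <= (R * ?N (?f * b)) * (R * ?N b)" using \<open>0 <= R\<close> by (intro mult_mono bound) (auto simp: Nn)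
  finally have "?N (?f * b) * ?N (?f * b) <= R\<^sup>2 * ?N b * ?N (?f * b)" by (simp add: power2_eq_square mult_ac)
  hence "?N (?f * b) <= R\<^sup>2 * ?N b" using Nn[of "?f * b"] Nn[of b] by (cases "?N (?f * b) = 0") auto
  hence "1 / (norm a)\<^sup>2 * ?N (?f * b) <= 1 / (norm a)\<^sup>2 * (R\<^sup>2 * ?N b)" by (intro mult_left_mono) auto
  thus ?thesis by (simp add: e_def \<rho>_def scR)
 qed
 \<comment> \<open>Any \<open>t\<close> strictly between \<open>\<rho>\<^sup>2\<close> and
   \<open>1\<close> would do: it separates the bound \<rho> on \<open>e\<close> in the GNS
   representation from \<open>norm e = 1\<close>.\<close>
 define t where "t = (1 + \<rho>\<^sup>2) / 2"
 have \<rho>2: "\<rho>\<^sup>2 < 1" using \<rho> by (simp add: power_less_one_iff abs_square_less_1)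
 hence t: "\<rho>\<^sup>2 < t" "t < 1" "0 <= t" by (auto simp: t_def)
 define x where "x = (1/2) *R (e * e - t *R 1)"
 have "norm (e * e) <= 1" using norm_mult_ineq[of e e] ne by simp
 moreover have "norm (t *R (1 :: 'a)) <= 1" using t norm_one_le[where 'a='a] by (simp add: mult_le_one)
 ultimately have nx: "norm x <= 1" using norm_triangle_ineq4[of "e * e" "t *R 1"] by (simp add: x_def)
 have sx: "star x = x" by (simp add: x_def star_scaleR star_diff star_mult se)
 obtain m n where mn: "star n = n" "m = n * n" "m * m = x * x" "!!u. u * x = x * u ==> u * n = n * u" using abs_and_root_exist[OF nx sx] by blast
 have xn: "x * n = n * x" using mn(4) by simp
 hence xm: "x * m = m * x" unfolding mn(2) by (metis mult.assoc)
 \<comment> \<open>Twice the positive part of \<open>x\<close>. On its range \<open>e * e\<close> is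
   at least \<open>t\<close>, which exceeds \<open>\<rho>\<^sup>2\<close>, so the bound
   \<open>Ne\<close> forces it to be null.\<close>
 define k where "k = m + x"
 have sk: "star k = k" by (simp add: k_def star_add sx mn(1,2) star_mult)
 have xk: "2 *R (x * k) = k * k" and mk: "2 *R (m * k) = k * k" by (simp_all add: k_def distrib_left distrib_right mn(3) xm scaleR_2)
 have "h (star (e * k) * (e * k)) = h (t *R (k * k) + 2 *R (star (n * k) * (n * k)))"
 proof -
  have ee: "e * e = t *R 1 + 2 *R x" by (simp add: x_def)
  have "star (e * k) * (e * k) = k * (e * e) * k" by (simp add: star_mult sk se mult.assoc)
  also have "\<dots> = t *R (k * k) + k * (2 *R (x * k))" unfolding ee by (simp add: distrib_left distrib_right mult.assoc)
  also have "k * (2 *R (x * k)) = 2 *R (k * (m * k))" unfolding xk mk[symmetric] by simp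
  also have "k * (m * k) = star (n * k) * (n * k)" by (simp add: star_mult sk mn(1,2) mult.assoc)
  finally show ?thesis by simp
 qed
 also have "\<dots> = t * h (star k * k) + 2 * h (star (n * k) * (n * k))" by (simp add: clinear_add[OF cl] clinear_scaleC[OF cl] scaleR_scaleC sk)
 finally have "complex_of_real ((?N (e * k))\<^sup>2) = of_real (t * (?N k)\<^sup>2 + 2 * (?N (n * k))\<^sup>2)"
  by (simp add: functional_seminorm_sq[OF h])
 hence "(?N (e * k))\<^sup>2 = t * (?N k)\<^sup>2 + 2 * (?N (n * k))\<^sup>2" by (simp only: of_real_eq_iff)
 moreover have "(?N (e * k))\<^sup>2 <= (\<rho> * ?N k)\<^sup>2" using Ne[of k] Nn by (intro power_mono) auto
 ultimately have "t * (?N k)\<^sup>2 <= \<rho>\<^sup>2 * (?N k)\<^sup>2" by (simp add: power_mult_distrib) (smt (verit) zero_le_power2)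
 hence "(t - \<rho>\<^sup>2) * (?N k)\<^sup>2 <= 0" by (simp add: algebra_simps)
 hence "(?N k)\<^sup>2 = 0" using t(1) by (simp add: mult_le_0_iff)
 hence "h (star k * k) = 0" by (simp add: functional_seminorm_sq[OF h])
 hence "k = 0" by (rule faithful)
 hence mx: "x = - m" by (simp add: k_def eq_neg_iff_add_eq_0 add.commute)
 have "norm e <= sqrt t"
 proof (rule norm_sum_of_squares[where s = "sqrt 2 *R n"])
  have "e * e - t *R 1 = 2 *R x" by (simp add: x_def)
  thus "e * e + (sqrt 2 *R n) * (sqrt 2 *R n) = t *R 1" unfolding mx mn(2) by (simp add: algebra_simps)
  have "e * x = x * e" by (simp add: x_def algebra_simps mult.assoc)
  thus "e * (sqrt 2 *R n) = (sqrt 2 *R n) * e" using mn(4) by simp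
 qed (auto simp: se mn(1) star_scaleR t)
 also have "\<dots> < 1" using t by simp
 finally show False using ne by simp
qed

section \<open>Slices of the tensor product along characters\<close>

lemma to_completion_mult: "to_completion (x * y) = to_completion x * to_completion y" by transfer (rule seminorm_rel_refl, rule seminorm_Cauchy_const)

lemma to_completion_scaleC: "to_completion (c *\<^sub>C x) = c *\<^sub>C to_completion x"
 by transfer (rule seminorm_rel_refl, rule seminorm_Cauchy_const)

lemma to_completion_star: "to_completion (star x) = star (to_completion x)" by transfer (rule seminorm_rel_refl, rule seminorm_Cauchy_const)

lemma to_completion_one: "to_completion 1 = 1" by transfer (rule seminorm_rel_refl, rule seminorm_Cauchy_const)

lemma closure_range_to_completion: "closure (range to_completion) = UNIV"
proof -
 have "x \<in> closure (range to_completion)" for x :: "'a::cstar_seminormed_algebra cstar_completion" unfolding closure_approachable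
 proof (intro allI impI)
  fix e :: real assume "e > 0"
  then obtain a where "norm (x - to_completion a) < e" using to_completion_dense by blast
  thus "\<exists>y\<in>range to_completion. dist y x < e" by (intro bexI[of _ "to_completion a"]) (auto simp: dist_norm norm_minus_commute)
 qed
 thus ?thesis by blast
qed

lemma continuous_scaleC: "continuous_on UNIV (%x. c *\<^sub>C (x :: 'a::cstar_algebra))"
proof -
 have "bounded_linear (%x. c *\<^sub>C (x :: 'a))" by (rule bounded_linear_intro[of _ "cmod c"])
   (auto simp: scaleC_add_right scaleR_scaleC scaleC_scaleC norm_scaleC mult.commute)
 thus ?thesis by (rule linear_continuous_on)
qed

lemma cstar_hom_completion_extension:
 fixes S :: "'b::cstar_seminormed_algebra => 'a::cstar_algebra"
 assumes add: "!!s t. S (s + t) = S s + S t" and scale: "!!c t. S (c *\<^sub>C t) = c *\<^sub>C S t"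
  and mult: "!!s t. S (s * t) = S s * S t" and star: "!!t. S (star t) = star (S t)" and one: "S 1 = 1"
  and bound: "!!t. norm (S t) <= cstar_seminorm t"
 obtains T where "cstar_hom T" "bounded_linear T" "!!t. T (to_completion t) = S t"
proof -
 let ?X = "range to_completion :: 'b cstar_completion set"
 have diff: "S (s - t) = S s - S t" for s t
 proof -
  have "S (s - t) = S (s + (-1) *\<^sub>C t)" by simp
  also have "\<dots> = S s - S t" unfolding add scale by simp
  finally show ?thesis .
 qed
 have lip: "dist (S s) (S t) <= dist (to_completion s) (to_completion t)" for s t
  using bound[of "s - t"] by (simp add: dist_norm diff to_completion_diff[symmetric] norm_to_completion)
 define F where "F = (%u. S (SOME t. to_completion t = u))"
 have F: "F (to_completion t) = S t" for t
 proof -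
  have "to_completion (SOME s. to_completion s = to_completion t) = to_completion t" by (rule someI) simp
  thus ?thesis using lip[of "SOME s. to_completion s = to_completion t" t] by (simp add: F_def)
 qed
 have "uniformly_continuous_on ?X F" unfolding uniformly_continuous_on_def
 proof (intro allI impI)
  fix e :: real assume "e > 0"
  thus "\<exists>d>0. \<forall>x\<in>?X. \<forall>x'\<in>?X. dist x' x < d --> dist (F x') (F x) < e"
   using lip by (intro exI[of _ e]) (auto simp: F intro: le_less_trans)
 qed
 then obtain T where uT: "uniformly_continuous_on (closure ?X) T" and TF: "!!u. u \<in> ?X ==> F u = T u"
  by (rule uniformly_continuous_on_extension_on_closure) blast
 have cT: "continuous_on UNIV T" using uniformly_continuous_imp_continuous[OF uT] by (simp add: closure_range_to_completion)
 have T: "T (to_completion t) = S t" for t using TF[of "to_completion t"] F by simp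
 have cont: "continuous_on UNIV (%u. T (g u))" if "continuous_on UNIV g" for g :: "'b cstar_completion => 'b cstar_completion"
  using continuous_on_compose2[OF cT that] by simp
 have ext: "P u" if "closed {u. P u}" "!!t. P (to_completion t)" for P :: "'b cstar_completion => bool" and u
 proof -
  have "closure ?X \<subseteq> {u. P u}" using that by (intro closure_minimal) auto
  thus ?thesis by (auto simp: closure_range_to_completion)
 qed
 have Tadd: "T (u + v) = T u + T v" for u v
 proof -
  have "T (to_completion s + v) = T (to_completion s) + T v" for s by (rule ext[of "%v. T (to_completion s + v) = T (to_completion s) + T v"])
    (intro closed_Collect_eq continuous_intros cont cT, simp add: to_completion_add[symmetric] T add)
  note 1 = this
  show ?thesis by (rule ext[of "%u. T (u + v) = T u + T v", OF _ 1]) (intro closed_Collect_eq continuous_intros cont cT)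
 qed
 have Tmult: "T (u * v) = T u * T v" for u v
 proof -
  have "T (to_completion s * v) = T (to_completion s) * T v" for s by (rule ext[of "%v. T (to_completion s * v) = T (to_completion s) * T v"])
    (intro closed_Collect_eq continuous_intros cont cT, simp add: to_completion_mult[symmetric] T mult)
  note 1 = this
  show ?thesis by (rule ext[of "%u. T (u * v) = T u * T v", OF _ 1]) (intro closed_Collect_eq continuous_intros cont cT)
 qed
 have Tscale: "T (c *\<^sub>C u) = c *\<^sub>C T u" for c u by (rule ext[of "%u. T (c *\<^sub>C u) = c *\<^sub>C T u"])
   (intro closed_Collect_eq cont continuous_scaleC continuous_on_compose2[OF continuous_scaleC cT] subset_UNIV,
    simp add: to_completion_scaleC[symmetric] T scale)
 have Tstar: "T (star u) = star (T u)" for u by (rule ext[of "%u. T (star u) = star (T u)"])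
   (intro closed_Collect_eq cont continuous_star continuous_on_compose2[OF continuous_star cT] subset_UNIV,
    simp add: to_completion_star[symmetric] T star)
 have Tnorm: "norm (T u) <= norm u" for u by (rule ext[of "%u. norm (T u) <= norm u"])
   (intro closed_Collect_le continuous_intros cT, simp add: T norm_to_completion bound)
 show ?thesis
 proof (rule that)
  show "cstar_hom T" using T[of 1] by (simp add: cstar_hom_def clinear_def Tadd Tscale Tmult Tstar to_completion_one one)
  show "bounded_linear T" by (rule bounded_linear_intro[of _ 1]) (auto simp: Tadd scaleR_scaleC Tscale Tnorm)
 qed (rule T)
qed

lemma alg_tensor_eval_pure: "cbilinear \<beta> ==> alg_tensor_eval \<beta> (pure_tensor a b) = \<beta> a b" by transfer simp

text \<open>For a character \<mu> the slice \<open>S\<close> is a homomorphism on the algebraic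
  tensor product with \<open>\<mu> \<otimes> h = h \<circ> S\<close>. Hence multiplication by
  \<open>S t\<close> in the GNS space of \<open>h\<close> is bounded by the spatial seminorm of
  \<open>t\<close>, and \<open>norm_le_of_faithful\<close> turns this into a norm bound. In
  particular the slice exists on the completion.\<close>

lemma character_slice:
 fixes \<mu> :: "'b::cstar_algebra => complex" and h :: "'a::cstar_algebra => complex"
 assumes \<mu>: "state \<mu>" "!!f g. \<mu> (f * g) = \<mu> f * \<mu> g" and h: "state h" "faithful_state h"
 shows "cstar_hom (slice_left \<mu> :: ('b, 'a) min_tensor => 'a)" and "bounded_linear (slice_left \<mu> :: ('b, 'a) min_tensor => 'a)"
  and "slice_left \<mu> (f \<otimes> a) = \<mu> f *\<^sub>C (a :: 'a)"
  and "tensor_functional \<mu> h u = h (slice_left \<mu> u)"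
proof -
 have hp: "positive_functional h" "clinear h" and mp: "positive_functional \<mu>" "clinear \<mu>"
  using h(1) \<mu>(1) by (auto simp: state_def positive_functional_def)
 have faithful: "x = 0" if "h (star x * x) = 0" for x using h(2) that by (simp add: faithful_state_def)
 have \<mu>s: "\<mu> (star f) = cnj (\<mu> f)" for f by (rule positive_functional_star[OF mp(1)])
 have \<mu>1: "\<mu> 1 = 1" using \<mu>(1) by (simp add: state_def)
 define B where "B = (%c f a. \<mu> f * h (star c * a))"
 have cB: "cbilinear (B c)" for c unfolding B_def by (rule cbilinearI)
   (auto simp: clinear_add[OF mp(2)] clinear_add[OF hp(2)] clinear_scaleC[OF mp(2)] clinear_scaleC[OF hp(2)]
    distrib_left mult_scaleC_right algebra_simps)
 have Bpure: "alg_tensor_eval (B c) (pure_tensor f a) = \<mu> f * h (star c * a)" for c f a using alg_tensor_eval_pure[OF cB] by (simp add: B_def)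
 \<comment> \<open>Evaluation on algebraic tensors is available for scalar bilinear maps only, so
   the \<open>'a\<close>-valued slice is characterised by its pairings with all \<open>c\<close>;
   faithfulness of \<open>h\<close> makes it unique.\<close>
 define Q where "Q = (%t v. \<forall>c. alg_tensor_eval (B c) t = h (star c * v))"
 have Qadd: "Q (s + t) (v + w)" if "Q s v" "Q t w" for s t v w
  using that by (simp add: Q_def clinear_add[OF clinear_alg_tensor_eval] distrib_left clinear_add[OF hp(2)])
 have Qscale: "Q (c *\<^sub>C t) (c *\<^sub>C v)" if "Q t v" for c t v
  using that by (simp add: Q_def clinear_scaleC[OF clinear_alg_tensor_eval] mult_scaleC_right clinear_scaleC[OF hp(2)])
 have Qpure: "Q (pure_tensor f a) (\<mu> f *\<^sub>C a)" for f a by (simp add: Q_def Bpure mult_scaleC_right clinear_scaleC[OF hp(2)])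
 have Q0: "Q 0 0" by (simp add: Q_def clinear_zero[OF clinear_alg_tensor_eval] clinear_zero[OF hp(2)])
 have Qex: "\<exists>v. Q t v" for t
 proof (induction t rule: alg_tensor_induct)
  case zero
  show ?case using Q0 by blast
 next case (pure_add a b x)
  thus ?case using Qadd Qpure by blast
 qed
 have Quniq: "v = w" if "Q t v" "Q t w" for t v w
 proof -
  have "h (star (v - w) * v) = h (star (v - w) * w)" using that by (simp add: Q_def)
  hence "h (star (v - w) * (v - w)) = 0" using clinear_add[OF hp(2), of "star (v - w) * v" "- (star (v - w) * w)"] clinear_minus[OF hp(2)]
   by (simp add: right_diff_distrib)
  hence "v - w = 0" by (rule faithful)
  thus ?thesis by simp
 qed
 define S where "S = (%t. SOME v. Q t v)"
 have S: "Q t (S t)" for t unfolding S_def by (rule someI_ex[OF Qex])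
 have Seq: "S t = v" if "Q t v" for t v using Quniq[OF S that] .
 have Sadd: "S (s + t) = S s + S t" for s t by (intro Seq Qadd S)
 have Sscale: "S (c *\<^sub>C t) = c *\<^sub>C S t" for c t by (intro Seq Qscale S)
 have Spure: "S (pure_tensor f a) = \<mu> f *\<^sub>C a" for f a by (intro Seq Qpure)
 have S0: "S 0 = 0" by (intro Seq Q0)
 have Smult: "S (s * t) = S s * S t" for s t
 proof (induction s rule: alg_tensor_induct)
  case (pure_add f a s)
  have "S (pure_tensor f a * t) = \<mu> f *\<^sub>C a * S t"
  proof (induction t rule: alg_tensor_induct)
   case (pure_add f' a' t)
   thus ?case
    by (simp add: distrib_left Sadd pure_tensor_mult Spure \<mu>(2) mult_scaleC_left mult_scaleC_right scaleC_scaleC mult.commute[of "\<mu> f"])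
  qed (simp add: S0)
  thus ?case using pure_add by (simp add: distrib_right Sadd Spure)
 qed (simp add: S0)
 have Sstar: "S (star t) = star (S t)" for t by (induction t rule: alg_tensor_induct)
   (simp_all add: S0 star_add Sadd pure_tensor_star Spure star_scaleC \<mu>s)
 have S1: "S 1 = 1" using Spure[of 1 1] by (simp add: pure_tensor_one \<mu>1)
 have hS: "product_functional \<mu> h t = h (S t)" for t by (induction t rule: alg_tensor_induct)
   (simp_all add: S0 clinear_zero[OF hp(2)] clinear_zero[OF product_functional_clinear] Sadd Spure
    clinear_add[OF hp(2)] clinear_add[OF product_functional_clinear] product_functional_pure[OF mp(2) hp(2)]
    clinear_scaleC[OF hp(2)])
 have Nh: "functional_seminorm (product_functional \<mu> h) t = functional_seminorm h (S t)" for t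
  by (simp add: functional_seminorm_def hS Smult Sstar)
 have bound: "norm (S t) <= cstar_seminorm t" for t
 proof (rule norm_le_of_faithful[OF hp(1) faithful])
  fix b
  have "functional_seminorm (product_functional \<mu> h) (t * pure_tensor 1 b)
    <= min_tensor_norm t * functional_seminorm (product_functional \<mu> h) (pure_tensor 1 b)" by (rule functional_seminorm_mult_le[OF \<mu>(1) h(1)])
  thus "functional_seminorm h (S t * b) <= cstar_seminorm t * functional_seminorm h b"
   by (simp add: Nh Smult Spure \<mu>1 cstar_seminorm_alg_tensor_def)
 qed (auto simp: cstar_seminorm_nonneg)
 obtain T where T: "cstar_hom T" "bounded_linear T" "!!t. T (to_completion t) = S t"
  by (rule cstar_hom_completion_extension[OF Sadd Sscale Smult Sstar S1 bound]) blast
 have Tt: "T (f \<otimes> a) = \<mu> f *\<^sub>C a" for f a by (simp add: tensor_def T(3) Spure)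
 have sl: "slice_left \<mu> = T" unfolding slice_left_def by (rule tensor_ext_eqI[OF T(2) Tt])
 show "cstar_hom (slice_left \<mu> :: ('b, 'a) min_tensor => 'a)"
  "bounded_linear (slice_left \<mu> :: ('b, 'a) min_tensor => 'a)" "slice_left \<mu> (f \<otimes> a) = \<mu> f *\<^sub>C a"
  using T Tt by (auto simp: sl)
 have "bounded_linear (%u. h (T u))" using h(1) T(2) by (intro bounded_linear_compose[of h T]) (auto simp: state_def)
 hence "tensor_functional \<mu> h = (%u. h (T u))" unfolding tensor_functional_def by (rule tensor_ext_eqI) (simp add: Tt clinear_scaleC[OF hp(2)])
 thus "tensor_functional \<mu> h u = h (slice_left \<mu> u)" by (simp add: sl)
qed

lemma state_dirac: "state (dirac x)" unfolding state_def positive_functional_def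
proof (intro conjI allI)
 show "clinear (dirac x)" by (simp add: clinear_def dirac_def scaleC_bcontfun.rep_eq plus_bcontfun.rep_eq)
 show "dirac x (star f * f) \<in> \<real>\<^sub>\<ge>\<^sub>0" for f
  by (simp add: dirac_def times_bcontfun.rep_eq star_bcontfun.rep_eq complex_nonneg_Reals_iff mult.commute)
 show "bounded_linear (dirac x)"
  by (rule bounded_linear_intro[of _ 1]) (auto simp: dirac_def norm_bounded scaleR_bcontfun.rep_eq plus_bcontfun.rep_eq)
 show "dirac x 1 = 1" by (simp add: dirac_def one_bcontfun.rep_eq)
qed

lemma dirac_mult: "dirac x (f * g) = dirac x f * dirac x g" by (simp add: dirac_def times_bcontfun.rep_eq)

lemma action_eval_hom:
 assumes "quantum_action \<Delta> \<rho>" "state h" "faithful_state h"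
 shows "cstar_hom (%f. action_eval \<rho> f x)" and "convolve \<rho> (dirac x) h f = h (action_eval \<rho> f x)"
proof -
 note sl = character_slice[OF state_dirac dirac_mult assms(2,3)]
 have "cstar_hom \<rho>" using assms(1) by (rule quantum_action.action_hom)
 with sl(1)[of x] show "cstar_hom (%f. action_eval \<rho> f x)" by (simp add: cstar_hom_def clinear_def action_eval_def)
 show "convolve \<rho> (dirac x) h f = h (action_eval \<rho> f x)" by (simp add: convolve_def action_eval_def sl(4))
qed

section \<open>Positive functionals\<close>

lemma positive_functional_conj:
 assumes "positive_functional \<phi>"
 shows "positive_functional (%a. \<phi> (star b * a * b))" unfolding positive_functional_def clinear_def
proof (intro conjI allI)
 note cl = pos_fun_clinear[OF assms]
 show "\<phi> (star b * (x + y) * b) = \<phi> (star b * x * b) + \<phi> (star b * y * b)" for x y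
  by (simp add: distrib_left distrib_right clinear_add[OF cl])
 show "\<phi> (star b * (c *\<^sub>C x) * b) = c *\<^sub>C \<phi> (star b * x * b)" for c x
  by (simp add: mult_scaleC_left mult_scaleC_right clinear_scaleC[OF cl])
 show "\<phi> (star b * (star x * x) * b) \<in> \<real>\<^sub>\<ge>\<^sub>0" for x
 proof -
  have "star b * (star x * x) * b = star (x * b) * (x * b)" by (simp add: star_mult mult.assoc)
  thus ?thesis using assms by (simp add: positive_functional_def)
 qed
qed

text \<open>After normalisation \<open>1 - z\<close> is the square of a selfadjoint element, by
  \<open>sqrt_one_minus_exists\<close>, and is therefore mapped to a nonnegative number.\<close>

lemma positive_functional_bound:
 fixes a :: "'a::cstar_algebra"
 assumes "positive_functional \<phi>"
 shows "Re (\<phi> (star a * a)) <= (norm a)\<^sup>2 * Re (\<phi> 1)"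
proof (cases "norm a = 0")
 case True
 thus ?thesis using clinear_zero[OF pos_fun_clinear[OF assms]] by simp
next case False
 note cl = pos_fun_clinear[OF assms]
 define z where "z = (1 / (norm a)\<^sup>2) *R (star a * a)"
 have "norm z <= 1" "star z = z" using False by (auto simp: z_def cstar_identity star_scaleR star_mult)
 then obtain w where w: "star w = w" "(1 - w) * (1 - w) = 1 - z" by (rule sqrt_one_minus_exists) blast
 hence "star (1 - w) * (1 - w) = 1 - z" by (simp add: star_diff)
 hence "0 <= Re (\<phi> (1 - z))" using pos_fun_nonneg[OF assms, of "1 - w"] by simp
 also have "\<phi> (1 - z) = \<phi> 1 - \<phi> z" using clinear_add[OF cl, of 1 "- z"] clinear_minus[OF cl] by simp
 finally have "Re (\<phi> z) <= Re (\<phi> 1)" by simp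
 moreover have "\<phi> z = of_real (1 / (norm a)\<^sup>2) * \<phi> (star a * a)" by (simp add: z_def scaleR_scaleC clinear_scaleC[OF cl])
 hence "Re (\<phi> z) = Re (\<phi> (star a * a)) / (norm a)\<^sup>2" by simp
 ultimately show ?thesis using False by (simp add: divide_le_eq mult.commute)
qed

lemma functional_seminorm_mult_norm:
 fixes a :: "'a::cstar_algebra"
 assumes "positive_functional \<phi>"
 shows "functional_seminorm \<phi> (a * b) <= norm a * functional_seminorm \<phi> b"
proof -
 have "star (a * b) * (a * b) = star b * (star a * a) * b" by (simp add: star_mult mult.assoc)
 hence "Re (\<phi> (star (a * b) * (a * b))) <= (norm a)\<^sup>2 * Re (\<phi> (star b * b))"
  using positive_functional_bound[OF positive_functional_conj[OF assms, of b], of a] by simp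
 thus ?thesis unfolding functional_seminorm_def by (metis norm_ge_zero real_sqrt_abs real_sqrt_le_iff real_sqrt_mult abs_of_nonneg)
qed

lemma positive_functional_norm_bound:
 fixes a :: "'a::cstar_algebra"
 assumes "positive_functional \<phi>" "\<phi> 1 = 1"
 shows "cmod (\<phi> a) <= norm a"
proof -
 have N1: "functional_seminorm \<phi> 1 = 1" using assms(2) by (simp add: functional_seminorm_def)
 have "cmod (\<phi> (star 1 * a)) <= functional_seminorm \<phi> 1 * functional_seminorm \<phi> a"
  by (rule positive_functional_Cauchy_Schwarz[OF assms(1)])
 also have "\<dots> <= norm a" using functional_seminorm_mult_norm[OF assms(1), of a 1] N1 by simp
 finally show ?thesis by simp
qed

text \<open>A weak-* cluster point, from compactness of the product of the discs of radius
  \<open>norm a\<close>. No subsequence need converge, so \<psi> inherits only those values along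
  which the whole sequence converges.\<close>

lemma limit_functional_exists:
 fixes \<phi> :: "nat => 'a::cstar_algebra => complex"
 assumes \<phi>: "!!n. positive_functional (\<phi> n)" "!!n. \<phi> n 1 = 1"
 obtains \<psi> where "positive_functional \<psi>" "\<psi> 1 = 1" "!!a t. (%n. \<phi> n a) ----> t ==> \<psi> a = t"
proof -
 define K where "K = PiE UNIV (%a :: 'a. cball (0 :: complex) (norm a))"
 have "compactin (product_topology (%i :: 'a. euclidean) UNIV) K" unfolding K_def compactin_PiE by simp
 hence cK: "compact K" by (simp add: euclidean_product_topology)
 have "\<phi> n \<in> K" for n unfolding K_def using positive_functional_norm_bound[OF \<phi>] by (intro PiE_I) auto
 hence "eventually (%f. f \<in> K) (filtermap \<phi> sequentially)" by (simp add: eventually_filtermap)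
 moreover have "filtermap \<phi> sequentially ~= bot" by (simp add: filtermap_bot_iff)
 ultimately obtain \<psi> where \<psi>: "inf (nhds \<psi>) (filtermap \<phi> sequentially) ~= bot" using cK unfolding compact_filter by blast
 define G where "G = inf (nhds \<psi>) (filtermap \<phi> sequentially)"
 have G: "G ~= bot" using \<psi> by (simp add: G_def)
 have ev: "((%f. f a) \<longlongrightarrow> \<psi> a) G" for a
 proof -
  have "((%f. f a) \<longlongrightarrow> \<psi> a) (nhds \<psi>)"
  proof (rule topological_tendstoI)
   fix S :: "complex set" assume S: "open S" "\<psi> a \<in> S"
   have "open ((%f. f a) -` S)" by (rule open_vimage[OF S(1) continuous_on_product_coordinates])
   thus "\<forall>\<^sub>F f in nhds \<psi>. f a \<in> S" using S(2) unfolding eventually_nhds by auto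
  qed
  thus ?thesis by (rule tendsto_mono[rotated]) (simp add: G_def)
 qed
 have all: "eventually Q G" if "!!n. Q (\<phi> n)" for Q unfolding G_def using that by (intro filter_leD[OF inf_le2]) (simp add: eventually_filtermap)
 have lim: "\<psi> a = t" if "(%n. \<phi> n a) ----> t" for a t
 proof -
  have "((%f. f a) \<longlongrightarrow> t) (filtermap \<phi> sequentially)" using that by (simp add: filterlim_filtermap)
  hence "((%f. f a) \<longlongrightarrow> t) G" by (rule tendsto_mono[rotated]) (simp add: G_def)
  thus ?thesis using tendsto_unique[OF G ev] by blast
 qed
 note cl = pos_fun_clinear[OF \<phi>(1)]
 have "\<psi> (a + b) = \<psi> a + \<psi> b" for a b
 proof (rule tendsto_unique[OF G ev])
  show "((%f. f (a + b)) \<longlongrightarrow> \<psi> a + \<psi> b) G" by (rule Lim_transform_eventually[OF tendsto_add[OF ev ev]])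
    (rule all, simp add: clinear_add[OF cl])
 qed
 moreover have "\<psi> (c *\<^sub>C a) = c *\<^sub>C \<psi> a" for c a
 proof (rule tendsto_unique[OF G ev])
  show "((%f. f (c *\<^sub>C a)) \<longlongrightarrow> c *\<^sub>C \<psi> a) G" unfolding scaleC_complex_def
   by (rule Lim_transform_eventually[OF tendsto_mult_left[OF ev]]) (rule all, simp add: clinear_scaleC[OF cl])
 qed
 moreover have "\<psi> (star a * a) \<in> \<real>\<^sub>\<ge>\<^sub>0" for a by (rule Lim_in_closed_set[OF closed_nonneg_Reals_complex all G ev])
   (use \<phi>(1) in "simp add: positive_functional_def")
 ultimately have "positive_functional \<psi>" by (simp add: positive_functional_def clinear_def)
 moreover have "\<psi> 1 = 1" using lim[of 1 1] \<phi>(2) by simp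
 ultimately show ?thesis using that lim by blast
qed

section \<open>Isometric families of homomorphisms\<close>

definition cf :: "('x::metric_space => real) => 'x cfun" where "cf u = Bcontfun (%z. complex_of_real (u z))"

definition hat :: "real => real => real" where "hat e t = max 0 (1 - t / e)"

lemma hat_simps: "0 <= hat e t" "0 < e ==> t \<ge> e ==> hat e t = 0" "0 < e ==> 0 <= t ==> hat e t <= 1"
 "0 < e ==> t < e ==> 0 < hat e t" "hat e 0 = 1" by (auto simp: hat_def)

lemma continuous_hat: "continuous_on UNIV (hat e)" unfolding hat_def divide_inverse by (intro continuous_intros)

text \<open>\<open>P x f\<close> stands for \<open>action_eval \<rho> f x\<close>, and
  \<open>h\<close> for the Haar state.\<close>

locale isometric_family =
 fixes P :: "'x::metric_space => 'x cfun => 'a::cstar_algebra" and h :: "'a => complex" and \<kappa> :: "'a => 'a"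
 assumes compact_UNIV: "compact (UNIV :: 'x set)" and hom: "cstar_hom (P x)" and h_state: "state h" "faithful_state h"
  and \<kappa>_lin: "bounded_linear \<kappa>" "clinear \<kappa>" and \<kappa>_invol: "\<kappa> (\<kappa> a) = a" and \<kappa>_mult: "\<kappa> (a * b) = \<kappa> b * \<kappa> a"
  and isometric: "P x (dist_fun y) = \<kappa> (P y (dist_fun x))"
begin

abbreviation cont :: "('x => real) => bool" where "cont u \<equiv> continuous_on UNIV u"

lemma apply_cf: "cont u ==> apply_bcontfun (cf u) z = complex_of_real (u z)"
proof -
 assume "cont u"
 hence c: "continuous_on UNIV (%z. complex_of_real (u z))" by (intro continuous_intros)
 hence "bounded (range (%z. complex_of_real (u z)))" using compact_UNIV compact_continuous_image compact_imp_bounded by blast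
 with c have "(%z. complex_of_real (u z)) \<in> bcontfun" by (simp add: bcontfun_def)
 thus ?thesis by (simp add: cf_def Bcontfun_inverse)
qed

definition C :: "'x => ('x => real) => 'a" where "C x u = P x (cf u)"

lemma P_simps: "P x (f + g) = P x f + P x g" "P x (c *\<^sub>C f) = c *\<^sub>C P x f" "P x (f * g) = P x f * P x g"
 "P x (star f) = star (P x f)" "P x 1 = 1" using hom[of x] by (auto simp: cstar_hom_def clinear_def)

lemma cf_eqI: "cont u ==> (!!z. apply_bcontfun f z = complex_of_real (u z)) ==> cf u = f" by (rule bcontfun_eqI) (simp add: apply_cf)

lemma C_add: "cont u ==> cont v ==> C x (%z. u z + v z) = C x u + C x v" unfolding C_def P_simps(1)[symmetric]
 by (intro arg_cong[of _ _ "P x"] cf_eqI continuous_intros) (auto simp: plus_bcontfun.rep_eq apply_cf)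

lemma C_mult: "cont u ==> cont v ==> C x (%z. u z * v z) = C x u * C x v" unfolding C_def P_simps(3)[symmetric]
 by (intro arg_cong[of _ _ "P x"] cf_eqI continuous_intros) (auto simp: times_bcontfun.rep_eq apply_cf)

lemma C_scale: "cont u ==> C x (%z. r * u z) = r *R C x u" unfolding C_def scaleR_scaleC P_simps(2)[symmetric]
 by (intro arg_cong[of _ _ "P x"] cf_eqI continuous_intros) (auto simp: scaleC_bcontfun.rep_eq apply_cf)

lemma C_one: "C x (%_. 1) = 1" unfolding C_def P_simps(5)[of x, symmetric]
 by (intro arg_cong[of _ _ "P x"] cf_eqI continuous_intros) (auto simp: one_bcontfun.rep_eq)

lemma C_const: "C x (%_. r) = r *R 1" using C_scale[of "%_. 1" x r] by (simp add: C_one)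

lemma C_zero: "C x (%_. 0) = 0" using C_const[of x 0] by simp

lemma C_diff: "cont u ==> cont v ==> C x (%z. u z - v z) = C x u - C x v"
 using C_add[of u "%z. (-1) * v z" x] C_scale[of v x "-1"] by (simp add: continuous_intros)

lemma C_star: "cont u ==> star (C x u) = C x u" unfolding C_def P_simps(4)[symmetric]
 by (intro arg_cong[of _ _ "P x"] bcontfun_eqI) (simp add: star_bcontfun.rep_eq apply_cf)

lemma C_commute: "cont u ==> cont v ==> C x u * C x v = C x v * C x u" using C_mult[of u v x] C_mult[of v u x] by (simp add: mult.commute)

text \<open>\<open>v\<close> completes \<open>u\<close> to
  \<open>u\<^sup>2 + v\<^sup>2 = B\<^sup>2\<close>, and \<open>norm_sum_of_squares\<close> applies
  to the images.\<close>

lemma C_norm: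
 assumes u: "cont u" and b: "!!z. \<bar>u z\<bar> <= B" and B: "0 <= B"
 shows "norm (C x u) <= B"
proof -
 define v where "v = (%z. sqrt (B\<^sup>2 - (u z)\<^sup>2))"
 have v: "cont v" unfolding v_def by (intro continuous_intros u)
 have eq: "u z * u z + v z * v z = B\<^sup>2" for z using power_mono[OF b[of z] abs_ge_zero, of 2] by (simp add: v_def power2_eq_square)
 have "norm (C x u) <= sqrt (B\<^sup>2)"
 proof (rule norm_sum_of_squares)
  show "star (C x u) = C x u" "star (C x v) = C x v" by (simp_all add: C_star u v)
  show "C x u * C x v = C x v * C x u" by (rule C_commute[OF u v])
  have "C x u * C x u + C x v * C x v = C x (%z. u z * u z + v z * v z)" by (simp add: C_add C_mult continuous_intros u v)
  thus "C x u * C x u + C x v * C x v = B\<^sup>2 *R 1" by (simp add: eq C_const)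
 qed simp
 thus ?thesis using B by simp
qed

lemma \<kappa>_one: "\<kappa> 1 = 1" using \<kappa>_mult[of "\<kappa> 1" 1] \<kappa>_invol[of 1] by simp

lemma cont_radial: "continuous_on UNIV k ==> cont (%z. k (dist y z))" by (rule continuous_on_compose2[of UNIV k]) (auto intro: continuous_intros)

lemma C_dist: "C x (dist y) = P x (dist_fun y)" by (simp add: C_def cf_def dist_fun_def)

lemma continuous_real_poly: "real_polynomial_function p ==> continuous_on UNIV (p :: real => real)"
 by (intro continuous_on_polymonial_function) (simp add: real_polynomial_function_eq)

text \<open>Isometry is the case of the identity function. Products follow because \<kappa> reverses
  factors that commute, and continuous \<open>k\<close> by polynomial approximation on an interval
  containing all distances, since \<kappa> is bounded.\<close>

lemma radial_symmetry:
 assumes k: "continuous_on UNIV k"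
 shows "C x (%z. k (dist y z)) = \<kappa> (C y (%z. k (dist x z)))"
proof -
 have poly: "C x (%z. p (dist y z)) = \<kappa> (C y (%z. p (dist x z)))" if "real_polynomial_function p" for p using that
 proof (induction p rule: real_polynomial_function.induct)
  case (linear f)
  hence "f = (%t. f 1 * t)" by (metis bounded_linear.linear linear_iff mult.commute mult.right_neutral real_scaleR_def)
  then obtain c where f: "f = (%t. c * t)" by blast
  have d: "cont (dist y)" for y by (intro continuous_intros)
  show ?case unfolding f C_scale[OF d] C_dist isometric[of x y] by (simp add: scaleR_scaleC clinear_scaleC[OF \<kappa>_lin(2)])
 next case (const c)
  show ?case by (simp add: C_const scaleR_scaleC clinear_scaleC[OF \<kappa>_lin(2)] \<kappa>_one)
 next case (add f g)
  note c = cont_radial[OF continuous_real_poly[OF add.hyps(1)]]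
   cont_radial[OF continuous_real_poly[OF add.hyps(2)]]
  show ?case by (simp add: C_add c add.IH clinear_add[OF \<kappa>_lin(2)])
 next case (mult f g)
  note c = cont_radial[OF continuous_real_poly[OF mult.hyps(1)]]
   cont_radial[OF continuous_real_poly[OF mult.hyps(2)]]
  show ?case by (simp add: C_mult c mult.IH \<kappa>_mult[symmetric] C_commute[OF c(2,1)])
 qed
 obtain D where D: "!!y z :: 'x. dist y z <= D" using compact_imp_bounded[OF compact_UNIV] unfolding bounded_two_points by blast
 obtain M where M: "!!a. norm (\<kappa> a) <= norm a * M" "M \<ge> 0" using bounded_linear.nonneg_bounded[OF \<kappa>_lin(1)] by blast
 have "norm (C x (%z. k (dist y z)) - \<kappa> (C y (%z. k (dist x z)))) <= e" if e: "e > 0" for e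
 proof -
  have e1: "e / (1 + M) > 0" using e M by simp
  obtain p where p: "real_polynomial_function p" "!!t. t \<in> {0..D} ==> \<bar>k t - p t\<bar> < e / (1 + M)"
   by (rule Stone_Weierstrass_real_polynomial_function[OF compact_Icc continuous_on_subset[OF k subset_UNIV] e1]) blast
  have cp: "continuous_on UNIV p" by (rule continuous_real_poly[OF p(1)])
  have b: "norm (C x (%z. k (dist y z)) - C x (%z. p (dist y z))) <= e / (1 + M)" for x y
   unfolding C_diff[OF cont_radial[OF k] cont_radial[OF cp], symmetric]
   using p(2) D e1 by (intro C_norm continuous_intros cont_radial k cp) (auto intro: less_imp_le)
  have "\<kappa> (C y (%z. p (dist x z))) - \<kappa> (C y (%z. k (dist x z)))
    = - \<kappa> (C y (%z. k (dist x z)) - C y (%z. p (dist x z)))" by (simp add: linear_diff[OF bounded_linear.linear[OF \<kappa>_lin(1)]])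
  hence b2: "norm (\<kappa> (C y (%z. p (dist x z))) - \<kappa> (C y (%z. k (dist x z)))) <= e / (1 + M) * M"
   using M(1)[of "C y (%z. k (dist x z)) - C y (%z. p (dist x z))"] mult_right_mono[OF b[of y x] M(2)] by simp
  have "C x (%z. k (dist y z)) - \<kappa> (C y (%z. k (dist x z)))
   = (C x (%z. k (dist y z)) - C x (%z. p (dist y z))) + (\<kappa> (C y (%z. p (dist x z))) - \<kappa> (C y (%z. k (dist x z))))"
   by (simp add: poly[OF p(1)])
  also have "norm \<dots> <= e / (1 + M) + e / (1 + M) * M" by (rule norm_triangle_mono[OF b b2])
  also have "\<dots> = e / (1 + M) * (1 + M)" by (simp only: distrib_left mult_1_right)
  also have "\<dots> = e" using M(2) by simp
  finally show ?thesis .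
 qed
 hence "norm (C x (%z. k (dist y z)) - \<kappa> (C y (%z. k (dist x z)))) <= 0" by (rule field_le_epsilon) simp
 thus ?thesis by simp
qed

text \<open>The antipode exchanges centre and evaluation point. Both factors become images under
  \<kappa> of evaluations at the same \<open>w\<close>, where the product of the two functions
  vanishes.\<close>

lemma radial_product_zero:
 assumes k: "continuous_on UNIV k" "continuous_on UNIV l" and z: "!!u. k (dist x u) * l (dist z u) = 0"
 shows "C x (%u. k (dist w u)) * C z (%u. l (dist w u)) = 0"
proof -
 have "C x (%u. k (dist w u)) * C z (%u. l (dist w u))
   = \<kappa> (C w (%u. l (dist z u) * k (dist x u)))"
 proof -
  have 1: "C x (%u. k (dist w u)) = \<kappa> (C w (%u. k (dist x u)))" by (rule radial_symmetry[OF k(1)])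
  have 2: "C z (%u. l (dist w u)) = \<kappa> (C w (%u. l (dist z u)))" by (rule radial_symmetry[OF k(2)])
  show ?thesis unfolding C_mult[OF cont_radial[OF k(2)] cont_radial[OF k(1)]] \<kappa>_mult by (simp only: 1 2)
 qed
 also have "(%u. l (dist z u) * k (dist x u)) = (%_. 0)" using z by (simp add: fun_eq_iff mult.commute)
 finally show ?thesis by (simp add: C_zero clinear_zero[OF \<kappa>_lin(2)])
qed

text \<open>The analogue for matrix coefficients \<open>u\<^sub>x\<^sub>a\<close> of a quantum permutation of a finite metric
 space is \<open>u\<^sub>x\<^sub>a u\<^sub>z\<^sub>b = 0\<close> unless \<open>d(a, b) = d(x, z)\<close>.\<close>

lemma local_product_zero:
 assumes "dist a b ~= dist x z"
 obtains e where "0 < e" "!!u v. cont u ==> cont v ==> (!!w. e <= dist a w ==> u w = 0) ==> (!!w. e <= dist b w ==> v w = 0) ==> C x u * C z v = 0"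
proof -
 \<comment> \<open>Width \<open>4 * e\<close> keeps the radial functions positive on the balls of
   radius \<open>2 * e\<close> about \<open>a\<close> and \<open>b\<close>, while two such widths
   just reach the discrepancy \<open>8 * e\<close> of the distances.\<close>
 define e where "e = \<bar>dist a b - dist x z\<bar> / 8"
 have e: "0 < e" using assms by (simp add: e_def)
 define k where "k = (%t. hat (4 * e) \<bar>t - dist a b\<bar>)"
 define l where "l = hat (4 * e)"
 have kc: "continuous_on UNIV k" unfolding k_def by (intro continuous_on_compose2[OF continuous_hat] continuous_intros) auto
 have lc: "continuous_on UNIV l" unfolding l_def by (rule continuous_hat)
 have z: "k (dist x u) * l (dist z u) = 0" for u
 proof (rule ccontr)
  assume "k (dist x u) * l (dist z u) ~= 0"
  hence "\<bar>dist x u - dist a b\<bar> < 4 * e" "dist z u < 4 * e"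
   using hat_simps(2)[of "4 * e"] e by (force simp: k_def l_def not_less[symmetric])+
  hence "\<bar>dist a b - dist x z\<bar> < 8 * e" using dist_triangle[of x u z] dist_triangle[of x z u] by (simp add: dist_commute)
  thus False by (simp add: e_def)
 qed
 have zero: "C x (%u. k (dist b u)) * C z (%u. l (dist b u)) = 0" by (rule radial_product_zero[OF kc lc z])
 show ?thesis
 proof (rule that[OF e])
  fix u v assume uv: "cont u" "cont v" "!!w. e <= dist a w ==> u w = 0" "!!w. e <= dist b w ==> v w = 0"
  have kpos: "0 < k (dist b w)" if "dist a w < e" for w unfolding k_def using that e dist_triangle[of b w a] dist_triangle[of b a w]
   by (intro hat_simps(4)) (auto simp: dist_commute abs_less_iff)
  have lpos: "0 < l (dist b w)" if "dist b w < e" for w unfolding l_def using that e by (intro hat_simps(4)) auto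
  \<comment> \<open>A function supported near \<open>a\<close> is a continuous multiple of the
    radial function \<open>k (dist b w)\<close>, and one supported near \<open>b\<close> of
    \<open>l (dist b w)\<close>; so the vanishing of the radial product extends to all of
    them.\<close>
  have div: "cont (%w. u w / q w)" if q: "cont q" "!!w. dist c w < 2 * e ==> 0 < q w" "!!w. e <= dist c w ==> u w = 0" "cont u"
   for u q :: "'x => real" and c
  proof -
   have "continuous_on (ball c (2 * e) \<union> - cball c e) (%w. u w / q w)"
   proof (rule continuous_on_open_Un)
    have "q w ~= 0" if "w \<in> ball c (2 * e)" for w using q(2)[of w] that by simp
    thus "continuous_on (ball c (2 * e)) (%w. u w / q w)"
     by (intro continuous_on_divide continuous_on_subset[OF q(4)] continuous_on_subset[OF q(1)]) auto
    have "continuous_on (- cball c e) (%w. u w / q w) = continuous_on (- cball c e) (%w. 0 :: real)" by (rule continuous_on_cong) (use q(3) in auto)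
    thus "continuous_on (- cball c e) (%w. u w / q w)" by simp
   qed (auto simp: open_Compl)
   moreover have "ball c (2 * e) \<union> - cball c e = UNIV" using e by auto
   ultimately show ?thesis by simp
  qed
  have kpos2: "0 < k (dist b w)" if "dist a w < 2 * e" for w unfolding k_def using that e dist_triangle[of b w a] dist_triangle[of b a w]
   by (intro hat_simps(4)) (auto simp: dist_commute abs_less_iff)
  have lpos2: "0 < l (dist b w)" if "dist b w < 2 * e" for w unfolding l_def using that e by (intro hat_simps(4)) auto
  have du: "cont (%w. u w / k (dist b w))" by (rule div[OF cont_radial[OF kc] kpos2 uv(3,1)])
  have dv: "cont (%w. v w / l (dist b w))" by (rule div[OF cont_radial[OF lc] lpos2 uv(4,2)])
  have ku: "u w = u w / k (dist b w) * k (dist b w)" for w using uv(3)[of w] kpos[of w] by (cases "e <= dist a w") auto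
  hence "u = (%w. u w / k (dist b w) * k (dist b w))" by (rule ext)
  hence cu: "C x u = C x (%w. u w / k (dist b w)) * C x (%w. k (dist b w))" by (subst C_mult[OF du cont_radial[OF kc], symmetric]) simp
  have lv: "v w = l (dist b w) * (v w / l (dist b w))" for w using uv(4)[of w] lpos[of w] by (cases "e <= dist b w") auto
  hence "v = (%w. l (dist b w) * (v w / l (dist b w)))" by (rule ext)
  hence cv: "C z v = C z (%w. l (dist b w)) * C z (%w. v w / l (dist b w))" by (subst C_mult[OF cont_radial[OF lc] dv, symmetric]) simp
  have "C x u * C z v = C x (%w. u w / k (dist b w)) * (C x (%w. k (dist b w)) * C z (%w. l (dist b w))) * C z (%w. v w / l (dist b w))"
   unfolding cu cv by (simp only: mult.assoc)
  thus "C x u * C z v = 0" by (simp add: zero)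
 qed
qed

end

section \<open>Laws of states and their null elements\<close>

context isometric_family
begin

lemma partition_of_unity:
 fixes e :: "'x => real"
 assumes e: "!!z. 0 < e z"
 obtains Z b where "finite Z" "!!z. cont (b z)" "!!z w. e z <= dist z w ==> b z w = 0" "!!w. (\<Sum>z\<in>Z. b z w) = (1 :: real)"
proof -
 obtain Z where Z: "finite Z" "(UNIV :: 'x set) \<subseteq> (\<Union>z\<in>Z. ball z (e z))"
  using compactE_image[OF compact_UNIV, of UNIV "%z. ball z (e z)"] e by (metis (no_types, lifting) UNIV_I UN_I centre_in_ball open_ball subsetI)
 define s where "s = (%w. \<Sum>z\<in>Z. hat (e z) (dist z w))"
 have ch: "cont (%w. hat (e z) (dist z w))" for z by (rule cont_radial[OF continuous_hat])
 have cs: "cont s" unfolding s_def by (intro continuous_on_sum ch)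
 have s: "0 < s w" for w
 proof -
  have "w \<in> (\<Union>z\<in>Z. ball z (e z))" using Z(2) by blast
  then obtain z where z: "z \<in> Z" "dist z w < e z" by auto
  thus ?thesis unfolding s_def by (intro sum_pos2[OF Z(1) z(1)] hat_simps) (use e in auto)
 qed
 show ?thesis
 proof (rule that[OF Z(1), of "%z w. hat (e z) (dist z w) / s w"])
  show "cont (%w. hat (e z) (dist z w) / s w)" for z using s by (intro continuous_on_divide ch cs) (metis less_irrefl)
  show "hat (e z) (dist z w) / s w = 0" if "e z <= dist z w" for z w using hat_simps(2)[OF e that] by simp
  show "(\<Sum>z\<in>Z. hat (e z) (dist z w) / s w) = 1" for w
  proof -
   have "(\<Sum>z\<in>Z. hat (e z) (dist z w)) = s w" by (simp add: s_def)
   thus ?thesis using s[of w] by (simp add: sum_divide_distrib[symmetric])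
  qed
 qed
qed

lemma C_sum: "finite Z ==> (!!z. cont (u z)) ==> C x (%w. \<Sum>z\<in>Z. u z w) = (\<Sum>z\<in>Z. C x (u z))"
proof (induction Z rule: finite_induct)
 case (insert z Z)
 have "cont (%w. \<Sum>z\<in>Z. u z w)" using insert.prems by (intro continuous_on_sum)
 thus ?case using insert by (simp add: C_add)
qed (simp add: C_zero)

text \<open>The law of \<psi> at \<open>x\<close>, the measure sending \<open>u\<close> to
  \<open>\<psi> (C x u)\<close>, is the Dirac measure at \<open>x'\<close>: \<psi> behaves like an
  isometry that moves \<open>x\<close> to \<open>x'\<close>.\<close>

definition state_at :: "('a => complex) => 'x => 'x => bool"
 where "state_at \<psi> x x' \<longleftrightarrow> positive_functional \<psi> & \<psi> 1 = 1 & (\<forall>u. cont u --> \<psi> (C x u) = complex_of_real (u x'))"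

text \<open>The elements that vanish in the GNS space of \<psi> form a left ideal but in general no
  right ideal, so the order of the factors matters in all null statements below.\<close>

abbreviation null :: "('a => complex) => 'a => bool" where "null \<psi> a \<equiv> functional_seminorm \<psi> a = 0"

lemma null_mult: "positive_functional \<psi> ==> null \<psi> a ==> null \<psi> (b * a)"
 using functional_seminorm_mult_norm[of \<psi> b a] functional_seminorm_nonneg[of \<psi> "b * a"] by simp

lemma null_add: "positive_functional \<psi> ==> null \<psi> a ==> null \<psi> b ==> null \<psi> (a + b)"
 using functional_seminorm_triangle[of \<psi> a b] functional_seminorm_nonneg[of \<psi> "a + b"] by simp

lemma null_zero: "positive_functional \<psi> ==> null \<psi> 0" by (simp add: functional_seminorm_def clinear_zero[OF pos_fun_clinear])

lemma null_sum: "positive_functional \<psi> ==> (!!z. z \<in> Z ==> null \<psi> (a z)) ==> null \<psi> (sum a Z)"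
 by (induction Z rule: infinite_finite_induct) (auto simp: null_zero null_add)

lemma null_apply:
 assumes "positive_functional \<psi>" "null \<psi> a"
 shows "\<psi> (b * a) = 0" "\<psi> (star a * b) = 0" using positive_functional_Cauchy_Schwarz[OF assms(1), of "star b" a]
  positive_functional_Cauchy_Schwarz[OF assms(1), of a b] assms(2) by auto

lemma seminorm_minus: "positive_functional \<psi> ==> functional_seminorm \<psi> (- a) = functional_seminorm \<psi> a"
 using functional_seminorm_scaleC[of \<psi> "-1" a] by simp

lemma seminorm_C_sq:
 "positive_functional \<psi> ==> cont u ==> (functional_seminorm \<psi> (C x u))\<^sup>2 = Re (\<psi> (C x (%w. u w * u w)))"
 using functional_seminorm_sq[of \<psi> "C x u"] by (simp add: C_star C_mult)

lemma C_mono: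
 assumes "positive_functional \<psi>" "cont u" "cont v" "!!w. u w <= v w"
 shows "Re (\<psi> (C x u)) <= Re (\<psi> (C x v))"
proof -
 define s where "s = (%w. sqrt (v w - u w))"
 have s: "cont s" unfolding s_def by (intro continuous_intros assms)
 have "(%w. s w * s w) = (%w. v w - u w)" using assms(4) by (simp add: s_def fun_eq_iff)
 hence "0 <= Re (\<psi> (C x (%w. v w - u w)))" using seminorm_C_sq[OF assms(1) s, of x] by (metis zero_le_power2)
 thus ?thesis using clinear_add[OF pos_fun_clinear[OF assms(1)], of "C x v" "- C x u"] clinear_minus[OF pos_fun_clinear[OF assms(1)], of "C x u"]
  by (simp add: C_diff assms)
qed

text \<open>\<open>C x u\<close> has variance zero under \<psi>, hence acts as the scalar
  \<open>u x'\<close> when it stands on the right.\<close>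

lemma state_at_absorb:
 assumes "state_at \<psi> x x'" "cont u"
 shows "\<psi> (a * C x u) = \<psi> a * complex_of_real (u x')"
proof -
 have p: "positive_functional \<psi>" and s: "!!u. cont u ==> \<psi> (C x u) = complex_of_real (u x')" using assms(1) by (auto simp: state_at_def)
 note cl = pos_fun_clinear[OF p]
 define g where "g = (%w. u w - u x')"
 have g: "cont g" unfolding g_def by (intro continuous_intros assms)
 have "(functional_seminorm \<psi> (C x g))\<^sup>2 = 0"
  unfolding seminorm_C_sq[OF p g] by (subst s) (auto intro!: continuous_intros g assms(2) simp: g_def)
 hence "null \<psi> (C x g)" by simp
 hence "\<psi> (a * C x g) = 0" by (rule null_apply[OF p])
 moreover have "C x u = C x g + u x' *R 1"
 proof -
  have "C x u = C x (%w. g w + u x')" by (simp add: g_def)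
  also have "\<dots> = C x g + C x (%_. u x')" by (rule C_add[OF g]) (rule continuous_on_const)
  finally show ?thesis by (simp add: C_const)
 qed
 ultimately show ?thesis by (simp add: distrib_left clinear_add[OF cl] scaleR_scaleC mult_scaleC_right clinear_scaleC[OF cl] mult.commute)
qed

text \<open>A measure is Dirac once every other point has a neighbourhood of measure zero. Away from
  \<open>x'\<close> the function \<open>u - u x'\<close> is cut by a partition of unity into pieces
  of integral zero; near \<open>x'\<close> it is small.\<close>

lemma state_atI:
 assumes p: "positive_functional \<psi>" "\<psi> 1 = 1"
  and loc: "!!z. z ~= x' ==> \<exists>e>0. \<forall>u. cont u --> (\<forall>w. e <= dist z w --> u w = 0) --> \<psi> (C x u) = 0"
 shows "state_at \<psi> x x'" unfolding state_at_def
proof (intro conjI allI impI p)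
 note cl = pos_fun_clinear[OF p(1)]
 fix u :: "'x => real" assume u: "cont u"
 have "cmod (\<psi> (C x (%w. u w - u x'))) <= \<eta>" if \<eta>: "\<eta> > 0" for \<eta>
 proof -
  have "\<exists>d>0. \<forall>w. dist w x' < d --> dist (u w) (u x') < \<eta>" using u \<eta> unfolding continuous_on_iff by simp
  then obtain d where d: "d > 0" "!!w. dist w x' < d ==> dist (u w) (u x') < \<eta>" by blast
  define c where "c = (%w. min 1 (max 0 (2 * dist x' w / d - 1)))"
  have c: "cont c" unfolding c_def divide_inverse by (intro continuous_intros)
  have c0: "c w = 0" if "dist x' w < d / 2" for w using that d(1) by (simp add: c_def field_simps)
  have c1: "c w = 1" if "d <= dist x' w" for w using that d(1) by (simp add: c_def field_simps)
  have c01: "0 <= c w" "c w <= 1" for w by (auto simp: c_def)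
  define v where "v = (%w. (u w - u x') * c w)"
  have v: "cont v" unfolding v_def by (intro continuous_intros u c)
  have "\<exists>e>0. \<forall>b. cont b --> (\<forall>w. e <= dist z w --> b w = 0) --> \<psi> (C x (%w. v w * b w)) = 0" for z
  proof (cases "z = x'")
   case True
   have "(%w. v w * b w) = (%_. 0)" if b: "\<forall>w. d / 2 <= dist z w --> b w = 0" for b
   proof
    fix w
    show "v w * b w = 0" using b c0[of w] True by (cases "d / 2 <= dist z w") (auto simp: v_def)
   qed
   thus ?thesis using d(1) by (intro exI[of _ "d / 2"]) (auto simp: C_zero clinear_zero[OF cl])
  next case False
   then obtain e where e: "e > 0" "!!u. cont u ==> (\<forall>w. e <= dist z w --> u w = 0) ==> \<psi> (C x u) = 0" using loc by blast
   have "\<psi> (C x (%w. v w * b w)) = 0" if "cont b" "\<forall>w. e <= dist z w --> b w = 0" for b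
    using that by (intro e(2) continuous_intros v) auto
   thus ?thesis using e(1) by blast
  qed
  then obtain e where e: "!!z. e z > 0" "!!z b. cont b ==> (\<forall>w. e z <= dist z w --> b w = 0) ==> \<psi> (C x (%w. v w * b w)) = 0" by metis
  obtain Z b where b: "finite Z" "!!z. cont (b z)" "!!z w. e z <= dist z w ==> b z w = 0" "!!w. (\<Sum>z\<in>Z. b z w) = 1"
   using partition_of_unity[of e] e(1) by blast
  have "v = (%w. \<Sum>z\<in>Z. v w * b z w)" by (simp add: sum_distrib_left[symmetric] b(4))
  hence "C x v = (\<Sum>z\<in>Z. C x (%w. v w * b z w))" using C_sum[OF b(1), of "%z w. v w * b z w" x] v b(2) by (simp add: continuous_intros)
  moreover have "\<psi> (C x (%w. v w * b z w)) = 0" for z using e(2)[OF b(2)[of z], of z] b(3)[of z] by blast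
  ultimately have v0: "\<psi> (C x v) = 0" by (simp add: clinear_sum[OF cl])
  define v' where "v' = (%w. (u w - u x') * (1 - c w))"
  have v': "cont v'" unfolding v'_def by (intro continuous_intros u c)
  have "\<bar>v' w\<bar> <= \<eta>" for w
  proof (cases "d <= dist x' w")
   case True
   thus ?thesis using c1 \<eta> by (simp add: v'_def)
  next case False
   hence "\<bar>u w - u x'\<bar> <= \<eta>" using d(2)[of w] by (simp add: dist_real_def dist_commute)
   thus ?thesis using c01[of w] mult_mono[of "\<bar>u w - u x'\<bar>" \<eta> "\<bar>1 - c w\<bar>" 1] \<eta> by (simp add: v'_def abs_mult)
  qed
  hence "norm (C x v') <= \<eta>" using C_norm[OF v'] \<eta> by simp
  hence "cmod (\<psi> (C x v')) <= \<eta>" using positive_functional_norm_bound[OF p, of "C x v'"] by simp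
  moreover have "(%w. u w - u x') = (%w. v w + v' w)" by (simp add: v_def v'_def fun_eq_iff algebra_simps)
  ultimately show ?thesis using v0 by (simp add: C_add v v' clinear_add[OF cl])
 qed
 hence "cmod (\<psi> (C x (%w. u w - u x'))) <= 0" by (rule field_le_epsilon) simp
 hence "\<psi> (C x u - u x' *R 1) = 0" by (simp add: C_diff u C_const)
 thus "\<psi> (C x u) = complex_of_real (u x')" using clinear_add[OF cl, of "C x u" "- (u x' *R 1)"] clinear_minus[OF cl, of "u x' *R 1"]
   clinear_scaleC[OF cl, of "complex_of_real (u x')" 1] p(2) by (simp add: scaleR_scaleC)
qed

lemma product_zero_swap:
 assumes "cont u" "cont v" "C x u * C z v = 0"
 shows "C z v * C x u = 0" using arg_cong[OF assms(3), of star] assms(1,2) by (simp add: star_mult C_star)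

text \<open>A bump at \<open>x'\<close> evaluated at \<open>x\<close> is absorbed as the scalar
  \<open>1\<close>, and its product with evaluations of bumps near \<open>z'\<close> vanishes by
  \<open>local_product_zero\<close>.\<close>

lemma state_at_null:
 assumes s: "state_at \<psi> x x'" and d: "dist x' z' ~= dist x z"
 obtains e where "0 < e" "!!v. cont v ==> (!!w. e <= dist z' w ==> v w = 0) ==> null \<psi> (C z v)"
proof -
 have p: "positive_functional \<psi>" using s by (simp add: state_at_def)
 obtain e where e: "0 < e" "!!u v. cont u ==> cont v ==> (!!w. e <= dist x' w ==> u w = 0) ==>
  (!!w. e <= dist z' w ==> v w = 0) ==> C x u * C z v = 0" using local_product_zero[OF d] by blast
 show ?thesis
 proof (rule that[OF e(1)])
  fix v assume v: "cont v" "!!w. e <= dist z' w ==> v w = 0"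
  let ?u = "%w. hat e (dist x' w)"
  have u: "cont ?u" by (rule cont_radial[OF continuous_hat])
  have "C z v * C x ?u = 0" by (rule product_zero_swap[OF u v(1)]) (rule e(2)[OF u v(1)], use v(2) hat_simps(2)[OF e(1)] in auto)
  moreover have "\<psi> (C z v * C z v) = \<psi> (C z v * C z v * C x ?u)" by (simp add: state_at_absorb[OF s u] hat_simps(5))
  ultimately have "\<psi> (C z v * C z v) = 0" by (simp add: mult.assoc clinear_zero[OF pos_fun_clinear[OF p]])
  thus "null \<psi> (C z v)" by (simp add: functional_seminorm_def C_star v)
 qed
qed

text \<open>Since \<open>\<psi>\<close> is concentrated at \<open>x'\<close>, its law at \<open>m\<close> lives on a sphere around \<open>x'\<close>.\<close>

lemma pair_null:
 assumes s: "state_at \<psi> x x'" and f: "cont f" and g: "cont g" and sep: "!!m' y'. dist x' m' = dist x m ==> dist m' y' = dist m y ==>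
   (\<exists>e>0. \<forall>w. dist m' w < e --> g w = 0) \<or> (\<exists>e>0. \<forall>w. dist y' w < e --> f w = 0)"
 shows "null \<psi> (C y f * C m g)"
proof -
 have p: "positive_functional \<psi>" using s by (simp add: state_at_def)
 have ex: "\<exists>e>0. \<forall>b c. cont b --> cont c --> (\<forall>w. e <= dist y' w --> b w = 0) --> (\<forall>w. e <= dist m' w --> c w = 0)
   --> null \<psi> (C y (%w. f w * b w) * C m (%w. g w * c w))" for m' y'
 proof -
  consider "dist x' m' ~= dist x m" | "dist m' y' ~= dist m y" | "\<exists>e>0. \<forall>w. dist m' w < e --> g w = 0"
   | "\<exists>e>0. \<forall>w. dist y' w < e --> f w = 0" using sep by blast
  thus ?thesis
  proof cases
   case 1
   obtain e where e: "0 < e" "!!v. cont v ==> (!!w. e <= dist m' w ==> v w = 0) ==> null \<psi> (C m v)" using state_at_null[OF s 1] by blast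
   show ?thesis by (intro exI[of _ e] conjI allI impI e(1) null_mult[OF p] e(2)) (auto intro!: continuous_intros g)
  next case 2
   hence 2: "dist y' m' ~= dist y m" by (simp add: dist_commute)
   obtain e where e: "0 < e" "!!u v. cont u ==> cont v ==> (!!w. e <= dist y' w ==> u w = 0) ==>
    (!!w. e <= dist m' w ==> v w = 0) ==> C y u * C m v = 0" using local_product_zero[OF 2] by blast
   have "C y (%w. f w * b w) * C m (%w. g w * c w) = 0"
    if "cont b" "cont c" "\<forall>w. e <= dist y' w --> b w = 0" "\<forall>w. e <= dist m' w --> c w = 0" for b c
    by (rule e(2)) (use that in "auto intro!: continuous_intros f g")
   thus ?thesis using e(1) by (intro exI[of _ e]) (auto simp: null_zero[OF p])
  next case 3
   then obtain e where e: "0 < e" "!!w. dist m' w < e ==> g w = 0" by blast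
   have "(%w. g w * c w) = (%_. 0)" if "\<forall>w. e <= dist m' w --> c w = 0" for c using that e(2) by (auto simp: fun_eq_iff) (meson not_le)
   thus ?thesis using e(1) by (intro exI[of _ e]) (auto simp: null_zero[OF p] C_zero)
  next case 4
   then obtain e where e: "0 < e" "!!w. dist y' w < e ==> f w = 0" by blast
   have "(%w. f w * b w) = (%_. 0)" if "\<forall>w. e <= dist y' w --> b w = 0" for b using that e(2) by (auto simp: fun_eq_iff) (meson not_le)
   thus ?thesis using e(1) by (intro exI[of _ e]) (auto simp: null_zero[OF p] C_zero)
  qed
 qed
 define E where "E = (%y' m'. SOME e. e > 0 & (\<forall>b c. cont b --> cont c --> (\<forall>w. e <= dist y' w --> b w = 0) --> (\<forall>w. e <= dist m' w --> c w = 0)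
   --> null \<psi> (C y (%w. f w * b w) * C m (%w. g w * c w))))"
 have E': "E y' m' > 0 & (\<forall>b c. cont b --> cont c --> (\<forall>w. E y' m' <= dist y' w --> b w = 0) --> (\<forall>w. E y' m' <= dist m' w --> c w = 0)
   --> null \<psi> (C y (%w. f w * b w) * C m (%w. g w * c w)))" for y' m' unfolding E_def by (rule someI_ex[OF ex])
 have E: "E y' m' > 0" "cont b ==> cont c ==> (!!w. E y' m' <= dist y' w ==> b w = 0) ==> (!!w. E y' m' <= dist m' w ==> c w = 0)
   ==> null \<psi> (C y (%w. f w * b w) * C m (%w. g w * c w))" for y' m' b c using E'[of y' m'] by blast+
 \<comment> \<open>For fixed \<open>y'\<close> finitely many bumps cover the positions of
   \<open>m\<close>, so one radius \<open>d\<close> serves them all; a second partition of unity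
   then covers the positions of \<open>y\<close>.\<close>
 have "\<exists>d>0. \<forall>b. cont b --> (\<forall>w. d <= dist y' w --> b w = 0) --> null \<psi> (C y (%w. f w * b w) * C m g)" for y'
 proof -
  obtain Z c where c: "finite Z" "!!z. cont (c z)" "!!z w. E y' z <= dist z w ==> c z w = 0" "!!w. (\<Sum>z\<in>Z. c z w) = 1"
   using partition_of_unity[of "E y'"] E(1) by blast
  define d where "d = Min (insert 1 (E y' ` Z))"
  have d: "d > 0" "!!z. z \<in> Z ==> d <= E y' z" using c(1) E(1) by (auto simp: d_def)
  have "g = (%w. \<Sum>z\<in>Z. g w * c z w)" by (simp add: sum_distrib_left[symmetric] c(4))
  hence Cg: "C m g = (\<Sum>z\<in>Z. C m (%w. g w * c z w))" using C_sum[OF c(1), of "%z w. g w * c z w" m] g c(2) by (simp add: continuous_intros)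
  have "null \<psi> (C y (%w. f w * b w) * C m g)" if b: "cont b" "!!w. d <= dist y' w ==> b w = 0" for b unfolding Cg sum_distrib_left
  proof (rule null_sum[OF p])
   fix z assume z: "z \<in> Z"
   show "null \<psi> (C y (%w. f w * b w) * C m (%w. g w * c z w))"
    by (rule E(2)[OF b(1) c(2)]) (use b(2) d(2)[OF z] c(3) in "auto intro: order_trans")
  qed
  thus ?thesis using d(1) by blast
 qed
 then obtain d where d: "!!y'. d y' > 0"
  "!!y' b. cont b ==> (!!w. d y' <= dist y' w ==> b w = 0) ==> null \<psi> (C y (%w. f w * b w) * C m g)" by metis
 obtain Z b where b: "finite Z" "!!z. cont (b z)" "!!z w. d z <= dist z w ==> b z w = 0" "!!w. (\<Sum>z\<in>Z. b z w) = 1"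
  using partition_of_unity[of d] d(1) by blast
 have "f = (%w. \<Sum>z\<in>Z. f w * b z w)" by (simp add: sum_distrib_left[symmetric] b(4))
 hence "C y f = (\<Sum>z\<in>Z. C y (%w. f w * b z w))" using C_sum[OF b(1), of "%z w. f w * b z w" y] f b(2) by (simp add: continuous_intros)
 moreover have "null \<psi> (C y (%w. f w * b z w) * C m g)" for z by (rule d(2)[OF b(2)]) (rule b(3))
 ultimately show ?thesis by (simp add: sum_distrib_right null_sum[OF p])
qed

lemma single_null:
 assumes s: "state_at \<psi> x x'" and f: "cont f" and sep: "!!y'. dist x' y' = dist x y ==> \<exists>e>0. \<forall>w. dist y' w < e --> f w = 0"
 shows "null \<psi> (C y f)"
proof -
 have "null \<psi> (C y f * C x (%_. 1))"
 proof (rule pair_null[OF s f])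
  fix m' y' assume "dist x' m' = dist x x" "dist m' y' = dist x y"
  thus "(\<exists>e>0. \<forall>w. dist m' w < e --> (1 :: real) = 0) \<or> (\<exists>e>0. \<forall>w. dist y' w < e --> f w = 0)"
   using sep[of y'] by simp
 qed (rule continuous_on_const)
 thus ?thesis by (simp add: C_one)
qed

end

context isometric_family
begin

lemma null_of_hat:
 assumes p: "positive_functional \<psi>" and e: "0 < e" "\<psi> (C z (%w. hat e (dist z' w))) = 0"
  and v: "cont v" "!!w. e / 2 <= dist z' w ==> v w = 0"
 shows "null \<psi> (C z v)"
proof -
 have "bounded (range v)" using compact_continuous_image[OF v(1) compact_UNIV] by (rule compact_imp_bounded)
 then obtain B where B: "!!w. \<bar>v w\<bar> <= B" unfolding bounded_iff by auto
 have h: "cont (%w. hat e (dist z' w))" by (rule cont_radial[OF continuous_hat])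
 have "v w * v w <= (2 * B\<^sup>2) * hat e (dist z' w)" for w
 proof (cases "e / 2 <= dist z' w")
  case True
  thus ?thesis using v(2) hat_simps(1) by simp
 next case False
  hence "1 / 2 <= hat e (dist z' w)" using e(1) by (simp add: hat_def field_simps)
  hence "(2 * B\<^sup>2) * (1 / 2) <= (2 * B\<^sup>2) * hat e (dist z' w)" by (rule mult_left_mono) simp
  moreover have "v w * v w <= B\<^sup>2" using power_mono[OF B[of w], of 2] by (simp add: power2_eq_square)
  ultimately show ?thesis by simp
 qed
 hence "Re (\<psi> (C z (%w. v w * v w))) <= Re (\<psi> (C z (%w. (2 * B\<^sup>2) * hat e (dist z' w))))" by (intro C_mono p continuous_intros v(1) h)
 also have "\<dots> = 0" unfolding C_scale[OF h] scaleR_scaleC clinear_scaleC[OF pos_fun_clinear[OF p]] by (simp add: e(2))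
 finally have "(functional_seminorm \<psi> (C z v))\<^sup>2 <= 0" unfolding seminorm_C_sq[OF p v(1)] .
 thus ?thesis by simp
qed

text \<open>Otherwise finitely many null elements would add up to \<open>1\<close>.\<close>

lemma support_exists:
 assumes p: "positive_functional \<psi>" "\<psi> 1 = 1"
 obtains z' where "!!e. 0 < e ==> \<psi> (C z (%w. hat e (dist z' w))) ~= 0"
proof (rule ccontr)
 assume "\<not> thesis"
 hence "\<forall>z'. \<exists>e>0. \<psi> (C z (%w. hat e (dist z' w))) = 0" using that by blast
 then obtain e where e: "!!z'. 0 < e z'" "!!z'. \<psi> (C z (%w. hat (e z') (dist z' w))) = 0" by metis
 obtain Z b where b: "finite Z" "!!z. cont (b z)" "!!z w. e z / 2 <= dist z w ==> b z w = 0" "!!w. (\<Sum>z\<in>Z. b z w) = 1"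
  using partition_of_unity[of "%z. e z / 2"] e(1) by auto
 have n: "null \<psi> (C z (b z'))" for z' by (rule null_of_hat[OF p(1) e b(2,3)])
 have "1 = (\<Sum>z'\<in>Z. C z (b z'))" unfolding C_sum[OF b(1,2), symmetric] by (simp add: b(4) C_one)
 moreover have "null \<psi> (\<Sum>z'\<in>Z. C z (b z'))" by (rule null_sum[OF p(1) n])
 ultimately have "null \<psi> 1" by simp
 hence "\<psi> (1 * 1) = 0" by (rule null_apply(1)[OF p(1)])
 thus False using p(2) by simp
qed

text \<open>Conditioning \<phi> on the event that \<open>z\<close> is sent into shrinking
  neighbourhoods of \<open>z'\<close>, and passing to a cluster point. Whatever is negligible
  relative to the conditioning becomes null in the limit.\<close>

lemma compress:
 assumes p: "positive_functional \<phi>" and g: "!!n. cont (g n)" and supp: "!!n w. 1 / real (Suc n) <= dist z' w ==> g n w = 0"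
  and pos: "!!n. 0 < functional_seminorm \<phi> (C z (g n))"
 obtains \<psi> where "state_at \<psi> z z'" "!!y v. cont v ==>
  (%n. functional_seminorm \<phi> (C y v * C z (g n)) / functional_seminorm \<phi> (C z (g n))) ----> 0 ==> null \<psi> (C y v)"
proof -
 define N where "N = functional_seminorm \<phi>"
 define B where "B = (%n. complex_of_real (1 / N (C z (g n))) *\<^sub>C C z (g n))"
 define \<Phi> where "\<Phi> = (%n a. \<phi> (star (B n) * a * B n))"
 have NB: "N (a * B n) = N (a * C z (g n)) / N (C z (g n))" for a n
  using pos[of n] unfolding B_def mult_scaleC_right N_def functional_seminorm_scaleC[OF p] by (simp add: norm_divide)
 have \<Phi>: "positive_functional (\<Phi> n)" for n unfolding \<Phi>_def by (rule positive_functional_conj[OF p])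
 have sq: "\<Phi> n (star a * a) = complex_of_real ((N (a * B n))\<^sup>2)" for n a
  using functional_seminorm_sq[OF p, of "a * B n"] unfolding \<Phi>_def N_def by (simp add: star_mult mult.assoc)
 have \<Phi>1: "\<Phi> n 1 = 1" for n using sq[of n 1] NB[of 1 n] pos[of n] by (simp add: N_def)
 obtain \<psi> where \<psi>: "positive_functional \<psi>" "\<psi> 1 = 1" "!!a t. (%n. \<Phi> n a) ----> t ==> \<psi> a = t"
  by (rule limit_functional_exists[of \<Phi>, OF \<Phi> \<Phi>1]) blast
 show ?thesis
 proof (rule that)
  show "state_at \<psi> z z'"
  proof (rule state_atI[OF \<psi>(1,2)])
   fix z1 assume "z1 ~= z'"
   define e where "e = dist z1 z' / 2"
   have e: "0 < e" using \<open>z1 ~= z'\<close> by (simp add: e_def)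
   obtain n0 where n0: "1 / real (Suc n0) < e" using nat_approx_posE[OF e] by blast
   have "\<psi> (C z u) = 0" if u: "cont u" "\<forall>w. e <= dist z1 w --> u w = 0" for u
   proof (rule \<psi>(3))
    have "\<Phi> n (C z u) = 0" if n: "n0 <= n" for n
    proof -
     have "1 / real (Suc n) <= 1 / real (Suc n0)" using n by (intro divide_left_mono) auto
     hence n: "1 / real (Suc n) < e" using n0 by linarith
     have "u w * g n w = 0" for w
     proof (cases "e <= dist z1 w")
      case False
      hence "e <= dist z' w" using dist_triangle[of z1 z' w] by (simp add: e_def dist_commute)
      thus ?thesis using supp[of n w] n by simp
     qed (simp add: u)
     hence "(%w. u w * g n w) = (%_. 0)" by (rule ext)
     hence "C z u * C z (g n) = 0" unfolding C_mult[OF u(1) g, symmetric] by (simp only: C_zero)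
     hence "C z u * B n = 0" by (simp add: B_def mult_scaleC_right)
     thus ?thesis unfolding \<Phi>_def by (simp add: mult.assoc clinear_zero[OF pos_fun_clinear[OF p]])
    qed
    thus "(%n. \<Phi> n (C z u)) ----> 0" by (intro tendsto_eventually eventually_sequentiallyI[of n0])
   qed
   thus "\<exists>e>0. \<forall>u. cont u --> (\<forall>w. e <= dist z1 w --> u w = 0) --> \<psi> (C z u) = 0" using e by blast
  qed
  fix y v assume v: "cont v"
   "(%n. functional_seminorm \<phi> (C y v * C z (g n)) / functional_seminorm \<phi> (C z (g n))) ----> 0"
  have "(%n. N (C y v * B n)) ----> 0" unfolding NB using v(2) unfolding N_def .
  hence "(%n. complex_of_real ((N (C y v * B n))\<^sup>2)) ----> complex_of_real (0\<^sup>2)" by (intro tendsto_of_real tendsto_power)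
  hence "\<psi> (star (C y v) * C y v) = 0" by (intro \<psi>(3)) (simp only: sq, simp)
  thus "null \<psi> (C y v)" by (simp add: functional_seminorm_def)
 qed
qed

definition related :: "'x => 'x => bool" where "related x x' \<longleftrightarrow> (\<forall>e>0. C x (%w. hat e (dist x' w)) ~= 0)"

lemma h_pos: "positive_functional h" "h 1 = 1" using h_state(1) by (auto simp: state_def)

lemma h_null: "null h a ==> a = 0" using h_state(2) functional_seminorm_sq[OF h_pos(1), of a] by (simp add: faithful_state_def)

lemma related_state:
 assumes "related x x'"
 obtains \<psi> where "state_at \<psi> x x'"
proof -
 let ?g = "%n w. hat (1 / real (Suc n)) (dist x' w)"
 have c: "cont (?g n)" for n by (rule cont_radial[OF continuous_hat])
 have s: "?g n w = 0" if "1 / real (Suc n) <= dist x' w" for n w using that by (intro hat_simps(2)) auto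
 have "C x (?g n) ~= 0" for n using assms unfolding related_def by simp
 hence pos: "0 < functional_seminorm h (C x (?g n))" for n using h_null functional_seminorm_nonneg[OF h_pos(1)] by (metis less_eq_real_def)
 show ?thesis by (rule compress[where g = ?g and \<phi> = h and z = x and z' = x', OF h_pos(1) c s pos]) (assumption | rule that)+
qed

lemma state_related:
 assumes "state_at \<psi> x x'"
 shows "related x x'" unfolding related_def
proof (intro allI impI)
 fix e :: real
 have "\<psi> (C x (%w. hat e (dist x' w))) = 1" using assms cont_radial[OF continuous_hat] by (simp add: state_at_def hat_simps(5))
 moreover have "\<psi> 0 = 0" using assms by (simp add: state_at_def clinear_zero[OF pos_fun_clinear])
 ultimately show "C x (%w. hat e (dist x' w)) ~= 0" by auto
qed

text \<open>\<open>radial_symmetry\<close> exchanges the centre of a bump with the point of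
  evaluation.\<close>

lemma related_sym:
 assumes "related x x'"
 shows "related x' x" unfolding related_def
proof (intro allI impI notI)
 fix e :: real assume e: "0 < e" and z: "C x' (%w. hat e (dist x w)) = 0"
 have "C x (%w. hat e (dist x' w)) = \<kappa> (C x' (%w. hat e (dist x w)))" by (rule radial_symmetry[OF continuous_hat])
 also have "\<dots> = 0" unfolding z by (rule clinear_zero[OF \<kappa>_lin(2)])
 finally show False using assms e unfolding related_def by blast
qed

lemma related_closed:
 assumes "!!k. related z (f k)" "f ----> l"
 shows "related z l" unfolding related_def
proof (intro allI impI notI)
 fix e :: real assume e: "0 < e" and z: "C z (%w. hat e (dist l w)) = 0"
 have e4: "0 < e / 4" using e by simp
 have "eventually (%k. dist (f k) l < e / 4) sequentially" using assms(2) e4 by (rule tendstoD)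
 then obtain k where k: "dist (f k) l < e / 4" by (auto simp: eventually_sequentially)
 have "null h (C z (%w. hat (e / 4) (dist (f k) w)))"
 proof (rule null_of_hat[OF h_pos(1) e])
  show "h (C z (%w. hat e (dist l w))) = 0" by (simp add: z clinear_zero[OF pos_fun_clinear[OF h_pos(1)]])
  show "cont (%w. hat (e / 4) (dist (f k) w))" by (rule cont_radial[OF continuous_hat])
  fix w assume "e / 2 <= dist l w"
  hence "e / 4 <= dist (f k) w" using k dist_triangle[of l w "f k"] by (simp add: dist_commute)
  thus "hat (e / 4) (dist (f k) w) = 0" by (rule hat_simps(2)[OF e4])
 qed
 hence "C z (%w. hat (e / 4) (dist (f k) w)) = 0" by (rule h_null)
 thus False using assms(1)[of k] e4 unfolding related_def by blast
qed

text \<open>Trilateration: a position of \<open>z\<close> at the wrong distance from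
  \<open>x'\<close> or \<open>m'\<close> has no mass by \<open>state_at_null\<close>, and only
  \<open>z0\<close> has both distances right.\<close>

lemma state_at_determined:
 assumes s: "state_at \<psi> x x'" "state_at \<psi> m m'" and u: "!!z'. dist x' z' = dist x z ==> dist m' z' = dist m z ==> z' = z0"
 shows "state_at \<psi> z z0"
proof (rule state_atI)
 show p: "positive_functional \<psi>" "\<psi> 1 = 1" using s by (auto simp: state_at_def)
 fix z' assume "z' ~= z0"
 have "\<exists>e>0. \<forall>v. cont v --> (\<forall>w. e <= dist z' w --> v w = 0) --> null \<psi> (C z v)"
 proof (cases "dist x' z' = dist x z")
  case True
  hence "dist m' z' ~= dist m z" using u \<open>z' ~= z0\<close> by blast
  then obtain e where "0 < e" "!!v. cont v ==> (!!w. e <= dist z' w ==> v w = 0) ==> null \<psi> (C z v)" using state_at_null[OF s(2)] by blast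
  thus ?thesis by blast
 next case False
  then obtain e where "0 < e" "!!v. cont v ==> (!!w. e <= dist z' w ==> v w = 0) ==> null \<psi> (C z v)" using state_at_null[OF s(1)] by blast
  thus ?thesis by blast
 qed
 thus "\<exists>e>0. \<forall>v. cont v --> (\<forall>w. e <= dist z' w --> v w = 0) --> \<psi> (C z v) = 0"
  using null_apply(1)[OF p(1), of _ 1] by simp blast
qed

end

section \<open>States concentrated at two points\<close>

definition ramp :: "real => real => real => real" where "ramp a b t = min 1 (hat (b - a) (t - a))"

lemma ramp_simps: "0 <= ramp a b t" "ramp a b t <= 1" "a < b ==> b <= t ==> ramp a b t = 0" "a < b ==> t <= a ==> ramp a b t = 1"
 by (auto simp: ramp_def hat_def divide_le_0_iff)

lemma continuous_ramp: "continuous_on UNIV (ramp a b)" unfolding ramp_def by (intro continuous_intros continuous_on_compose2[OF continuous_hat]) auto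

text \<open>The sum of the increments telescopes to at most \<open>2\<close>. Increments over two
  indices are taken so that an index in between can serve as a gap.\<close>

lemma small_increment_exists:
 fixes a :: "nat => real"
 assumes "!!i. 0 <= a i" "!!i. a i <= 1" "0 < K"
 obtains i where "i < K" "a (i + 2) - a i <= 2 / real K"
proof (rule ccontr)
 note obt = that
 assume "\<not> thesis"
 hence lt: "2 / real K < a (i + 2) - a i" if "i < K" for i using that \<open>\<not> thesis\<close> obt by (meson not_less)
 have "(\<Sum>i<K. 2 / real K) < (\<Sum>i<K. a (i + 2) - a i)" using assms(3) lt by (intro sum_strict_mono) auto
 moreover have "(\<Sum>i<n. a (i + 2) - a i) = a (n + 1) + a n - a 1 - a 0" for n by (induction n) auto
 ultimately show False using assms(1)[of 0] assms(1)[of 1] assms(2)[of "K + 1"] assms(2)[of K] assms(3) by simp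
qed

context isometric_family
begin

lemma vanish_near:
 fixes F u :: "'x => real"
 assumes "cont F" "t < F p" "!!w. t <= F w ==> u w = 0"
 shows "\<exists>e>0. \<forall>w. dist p w < e --> u w = 0"
proof -
 have "open {w. t < F w}" using assms(1) by (intro open_Collect_less continuous_intros)
 then obtain e where "e > 0" "!!w. dist w p < e ==> t < F w" using assms(2) unfolding open_dist by blast
 thus ?thesis using assms(3) by (metis dist_commute less_imp_le)
qed

lemma positive_gap:
 fixes F :: "'x \<times> 'x => real"
 assumes "continuous_on UNIV F" "closed K" "!!p. p \<in> K ==> 0 < F p"
 obtains s where "0 < s" "!!p. p \<in> K ==> s < F p"
proof (cases "K = {}")
 case False
 have "compact (UNIV :: ('x \<times> 'x) set)" using compact_Times[OF compact_UNIV compact_UNIV] by simp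
 hence "compact K" using assms(2) compact_Int_closed[of UNIV K] by simp
 then obtain p where p: "p \<in> K" "!!q. q \<in> K ==> F p <= F q" using continuous_attains_inf[OF _ False continuous_on_subset[OF assms(1)]] by auto
 show ?thesis using that[of "F p / 2"] p assms(3)[OF p(1)] by force
qed (use that[of 1] in auto)

text \<open>Conditioning on \<open>g\<close> at \<open>m\<close> hardly disturbs the certainty of
  \<open>c\<close> at \<open>y\<close>, although the two need not commute. Modulo null elements
  \<open>c g = u g\<close>, and \<open>u g\<close> differs from \<open>u\<close> by at most
  \<open>sqrt \<tau>\<close>, because \<open>u\<close> is killed by \<open>1 - g1\<close> and
  \<open>g1 - g\<close> is small. So \<open>c g\<close> carries almost all of the norm of
  \<open>g\<close>; since \<open>(1 - c)\<^sup>2 + c\<^sup>2 \<le> 1\<close>, little remains for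
  \<open>(1 - c) g\<close>.\<close>

lemma almost_absorbed:
 assumes p: "positive_functional \<psi>" "\<psi> 1 = 1" and c: "cont u" "cont c" "cont g" "cont g1"
  and b: "!!w. 0 <= u w" "!!w. u w <= 1" "!!w. 0 <= c w" "!!w. c w <= 1" "!!w. 0 <= g w" "!!w. g w <= g1 w" "!!w. g1 w <= 1"
  and n: "null \<psi> (C y (%w. c w - u w) * C m g)" "null \<psi> (C y u * C m (%w. 1 - g1 w))" "null \<psi> (C y (%w. 1 - c w))"
  and \<tau>: "Re (\<psi> (C m (%w. g1 w - g w))) <= \<tau>"
 shows "(functional_seminorm \<psi> (C y (%w. 1 - c w) * C m g))\<^sup>2 <= 3 * sqrt \<tau>"
proof -
 note cl = pos_fun_clinear[OF p(1)]
 define N where "N = functional_seminorm \<psi>"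
 have dif: "\<psi> (a - b) = \<psi> a - \<psi> b" for a b using clinear_add[OF cl, of a "- b"] clinear_minus[OF cl, of b] by simp
 have N0: "0 <= N a" for a unfolding N_def by (rule functional_seminorm_nonneg[OF p(1)])
 have tri: "N (a + b) <= N a + N b" for a b unfolding N_def by (rule functional_seminorm_triangle[OF p(1)])
 have Nm: "N (- a) = N a" for a unfolding N_def by (rule seminorm_minus[OF p(1)])
 have N_eq: "N a = N b" if "null \<psi> (a - b)" for a b using tri[of b "a - b"] tri[of a "- (a - b)"] that Nm[of "a - b"] by (simp add: N_def)
 have N_one: "N 1 = 1" unfolding N_def functional_seminorm_def by (simp add: p(2))
 have N_le: "cmod (\<psi> a) <= N a" for a using positive_functional_Cauchy_Schwarz[OF p(1), of 1 a] N_one by (simp add: N_def)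
 have contr: "N (C y u * a) <= N a" for a using functional_seminorm_mult_norm[OF p(1), of "C y u" a] C_norm[OF c(1), where B = 1 and x = y] b(1,2)
   mult_right_mono[of "norm (C y u)" 1 "N a"] N0[of a] unfolding N_def by (auto intro: order_trans)
 let ?Q = "C y u" and ?R = "C m g" and ?c = "C y c"
 have cd: "C y (%w. c w - u w) = ?c - ?Q" "C m (%w. 1 - g1 w) = 1 - C m g1" "C y (%w. 1 - c w) = 1 - ?c" "C m (%w. g1 w - g w) = C m g1 - ?R"
  by (simp_all add: C_diff C_one c continuous_on_const)
 have n1: "null \<psi> (?c * ?R - ?Q * ?R)" using n(1) unfolding cd by (simp add: left_diff_distrib)
 have QR: "N (?Q * ?R - ?Q) <= sqrt \<tau>"
 proof -
  have "N (?Q * ?R - ?Q) <= N (- (?Q * (C m g1 - ?R))) + N (- (?Q * (1 - C m g1)))"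
   using tri[of "- (?Q * (C m g1 - ?R))" "- (?Q * (1 - C m g1))"] by (simp add: right_diff_distrib)
  also have "N (- (?Q * (1 - C m g1))) = 0" using n(2) unfolding cd Nm by (simp add: N_def)
  also have "N (- (?Q * (C m g1 - ?R))) <= N (C m (%w. g1 w - g w))" unfolding Nm cd by (rule contr)
  finally have 1: "N (?Q * ?R - ?Q) <= N (C m (%w. g1 w - g w))" by simp
  have "(N (C m (%w. g1 w - g w)))\<^sup>2 <= Re (\<psi> (C m (%w. g1 w - g w)))"
  proof -
   have d: "cont (%w. g1 w - g w)" by (intro continuous_intros c)
   have "(g1 w - g w) * (g1 w - g w) <= g1 w - g w" for w using b(5-7)[of w] by (intro mult_left_le) auto
   thus ?thesis unfolding N_def seminorm_C_sq[OF p(1) d] by (intro C_mono[OF p(1)] continuous_on_mult d)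
  qed
  hence "N (C m (%w. g1 w - g w)) <= sqrt \<tau>" using \<tau> by (intro real_le_rsqrt) simp
  thus ?thesis using 1 by simp
 qed
 have left: "\<psi> (?c * a) = \<psi> a" for a using null_apply(2)[OF p(1) n(3), of a] C_star[of "%w. 1 - c w" y] c(2) unfolding cd
  by (simp add: left_diff_distrib dif continuous_intros)
 have sw: "?c * ?Q = ?Q * ?c" by (rule C_commute[OF c(2,1)])
 \<comment> \<open>\<psi> absorbs \<open>c\<close> on the left, and \<open>c\<close> commutes with
   \<open>u\<close> because both are evaluated at \<open>y\<close>; thus two factors
   \<open>c\<close> are traded for two factors \<open>u\<close>.\<close>
 have "\<psi> ?R = \<psi> (?c * (?c * ?R))" by (simp only: left)
 also have "\<dots> = \<psi> (?c * (?Q * ?R))" using null_apply(1)[OF p(1) n1, of ?c] by (simp add: right_diff_distrib dif)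
 also have "\<dots> = \<psi> (?Q * (?c * ?R))" by (simp only: mult.assoc[symmetric] sw)
 also have "\<dots> = \<psi> (?Q * (?Q * ?R))" using null_apply(1)[OF p(1) n1, of ?Q] by (simp add: right_diff_distrib dif)
 finally have eq: "\<psi> ?R - \<psi> (?Q * ?Q) = \<psi> (?Q * (?Q * ?R - ?Q))" by (simp add: right_diff_distrib dif)
 have "cmod (\<psi> ?R - \<psi> (?Q * ?Q)) <= sqrt \<tau>" unfolding eq using N_le[of "?Q * (?Q * ?R - ?Q)"] contr[of "?Q * ?R - ?Q"] QR by linarith
 hence 1: "Re (\<psi> ?R) - Re (\<psi> (?Q * ?Q)) <= sqrt \<tau>" using complex_Re_le_cmod[of "\<psi> ?R - \<psi> (?Q * ?Q)"] by simp
 have Qsq: "(N ?Q)\<^sup>2 = Re (\<psi> (?Q * ?Q))" unfolding N_def seminorm_C_sq[OF p(1) c(1)] by (simp only: C_mult[OF c(1,1)])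
 have Rsq: "(N ?R)\<^sup>2 <= Re (\<psi> ?R)"
 proof -
  have "g w * g w <= g w" for w using b(5-7)[of w] by (intro mult_left_le) auto
  thus ?thesis unfolding N_def seminorm_C_sq[OF p(1) c(3)] by (intro C_mono[OF p(1)] continuous_on_mult c)
 qed
 have "N ?Q <= N (?Q * ?R) + sqrt \<tau>" using tri[of "?Q * ?R" "- (?Q * ?R - ?Q)"] Nm[of "?Q * ?R - ?Q"] QR by simp
 hence a: "N ?Q - sqrt \<tau> <= N (?c * ?R)" using N_eq[OF n1] by simp
 have q1: "N ?Q <= 1" using contr[of 1] N_one by simp
 have \<tau>0: "0 <= sqrt \<tau>" using QR N0 order_trans by blast
 have "(N ?Q)\<^sup>2 - 2 * sqrt \<tau> <= (N (?c * ?R))\<^sup>2"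
 proof (cases "sqrt \<tau> <= N ?Q")
  case True
  hence "(N ?Q - sqrt \<tau>)\<^sup>2 <= (N (?c * ?R))\<^sup>2" using a by (intro power_mono) auto
  moreover have "N ?Q * sqrt \<tau> <= 1 * sqrt \<tau>" by (rule mult_right_mono[OF q1 \<tau>0])
  moreover have "(N ?Q - sqrt \<tau>)\<^sup>2 = (N ?Q)\<^sup>2 - 2 * (N ?Q * sqrt \<tau>) + (sqrt \<tau>)\<^sup>2"
   by (simp add: power2_eq_square algebra_simps)
  ultimately show ?thesis using zero_le_power2[of "sqrt \<tau>"] by linarith
 next case False
  hence "N ?Q * N ?Q <= 1 * sqrt \<tau>" using q1 N0 by (intro mult_mono) auto
  thus ?thesis using \<tau>0 zero_le_power2[of "N (?c * ?R)"] unfolding power2_eq_square by linarith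
 qed
 moreover have "(N (C y (%w. 1 - c w) * ?R))\<^sup>2 + (N (?c * ?R))\<^sup>2 <= (N ?R)\<^sup>2"
 proof -
  let ?\<phi> = "%a. \<psi> (star ?R * a * ?R)"
  have \<phi>: "positive_functional ?\<phi>" by (rule positive_functional_conj[OF p(1)])
  have sq: "(N (C y v * ?R))\<^sup>2 = Re (?\<phi> (C y (%w. v w * v w)))" if v: "cont v" for v
   using functional_seminorm_sq[OF p(1), of "C y v * ?R"] C_star[OF v, of y] unfolding N_def C_mult[OF v v] by (simp add: star_mult mult.assoc)
  have d: "cont (%w. 1 - c w)" by (intro continuous_intros c)
  have d2: "cont (%w. (1 - c w) * (1 - c w))" "cont (%w. c w * c w)" by (intro continuous_on_mult c d)+
  have "Re (?\<phi> (C y (%w. (1 - c w) * (1 - c w) + c w * c w))) <= Re (?\<phi> (C y (%w. 1)))"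
  proof (rule C_mono[OF \<phi>])
   show "(1 - c w) * (1 - c w) + c w * c w <= 1" for w using mult_left_le[OF b(4)[of w] b(3)[of w]] by (simp add: algebra_simps)
  qed (intro continuous_on_add d2 continuous_on_const)+
  hence "(N (C y (%w. 1 - c w) * ?R))\<^sup>2 + (N (?c * ?R))\<^sup>2 <= Re (?\<phi> 1)"
   unfolding sq[OF d] sq[OF c(2)] by (simp add: C_add[OF d2] C_one clinear_add[OF pos_fun_clinear[OF \<phi>]])
  also have "Re (?\<phi> 1) = (N ?R)\<^sup>2" using functional_seminorm_sq[OF p(1), of ?R] by (simp add: N_def)
  finally show ?thesis .
 qed
 ultimately show ?thesis using 1 Qsq Rsq unfolding N_def by linarith
qed

text \<open>The link between \<open>m\<close> and \<open>y\<close> is a function \<open>u\<close> of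
  the position of \<open>y\<close> alone that detects whether the midpoint between \<open>x'\<close>
  and this position is near \<open>m'\<close>; \<open>mid\<close> makes this midpoint unique. Such a
  cutoff needs a transition zone, and the mass of \<psi> in that zone has to be small relative to
  the mass of \<open>g\<close>. One of \<open>K\<close> nested shells achieves this, because the
  mass of \<open>g\<close> is bounded below by \<open>p0\<close> uniformly in the shells.\<close>

lemma concentration:
 assumes s: "state_at \<psi> x x'" and d: "dist x m = \<delta>" "dist m y = \<delta>" "dist x y = 2 * \<delta>"
  and mid: "!!y1 m1 m2. dist x' y1 = 2 * \<delta> ==> dist x' m1 = \<delta> ==> dist m1 y1 = \<delta> ==>
   dist x' m2 = \<delta> ==> dist m2 y1 = \<delta> ==> m1 = m2"
  and m': "dist x' m' = \<delta>" "!!e. 0 < e ==> \<psi> (C m (%w. hat e (dist m' w))) ~= 0"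
  and y': "dist x' y' = 2 * \<delta>" "dist m' y' = \<delta>" and e: "0 < e"
 obtains g c where "cont g" "cont c" "!!w. 0 <= c w" "!!w. c w <= 1"
  "!!w. e <= dist m' w ==> g w = 0" "!!w. e <= \<bar>dist x' w - 2 * \<delta>\<bar> ==> c w = 0"
  "0 < functional_seminorm \<psi> (C m g)"
  "functional_seminorm \<psi> (C y (%w. 1 - c w) * C m g) <= e * functional_seminorm \<psi> (C m g)"
proof -
 have p: "positive_functional \<psi>" "\<psi> 1 = 1" using s by (auto simp: state_at_def)
 define h0 where "h0 = (%w. hat (e / 2) (dist m' w))"
 have h0: "cont h0" unfolding h0_def by (rule cont_radial[OF continuous_hat])
 define p0 where "p0 = (functional_seminorm \<psi> (C m h0))\<^sup>2"
 have "\<not> null \<psi> (C m h0)" using null_apply(1)[OF p(1), of "C m h0" 1] m'(2)[of "e / 2"] e unfolding h0_def by auto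
 hence p0: "0 < p0" by (simp add: p0_def)
 \<comment> \<open>With \<open>\<tau> = 2 / K\<close> the bound of \<open>almost_absorbed\<close> is
   \<open>3 * sqrt (2 / K) = sqrt (18 / K)\<close>, and this is to be at most
   \<open>e\<^sup>2 * p0\<close>.\<close>
 obtain K where K: "18 / (e\<^sup>2 * p0)\<^sup>2 < real K" using reals_Archimedean2 by blast
 have ep: "0 < (e\<^sup>2 * p0)\<^sup>2" using e p0 by simp
 hence K0: "0 < K" using K by (metis divide_nonneg_pos gr0I not_less of_nat_0 zero_le_numeral)
 define t where "t = (%i. e / 2 + e / 2 * (real i / real (K + 4)))"
 have t_less: "t i < t j" if "i < j" for i j
  using that e unfolding t_def by (intro add_strict_left_mono mult_strict_left_mono divide_strict_right_mono) auto
 have t_ge: "e / 2 <= t i" for i using e by (simp add: t_def)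
 have t_le: "t i <= e" if "i <= K + 4" for i
 proof -
  have "real i / real (K + 4) <= 1" using that by (subst divide_le_eq_1) auto
  hence "e / 2 * (real i / real (K + 4)) <= e / 2 * 1" using e by (intro mult_left_mono) auto
  thus ?thesis unfolding t_def by linarith
 qed
 define G where "G = (%i w. ramp (t i) (t (Suc i)) (dist m' w))"
 have G: "cont (G i)" for i unfolding G_def by (rule cont_radial[OF continuous_ramp])
 have G01: "0 <= G i w" "G i w <= 1" for i w by (auto simp: G_def ramp_simps)
 have G0: "G i w = 0" if "t (Suc i) <= dist m' w" for i w unfolding G_def by (rule ramp_simps(3)[OF t_less[OF lessI] that])
 have G1: "G i w = 1" if "dist m' w <= t i" for i w unfolding G_def by (rule ramp_simps(4)[OF t_less[OF lessI] that])
 have rel: "0 <= Re (\<psi> (C m (G i)))" "Re (\<psi> (C m (G i))) <= 1" for i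
  using C_mono[OF p(1) continuous_on_const[of _ 0] G G01(1), of m] C_mono[OF p(1) G continuous_on_const[of _ 1] G01(2), of m]
  by (simp_all add: C_zero C_one p(2) clinear_zero[OF pos_fun_clinear[OF p(1)]])
 obtain i where i: "i < K" "Re (\<psi> (C m (G (i + 2)))) - Re (\<psi> (C m (G i))) <= 2 / real K"
  using small_increment_exists[where a = "%i. Re (\<psi> (C m (G i)))", OF rel K0] by blast
 \<comment> \<open>\<open>G i\<close> vanishes beyond \<open>a\<close> and \<open>G (i + 2)\<close>
   equals \<open>1\<close> up to \<open>b\<close>. Skipping \<open>G (i + 1)\<close> leaves the gap
   in which the cutoff \<open>f\<close> can switch.\<close>
 define a where "a = t (i + 1)"
 define b where "b = t (i + 2)"
 have ab: "a < b" unfolding a_def b_def by (rule t_less) simp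
 have "a <= e" unfolding a_def using i(1) by (intro t_le) simp
 have "0 < a" unfolding a_def using t_ge[of "i + 1"] e by linarith
 let ?E = "%q :: 'x \<times> 'x. dist x' (snd q) = \<delta> & dist (snd q) (fst q) = \<delta>"
 have c: "closed {q. ?E q}" by (intro closed_Collect_conj closed_Collect_eq continuous_intros)
 \<comment> \<open>The possible positions of \<open>y\<close> when \<open>m\<close> is sent within
   \<open>a\<close> of \<open>m'\<close>; as a projection of a compact set of pairs,
   \<open>Y\<close> is closed.\<close>
 define Y where "Y = fst ` {q. dist x' (fst q) = 2 * \<delta> & ?E q & dist m' (snd q) <= a}"
 have Y_iff: "y1 \<in> Y \<longleftrightarrow> dist x' y1 = 2 * \<delta> & (\<exists>m1. dist x' m1 = \<delta> & dist m1 y1 = \<delta> & dist m' m1 <= a)" for y1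
  by (auto simp: Y_def image_iff Bex_def)
 have "compact (UNIV :: ('x \<times> 'x) set)" using compact_Times[OF compact_UNIV compact_UNIV] by simp
 hence cS: "closed S ==> compact S" for S :: "('x \<times> 'x) set" using compact_Int_closed[of UNIV S] by simp
 have "compact {q. dist x' (fst q) = 2 * \<delta> & ?E q & dist m' (snd q) <= a}"
  by (intro cS closed_Collect_conj c closed_Collect_eq closed_Collect_le continuous_intros)
 hence "closed Y" unfolding Y_def by (intro compact_imp_closed compact_continuous_image continuous_intros)
 have "y' \<in> Y" unfolding Y_iff using y' m'(1) \<open>0 < a\<close> by (auto intro!: exI[of _ m'])
 hence "Y ~= {}" by blast
 have Y0: "infdist y1 Y = 0 \<longleftrightarrow> y1 \<in> Y" for y1
  using in_closed_iff_infdist_zero[OF \<open>closed Y\<close> \<open>Y ~= {}\<close>] by simp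
 let ?D = "%q :: 'x \<times> 'x. \<bar>dist x' (fst q) - 2 * \<delta>\<bar>"
 obtain s1 where s1: "0 < s1" "!!q. q \<in> {q. ?E q & b <= dist m' (snd q)} ==>
   s1 < max (infdist (fst q) Y) (?D q)"
 proof (rule positive_gap[where F = "%q. max (infdist (fst q) Y) (?D q)"])
  show "continuous_on UNIV (%q. max (infdist (fst q) Y) (?D q))" by (intro continuous_intros)
  show "closed {q. ?E q & b <= dist m' (snd q)}" by (intro closed_Collect_conj c closed_Collect_le continuous_intros)
  fix q assume q: "q \<in> {q. ?E q & b <= dist m' (snd q)}"
  show "0 < max (infdist (fst q) Y) (?D q)"
  proof (rule ccontr)
   assume "\<not> ?thesis"
   hence "infdist (fst q) Y = 0" "dist x' (fst q) = 2 * \<delta>" using infdist_nonneg[of "fst q" Y] by auto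
   hence "fst q \<in> Y" using Y0 by blast
   then obtain m1 where m1: "dist x' m1 = \<delta>" "dist m1 (fst q) = \<delta>" "dist m' m1 <= a" unfolding Y_iff by blast
   have "m1 = snd q" using q by (intro mid[OF \<open>dist x' (fst q) = 2 * \<delta>\<close> m1(1,2)]) auto
   thus False using q m1(3) ab by auto
  qed
 qed blast
 obtain s2 where s2: "0 < s2" "!!q. q \<in> {q. ?E q & dist m' (snd q) <= a
   & s1 / 2 <= infdist (fst q) Y} ==> s2 < ?D q"
 proof (rule positive_gap[where F = ?D])
  show "continuous_on UNIV ?D" by (intro continuous_intros)
  show "closed {q. ?E q & dist m' (snd q) <= a & s1 / 2 <= infdist (fst q) Y}" by (intro closed_Collect_conj c closed_Collect_le continuous_intros)
  fix q assume q: "q \<in> {q. ?E q & dist m' (snd q) <= a & s1 / 2 <= infdist (fst q) Y}"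
  show "0 < ?D q"
  proof (rule ccontr)
   assume "\<not> ?thesis"
   hence "fst q \<in> Y" unfolding Y_iff using q by auto
   hence "infdist (fst q) Y = 0" using Y0 by blast
   thus False using q s1(1) by auto
  qed
 qed blast
 define \<eta> where "\<eta> = min e (min s1 s2)"
 have \<eta>: "0 < \<eta>" "\<eta> <= e" "\<eta> <= s1" "\<eta> <= s2" using e s1(1) s2(1) by (auto simp: \<eta>_def)
 define f where "f = (%w. ramp (s1 / 2) s1 (infdist w Y))"
 define c where "c = (%w. ramp (\<eta> / 2) \<eta> \<bar>dist x' w - 2 * \<delta>\<bar>)"
 have fc: "cont f" "cont c" unfolding f_def c_def by (intro continuous_on_compose2[OF continuous_ramp] continuous_intros subset_UNIV)+
 define u where "u = (%w. f w * c w)"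
 have u: "cont u" unfolding u_def by (intro continuous_on_mult fc)
 have r01: "0 <= f w" "f w <= 1" "0 <= c w" "c w <= 1" for w by (auto simp: f_def c_def ramp_simps)
 have f1: "f w = 1" if "infdist w Y <= s1 / 2" for w using that s1(1) unfolding f_def by (intro ramp_simps(4)) auto
 have f0: "f w = 0" if "s1 <= infdist w Y" for w using that s1(1) unfolding f_def by (intro ramp_simps(3)) auto
 have c0: "c w = 0" if "\<eta> <= \<bar>dist x' w - 2 * \<delta>\<bar>" for w using that \<eta>(1) unfolding c_def by (intro ramp_simps(3)) auto
 have c1: "c w = 1" if "\<bar>dist x' w - 2 * \<delta>\<bar> <= \<eta> / 2" for w using that \<eta>(1) unfolding c_def by (intro ramp_simps(4)) auto
 have cD: "cont (%w. \<bar>dist x' w - 2 * \<delta>\<bar>)" by (intro continuous_intros)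
 have cM: "cont (dist m')" by (intro continuous_intros)
 have cI: "cont (%w. infdist w Y)" by (intro continuous_intros)
 have "null \<psi> (C y (%w. c w - u w) * C m (G i))"
 proof (rule pair_null[OF s continuous_on_diff[OF fc(2) u] G])
  fix m1 y1 assume q: "dist x' m1 = dist x m" "dist m1 y1 = dist m y"
  show "(\<exists>e>0. \<forall>w. dist m1 w < e --> G i w = 0) \<or> (\<exists>e>0. \<forall>w. dist y1 w < e --> c w - u w = 0)"
  proof (cases "dist m' m1 <= a")
   case False
   hence "\<exists>e>0. \<forall>w. dist m1 w < e --> G i w = 0" by (intro vanish_near[OF cM, of a]) (auto intro: G0 simp: a_def)
   thus ?thesis by blast
  next case True
   show ?thesis
   proof (cases "s1 / 2 <= infdist y1 Y")
    case 1: True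
    have "s2 < ?D (y1, m1)" using q d True 1 by (intro s2(2)) auto
    hence "\<exists>e>0. \<forall>w. dist y1 w < e --> c w - u w = 0" using \<eta>(4) by (intro vanish_near[OF cD, of \<eta>]) (auto simp: u_def c0)
    thus ?thesis by blast
   next case False
    have cI': "cont (%w. - infdist w Y)" by (intro continuous_intros)
    have "\<exists>e>0. \<forall>w. dist y1 w < e --> c w - u w = 0" using False by (intro vanish_near[OF cI', of "- (s1 / 2)"]) (auto simp: u_def f1)
    thus ?thesis by blast
   qed
  qed
 qed
 moreover have "null \<psi> (C y u * C m (%w. 1 - G (i + 2) w))"
 proof (rule pair_null[OF s u continuous_on_diff[OF continuous_on_const G]])
  fix m1 y1 assume q: "dist x' m1 = dist x m" "dist m1 y1 = dist m y"
  show "(\<exists>e>0. \<forall>w. dist m1 w < e --> 1 - G (i + 2) w = 0) \<or> (\<exists>e>0. \<forall>w. dist y1 w < e --> u w = 0)"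
  proof (cases "b <= dist m' m1")
   case False
   have cM': "cont (%w. - dist m' w)" by (intro continuous_intros)
   have "\<exists>e>0. \<forall>w. dist m1 w < e --> 1 - G (i + 2) w = 0" using False by (intro vanish_near[OF cM', of "- b"]) (auto simp: b_def G1)
   thus ?thesis by blast
  next case True
   have "s1 < max (infdist y1 Y) (?D (y1, m1))" using s1(2)[of "(y1, m1)"] q d True by auto
   then consider "s1 < infdist y1 Y" | "s1 < \<bar>dist x' y1 - 2 * \<delta>\<bar>" by (auto simp: less_max_iff_disj)
   hence "\<exists>e>0. \<forall>w. dist y1 w < e --> u w = 0"
   proof cases
    case 1
    thus ?thesis by (intro vanish_near[OF cI, of s1]) (auto simp: u_def f0)
   next case 2
    thus ?thesis using \<eta>(3) by (intro vanish_near[OF cD, of \<eta>]) (auto simp: u_def c0)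
   qed
   thus ?thesis by blast
  qed
 qed
 moreover have "null \<psi> (C y (%w. 1 - c w))"
 proof (rule single_null[OF s continuous_on_diff[OF continuous_on_const fc(2)]])
  fix y1 assume "dist x' y1 = dist x y"
  have cD': "cont (%w. - \<bar>dist x' w - 2 * \<delta>\<bar>)" by (intro continuous_intros)
  show "\<exists>e>0. \<forall>w. dist y1 w < e --> 1 - c w = 0"
   using \<open>dist x' y1 = dist x y\<close> d(3) \<eta>(1) by (intro vanish_near[OF cD', of "- (\<eta> / 2)"]) (auto simp: c1)
 qed
 moreover have "Re (\<psi> (C m (%w. G (i + 2) w - G i w))) <= 2 / real K"
  using i(2) clinear_add[OF pos_fun_clinear[OF p(1)], of "C m (G (i + 2))" "- C m (G i)"]
   clinear_minus[OF pos_fun_clinear[OF p(1)], of "C m (G i)"] by (simp add: C_diff G)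
 moreover have GG: "G i w <= G (i + 2) w" for w
 proof (cases "dist m' w <= t (i + 2)")
  case True
  thus ?thesis using G1[of w "i + 2"] G01(2)[of i w] by simp
 next case False
  hence "t (Suc i) <= dist m' w" using t_less[of "Suc i" "i + 2"] by simp
  thus ?thesis using G0 G01(1) by simp
 qed
 moreover have "0 <= u w" "u w <= 1" for w using r01[of w] by (auto simp: u_def intro: mult_le_one)
 ultimately have le: "(functional_seminorm \<psi> (C y (%w. 1 - c w) * C m (G i)))\<^sup>2 <= 3 * sqrt (2 / real K)"
  by (intro almost_absorbed[OF p u fc(2) G G] r01(3,4) G01)
 have "3 * sqrt (2 / real K) = sqrt (18 / real K)" by (rule power2_eq_imp_eq) (auto simp: power_mult_distrib)
 also have "\<dots> <= sqrt ((e\<^sup>2 * p0)\<^sup>2)" using K K0 ep by (intro real_sqrt_le_mono) (simp add: field_simps)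
 also have "\<dots> = e\<^sup>2 * p0" using e p0 by simp
 also have "\<dots> <= e\<^sup>2 * (functional_seminorm \<psi> (C m (G i)))\<^sup>2"
 proof -
  have hG: "h0 w <= G i w" for w
  proof (cases "dist m' w < e / 2")
   case True
   thus ?thesis using t_ge[of i] G1[of w i] hat_simps(3)[of "e / 2" "dist m' w"] e by (simp add: h0_def)
  next case False
   thus ?thesis using hat_simps(2)[of "e / 2" "dist m' w"] e G01(1) by (simp add: h0_def)
  qed
  have "p0 <= (functional_seminorm \<psi> (C m (G i)))\<^sup>2" unfolding p0_def seminorm_C_sq[OF p(1) h0] seminorm_C_sq[OF p(1) G]
  proof (rule C_mono[OF p(1) continuous_on_mult[OF h0 h0] continuous_on_mult[OF G G]])
   show "h0 w * h0 w <= G i w * G i w" for w using hG[of w] hat_simps(1) G01(1) by (intro mult_mono) (auto simp: h0_def)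
  qed
  thus ?thesis by (intro mult_left_mono) auto
 qed
 finally have fin: "3 * sqrt (2 / real K) <= (e * functional_seminorm \<psi> (C m (G i)))\<^sup>2" by (simp add: power_mult_distrib)
 show ?thesis
 proof (rule that[OF G fc(2) r01(3,4)])
  show "G i w = 0" if "e <= dist m' w" for w using that \<open>a <= e\<close> by (intro G0) (simp add: a_def)
  show "c w = 0" if "e <= \<bar>dist x' w - 2 * \<delta>\<bar>" for w using that \<eta>(2) by (intro c0) linarith
  show "functional_seminorm \<psi> (C y (%w. 1 - c w) * C m (G i)) <= e * functional_seminorm \<psi> (C m (G i))"
   using order_trans[OF le fin] e functional_seminorm_nonneg[OF p(1)] by (meson less_imp_le mult_nonneg_nonneg power2_le_imp_le)
  have "0 < 3 * sqrt (2 / real K)" using K0 by simp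
  thus "0 < functional_seminorm \<psi> (C m (G i))"
   using fin functional_seminorm_nonneg[OF p(1), of "C m (G i)"] by (metis less_eq_real_def mult_zero_right not_less power_zero_numeral)
 qed
qed

text \<open>Compression at \<open>m\<close> concentrates the state at \<open>m'\<close>. For the
  bumps of \<open>concentration\<close> it also keeps \<open>y\<close> on the sphere of radius
  \<open>2 * \<delta>\<close> about \<open>x'\<close>, which together with distance \<delta> from
  \<open>m'\<close> leaves only \<open>y'\<close>.\<close>

lemma two_point_state:
 assumes s: "state_at \<psi> x x'" and d: "dist x m = \<delta>" "dist m y = \<delta>" "dist x y = 2 * \<delta>"
  and mid: "!!y1 m1 m2. dist x' y1 = 2 * \<delta> ==> dist x' m1 = \<delta> ==> dist m1 y1 = \<delta> ==>
   dist x' m2 = \<delta> ==> dist m2 y1 = \<delta> ==> m1 = m2"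
  and m': "dist x' m' = \<delta>" "!!e. 0 < e ==> \<psi> (C m (%w. hat e (dist m' w))) ~= 0"
  and y': "dist x' y' = 2 * \<delta>" "dist m' y' = \<delta>"
  and uniq: "!!z. dist x' z = 2 * \<delta> ==> dist m' z = \<delta> ==> z = y'"
 obtains \<psi>1 where "state_at \<psi>1 m m'" "state_at \<psi>1 y y'"
proof -
 have p: "positive_functional \<psi>" "\<psi> 1 = 1" using s by (auto simp: state_at_def)
 define N where "N = functional_seminorm \<psi>"
 define \<epsilon> where "\<epsilon> = (%n. 1 / real (Suc n))"
 have \<epsilon>: "0 < \<epsilon> n" for n by (simp add: \<epsilon>_def)
 have "\<exists>g c. cont g & cont c & (\<forall>w. 0 <= c w) & (\<forall>w. c w <= 1) & (\<forall>w. \<epsilon> n <= dist m' w --> g w = 0)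
   & (\<forall>w. \<epsilon> n <= \<bar>dist x' w - 2 * \<delta>\<bar> --> c w = 0) & 0 < N (C m g) & N (C y (%w. 1 - c w) * C m g) <= \<epsilon> n * N (C m g)" for n
  unfolding N_def by (rule concentration[OF s d mid m' y' \<epsilon>]) (assumption | blast)+
 then obtain g c where gc: "!!n. cont (g n)" "!!n. cont (c n)" "!!n w. 0 <= c n w" "!!n w. c n w <= 1"
  "!!n w. \<epsilon> n <= dist m' w ==> g n w = 0" "!!n w. \<epsilon> n <= \<bar>dist x' w - 2 * \<delta>\<bar> ==> c n w = 0"
  "!!n. 0 < N (C m (g n))" "!!n. N (C y (%w. 1 - c n w) * C m (g n)) <= \<epsilon> n * N (C m (g n))" by metis
 obtain \<psi>1 where \<psi>1: "state_at \<psi>1 m m'" "!!y v. cont v ==>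
  (%n. N (C y v * C m (g n)) / N (C m (g n))) ----> 0 ==> null \<psi>1 (C y v)"
  unfolding N_def by (rule compress[OF p(1), of g m' m]) (use gc(1,5,7) in "auto simp: N_def \<epsilon>_def")
 have p1: "positive_functional \<psi>1" "\<psi>1 1 = 1" using \<psi>1(1) by (auto simp: state_at_def)
 have "state_at \<psi>1 y y'"
 proof (rule state_atI[OF p1])
  fix z assume "z ~= y'"
  define r where "r = dist z y' / 2"
  have r: "0 < r" using \<open>z ~= y'\<close> by (simp add: r_def)
  let ?F = "%q :: 'x \<times> 'x. max (dist m' (snd q)) \<bar>dist x' (fst q) - 2 * \<delta>\<bar>"
  \<comment> \<open>By compactness, a pair at distance \<delta> whose second point is near
    \<open>z\<close> misses \<open>m'\<close> or the sphere about \<open>x'\<close> by a definite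
    amount, for otherwise its second point would be \<open>y'\<close>.\<close>
  obtain \<gamma> where \<gamma>: "0 < \<gamma>" "!!q. q \<in> {q. dist (snd q) (fst q) = \<delta> & dist z (fst q) <= r} ==> \<gamma> < ?F q"
  proof (rule positive_gap[where F = ?F])
   show "continuous_on UNIV ?F" by (intro continuous_intros)
   show "closed {q :: 'x \<times> 'x. dist (snd q) (fst q) = \<delta> & dist z (fst q) <= r}"
    by (intro closed_Collect_conj closed_Collect_eq closed_Collect_le continuous_intros)
   fix q :: "'x \<times> 'x" assume q: "q \<in> {q. dist (snd q) (fst q) = \<delta> & dist z (fst q) <= r}"
   show "0 < ?F q"
   proof (rule ccontr)
    assume "\<not> ?thesis"
    hence "m' = snd q" "dist x' (fst q) = 2 * \<delta>" by (auto simp: max_def not_less split: if_splits)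
    hence "fst q = y'" using q by (intro uniq) auto
    thus False using q r by (simp add: r_def)
   qed
  qed blast
  have "\<psi>1 (C y v) = 0" if v: "cont v" "\<forall>w. r <= dist z w --> v w = 0" for v
  proof -
   have "bounded (range v)" using compact_continuous_image[OF v(1) compact_UNIV] by (rule compact_imp_bounded)
   then obtain B0 where B0: "!!w. \<bar>v w\<bar> <= B0" unfolding bounded_iff by auto
   hence "0 <= B0" using abs_ge_zero order_trans by blast
   hence B: "norm (C y v) <= B0" using B0 by (intro C_norm[OF v(1)])
   obtain n0 where n0: "\<epsilon> n0 < \<gamma>" using nat_approx_posE[OF \<gamma>(1)] unfolding \<epsilon>_def by blast
   have le: "N (C y v * C m (g n)) / N (C m (g n)) <= B0 * \<epsilon> n" if n: "n0 <= n" for n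
   proof -
    have "\<epsilon> n <= \<epsilon> n0" using n unfolding \<epsilon>_def by (intro divide_left_mono) auto
    hence n\<gamma>: "\<epsilon> n < \<gamma>" using n0 by linarith
    have "null \<psi> (C y (%w. v w * c n w) * C m (g n))"
    proof (rule pair_null[OF s continuous_on_mult[OF v(1) gc(2)] gc(1)])
     fix m1 y1 assume q: "dist x' m1 = dist x m" "dist m1 y1 = dist m y"
     show "(\<exists>e>0. \<forall>w. dist m1 w < e --> g n w = 0) \<or> (\<exists>e>0. \<forall>w. dist y1 w < e --> v w * c n w = 0)"
     proof (cases "dist z y1 <= r")
      case True
      have "\<gamma> < ?F (y1, m1)" using \<gamma>(2)[of "(y1, m1)"] q d True by auto
      then consider "\<gamma> < dist m' m1" | "\<gamma> < \<bar>dist x' y1 - 2 * \<delta>\<bar>" by (auto simp: less_max_iff_disj)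
      thus ?thesis
      proof cases
       case 1
       have cM: "cont (dist m')" by (intro continuous_intros)
       have "\<exists>e>0. \<forall>w. dist m1 w < e --> g n w = 0" using 1 n\<gamma> by (intro vanish_near[OF cM, of "\<epsilon> n"] gc(5)) auto
       thus ?thesis by blast
      next case 2
       have cD: "cont (%w. \<bar>dist x' w - 2 * \<delta>\<bar>)" by (intro continuous_intros)
       have "\<exists>e>0. \<forall>w. dist y1 w < e --> v w * c n w = 0"
        using 2 n\<gamma> by (intro vanish_near[OF cD, of "\<epsilon> n"]) (auto simp: gc(6))
       thus ?thesis by blast
      qed
     next case False
      have cZ: "cont (dist z)" by (intro continuous_intros)
      have "\<exists>e>0. \<forall>w. dist y1 w < e --> v w * c n w = 0" using False v(2) by (intro vanish_near[OF cZ, of r]) auto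
      thus ?thesis by blast
     qed
    qed
    hence z: "N (C y (%w. v w * c n w) * C m (g n)) = 0" by (simp add: N_def)
    have d1: "cont (%w. 1 - c n w)" by (intro continuous_intros gc)
    have "v = (%w. v w * c n w + v w * (1 - c n w))" by (simp add: algebra_simps)
    hence "C y v = C y (%w. v w * c n w) + C y v * C y (%w. 1 - c n w)"
     using C_add[OF continuous_on_mult[OF v(1) gc(2)] continuous_on_mult[OF v(1) d1], of y n] unfolding C_mult[OF v(1) d1] by simp
    hence "C y v * C m (g n) = C y (%w. v w * c n w) * C m (g n) + C y v * (C y (%w. 1 - c n w) * C m (g n))" by (metis distrib_right mult.assoc)
    hence "N (C y v * C m (g n)) <= 0 + N (C y v * (C y (%w. 1 - c n w) * C m (g n)))"
     using functional_seminorm_triangle[OF p(1), of "C y (%w. v w * c n w) * C m (g n)"] z unfolding N_def by simp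
    also have "\<dots> <= norm (C y v) * N (C y (%w. 1 - c n w) * C m (g n))" unfolding N_def using functional_seminorm_mult_norm[OF p(1)] by simp
    also have "\<dots> <= B0 * (\<epsilon> n * N (C m (g n)))"
     using B gc(8)[of n] \<open>0 <= B0\<close> functional_seminorm_nonneg[OF p(1)] unfolding N_def by (intro mult_mono) auto
    finally show ?thesis using gc(7)[of n] by (simp add: divide_le_eq mult.assoc)
   qed
   have ge: "0 <= N (C y v * C m (g n)) / N (C m (g n))" for n using functional_seminorm_nonneg[OF p(1)] by (simp add: N_def)
   have "\<epsilon> ----> 0" using LIMSEQ_inverse_real_of_nat by (simp add: \<epsilon>_def inverse_eq_divide)
   hence lim: "(%n. B0 * \<epsilon> n) ----> 0" by (rule tendsto_mult_right_zero)
   have "(%n. N (C y v * C m (g n)) / N (C m (g n))) ----> 0"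
   proof (rule tendsto_sandwich[OF _ _ tendsto_const lim])
    show "\<forall>\<^sub>F n in sequentially. 0 <= N (C y v * C m (g n)) / N (C m (g n))" using ge by (intro always_eventually allI)
    show "\<forall>\<^sub>F n in sequentially. N (C y v * C m (g n)) / N (C m (g n)) <= B0 * \<epsilon> n"
     by (rule eventually_sequentiallyI[of n0]) (rule le)
   qed
   hence "null \<psi>1 (C y v)" by (rule \<psi>1(2)[OF v(1)])
   thus ?thesis using null_apply(1)[OF p1(1), of "C y v" 1] by simp
  qed
  thus "\<exists>e>0. \<forall>u. cont u --> (\<forall>w. e <= dist z w --> u w = 0) --> \<psi>1 (C y u) = 0" using r by blast
 qed
 thus ?thesis using that \<psi>1(1) by blast
qed

end

section \<open>Transport along discrete geodesics\<close>

locale isometric_geodesic_family = isometric_family P h \<kappa> + metric: convex_geodesic_space r "TYPE('x)"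
 for P :: "'x::metric_space => 'x cfun => 'a::cstar_algebra" and h \<kappa> and r :: real
begin

lemma extension_half_unique:
 assumes "0 < \<delta>" "\<delta> <= r / 16" "dist p q = \<delta>" "dist q z = \<delta>" "dist p z = 2 * \<delta>" "dist q z' = \<delta>" "dist p z' = 2 * \<delta>"
 shows "(z :: 'x) = z'"
proof (rule metric.extension_unique[of p q \<delta>])
 show "p ~= q" "dist p q < r" "\<delta> < r" using assms metric.r_pos by auto
qed (use assms in auto)

lemma state_at_unique:
 assumes "state_at \<psi> x x'" "state_at \<psi> x x''"
 shows "x' = x''"
proof -
 have "cont (dist x')" by (intro continuous_intros)
 hence "complex_of_real (dist x' x') = complex_of_real (dist x' x'')" using assms unfolding state_at_def by metis
 thus ?thesis by simp
qed

text \<open>\<open>m'\<close> is any point in the support of the law at \<open>m\<close>, and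
  \<open>c 2\<close> prolongs the segment from \<open>x'\<close> to \<open>m'\<close>. Once the
  state is concentrated at \<open>m'\<close> and \<open>c 2\<close>, the position \<open>x'\<close>
  of \<open>x\<close> is recovered by unique extension in the backward direction.\<close>

lemma first_step:
 assumes s: "state_at \<psi> x x'" and d: "dist x m = \<delta>" "dist m y = \<delta>" "dist x y = 2 * \<delta>" and \<delta>: "0 < \<delta>" "\<delta> <= r / 16"
 obtains \<psi>1 c where "state_at \<psi>1 x x'" "state_at \<psi>1 m (c 1)" "c 0 = x'" "dist (c 0) (c 1) = \<delta>" "!!N. chain N c"
proof -
 have p: "positive_functional \<psi>" "\<psi> 1 = 1" using s by (auto simp: state_at_def)
 obtain m' where m': "!!e. 0 < e ==> \<psi> (C m (%w. hat e (dist m' w))) ~= 0" using support_exists[OF p] by blast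
 have xm: "dist x' m' = \<delta>"
 proof (rule ccontr)
  assume "dist x' m' ~= \<delta>"
  hence "dist x' m' ~= dist x m" using d by simp
  then obtain e where e: "0 < e" "!!v. cont v ==> (!!w. e <= dist m' w ==> v w = 0) ==> null \<psi> (C m v)" using state_at_null[OF s] by blast
  have "null \<psi> (C m (%w. hat e (dist m' w)))" by (intro e(2) cont_radial[OF continuous_hat] hat_simps(2)[OF e(1)])
  thus False using m'[OF e(1)] null_apply(1)[OF p(1), of _ 1] by simp
 qed
 have "x' ~= m'" "dist x' m' < r / 2" using xm \<delta> metric.r_pos by auto
 then obtain c where c: "c 0 = x'" "c 1 = m'" "!!N. chain N c" using metric.extended_chain by blast
 have c2: "dist x' (c 2) = 2 * \<delta>" "dist m' (c 2) = \<delta>"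
 proof -
  have "frac_point (1/2) (c 0) (c 2) (c 1)" using c(3)[of 2] unfolding chain_def by (simp add: numeral_2_eq_2)
  thus "dist x' (c 2) = 2 * \<delta>" "dist m' (c 2) = \<delta>" using xm c(1,2) by (auto simp: frac_point_def)
 qed
 have mid: "m1 = m2" if "dist x' y1 = 2 * \<delta>" "dist x' m1 = \<delta>" "dist m1 y1 = \<delta>" "dist x' m2 = \<delta>" "dist m2 y1 = \<delta>" for y1 m1 m2
  by (rule metric.frac_point_half_unique[of x' y1 "1/2"]) (use that \<delta> metric.r_pos in "auto simp: frac_point_def")
 obtain \<psi>1 where \<psi>1: "state_at \<psi>1 m m'" "state_at \<psi>1 y (c 2)"
 proof (rule two_point_state[OF s d mid xm m' c2])
  fix z assume "dist x' z = 2 * \<delta>" "dist m' z = \<delta>"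
  thus "z = c 2" using c2 xm by (intro extension_half_unique[OF \<delta>, of x' m'])
 qed
 have "state_at \<psi>1 x x'"
 proof (rule state_at_determined[OF \<psi>1])
  fix z assume "dist m' z = dist m x" "dist (c 2) z = dist y x"
  thus "z = x'" using c2 xm d by (intro extension_half_unique[OF \<delta>, of "c 2" m']) (simp_all add: dist_commute)
 qed
 thus ?thesis using that[of \<psi>1 c] \<psi>1(1) c xm by simp
qed

text \<open>Two consecutive vertices are pinned by \<open>first_step\<close>, and each further one
  by its distances to its two predecessors. The state stays the same along the chain, so a closed
  chain is transported to a closed one.\<close>

lemma related_transport:
 assumes R: "related x x'" and a: "chain N a" "a 0 = x" "dist (a 0) (a 1) <= r / 16" "0 < N"
 shows "\<exists>b. chain N b & b 0 = x' & (\<forall>i\<le>N. related (a i) (b i)) & dist (b 0) (b 1) = dist (a 0) (a 1) & (a N = a 0 --> b N = b 0)"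
proof (cases "a 0 = a 1")
 case True
 have "a i = x" if "i <= N" for i using that
 proof (induction i)
  case (Suc i)
  thus ?case using chain_step[OF a(1), of i] True by simp
 qed (simp add: a)
 thus ?thesis using R True by (intro exI[of _ "%_. x'"]) (auto simp: chain_def frac_point_def)
next case False
 define \<delta> where "\<delta> = dist (a 0) (a 1)"
 have \<delta>: "0 < \<delta>" "\<delta> <= r / 16" using False a(3) by (auto simp: \<delta>_def)
 \<comment> \<open>The chain \<open>a\<close> may consist of a single step; its prolongation
   \<open>d\<close> supplies the second vertex that \<open>first_step\<close> requires.\<close>
 have "dist (a 0) (a 1) < r / 2" using a(3) metric.r_pos by simp
 then obtain d where d: "d 0 = a 0" "d 1 = a 1" "!!N. chain N d" using metric.extended_chain[OF False] by blast
 have "frac_point (1/2) (d 0) (d 2) (d 1)" using d(3)[of 2] unfolding chain_def by (simp add: numeral_2_eq_2)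
 hence d2: "dist x (a 1) = \<delta>" "dist (a 1) (d 2) = \<delta>" "dist x (d 2) = 2 * \<delta>"
  using d(1,2) a(2) by (auto simp: \<delta>_def frac_point_def)
 obtain \<psi>0 where "state_at \<psi>0 x x'" using related_state[OF R] by blast
 then obtain \<psi> c where \<psi>: "state_at \<psi> x x'" "state_at \<psi> (a 1) (c 1)" and c: "c 0 = x'" "dist (c 0) (c 1) = \<delta>" "!!N. chain N c"
  using first_step[OF _ d2 \<delta>] by blast
 have st: "i < N ==> state_at \<psi> (a i) (c i) & state_at \<psi> (a (Suc i)) (c (Suc i))" for i
 proof (induction i)
  case 0
  thus ?case using \<psi> a(2) c(1) by simp
 next case (Suc i)
  hence IH: "state_at \<psi> (a i) (c i)" "state_at \<psi> (a (Suc i)) (c (Suc i))" by auto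
  have ch: "dist (b i) (b (Suc i)) = \<delta> & dist (b (Suc i)) (b (Suc (Suc i))) = \<delta> & dist (b i) (b (Suc (Suc i))) = 2 * \<delta>"
   if "chain N b" "dist (b 0) (b 1) = \<delta>" for b :: "nat => 'x"
  proof -
   have "frac_point (1/2) (b i) (b (Suc (Suc i))) (b (Suc i))" using that(1) Suc.prems unfolding chain_def by simp
   thus ?thesis using chain_step[OF that(1), of i] chain_step[OF that(1), of "Suc i"] that(2) Suc.prems by (simp add: frac_point_def)
  qed
  have "state_at \<psi> (a (Suc (Suc i))) (c (Suc (Suc i)))"
  proof (rule state_at_determined[OF IH])
   fix z assume "dist (c i) z = dist (a i) (a (Suc (Suc i)))" "dist (c (Suc i)) z = dist (a (Suc i)) (a (Suc (Suc i)))"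
   thus "z = c (Suc (Suc i))"
    using ch[OF a(1)] ch[OF c(3,2)] \<delta>_def by (intro extension_half_unique[OF \<delta>, of "c i" "c (Suc i)"]) simp_all
  qed
  thus ?case using IH by simp
 qed
 have at: "state_at \<psi> (a i) (c i)" if "i <= N" for i using st[of i] st[of "i - 1"] that a(4) by (cases "i < N") auto
 show ?thesis
 proof (intro exI[of _ c] conjI allI impI c)
  show "related (a i) (c i)" if "i <= N" for i by (rule state_related[OF at[OF that]])
  show "dist (c 0) (c 1) = dist (a 0) (a 1)" using c(2) unfolding \<delta>_def .
  assume "a N = a 0"
  thus "c N = c 0" using at[of N] at[of 0] state_at_unique by force
 qed
qed

sublocale transported_relation r "TYPE('x)" related by unfold_locales (fact related_sym, fact related_closed, rule related_transport)

text \<open>All points with the law of \<open>x\<close> are related to one support point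
  \<open>z0\<close> of that law.\<close>

lemma finite_same_law:
 "finite {y. \<forall>f. h (P y f) = h (P x f)}"
proof -
 obtain z0 where z0: "!!e. 0 < e ==> h (C x (%w. hat e (dist z0 w))) ~= 0" using support_exists[OF h_pos] by blast
 have "related z0 y" if "\<forall>f. h (P y f) = h (P x f)" for y
 proof (rule related_sym, unfold related_def, intro allI impI notI)
  fix e :: real assume "0 < e" "C y (%w. hat e (dist z0 w)) = 0"
  thus False using z0[of e] that clinear_zero[OF pos_fun_clinear[OF h_pos(1)]] unfolding C_def by metis
 qed
 hence "{y. \<forall>f. h (P y f) = h (P x f)} \<subseteq> {y. related z0 y}" by (intro subsetI CollectI) simp
 thus ?thesis by (rule finite_subset) (rule finite_related)
qed

end

theorem finite_orbit_of_convex_geodesic_space: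
 fixes \<Delta> :: "'a::cstar_algebra => ('a, 'a) min_tensor" and \<rho> :: "'x::metric_space cfun => ('x cfun, 'a) min_tensor"
 assumes "convex_geodesic_space TYPE('x) r" and "reduced_quantum_group \<Delta>" "quantum_action \<Delta> \<rho>" "isometric_action \<Delta> \<rho>"
 shows "finite (orbit \<Delta> \<rho> x)"
proof -
 obtain h where h: "haar_state \<Delta> h" "faithful_state h" using assms(2) by (auto simp: reduced_quantum_group_def)
 hence st: "state h" by (simp add: haar_state_def)
 obtain \<kappa> where \<kappa>: "kac_antipode \<Delta> \<kappa>" "!!x y. action_eval \<rho> (dist_fun y) x = \<kappa> (action_eval \<rho> (dist_fun x) y)"
  using assms(4) unfolding isometric_action_def by blast
 interpret convex_geodesic_space r "TYPE('x)" by fact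
 have k: "bounded_linear \<kappa>" "clinear \<kappa>" "!!a. \<kappa> (\<kappa> a) = a" "!!a b. \<kappa> (a * b) = \<kappa> b * \<kappa> a"
  using \<kappa>(1) by (auto simp: kac_antipode_def)
 interpret isometric_family "%x f. action_eval \<rho> f x" h \<kappa>
  by (rule isometric_family.intro) (fact compact_UNIV action_eval_hom(1)[OF assms(3) st h(2)] st h(2) k \<kappa>(2))+
 interpret isometric_geodesic_family "%x f. action_eval \<rho> f x" h \<kappa> r ..
 have "orbit \<Delta> \<rho> x = {y. \<forall>f. h (action_eval \<rho> f y) = h (action_eval \<rho> f x)}"
  unfolding orbit_def haar_eqI[OF h(1)] fun_eq_iff action_eval_hom(2)[OF assms(3) st h(2)] ..
 thus ?thesis using finite_same_law[of x] by simp
qed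

section \<open>The flow of a vector field with small derivative\<close>

text \<open>With \<open>M\<close> the maximum of \<open>f\<close>, the hypothesis reads
  \<open>M \<le> \<eta> + M / 2\<close>. On the unit time interval and with Lipschitz constant
  \<open>1 / 2\<close> this takes the place of Gronwall's inequality.\<close>

lemma half_contraction_bound:
 fixes f :: "real => real"
 assumes "continuous_on {0..1} f" and "!!M s. (!!r. r \<in> {0..1} ==> f r <= M) ==> s \<in> {0..1} ==> f s <= \<eta> + M / 2" and "s \<in> {0..1}"
 shows "f s <= 2 * \<eta>"
proof -
 obtain x where x: "x \<in> {0..1}" "!!r. r \<in> {0..1} ==> f r <= f x" using continuous_attains_sup[OF compact_Icc _ assms(1)] by force
 hence "f x <= \<eta> + f x / 2" using assms(2)[of "f x" x] by blast
 thus ?thesis using x(2)[OF assms(3)] by linarith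
qed

lemma norm_integral_unit:
 fixes f :: "real => 'b::banach"
 assumes "continuous_on {0..1} f" "!!r. r \<in> {0..1} ==> norm (f r) <= M" "s \<in> {0..1}"
 shows "norm (integral {0..s} f) <= M"
proof -
 have c: "continuous_on {0..s} f" using assms(1,3) by (rule_tac continuous_on_subset) auto
 have M: "0 <= M" using assms(2)[of 0] norm_ge_zero[of "f 0"] by (meson atLeastAtMost_iff order_refl order_trans zero_le_one)
 have "norm (integral {0..s} f) <= M * (s - 0)" using assms by (intro integral_bound c) auto
 also have "\<dots> <= M" using assms(3) M by (simp add: mult_left_le)
 finally show ?thesis .
qed

lemma picard_solution:
 fixes f :: "real => 'b::banach => 'b"
 assumes c: "!!u. continuous_on {0..1} u ==> continuous_on {0..1} (%r. f r (u r))"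
  and l: "!!r u v. r \<in> {0..1} ==> norm (f r u - f r v) <= norm (u - v) / 2"
 obtains u where "continuous_on {0..1} u" "!!s. s \<in> {0..1} ==> u s = u0 + integral {0..s} (%r. f r (u r))"
proof -
 \<comment> \<open>The complete space at hand consists of bounded functions on the whole line;
   \<open>clip\<close> extends functions on the unit interval by constants.\<close>
 define clip :: "real => real" where "clip = (%s. max 0 (min 1 s))"
 have clip: "continuous_on UNIV clip" "clip s \<in> {0..1}" "s \<in> {0..1} ==> clip s = s" for s unfolding clip_def by (intro continuous_intros) auto
 define I where "I = (%u s. u0 + integral {0..s} (%r. f r (u r)))"
 have cf: "continuous_on {0..1} (%r. f r (apply_bcontfun u r))" for u :: "real \<Rightarrow>\<^sub>C 'b"
  by (intro c) (rule continuous_on_apply_bcontfun)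
 have int: "(%r. f r (apply_bcontfun u r)) integrable_on {0..s}" if "s \<in> {0..1}" for u :: "real \<Rightarrow>\<^sub>C 'b" and s
  by (rule integrable_continuous_real, rule continuous_on_subset[OF cf]) (use that in auto)
 have cI: "continuous_on {0..1} (I (apply_bcontfun u))" for u :: "real \<Rightarrow>\<^sub>C 'b"
  unfolding I_def by (intro continuous_intros indefinite_integral_continuous_1 integrable_continuous_real cf)
 define T where "T = (%u :: real \<Rightarrow>\<^sub>C 'b. Bcontfun (%s. I (apply_bcontfun u) (clip s)))"
 have T: "apply_bcontfun (T u) s = I (apply_bcontfun u) (clip s)" for u s
 proof -
  have "continuous_on UNIV (%s. I (apply_bcontfun u) (clip s))" by (rule continuous_on_compose2[OF cI clip(1)]) (use clip(2) in auto)
  moreover have "bounded (range (%s. I (apply_bcontfun u) (clip s)))"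
   using compact_imp_bounded[OF compact_continuous_image[OF cI[of u] compact_Icc]] clip(2) by (rule_tac bounded_subset) auto
  ultimately have "(%s. I (apply_bcontfun u) (clip s)) \<in> bcontfun" by (simp add: bcontfun_def)
  thus ?thesis by (simp add: T_def Bcontfun_inverse)
 qed
 have "\<exists>!u. T u = u"
 proof (rule banach_fix_type[of "1/2"])
  show "\<forall>u v. dist (T u) (T v) <= 1 / 2 * dist u v"
  proof (intro allI dist_bound)
   fix u v :: "real \<Rightarrow>\<^sub>C 'b" and s :: real
   let ?u = "apply_bcontfun u" and ?v = "apply_bcontfun v"
   have "dist (apply_bcontfun (T u) s) (apply_bcontfun (T v) s) = norm (integral {0..clip s} (%r. f r (?u r) - f r (?v r)))"
    unfolding T I_def dist_norm using int[OF clip(2)] by (simp add: integral_diff)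
   also have "\<dots> <= 1 / 2 * dist u v"
   proof (rule norm_integral_unit[OF _ _ clip(2)])
    show "continuous_on {0..1} (%r. f r (?u r) - f r (?v r))" by (intro continuous_intros cf)
    show "norm (f r (?u r) - f r (?v r)) <= 1 / 2 * dist u v" if "r \<in> {0..1}" for r
     using l[OF that, of "?u r" "?v r"] dist_bounded[of u r v] by (simp add: dist_norm)
   qed
   finally show "dist (apply_bcontfun (T u) s) (apply_bcontfun (T v) s) <= 1 / 2 * dist u v" .
  qed
 qed auto
 then obtain u where u: "T u = u" by blast
 show ?thesis
 proof (rule that)
  show "continuous_on {0..1} (apply_bcontfun u)" by (rule continuous_on_apply_bcontfun)
  show "apply_bcontfun u s = u0 + integral {0..s} (%r. f r (apply_bcontfun u r))" if "s \<in> {0..1}" for s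
   using T[of u s] that clip(3) unfolding u I_def by simp
 qed
qed

lemma integral_equation_derivative:
 fixes u :: "real => 'b::banach"
 assumes "continuous_on {0..1} v" "!!s. s \<in> {0..1} ==> u s = u0 + integral {0..s} v" "s \<in> {0..1}"
 shows "(u has_vector_derivative v s) (at s within {0..1})"
proof -
 have "((%s. u0 + integral {0..s} v) has_vector_derivative v s) (at s within {0..1})"
  using integral_has_vector_derivative[OF assms(1,3)] by (auto intro!: derivative_eq_intros)
 thus ?thesis by (rule has_vector_derivative_transform[OF assms(3), rotated]) (simp add: assms(2))
qed

lemma derivative_integral_equation:
 fixes u :: "real => 'b::banach"
 assumes "!!s. s \<in> {0..1} ==> (u has_vector_derivative v s) (at s within {0..1})" "s \<in> {0..1}"
 shows "u s = u 0 + integral {0..s} v"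
proof -
 have "(v has_integral u s - u 0) {0..s}"
 proof (rule fundamental_theorem_of_calculus)
  fix x assume "x \<in> {0..s}"
  thus "(u has_vector_derivative v x) (at x within {0..s})" using assms by (intro has_vector_derivative_within_subset[OF assms(1)]) auto
 qed (use assms(2) in auto)
 thus ?thesis by (simp add: integral_unique)
qed

text \<open>Slowing a field down near a zero makes its derivative at most \<open>1 / 2\<close>, so
  that a single contraction argument gives the flow of the half ball up to time
  \<open>1\<close>.\<close>

locale small_vector_field =
 fixes F :: "'z::euclidean_space => 'z" and F' :: "'z => 'z \<Rightarrow>\<^sub>L 'z" and a :: 'z and \<rho> :: real
 assumes \<rho>_pos: "0 < \<rho>" and F_deriv: "!!z. z \<in> cball a \<rho> ==> (F has_derivative blinfun_apply (F' z)) (at z)"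
  and F'_cont: "continuous_on (cball a \<rho>) F'"
  and F'_small: "!!z. z \<in> cball a \<rho> ==> norm (F' z) <= 1 / 2"
  and F_zero: "F a = 0"
begin

abbreviation B where "B \<equiv> cball a \<rho>"
abbreviation B2 where "B2 \<equiv> cball a (\<rho> / 2)"

lemma F_lipschitz: "z \<in> B ==> w \<in> B ==> norm (F z - F w) <= norm (z - w) / 2"
 using differentiable_bound[of B F "%z. blinfun_apply (F' z)" "1/2" z w] F_deriv F'_small by (simp add: has_derivative_at_withinI norm_blinfun.rep_eq)

lemma F_bound: "z \<in> B ==> norm (F z) <= \<rho> / 2" using F_lipschitz[of z a] \<rho>_pos F_zero by (simp add: dist_norm norm_minus_commute)

lemma F_cont: "continuous_on B F" by (rule has_derivative_continuous_on) (rule has_derivative_at_withinI[OF F_deriv])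

lemma F_cont_comp: "continuous_on {0..1} u ==> u ` {0..1} \<subseteq> B ==> continuous_on {0..1} (%r. F (u r))"
 using F_cont by (rule continuous_on_compose2)

definition solution :: "'z => (real => 'z) => bool" where "solution z u \<longleftrightarrow> continuous_on {0..1} u & u ` {0..1} \<subseteq> B &
  (\<forall>s\<in>{0..1}. u s = z + integral {0..s} (%r. F (u r)))"

lemma solution_exists:
 assumes z: "z \<in> B2"
 shows "\<exists>u. solution z u"
proof -
 \<comment> \<open>Composition with the nearest-point projection makes the field globally Lipschitz.
   As the field is at most \<open>\<rho> / 2\<close>, the solution stays in the ball, where the
   projection is the identity.\<close>
 define p where "p = closest_point B"
 have p: "p w \<in> B" "norm (p w - p w') <= norm (w - w')" "w \<in> B ==> p w = w" for w w'
  using closest_point_in_set[of B w] closest_point_lipschitz[of B w w'] closest_point_self[of w B] \<rho>_pos by (auto simp: p_def dist_norm)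
 have pc: "continuous_on UNIV p" unfolding p_def using continuous_on_closest_point[of B UNIV] \<rho>_pos by simp
 have 1: "continuous_on {0..1} (%r. F (p (u r)))" if "continuous_on {0..1} u" for u :: "real => 'z"
   using that by (intro F_cont_comp continuous_on_compose2[OF pc]) (use p(1) in auto)
 have 2: "norm (F (p w) - F (p w')) <= norm (w - w') / 2" for w w' using F_lipschitz[OF p(1) p(1), of w w'] p(2)[of w w'] by linarith
 obtain u :: "real => 'z" where u: "continuous_on {0..1} u" "!!s. s \<in> {0..1} ==> u s = z + integral {0..s} (%r. F (p (u r)))"
  by (rule picard_solution[of "%_ w. F (p w)" z, OF 1 2]) blast+
 have inB: "u s \<in> B" if s: "s \<in> {0..1}" for s
 proof -
  have "norm (integral {0..s} (%r. F (p (u r)))) <= \<rho> / 2"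
   using u(1) F_bound p(1) s by (intro norm_integral_unit F_cont_comp continuous_on_compose2[OF pc]) auto
  moreover have "norm (z - a) <= \<rho> / 2" using z by (simp add: dist_norm norm_minus_commute)
  moreover have eq: "u s - a = (z - a) + integral {0..s} (%r. F (p (u r)))" using u(2)[OF s] by simp
  ultimately have "norm (u s - a) <= \<rho>" unfolding eq by (intro norm_triangle_le) linarith
  thus ?thesis by (simp add: dist_norm norm_minus_commute)
 qed
 have "u s = z + integral {0..s} (%r. F (u r))" if s: "s \<in> {0..1}" for s
  unfolding u(2)[OF s] using s inB p(3) by (intro arg_cong2[of _ _ _ _ "(+)"] integral_cong) auto
 thus ?thesis using u(1) inB unfolding solution_def by blast
qed

lemma solution_gap:
 assumes u: "solution z u" and v: "solution w v" and s: "s \<in> {0..1}"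
 shows "norm (u s - v s) <= 2 * norm (z - w)"
proof (rule half_contraction_bound[OF _ _ s])
 note c = F_cont_comp[of u] F_cont_comp[of v]
 show "continuous_on {0..1} (%s. norm (u s - v s))" using u v by (intro continuous_intros) (auto simp: solution_def)
 fix M t assume M: "!!r. r \<in> {0..1} ==> norm (u r - v r) <= M" and t: "t \<in> {0..1::real}"
 have cu: "continuous_on {0..1} (%r. F (u r))" and cv: "continuous_on {0..1} (%r. F (v r))" using u v by (auto simp: solution_def intro!: F_cont_comp)
 have i: "(%r. F (u r)) integrable_on {0..t}" "(%r. F (v r)) integrable_on {0..t}"
  using t by (auto intro!: integrable_continuous_real continuous_on_subset[OF cu] continuous_on_subset[OF cv])
 have "u t - v t = (z - w) + integral {0..t} (%r. F (u r) - F (v r))" using u v t by (simp add: solution_def integral_diff[OF i])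
 moreover have "norm (integral {0..t} (%r. F (u r) - F (v r))) <= M / 2"
 proof (rule norm_integral_unit[OF _ _ t])
  show "continuous_on {0..1} (%r. F (u r) - F (v r))" by (intro continuous_intros cu cv)
  show "norm (F (u r) - F (v r)) <= M / 2" if "r \<in> {0..1}" for r
  proof -
   have "u r \<in> B" "v r \<in> B" using u v that unfolding solution_def by blast+
   thus ?thesis using F_lipschitz[of "u r" "v r"] M[OF that] by simp
  qed
 qed
 ultimately show "norm (u t - v t) <= norm (z - w) + M / 2" using norm_triangle_ineq[of "z - w" "integral {0..t} (%r. F (u r) - F (v r))"] by simp
qed

definition flow :: "'z => real => 'z" where "flow z = (SOME u. solution z u)"

lemma flow_solution: "z \<in> B2 ==> solution z (flow z)" unfolding flow_def by (rule someI_ex[OF solution_exists])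

lemma solution_unique: "solution z u ==> z \<in> B2 ==> s \<in> {0..1} ==> u s = flow z s"
 using solution_gap[of z u z "flow z" s] flow_solution by simp

lemma solutionI:
 assumes "!!s. s \<in> {0..1} ==> (u has_vector_derivative F (u s)) (at s within {0..1})" "!!s. s \<in> {0..1} ==> u s \<in> B"
 shows "solution (u 0) u" unfolding solution_def
proof (intro conjI ballI)
 show "continuous_on {0..1} u" unfolding continuous_on_eq_continuous_within by (intro ballI has_vector_derivative_continuous[OF assms(1)])
 show "u ` {0..1} \<subseteq> B" using assms(2) by blast
 fix s :: real assume s: "s \<in> {0..1}"
 show "u s = u 0 + integral {0..s} (%r. F (u r))" by (rule derivative_integral_equation[where v = "%r. F (u r)", OF _ s]) (rule assms(1))
qed

lemma flow_in: "z \<in> B2 ==> s \<in> {0..1} ==> flow z s \<in> B" using flow_solution[of z] unfolding solution_def by blast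

lemma flow_cont: "z \<in> B2 ==> continuous_on {0..1} (flow z)" using flow_solution[of z] by (auto simp: solution_def)

lemma flow_eq: "z \<in> B2 ==> s \<in> {0..1} ==> flow z s = z + integral {0..s} (%r. F (flow z r))"
 using flow_solution[of z] by (auto simp: solution_def)

lemma flow_F_cont: "z \<in> B2 ==> continuous_on {0..1} (%r. F (flow z r))" by (rule F_cont_comp) (auto intro: flow_cont flow_in simp del: mem_cball)

lemma flow_deriv:
 "z \<in> B2 ==> s \<in> {0..1} ==> (flow z has_vector_derivative F (flow z s)) (at s within {0..1})"
 by (rule integral_equation_derivative[OF flow_F_cont flow_eq])

lemma flow_zero: "z \<in> B2 ==> flow z 0 = z" using flow_eq[of z 0] by simp

lemma flow_lipschitz:
 "z \<in> B2 ==> w \<in> B2 ==> s \<in> {0..1} ==> norm (flow z s - flow w s) <= 2 * norm (z - w)"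
 using solution_gap[OF flow_solution flow_solution] .

section \<open>Differentiability of the flow in the initial value\<close>

definition variation :: "'z => (real => 'z \<Rightarrow>\<^sub>L 'z) => bool" where "variation z V \<longleftrightarrow> continuous_on {0..1} V &
  (\<forall>s\<in>{0..1}. V s = id_blinfun + integral {0..s} (%r. F' (flow z r) o\<^sub>L V r))"

definition dflow :: "'z => real => 'z \<Rightarrow>\<^sub>L 'z" where "dflow z = (SOME V. variation z V)"

lemma F'_flow_cont: "z \<in> B2 ==> continuous_on {0..1} (%r. F' (flow z r))"
 by (rule continuous_on_compose2[OF F'_cont flow_cont]) (auto intro: flow_in simp del: mem_cball)

lemma dflow_variation:
 assumes z: "z \<in> B2"
 shows "variation z (dflow z)"
proof -
 obtain V where "continuous_on {0..1} V" "!!s. s \<in> {0..1} ==> V s = id_blinfun + integral {0..s} (%r. F' (flow z r) o\<^sub>L V r)"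
 proof (rule picard_solution[of "%r V. F' (flow z r) o\<^sub>L V"])
  show "continuous_on {0..1} (%r. F' (flow z r) o\<^sub>L u r)" if "continuous_on {0..1} u" for u :: "real => 'z \<Rightarrow>\<^sub>L 'z"
   using that by (intro continuous_intros F'_flow_cont z)
  show "norm ((F' (flow z r) o\<^sub>L u) - (F' (flow z r) o\<^sub>L v)) <= norm (u - v) / 2" if "r \<in> {0..1}" for r and u v :: "'z \<Rightarrow>\<^sub>L 'z"
  proof -
   have "(F' (flow z r) o\<^sub>L u) - (F' (flow z r) o\<^sub>L v) = F' (flow z r) o\<^sub>L (u - v)"
    by (rule blinfun_eqI) (simp add: blinfun.diff_left blinfun.diff_right)
   thus ?thesis using norm_blinfun_compose[of "F' (flow z r)" "u - v"] mult_right_mono[OF F'_small[OF flow_in[OF z that]] norm_ge_zero[of "u - v"]]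
    by simp
  qed
 qed blast
 hence "\<exists>V. variation z V" unfolding variation_def by blast
 thus ?thesis unfolding dflow_def by (rule someI_ex)
qed

lemma dflow_cont: "z \<in> B2 ==> continuous_on {0..1} (dflow z)" and dflow_eq: "z \<in> B2 ==> s \<in> {0..1} ==>
  dflow z s = id_blinfun + integral {0..s} (%r. F' (flow z r) o\<^sub>L dflow z r)" using dflow_variation[of z] by (auto simp: variation_def)

lemma F'_dflow_cont: "z \<in> B2 ==> continuous_on {0..1} (%r. F' (flow z r) o\<^sub>L dflow z r)"
 by (intro continuous_intros F'_flow_cont dflow_cont)

lemma dflow_deriv:
 assumes "z \<in> B2" "s \<in> {0..1}"
 shows "((%s. dflow z s h) has_vector_derivative F' (flow z s) (dflow z s h)) (at s within {0..1})"
proof -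
 have "(dflow z has_vector_derivative (F' (flow z s) o\<^sub>L dflow z s)) (at s within {0..1})"
  by (rule integral_equation_derivative[OF F'_dflow_cont[OF assms(1)] dflow_eq[OF assms(1)] assms(2)])
 hence "((%s. dflow z s h) has_vector_derivative (F' (flow z s) o\<^sub>L dflow z s) h) (at s within {0..1})"
  by (rule bounded_linear.has_vector_derivative[OF blinfun.bounded_linear_left])
 thus ?thesis by simp
qed

lemma dflow_zero: "z \<in> B2 ==> dflow z 0 h = h" using dflow_eq[of z 0] by simp

lemma F'_half: "z \<in> B ==> norm (F' z o\<^sub>L V) <= norm V / 2"
 using norm_blinfun_compose[of "F' z" V] mult_right_mono[OF F'_small[of z] norm_ge_zero[of V]] by linarith

lemma dflow_bound:
 assumes z: "z \<in> B2" and s: "s \<in> {0..1}"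
 shows "norm (dflow z s) <= 2"
proof -
 have "norm (dflow z s) <= 2 * 1"
 proof (rule half_contraction_bound[OF _ _ s])
  show "continuous_on {0..1} (%s. norm (dflow z s))" by (intro continuous_intros dflow_cont z)
  fix M t assume M: "!!r. r \<in> {0..1} ==> norm (dflow z r) <= M" and t: "t \<in> {0..1::real}"
  have "norm (integral {0..t} (%r. F' (flow z r) o\<^sub>L dflow z r)) <= M / 2"
  proof (rule norm_integral_unit[OF F'_dflow_cont[OF z] _ t])
   show "norm (F' (flow z r) o\<^sub>L dflow z r) <= M / 2" if "r \<in> {0..1}" for r
    using F'_half[OF flow_in[OF z that], of "dflow z r"] M[OF that] by linarith
  qed
  thus "norm (dflow z t) <= 1 + M / 2" unfolding dflow_eq[OF z t] by (intro norm_triangle_le add_mono norm_blinfun_id_le)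
 qed
 thus ?thesis by simp
qed

lemma F'_uniform:
 assumes "0 < e"
 obtains d where "0 < d" "!!z w. z \<in> B ==> w \<in> B ==> norm (z - w) < d ==> norm (F' z - F' w) < e"
 using compact_uniformly_continuous[OF F'_cont compact_cball] assms unfolding uniformly_continuous_on_def dist_norm by metis

lemma F_linearization:
 assumes "z \<in> B" "w \<in> B" "!!v. v \<in> B ==> norm (v - z) <= norm (w - z) ==> norm (F' v - F' z) <= e"
 shows "norm (F w - F z - F' z (w - z)) <= e * norm (w - z)"
proof -
 have seg: "z + t *R (w - z) \<in> B" "norm (z + t *R (w - z) - z) <= norm (w - z)" if "t \<in> {0..1}" for t
 proof -
  have "z + t *R (w - z) = (1 - t) *R z + t *R w" by (simp add: algebra_simps)
  thus "z + t *R (w - z) \<in> B" using that convexD_alt[OF convex_cball assms(1,2), of t] by simp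
  show "norm (z + t *R (w - z) - z) <= norm (w - z)" using that by (simp add: mult_left_le_one_le)
 qed
 let ?S = "{v \<in> B. norm (v - z) <= norm (w - z)}"
 have "norm (F w - F z - blinfun_apply (F' z) (w - z)) <= norm (w - z) * e"
 proof (rule differentiable_bound_linearization[where S = ?S and f' = "%v. blinfun_apply (F' v)"])
  show "z + t *R (w - z) \<in> ?S" if "t \<in> {0..1}" for t using seg[OF that] by blast
  show "(F has_derivative blinfun_apply (F' v)) (at v within ?S)" if "v \<in> ?S" for v using F_deriv that by (blast intro: has_derivative_at_withinI)
  show "onorm (blinfun_apply (F' v) - blinfun_apply (F' z)) <= e" if "v \<in> ?S" for v
   using assms(3)[of v] that by (simp add: norm_blinfun.rep_eq minus_blinfun.rep_eq fun_diff_def)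
  show "z \<in> ?S" using assms(1) by simp
 qed
 thus ?thesis by (simp add: mult.commute)
qed

text \<open>The remainder solves the linearised equation up to an error
  \<open>e / 2 * norm (w - z)\<close>, which \<open>half_contraction_bound\<close> doubles. The
  modulus is taken for \<open>e / 4\<close> because the flow is Lipschitz with constant
  \<open>2\<close>.\<close>

lemma flow_has_derivative:
 assumes z: "z \<in> ball a (\<rho> / 2)" and s: "s \<in> {0..1}"
 shows "((%z. flow z s) has_derivative dflow z s) (at z)" unfolding has_derivative_at_alt
proof (intro conjI allI impI blinfun.bounded_linear_right)
 fix e :: real assume e: "0 < e"
 have z': "z \<in> B2" using z by simp
 obtain d where d: "0 < d" "!!z w. z \<in> B ==> w \<in> B ==> norm (z - w) < d ==> norm (F' z - F' w) < e / 4" using F'_uniform[of "e / 4"] e by auto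
 obtain d1 where d1: "0 < d1" "ball z d1 \<subseteq> ball a (\<rho> / 2)" using z open_ball open_contains_ball by metis
 show "\<exists>d>0. \<forall>w. norm (w - z) < d --> norm (flow w s - flow z s - dflow z s (w - z)) <= e * norm (w - z)"
 proof (intro exI[of _ "min d1 (d / 2)"] conjI allI impI)
  fix w assume w: "norm (w - z) < min d1 (d / 2)"
  have w': "w \<in> B2"
  proof -
   have "w \<in> ball z d1" using w by (simp add: dist_norm norm_minus_commute)
   thus ?thesis using d1(2) by auto
  qed
  have "norm (flow w s - flow z s - dflow z s (w - z)) <= 2 * (e / 2 * norm (w - z))"
  proof (rule half_contraction_bound[OF _ _ s])
   show "continuous_on {0..1} (%s. norm (flow w s - flow z s - dflow z s (w - z)))" by (intro continuous_intros flow_cont dflow_cont z' w')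
   fix M t assume M: "!!r. r \<in> {0..1} ==> norm (flow w r - flow z r - dflow z r (w - z)) <= M" and t: "t \<in> {0..1::real}"
   define f where "f = (%r. F (flow w r) - F (flow z r) - F' (flow z r) (dflow z r (w - z)))"
   have cd: "continuous_on {0..1} (%r. F' (flow z r) (dflow z r (w - z)))" by (intro continuous_intros F'_flow_cont dflow_cont z')
   have fc: "continuous_on {0..1} f" unfolding f_def by (intro continuous_intros flow_F_cont cd z' w')
   have sub: "{0..t} \<subseteq> {0..1}" using t by auto
   have i: "(%r. F (flow w r)) integrable_on {0..t}" "(%r. F (flow z r)) integrable_on {0..t}"
    "(%r. F' (flow z r) (dflow z r (w - z))) integrable_on {0..t}" "(%r. F' (flow z r) o\<^sub>L dflow z r) integrable_on {0..t}"
    by (intro integrable_continuous_real continuous_on_subset[OF _ sub] flow_F_cont cd F'_dflow_cont z' w')+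
   have "dflow z t (w - z) = (w - z) + integral {0..t} (%r. F' (flow z r) (dflow z r (w - z)))" unfolding dflow_eq[OF z' t] blinfun.add_left
    using integral_linear[OF i(4) blinfun.bounded_linear_left[of "w - z"]] by (simp add: o_def)
   hence "flow w t - flow z t - dflow z t (w - z) = integral {0..t} f"
    unfolding flow_eq[OF z' t] flow_eq[OF w' t] f_def using i by (simp add: integral_diff integrable_diff)
   also have "norm \<dots> <= e / 2 * norm (w - z) + M / 2"
   proof (rule norm_integral_unit[OF fc _ t])
    fix r :: real assume r: "r \<in> {0..1}"
    have B: "flow z r \<in> B" "flow w r \<in> B" using flow_in z' w' r by auto
    have fl: "norm (flow w r - flow z r) <= 2 * norm (w - z)" by (rule flow_lipschitz[OF w' z' r])
    have "norm (F (flow w r) - F (flow z r) - F' (flow z r) (flow w r - flow z r)) <= e / 4 * norm (flow w r - flow z r)"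
    proof (rule F_linearization[OF B])
     fix v assume v: "v \<in> B" "norm (v - flow z r) <= norm (flow w r - flow z r)"
     hence "norm (v - flow z r) < d" using fl w by linarith
     thus "norm (F' v - F' (flow z r)) <= e / 4" using d(2)[OF v(1) B(1)] by simp
    qed
    also have "\<dots> <= e / 4 * (2 * norm (w - z))" using e fl by (intro mult_left_mono) auto
    finally have 1: "norm (F (flow w r) - F (flow z r) - F' (flow z r) (flow w r - flow z r)) <= e / 2 * norm (w - z)" by simp
    have "norm (F' (flow z r) (flow w r - flow z r - dflow z r (w - z))) <= 1 / 2 * M"
     using M[OF r] by (intro order_trans[OF norm_blinfun] mult_mono F'_small B) auto
    hence "norm ((F (flow w r) - F (flow z r) - F' (flow z r) (flow w r - flow z r))
      + F' (flow z r) (flow w r - flow z r - dflow z r (w - z))) <= e / 2 * norm (w - z) + M / 2" using 1 by (intro norm_triangle_le) linarith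
    moreover have "f r = (F (flow w r) - F (flow z r) - F' (flow z r) (flow w r - flow z r))
      + F' (flow z r) (flow w r - flow z r - dflow z r (w - z))" by (simp add: f_def blinfun.diff_right)
    ultimately show "norm (f r) <= e / 2 * norm (w - z) + M / 2" by simp
   qed
   finally show "norm (flow w t - flow z t - dflow z t (w - z)) <= e / 2 * norm (w - z) + M / 2" .
  qed
  thus "norm (flow w s - flow z s - dflow z s (w - z)) <= e * norm (w - z)" by simp
 qed (use d d1 in auto)
qed

lemma dflow_uniform:
 assumes "0 < e"
 obtains d where "0 < d" "!!z w s. z \<in> B2 ==> w \<in> B2 ==> norm (z - w) < d ==>
  s \<in> {0..1} ==> norm (dflow z s - dflow w s) < e"
proof -
 obtain d where d: "0 < d" "!!z w. z \<in> B ==> w \<in> B ==> norm (z - w) < d ==> norm (F' z - F' w) < e / 8"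
  using F'_uniform[of "e / 8"] assms by auto
 show ?thesis
 proof (rule that[of "d / 2"])
  fix z w and s :: real assume zw: "z \<in> B2" "w \<in> B2" "norm (z - w) < d / 2" and s: "s \<in> {0..1}"
  have "norm (dflow z s - dflow w s) <= 2 * (e / 4)"
  proof (rule half_contraction_bound[OF _ _ s])
   show "continuous_on {0..1} (%s. norm (dflow z s - dflow w s))" by (intro continuous_intros dflow_cont zw)
   fix M t assume M: "!!r. r \<in> {0..1} ==> norm (dflow z r - dflow w r) <= M" and t: "t \<in> {0..1::real}"
   have sub: "{0..t} \<subseteq> {0..1}" using t by auto
   have i: "(%r. F' (flow z r) o\<^sub>L dflow z r) integrable_on {0..t}" "(%r. F' (flow w r) o\<^sub>L dflow w r) integrable_on {0..t}"
    by (intro integrable_continuous_real continuous_on_subset[OF _ sub] F'_dflow_cont zw)+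
   have "dflow z t - dflow w t = integral {0..t} (%r. (F' (flow z r) o\<^sub>L dflow z r) - (F' (flow w r) o\<^sub>L dflow w r))"
    unfolding dflow_eq[OF zw(1) t] dflow_eq[OF zw(2) t] using i by (simp add: integral_diff)
   also have "norm \<dots> <= e / 4 + M / 2"
   proof (rule norm_integral_unit[OF _ _ t])
    show "continuous_on {0..1} (%r. (F' (flow z r) o\<^sub>L dflow z r) - (F' (flow w r) o\<^sub>L dflow w r))"
     by (intro continuous_on_diff F'_dflow_cont zw)
    fix r :: real assume r: "r \<in> {0..1}"
    have "norm (flow z r - flow w r) < d" using flow_lipschitz[OF zw(1,2) r] zw(3) by linarith
    hence le: "norm (F' (flow z r) - F' (flow w r)) <= e / 8" using d(2) flow_in zw r by (simp add: less_imp_le)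
    have "norm ((F' (flow z r) - F' (flow w r)) o\<^sub>L dflow w r) <= e / 8 * 2"
     using le assms by (intro order_trans[OF norm_blinfun_compose] mult_mono dflow_bound zw r) auto
    moreover have "norm (F' (flow z r) o\<^sub>L (dflow z r - dflow w r)) <= M / 2"
     using F'_half[OF flow_in[OF zw(1) r], of "dflow z r - dflow w r"] M[OF r] by linarith
    moreover have eq: "(F' (flow z r) o\<^sub>L dflow z r) - (F' (flow w r) o\<^sub>L dflow w r)
      = ((F' (flow z r) - F' (flow w r)) o\<^sub>L dflow w r) + (F' (flow z r) o\<^sub>L (dflow z r - dflow w r))"
     by (rule blinfun_eqI) (simp add: blinfun.diff_left blinfun.diff_right blinfun.add_left)
    ultimately show "norm ((F' (flow z r) o\<^sub>L dflow z r) - (F' (flow w r) o\<^sub>L dflow w r)) <= e / 4 + M / 2"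
     unfolding eq by (intro norm_triangle_le) linarith
   qed
   finally show "norm (dflow z t - dflow w t) <= e / 4 + M / 2" .
  qed
  thus "norm (dflow z s - dflow w s) < e" using assms by simp
 qed (use d in auto)
qed

lemma dflow_jointly_continuous: "continuous_on (B2 \<times> {0..1}) (%p. dflow (fst p) (snd p))" unfolding continuous_on_iff
proof (intro ballI allI impI)
 fix p :: "'z \<times> real" and e :: real assume p: "p \<in> B2 \<times> {0..1}" and e: "0 < e"
 hence p': "fst p \<in> B2" "snd p \<in> {0..1}" by auto
 have e2: "0 < e / 2" using e by simp
 obtain d1 where d1: "0 < d1" "!!z w s. z \<in> B2 ==> w \<in> B2 ==> norm (z - w) < d1 ==> s \<in> {0..1} ==> norm (dflow z s - dflow w s) < e / 2"
  by (rule dflow_uniform[OF e2]) blast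
 obtain d2 where d2: "0 < d2" "!!s. s \<in> {0..1} ==> dist s (snd p) < d2 ==> dist (dflow (fst p) s) (dflow (fst p) (snd p)) < e / 2"
  using dflow_cont[OF p'(1)] p'(2) e2 unfolding continuous_on_iff by blast
 show "\<exists>d>0. \<forall>q\<in>B2 \<times> {0..1}. dist q p < d --> dist (dflow (fst q) (snd q)) (dflow (fst p) (snd p)) < e"
 proof (intro exI[of _ "min d1 d2"] conjI ballI impI)
  fix q assume q: "q \<in> B2 \<times> {0..1}" "dist q p < min d1 d2"
  hence q': "fst q \<in> B2" "snd q \<in> {0..1}" by auto
  have "dist (fst q) (fst p) < d1" "dist (snd q) (snd p) < d2" using q(2) dist_fst_le[of q p] dist_snd_le[of q p] by linarith+
  hence "dist (dflow (fst q) (snd q)) (dflow (fst p) (snd q)) < e / 2" "dist (dflow (fst p) (snd q)) (dflow (fst p) (snd p)) < e / 2"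
   using d1(2)[OF q'(1) p'(1) _ q'(2)] d2(2)[OF q'(2)] by (simp_all add: dist_norm)
  thus "dist (dflow (fst q) (snd q)) (dflow (fst p) (snd p)) < e"
   using dist_triangle[of "dflow (fst q) (snd q)" "dflow (fst p) (snd p)" "dflow (fst p) (snd q)"] by linarith
 qed (use d1 d2 in auto)
qed

end

section \<open>Bilinear fields and linear equations with parameters\<close>

text \<open>Metric and Christoffel symbols are known to be regular for fixed vector arguments only;
  expansion in a basis gives regularity when the arguments vary along a curve.\<close>

lemma bilinear_basis_expansion:
 fixes T :: "'e::euclidean_space => 'e => 'f::real_vector"
 assumes "bilinear T"
 shows "T v w = (\<Sum>i\<in>Basis. \<Sum>j\<in>Basis. ((v \<bullet> i) * (w \<bullet> j)) *R T i j)"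
proof -
 have "T v w = T (\<Sum>i\<in>Basis. (v \<bullet> i) *R i) (\<Sum>j\<in>Basis. (w \<bullet> j) *R j)" by (simp add: euclidean_representation)
 also have "\<dots> = (\<Sum>(i, j)\<in>Basis \<times> Basis. T ((v \<bullet> i) *R i) ((w \<bullet> j) *R j))" by (rule bilinear_sum[OF assms])
 also have "\<dots> = (\<Sum>i\<in>Basis. \<Sum>j\<in>Basis. T ((v \<bullet> i) *R i) ((w \<bullet> j) *R j))" by (simp add: sum.cartesian_product)
 finally show ?thesis by (simp add: bilinear_lmul[OF assms] bilinear_rmul[OF assms] mult.commute)
qed

lemma bilinear_field_continuous:
 fixes T :: "'p::topological_space => 'e::euclidean_space => 'e => 'f::real_normed_vector"
 assumes T: "!!p. p \<in> V ==> bilinear (T p)" "!!v w. continuous_on V (%p. T p v w)"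
  and c: "continuous_on S c" "c ` S \<subseteq> V" "continuous_on S v" "continuous_on S w"
 shows "continuous_on S (%y. T (c y) (v y) (w y))"
proof -
 have "continuous_on S (%y. T (c y) i j)" for i j by (rule continuous_on_compose2[OF T(2) c(1,2)])
 hence "continuous_on S (%y. \<Sum>i\<in>Basis. \<Sum>j\<in>Basis. ((v y \<bullet> i) * (w y \<bullet> j)) *R T (c y) i j)"
  by (intro continuous_intros c)
 moreover have "T (c y) (v y) (w y) = (\<Sum>i\<in>Basis. \<Sum>j\<in>Basis. ((v y \<bullet> i) * (w y \<bullet> j)) *R T (c y) i j)" if "y \<in> S" for y
  using c(2) that by (intro bilinear_basis_expansion T(1)) auto
 ultimately show ?thesis by (simp cong: continuous_on_cong)
qed

lemma bilinear_field_derivative: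
 fixes T :: "'p::real_normed_vector => 'e::euclidean_space => 'e => 'f::real_normed_vector"
 assumes V: "open V" and T: "!!p. p \<in> V ==> bilinear (T p)" and T': "!!p v w. p \<in> V ==> ((%q. T q v w) has_derivative T' p v w) (at p)"
  and c: "(c has_derivative c') (at x within S)" "c ` S \<subseteq> V" "x \<in> S"
  and v: "(v has_derivative v') (at x within S)" and w: "(w has_derivative w') (at x within S)"
 shows "((%y. T (c y) (v y) (w y)) has_derivative (%h. T' (c x) (v x) (w x) (c' h) + T (c x) (v' h) (w x) + T (c x) (v x) (w' h))) (at x within S)"
proof -
 have cx: "c x \<in> V" using c by blast
 have exp: "T' (c x) v w u = (\<Sum>i\<in>Basis. \<Sum>j\<in>Basis. ((v \<bullet> i) * (w \<bullet> j)) *R T' (c x) i j u)" for v w u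
 proof -
  have d1: "((%q. \<Sum>i\<in>Basis. \<Sum>j\<in>Basis. ((v \<bullet> i) * (w \<bullet> j)) *R T q i j) has_derivative T' (c x) v w) (at (c x))"
   by (rule has_derivative_transform_within_open[OF T'[OF cx] V cx]) (rule bilinear_basis_expansion[OF T])
  have d2: "((%q. \<Sum>i\<in>Basis. \<Sum>j\<in>Basis. ((v \<bullet> i) * (w \<bullet> j)) *R T q i j) has_derivative
    (%u. \<Sum>i\<in>Basis. \<Sum>j\<in>Basis. ((v \<bullet> i) * (w \<bullet> j)) *R T' (c x) i j u)) (at (c x))"
   by (intro has_derivative_sum has_derivative_scaleR_right T'[OF cx])
  show ?thesis by (rule fun_cong[OF has_derivative_unique[OF d1 d2]])
 qed
 have chain: "((%y. T (c y) i j) has_derivative (%h. T' (c x) i j (c' h))) (at x within S)" for i j using has_derivative_compose[OF c(1) T'[OF cx]] .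
 have "((%y. \<Sum>i\<in>Basis. \<Sum>j\<in>Basis. ((v y \<bullet> i) * (w y \<bullet> j)) *R T (c y) i j) has_derivative
  (%h. \<Sum>i\<in>Basis. \<Sum>j\<in>Basis. ((v x \<bullet> i) * (w x \<bullet> j)) *R T' (c x) i j (c' h) +
   ((v x \<bullet> i) * (w' h \<bullet> j) + (v' h \<bullet> i) * (w x \<bullet> j)) *R T (c x) i j)) (at x within S)"
  by (intro has_derivative_sum has_derivative_scaleR has_derivative_mult has_derivative_inner_left v w chain)
 moreover have "(\<Sum>i\<in>Basis. \<Sum>j\<in>Basis. ((v x \<bullet> i) * (w x \<bullet> j)) *R T' (c x) i j (c' h) +
   ((v x \<bullet> i) * (w' h \<bullet> j) + (v' h \<bullet> i) * (w x \<bullet> j)) *R T (c x) i j)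
  = T' (c x) (v x) (w x) (c' h) + T (c x) (v' h) (w x) + T (c x) (v x) (w' h)" for h
  unfolding exp[of "v x" "w x"] bilinear_basis_expansion[OF T[OF cx], of "v' h" "w x"]
   bilinear_basis_expansion[OF T[OF cx], of "v x" "w' h"] by (simp add: sum.distrib scaleR_add_left add.assoc add.commute)
 ultimately have d: "((%y. \<Sum>i\<in>Basis. \<Sum>j\<in>Basis. ((v y \<bullet> i) * (w y \<bullet> j)) *R T (c y) i j) has_derivative
  (%h. T' (c x) (v x) (w x) (c' h) + T (c x) (v' h) (w x) + T (c x) (v x) (w' h))) (at x within S)" by simp
 show ?thesis by (rule has_derivative_transform[OF c(3) _ d]) (use c(2) in "intro bilinear_basis_expansion T, auto")
qed

lemma bilinear_field_vector_derivative:
 fixes T :: "'p::real_normed_vector => 'e::euclidean_space => 'e => 'f::real_normed_vector"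
 assumes V: "open V" and T: "!!p. p \<in> V ==> bilinear (T p)" and T': "!!p v w. p \<in> V ==> ((%q. T q v w) has_derivative T' p v w) (at p)"
  and c: "(c has_vector_derivative c') (at x within S)" "c ` S \<subseteq> V" "x \<in> S"
  and v: "(v has_vector_derivative v') (at x within S)" and w: "(w has_vector_derivative w') (at x within S)"
 shows "((%y. T (c y) (v y) (w y)) has_vector_derivative (T' (c x) (v x) (w x) c' + T (c x) v' (w x) + T (c x) (v x) w')) (at x within S)"
proof -
 have cx: "c x \<in> V" using c by blast
 show ?thesis using bilinear_field_derivative[OF V T T' c(1)[unfolded has_vector_derivative_def] c(2,3)
    v[unfolded has_vector_derivative_def] w[unfolded has_vector_derivative_def]] unfolding has_vector_derivative_def
  by (simp add: bilinear_lmul[OF T[OF cx]] bilinear_rmul[OF T[OF cx]]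
    linear_scale[OF has_derivative_linear[OF T'[OF cx]]] scaleR_add_right)
qed

text \<open>\<open>(u q - u p) *R m q\<close> is of smaller order than \<open>q - p\<close> because
  \<open>m\<close> vanishes at \<open>p\<close>, so continuity of \<open>u\<close> suffices. It is
  meant for a coefficient \<open>u\<close> whose differentiability is still to be shown.\<close>

lemma has_derivative_scaleR_vanishing:
 fixes m :: "'p::real_normed_vector => 'f::real_normed_vector"
 assumes u: "isCont u p" and m: "(m has_derivative m') (at p)" "m p = 0"
 shows "((%q. u q *R m q) has_derivative (%h. u p *R m' h)) (at p)"
proof -
 obtain K where K: "!!h. norm (m' h) <= norm h * K" "0 < K" using bounded_linear.pos_bounded[OF has_derivative_bounded_linear[OF m(1)]] by blast
 have "((%q. (u q - u p) *R m q) has_derivative (%h. 0)) (at p)" unfolding has_derivative_at_alt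
 proof (intro conjI allI impI bounded_linear_zero)
  fix e :: real assume e: "0 < e"
  obtain d1 where d1: "0 < d1" "!!q. norm (q - p) < d1 ==> norm (m q - m p - m' (q - p)) <= 1 * norm (q - p)"
   using m(1) zero_less_one unfolding has_derivative_at_alt by blast
  have "0 < e / (K + 1)" using e K(2) by simp
  then obtain d2 where d2: "0 < d2" "!!q. dist q p < d2 ==> dist (u q) (u p) < e / (K + 1)"
   using u unfolding continuous_at_eps_delta by (metis dist_commute)
  show "\<exists>d>0. \<forall>q. norm (q - p) < d --> norm ((u q - u p) *R m q - (u p - u p) *R m p - 0) <= e * norm (q - p)"
  proof (intro exI[of _ "min d1 d2"] conjI allI impI)
   fix q assume q: "norm (q - p) < min d1 d2"
   have "norm (m q) <= norm (m q - m' (q - p)) + norm (m' (q - p))" using norm_triangle_ineq[of "m q - m' (q - p)" "m' (q - p)"] by simp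
   hence 1: "norm (m q) <= (K + 1) * norm (q - p)" using d1(2)[of q] K(1)[of "q - p"] q m(2) by (simp add: algebra_simps)
   have 2: "\<bar>u q - u p\<bar> <= e / (K + 1)" using d2(2)[of q] q by (simp add: dist_norm less_imp_le)
   have "\<bar>u q - u p\<bar> * norm (m q) <= e / (K + 1) * ((K + 1) * norm (q - p))" using e K(2) by (intro mult_mono 1 2) auto
   also have "\<dots> = e * norm (q - p)" using K(2) by simp
   finally show "norm ((u q - u p) *R m q - (u p - u p) *R m p - 0) <= e * norm (q - p)" by simp
  qed (use d1 d2 in auto)
 qed
 hence "((%q. (u q - u p) *R m q + u p *R m q) has_derivative (%h. 0 + u p *R m' h)) (at p)"
  by (intro has_derivative_add has_derivative_scaleR_right m(1))
 thus ?thesis by (simp add: scaleR_diff_left)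
qed

text \<open>The solution is expressed through the fixed inverse of \<open>A p\<close>. The unknown
  reappears only with the factor \<open>A q - A p\<close>, which vanishes at \<open>p\<close>; this
  yields first continuity and then differentiability of \<open>z\<close>.\<close>

lemma linear_solution_perturbation:
 fixes A :: "'p::t2_space => 'e::euclidean_space => 'e"
 assumes V: "open V" "p \<in> V" and A: "!!q. q \<in> V ==> linear (A q)" "!!x. A p x = 0 ==> x = 0" and z: "!!q. q \<in> V ==> A q (z q) = k q"
  and q: "q \<in> V"
 shows "z q = inv (A p) (k q - (\<Sum>b\<in>Basis. (z q \<bullet> b) *R (A q b - A p b)))"
proof -
 have inj: "inj (A p)" using A(2) linear_injective_0[OF A(1)[OF V(2)]] by blast
 have "A q (z q) - A p (z q) = (\<Sum>b\<in>Basis. (z q \<bullet> b) *R (A q b - A p b))"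
 proof -
  have "A q x = (\<Sum>b\<in>Basis. (x \<bullet> b) *R A q b)" if "q \<in> V" for q x
   using linear_sum[OF A(1)[OF that], of "%b. (x \<bullet> b) *R b" Basis] linear_scale[OF A(1)[OF that]] by (simp add: euclidean_representation)
  from this[OF q, of "z q"] this[OF V(2), of "z q"] show ?thesis by (simp add: sum_subtractf scaleR_diff_right)
 qed
 hence "k q - (\<Sum>b\<in>Basis. (z q \<bullet> b) *R (A q b - A p b)) = A p (z q)" using z[OF q] by (simp add: algebra_simps)
 thus ?thesis using inj by simp
qed

lemma linear_solution_continuous:
 fixes A :: "'p::t2_space => 'e::euclidean_space => 'e"
 assumes V: "open V" "p \<in> V" and A: "!!q. q \<in> V ==> linear (A q)" "!!x. A p x = 0 ==> x = 0" and z: "!!q. q \<in> V ==> A q (z q) = k q"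
  and cA: "!!x. continuous (at p) (%q. A q x)" and ck: "continuous (at p) k"
 shows "continuous (at p) z"
proof -
 let ?m = "%q. \<Sum>b\<in>Basis. (z q \<bullet> b) *R (A q b - A p b)"
 let ?B = "inv (A p)"
 have inj: "inj (A p)" using A(2) linear_injective_0[OF A(1)[OF V(2)]] by blast
 have lin: "linear ?B" by (rule inj_linear_imp_inv_linear[OF A(1)[OF V(2)] inj])
 obtain K where K: "0 < K" "!!x. norm (?B x) <= K * norm x" using linear_bounded_pos[OF lin] by blast
 have pert: "z q = inv (A p) (k q - ?m q)" if "q \<in> V" for q by (rule linear_solution_perturbation[of V p A z k]) (use V A z that in blast)+
 define \<alpha> where "\<alpha> = (%q. \<Sum>b\<in>Basis. norm (A q b - A p b))"
 have t: "((%q. A q x) \<longlongrightarrow> A p x) (at p)" "(k \<longlongrightarrow> k p) (at p)" for x using cA ck unfolding continuous_at by auto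
 have "((%q. A q b - A p b) \<longlongrightarrow> A p b - A p b) (at p)" for b by (intro tendsto_diff t tendsto_const)
 hence \<alpha>: "(\<alpha> \<longlongrightarrow> 0) (at p)" unfolding \<alpha>_def by (intro tendsto_null_sum tendsto_norm_zero) auto
 have ev: "eventually (%q. q \<in> V) (at p)" by (rule eventually_at_in_open'[OF V])
 have "eventually (%q. \<alpha> q < 1 / (2 * K)) (at p)" using order_tendstoD(2)[OF \<alpha>, of "1 / (2 * K)"] K(1) by simp
 with ev have le: "eventually (%q. norm (z q - z p) <= 2 * (K * (norm (k q - k p) + \<alpha> q * norm (z p)))) (at p)"
 proof eventually_elim
  case (elim q)
  have \<alpha>0: "0 <= \<alpha> q" by (simp add: \<alpha>_def sum_nonneg)
  have e1: "z q - z p = ?B (k q - k p - ?m q)"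
  proof -
   have "z p = ?B (k p)" using pert[OF V(2)] by simp
   moreover have "k q - k p - ?m q
     = (k q - ?m q) - k p" by simp
   ultimately show ?thesis using pert[OF elim(1)] linear_diff[OF lin, of "k q - ?m q" "k p"] by (simp only:)
  qed
  have e2: "norm (?m q) <= \<alpha> q * norm (z q)"
  proof -
   have "norm ((z q \<bullet> b) *R (A q b - A p b)) <= norm (z q) * norm (A q b - A p b)" if "b \<in> Basis" for b
    using Basis_le_norm[OF that, of "z q"] by (simp add: mult_right_mono)
   thus ?thesis unfolding \<alpha>_def by (subst mult.commute, subst sum_distrib_left, intro order_trans[OF norm_sum] sum_mono) auto
  qed
  have e3: "norm (z q) <= norm (z p) + norm (z q - z p)" using norm_triangle_ineq[of "z p" "z q - z p"] by simp
  have "norm (k q - k p - ?m q) <= norm (k q - k p) + \<alpha> q * norm (z q)" using norm_triangle_ineq4[of "k q - k p" "?m q"] e2 by linarith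
  also have "\<dots> <= norm (k q - k p) + \<alpha> q * (norm (z p) + norm (z q - z p))" by (intro add_left_mono mult_left_mono e3 \<alpha>0)
  finally have "K * norm (k q - k p - ?m q)
    <= K * (norm (k q - k p) + \<alpha> q * (norm (z p) + norm (z q - z p)))" using K(1) by (intro mult_left_mono) auto
  hence "norm (z q - z p) <= K * (norm (k q - k p) + \<alpha> q * (norm (z p) + norm (z q - z p)))"
   using K(2)[of "k q - k p - ?m q"] unfolding e1[symmetric] by linarith
  also have "\<dots> = K * (norm (k q - k p) + \<alpha> q * norm (z p)) + (K * \<alpha> q) * norm (z q - z p)" by (simp add: algebra_simps)
  also have "(K * \<alpha> q) * norm (z q - z p) <= 1 / 2 * norm (z q - z p)" using elim(2) K(1) by (intro mult_right_mono) (auto simp: field_simps)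
  finally show ?case by linarith
 qed
 have "((%q. 2 * (K * (norm (k q - k p) + \<alpha> q * norm (z p)))) \<longlongrightarrow> 2 * (K * (norm (k p - k p) + 0 * norm (z p)))) (at p)"
  by (intro tendsto_intros t \<alpha>)
 hence lim: "((%q. 2 * (K * (norm (k q - k p) + \<alpha> q * norm (z p)))) \<longlongrightarrow> 0) (at p)" by simp
 have "((%q. norm (z q - z p)) \<longlongrightarrow> 0) (at p)" by (rule tendsto_sandwich[OF _ le tendsto_const lim]) simp
 thus ?thesis unfolding continuous_at by (simp add: tendsto_norm_zero_iff LIM_zero_iff)
qed

lemma linear_solution_derivative:
 fixes A :: "'p::real_normed_vector => 'e::euclidean_space => 'e"
 assumes V: "open V" "p \<in> V" and A: "!!q. q \<in> V ==> linear (A q)" "!!x. A p x = 0 ==> x = 0" and z: "!!q. q \<in> V ==> A q (z q) = k q"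
  and dA: "!!x. ((%q. A q x) has_derivative A' x) (at p)" and dk: "(k has_derivative k') (at p)"
 shows "(z has_derivative (%h. inv (A p) (k' h - (\<Sum>b\<in>Basis. (z p \<bullet> b) *R A' b h)))) (at p)"
proof -
 have inj: "inj (A p)" using A(2) linear_injective_0[OF A(1)[OF V(2)]] by blast
 have lin: "linear (inv (A p))" by (rule inj_linear_imp_inv_linear[OF A(1)[OF V(2)] inj])
 have cz: "continuous (at p) z" by (rule linear_solution_continuous[OF V A z has_derivative_continuous[OF dA] has_derivative_continuous[OF dk]])
 have "((%q. (z q \<bullet> b) *R (A q b - A p b)) has_derivative (%h. (z p \<bullet> b) *R (A' b h - 0))) (at p)" for b
  by (rule has_derivative_scaleR_vanishing) (intro continuous_intros cz has_derivative_diff dA has_derivative_const | simp)+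
 hence "((%q. inv (A p) (k q - (\<Sum>b\<in>Basis. (z q \<bullet> b) *R (A q b - A p b)))) has_derivative
   (%h. inv (A p) (k' h - (\<Sum>b\<in>Basis. (z p \<bullet> b) *R A' b h)))) (at p)"
  by (intro bounded_linear.has_derivative[OF linear_conv_bounded_linear[THEN iffD1, OF lin]] has_derivative_diff dk has_derivative_sum) simp
 thus ?thesis
 proof (rule has_derivative_transform_within_open[OF _ V])
  fix q assume "q \<in> V"
  thus "inv (A p) (k q - (\<Sum>b\<in>Basis. (z q \<bullet> b) *R (A q b - A p b))) = z q"
   using linear_solution_perturbation[of V p A z k q] V A z by simp
 qed
qed

text \<open>The second difference \<Delta> is symmetric in its two directions, and two applications
  of the mean value theorem evaluate it by second derivatives in either order.\<close>

lemma second_derivative_symmetric: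
 fixes f :: "'e::real_normed_vector => real"
 assumes V: "open V" "p \<in> V" and f: "!!x. x \<in> V ==> (f has_derivative f' x) (at x)"
  and f': "!!x u. x \<in> V ==> ((%x. f' x u) has_derivative (%h. f'' x h u)) (at x)"
  and c: "!!u h. continuous_on V (%x. f'' x h u)"
 shows "f'' p h u = f'' p u h"
proof -
 define \<Delta> where "\<Delta> = (%\<tau> h u. f (p + \<tau> *R h + \<tau> *R u) - f (p + \<tau> *R h) - f (p + \<tau> *R u) + f p)"
 have along: "((%s. k (x + s *R h)) has_real_derivative k' h) (at s)" if "(k has_derivative k') (at (x + s *R h))" for k k' x s h
 proof -
  have "((%s. x + s *R h) has_derivative (%y. y *R h)) (at s)" by (auto intro!: derivative_eq_intros)
  from has_derivative_compose[OF this that] show ?thesis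
   by (simp add: has_field_derivative_def linear_scale[OF has_derivative_linear[OF that]] mult.commute[of _ "k' h"])
 qed
 have approx: "\<exists>\<delta>>0. \<forall>\<tau>. 0 < \<tau> --> \<tau> < \<delta> --> \<bar>\<Delta> \<tau> h u - \<tau> * (\<tau> * f'' p u h)\<bar> < \<tau> * (\<tau> * e)" if e: "0 < e" for e h u
 proof -
  have "isCont (%x. f'' x u h) p" using c V by (simp add: continuous_on_eq_continuous_at)
  hence "\<forall>\<^sub>F x in nhds p. dist (f'' x u h) (f'' p u h) < e"
   using tendstoD[OF iffD1[OF tendsto_at_iff_tendsto_nhds[of "%x. f'' x u h" p]] e] by (simp add: isCont_def)
  from eventually_conj[OF eventually_nhds_in_open[OF V] this]
  obtain d where d: "0 < d" "!!x. dist x p < d ==> x \<in> V & \<bar>f'' x u h - f'' p u h\<bar> < e"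
   unfolding eventually_nhds_metric dist_real_def by blast
  let ?L = "norm h + norm u + 1"
  show ?thesis
  proof (intro exI[of _ "d / ?L"] conjI allI impI)
   show "0 < d / ?L" using d(1) by (simp add: add_nonneg_pos)
   fix \<tau> assume \<tau>: "0 < \<tau>" "\<tau> < d / ?L"
   have inb: "dist (p + s *R h + t *R u) p < d" if "0 <= s" "s <= \<tau>" "0 <= t" "t <= \<tau>" for s t
   proof -
    have "norm (s *R h + t *R u) <= \<tau> * norm h + \<tau> * norm u" using that by (intro norm_triangle_mono) (auto intro: mult_right_mono)
    also have "\<dots> <= \<tau> * ?L" using \<tau>(1) by (simp add: algebra_simps)
    also have "\<dots> < d" using \<tau>(2) by (simp add: pos_less_divide_eq add_nonneg_pos)
    finally show ?thesis by (simp add: dist_norm add.assoc)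
   qed
   note V = d(2)[OF inb, THEN conjunct1]
   let ?g = "%s. f (p + \<tau> *R u + s *R h) - f (p + s *R h)"
   have "\<exists>s>0. s < \<tau> & ?g \<tau> - ?g 0 = (\<tau> - 0) * (f' (p + \<tau> *R u + s *R h) h - f' (p + s *R h) h)"
   proof (rule MVT2[OF \<tau>(1)])
    fix s assume "0 <= s" "s <= \<tau>"
    thus "(?g has_real_derivative f' (p + \<tau> *R u + s *R h) h - f' (p + s *R h) h) (at s)"
     using V[of s \<tau>] V[of s 0] \<tau>(1) by (intro DERIV_diff along f) (auto simp: add_ac)
   qed
   then obtain s where s: "0 < s" "s < \<tau>" "\<Delta> \<tau> h u = \<tau> * (f' (p + s *R h + \<tau> *R u) h - f' (p + s *R h + 0 *R u) h)"
    by (auto simp: \<Delta>_def add_ac algebra_simps)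
   have "\<exists>t>0. t < \<tau> & f' (p + s *R h + \<tau> *R u) h - f' (p + s *R h + 0 *R u) h = (\<tau> - 0) * f'' (p + s *R h + t *R u) u h"
    by (rule MVT2[OF \<tau>(1), where f = "%t. f' (p + s *R h + t *R u) h"], rule along, rule f') (use V s in auto)
   then obtain t where t: "0 < t" "t < \<tau>" "\<Delta> \<tau> h u = \<tau> * (\<tau> * f'' (p + s *R h + t *R u) u h)" using s(3) by auto
   have "\<bar>f'' (p + s *R h + t *R u) u h - f'' p u h\<bar> < e" using d(2)[OF inb] s t by simp
   thus "\<bar>\<Delta> \<tau> h u - \<tau> * (\<tau> * f'' p u h)\<bar> < \<tau> * (\<tau> * e)"
    unfolding t(3) right_diff_distrib[symmetric] abs_mult using \<tau>(1) by simp
  qed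
 qed
 show ?thesis
 proof (rule ccontr)
  define e where "e = \<bar>f'' p h u - f'' p u h\<bar> / 2"
  assume "\<not> ?thesis"
  hence e: "0 < e" by (simp add: e_def)
  obtain \<delta>1 \<delta>2 where \<delta>: "0 < \<delta>1" "!!\<tau>. 0 < \<tau> ==> \<tau> < \<delta>1 ==> \<bar>\<Delta> \<tau> h u - \<tau> * (\<tau> * f'' p u h)\<bar> < \<tau> * (\<tau> * e)"
   "0 < \<delta>2" "!!\<tau>. 0 < \<tau> ==> \<tau> < \<delta>2 ==> \<bar>\<Delta> \<tau> u h - \<tau> * (\<tau> * f'' p h u)\<bar> < \<tau> * (\<tau> * e)"
   using approx[OF e, of h u] approx[OF e, of u h] by blast
  define \<tau> where "\<tau> = min \<delta>1 \<delta>2 / 2"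
  have \<tau>: "0 < \<tau>" "\<tau> < \<delta>1" "\<tau> < \<delta>2" using \<delta>(1,3) by (auto simp: \<tau>_def)
  have "\<Delta> \<tau> u h = \<Delta> \<tau> h u" by (simp add: \<Delta>_def add_ac)
  hence "\<bar>\<tau> * (\<tau> * f'' p h u) - \<tau> * (\<tau> * f'' p u h)\<bar> < 2 * (\<tau> * (\<tau> * e))"
   using \<delta>(2)[OF \<tau>(1,2)] \<delta>(4)[OF \<tau>(1,3)] by linarith
  thus False unfolding right_diff_distrib[symmetric] abs_mult e_def using \<tau>(1) by simp
 qed
qed

section \<open>Riemannian metrics in coordinates\<close>

locale local_metric =
 fixes V :: "'e::euclidean_space set" and G :: "'e => 'e => 'e => real"
 assumes open_V: "open V" and bilinear_G: "p \<in> V ==> bilinear (G p)" and G_sym: "p \<in> V ==> G p v w = G p w v"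
  and G_pos: "p \<in> V ==> v ~= 0 ==> 0 < G p v v"
  and G_smooth: "smooth_on V (%p. G p v w)"
begin

abbreviation dG where "dG \<equiv> metric_deriv G"
abbreviation \<Gamma> where "\<Gamma> \<equiv> christoffel G"

definition ddG where "ddG p h u v w = frechet_derivative (%q. dG q u v w) (at p) h"

lemma G_simps: "p \<in> V ==> G p (a + b) w = G p a w + G p b w" "p \<in> V ==> G p w (a + b) = G p w a + G p w b"
 "p \<in> V ==> G p (a - b) w = G p a w - G p b w" "p \<in> V ==> G p w (a - b) = G p w a - G p w b"
 "p \<in> V ==> G p (- a) w = - G p a w" "p \<in> V ==> G p w (- a) = - G p w a"
 "p \<in> V ==> G p (r *R a) w = r * G p a w" "p \<in> V ==> G p w (r *R a) = r * G p w a"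
 "p \<in> V ==> G p 0 w = 0" "p \<in> V ==> G p w 0 = 0"
 using bilinear_G by (auto simp: bilinear_ladd bilinear_radd bilinear_lsub bilinear_rsub bilinear_lneg bilinear_rneg
   bilinear_lmul bilinear_rmul bilinear_lzero bilinear_rzero)

lemma G_nonneg: "p \<in> V ==> 0 <= G p v v" using G_pos[of p v] G_simps(9)[of p] by (cases "v = 0") auto

lemma G_zero_iff: "p \<in> V ==> G p v v = 0 \<longleftrightarrow> v = 0" using G_pos[of p v] G_simps(9)[of p] by (cases "v = 0") auto

lemma G_eqI: "p \<in> V ==> (!!u. G p a u = G p b u) ==> a = b" using G_zero_iff[of p "a - b"] by (simp add: G_simps)

lemma Ck: "Ck_on (Suc (Suc 0)) V (%p. G p v w)" using G_smooth unfolding smooth_on_def by blast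

lemma dG: "p \<in> V ==> ((%q. G q v w) has_derivative (%u. dG p u v w)) (at p)"
 using Ck[of v w] frechet_derivative_works unfolding metric_deriv_def by (auto simp: fun_eq_iff)

lemma ddG: "p \<in> V ==> ((%q. dG q u v w) has_derivative (%h. ddG p h u v w)) (at p)"
proof -
 assume p: "p \<in> V"
 have "(%q. dG q u v w) differentiable (at p)" using Ck[of v w] p unfolding metric_deriv_def by simp
 thus ?thesis unfolding ddG_def by (simp add: frechet_derivative_works[symmetric])
qed

lemma ddG_cont: "continuous_on V (%p. ddG p h u v w)" using Ck[of v w] unfolding ddG_def metric_deriv_def by simp

lemma ddG_sym: "p \<in> V ==> ddG p h u v w = ddG p u h v w" by (rule second_derivative_symmetric[OF open_V _ dG ddG ddG_cont])

lemma G_cont: "continuous_on V (%p. G p v w)" and dG_cont: "continuous_on V (%p. dG p u v w)"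
 by (rule has_derivative_continuous_on, rule has_derivative_at_withinI, (erule dG ddG))+

lemma linear_dG: "p \<in> V ==> linear (%u. dG p u v w)" by (rule has_derivative_linear[OF dG])

lemma dG_sym: "p \<in> V ==> dG p u v w = dG p u w v"
proof -
 assume p: "p \<in> V"
 have "((%q. G q w v) has_derivative (%u. dG p u v w)) (at p)" by (rule has_derivative_transform_within_open[OF dG[OF p] open_V p]) (rule G_sym)
 from fun_cong[OF has_derivative_unique[OF this dG[OF p]]] show ?thesis .
qed

lemma dG_bilinear: "p \<in> V ==> bilinear (dG p u)"
proof -
 assume p: "p \<in> V"
 have add: "dG p u (a + b) w = dG p u a w + dG p u b w" for a b w
 proof -
  have "((%q. G q (a + b) w) has_derivative (%u. dG p u a w + dG p u b w)) (at p)"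
   by (rule has_derivative_transform_within_open[OF has_derivative_add[OF dG[OF p] dG[OF p]] open_V p]) (simp add: G_simps)
  from fun_cong[OF has_derivative_unique[OF dG[OF p] this]] show ?thesis .
 qed
 have scale: "dG p u (r *R a) w = r * dG p u a w" for r a w
 proof -
  have "((%q. G q (r *R a) w) has_derivative (%u. r * dG p u a w)) (at p)"
   by (rule has_derivative_transform_within_open[OF has_derivative_mult_right[OF dG[OF p]] open_V p]) (simp add: G_simps)
  from fun_cong[OF has_derivative_unique[OF dG[OF p] this]] show ?thesis .
 qed
 have add2: "dG p u w (a + b) = dG p u w a + dG p u w b" for a b w unfolding dG_sym[OF p, of u w] by (rule add)
 have scale2: "dG p u w (r *R a) = r * dG p u w a" for r a w unfolding dG_sym[OF p, of u w] by (rule scale)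
 show ?thesis unfolding bilinear_def by (intro conjI allI linearI) (simp_all add: add scale add2 scale2)
qed

text \<open>The metric as an operator with respect to the Euclidean inner product. It turns the
  Koszul formula into a linear equation for the Christoffel symbol with coefficient
  \<open>A p\<close>.\<close>

definition A :: "'e => 'e => 'e" where "A p z = (\<Sum>b\<in>Basis. G p z b *R b)"
definition koszul :: "'e => 'e => 'e => 'e" where "koszul p v w = (\<Sum>b\<in>Basis. ((dG p v w b + dG p w v b - dG p b v w) / 2) *R b)"

lemma A_inner: "p \<in> V ==> A p z \<bullet> u = G p z u"
proof -
 assume p: "p \<in> V"
 have "G p z u = (\<Sum>b\<in>Basis. (u \<bullet> b) * G p z b)"
  using linear_sum[of "G p z" "%b. (u \<bullet> b) *R b" Basis] bilinear_G[OF p] G_simps(8)[OF p] by (simp add: bilinear_def euclidean_representation)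
 thus ?thesis unfolding A_def by (simp add: inner_sum_left inner_sum_right inner_commute mult.commute)
qed

lemma linear_A: "p \<in> V ==> linear (A p)" by (intro linearI) (auto simp: A_def G_simps scaleR_add_left sum.distrib scaleR_sum_right)

lemma A_inj: "p \<in> V ==> A p z = 0 ==> z = 0" using A_inner[of p z z] G_zero_iff[of p z] by simp

lemma bij_A: "p \<in> V ==> bij (A p)"
proof -
 assume p: "p \<in> V"
 have "inj (A p)" using linear_injective_0[OF linear_A[OF p]] A_inj[OF p] by blast
 thus ?thesis using linear_injective_imp_surjective[OF linear_A[OF p]] by (simp add: bij_def)
qed

lemma koszul_inner: "p \<in> V ==> 2 * (koszul p v w \<bullet> u) = dG p v w u + dG p w v u - dG p u v w"
proof -
 assume p: "p \<in> V"
 let ?l = "%u. dG p v w u + dG p w v u - dG p u v w"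
 have "linear ?l" using dG_bilinear[OF p] linear_dG[OF p] by (intro linear_compose_sub linear_compose_add) (auto simp: bilinear_def)
 from linear_sum[OF this, of "%b. (u \<bullet> b) *R b" Basis] linear_scale[OF this]
 have "?l u = (\<Sum>b\<in>Basis. (u \<bullet> b) * ?l b)" by (simp add: euclidean_representation)
 thus ?thesis unfolding koszul_def by (simp add: inner_sum_left inner_sum_right sum_distrib_left inner_commute mult.commute)
qed

lemma christoffel_koszul:
 assumes p: "p \<in> V"
 shows "2 * G p (\<Gamma> p v w) u = dG p v w u + dG p w v u - dG p u v w" and "A p (\<Gamma> p v w) = koszul p v w"
proof -
 define z where "z = inv (A p) (koszul p v w)"
 have Az: "A p z = koszul p v w" unfolding z_def by (rule surj_f_inv_f) (use bij_A[OF p] in "simp add: bij_def")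
 have z: "2 * G p z u = dG p v w u + dG p w v u - dG p u v w" for u using A_inner[OF p, of z u] koszul_inner[OF p, of v w u] Az by simp
 have \<Gamma>: "\<Gamma> p v w = z" unfolding christoffel_def
 proof (rule the_equality)
  fix z' assume z': "\<forall>u. 2 * G p z' u = dG p v w u + dG p w v u - dG p u v w"
  show "z' = z" by (rule G_eqI[OF p]) (use z z' in "metis mult_cancel_left zero_neq_numeral")
 qed (use z in blast)
 show "2 * G p (\<Gamma> p v w) u = dG p v w u + dG p w v u - dG p u v w" "A p (\<Gamma> p v w) = koszul p v w" unfolding \<Gamma> by (rule z Az)+
qed

lemma \<Gamma>_sym: "p \<in> V ==> \<Gamma> p v w = \<Gamma> p w v"
proof (rule G_eqI)
 fix u assume p: "p \<in> V"
 show "G p (\<Gamma> p v w) u = G p (\<Gamma> p w v) u"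
  using christoffel_koszul(1)[OF p, of v w u] christoffel_koszul(1)[OF p, of w v u] dG_sym[OF p, of u v w] by linarith
qed

lemma bilinear_\<Gamma>: "p \<in> V ==> bilinear (\<Gamma> p)"
proof -
 assume p: "p \<in> V"
 note b = dG_bilinear[OF p]
 have add: "\<Gamma> p (a + b) w = \<Gamma> p a w + \<Gamma> p b w" for a b w
 proof (rule G_eqI[OF p])
  fix u
  show "G p (\<Gamma> p (a + b) w) u = G p (\<Gamma> p a w + \<Gamma> p b w) u"
   using christoffel_koszul(1)[OF p, of "a + b" w u] christoffel_koszul(1)[OF p, of a w u] christoffel_koszul(1)[OF p, of b w u]
   by (simp add: G_simps(1)[OF p] bilinear_ladd[OF dG_bilinear[OF p]] linear_add[OF linear_dG[OF p]])
 qed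
 have scale: "\<Gamma> p (r *R a) w = r *R \<Gamma> p a w" for r a w
 proof (rule G_eqI[OF p])
  fix u
  have "2 * G p (\<Gamma> p (r *R a) w) u = r * (2 * G p (\<Gamma> p a w) u)" unfolding christoffel_koszul(1)[OF p]
   by (simp add: bilinear_lmul[OF dG_bilinear[OF p]] bilinear_rmul[OF dG_bilinear[OF p]] linear_scale[OF linear_dG[OF p]] algebra_simps)
  thus "G p (\<Gamma> p (r *R a) w) u = G p (r *R \<Gamma> p a w) u" by (simp add: G_simps(7)[OF p])
 qed
 have add2: "\<Gamma> p w (a + b) = \<Gamma> p w a + \<Gamma> p w b" for a b w unfolding \<Gamma>_sym[OF p, of w] by (rule add)
 have scale2: "\<Gamma> p w (r *R a) = r *R \<Gamma> p w a" for r a w unfolding \<Gamma>_sym[OF p, of w] by (rule scale)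
 show ?thesis unfolding bilinear_def by (intro conjI allI linearI) (simp_all add: add scale add2 scale2)
qed

lemma compat: "p \<in> V ==> dG p u v w = G p (\<Gamma> p u v) w + G p v (\<Gamma> p u w)"
 using christoffel_koszul(1)[of p u v w] christoffel_koszul(1)[of p u w v]
  dG_sym[of p u v w] dG_sym[of p v u w] dG_sym[of p w u v] G_sym[of p v "\<Gamma> p u w"] by linarith

section \<open>Curvature\<close>

definition d\<Gamma> where "d\<Gamma> p u v w = frechet_derivative (%q. \<Gamma> q v w) (at p) u"

lemma A_deriv: "p \<in> V ==> ((%q. A q x) has_derivative (%h. \<Sum>b\<in>Basis. dG p h x b *R b)) (at p)"
 unfolding A_def by (intro has_derivative_sum has_derivative_scaleR_left dG)

lemma koszul_deriv: "p \<in> V ==> ((%q. koszul q v w) has_derivative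
  (%h. \<Sum>b\<in>Basis. ((ddG p h v w b + ddG p h w v b - ddG p h b v w) / 2) *R b)) (at p)" unfolding koszul_def divide_inverse
 by (intro has_derivative_sum has_derivative_scaleR_left has_derivative_mult_left has_derivative_add has_derivative_diff ddG)

text \<open>\<open>d\<Gamma>_solves\<close> is the differentiated Koszul equation. It is again a
  linear equation with coefficient \<open>A p\<close>, from which \<open>d\<Gamma>_cont\<close>
  draws the continuity of the derivative.\<close>

lemma assumes p: "p \<in> V" shows d\<Gamma>: "((%q. \<Gamma> q v w) has_derivative (%u. d\<Gamma> p u v w)) (at p)"
  and d\<Gamma>_solves: "A p (d\<Gamma> p u v w) = (\<Sum>b\<in>Basis. ((ddG p u v w b + ddG p u w v b - ddG p u b v w) / 2) *R b)
   - (\<Sum>b\<in>Basis. (\<Gamma> p v w \<bullet> b) *R (\<Sum>c\<in>Basis. dG p u b c *R c))"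
proof -
 have d: "((%q. \<Gamma> q v w) has_derivative (%h. inv (A p) ((\<Sum>b\<in>Basis. ((ddG p h v w b + ddG p h w v b - ddG p h b v w) / 2) *R b)
   - (\<Sum>b\<in>Basis. (\<Gamma> p v w \<bullet> b) *R (\<Sum>c\<in>Basis. dG p h b c *R c))))) (at p)"
  by (rule linear_solution_derivative[OF open_V p linear_A A_inj[OF p] christoffel_koszul(2) A_deriv[OF p] koszul_deriv[OF p]])
 have eq: "(%u. d\<Gamma> p u v w) = (%h. inv (A p) ((\<Sum>b\<in>Basis. ((ddG p h v w b + ddG p h w v b - ddG p h b v w) / 2) *R b)
   - (\<Sum>b\<in>Basis. (\<Gamma> p v w \<bullet> b) *R (\<Sum>c\<in>Basis. dG p h b c *R c))))"
  unfolding d\<Gamma>_def by (rule frechet_derivative_at[OF d, symmetric])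
 show "((%q. \<Gamma> q v w) has_derivative (%u. d\<Gamma> p u v w)) (at p)" unfolding eq by (rule d)
 show "A p (d\<Gamma> p u v w) = (\<Sum>b\<in>Basis. ((ddG p u v w b + ddG p u w v b - ddG p u b v w) / 2) *R b)
   - (\<Sum>b\<in>Basis. (\<Gamma> p v w \<bullet> b) *R (\<Sum>c\<in>Basis. dG p u b c *R c))"
  unfolding fun_cong[OF eq] by (rule surj_f_inv_f) (use bij_A[OF p] in "simp add: bij_def")
qed

lemma \<Gamma>_cont: "continuous_on V (%p. \<Gamma> p v w)" by (rule has_derivative_continuous_on, rule has_derivative_at_withinI, erule d\<Gamma>)

lemma d\<Gamma>_cont: "continuous_on V (%p. d\<Gamma> p u v w)" unfolding continuous_on_eq_continuous_at[OF open_V]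
proof
 fix p assume p: "p \<in> V"
 have c: "continuous (at p) f" if "continuous_on V f" for f :: "'e => 'b::metric_space"
  using that p continuous_on_eq_continuous_at[OF open_V] by blast
 have A: "continuous (at p) (%q. A q x)" for x by (rule has_derivative_continuous[OF A_deriv[OF p]])
 have k: "continuous (at p) (%p. (\<Sum>b\<in>Basis. ((ddG p u v w b + ddG p u w v b - ddG p u b v w) / 2) *R b)
   - (\<Sum>b\<in>Basis. (\<Gamma> p v w \<bullet> b) *R (\<Sum>c\<in>Basis. dG p u b c *R c)))"
  unfolding divide_inverse by (rule c) (intro continuous_intros ddG_cont dG_cont \<Gamma>_cont)
 show "continuous (at p) (%p. d\<Gamma> p u v w)" by (rule linear_solution_continuous[OF open_V p linear_A A_inj[OF p] d\<Gamma>_solves A k])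
qed

lemma linear_d\<Gamma>: "p \<in> V ==> linear (%u. d\<Gamma> p u v w)" by (rule has_derivative_linear[OF d\<Gamma>])

lemma d\<Gamma>_sym: "p \<in> V ==> d\<Gamma> p u v w = d\<Gamma> p u w v"
proof -
 assume p: "p \<in> V"
 have "((%q. \<Gamma> q w v) has_derivative (%u. d\<Gamma> p u v w)) (at p)"
  by (rule has_derivative_transform_within_open[OF d\<Gamma>[OF p] open_V p]) (rule \<Gamma>_sym)
 from fun_cong[OF has_derivative_unique[OF this d\<Gamma>[OF p]]] show ?thesis .
qed

lemma bilinear_d\<Gamma>: "p \<in> V ==> bilinear (d\<Gamma> p u)"
proof -
 assume p: "p \<in> V"
 note b = bilinear_\<Gamma>
 have add: "d\<Gamma> p u (a + b) w = d\<Gamma> p u a w + d\<Gamma> p u b w" for a b w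
 proof -
  have "((%q. \<Gamma> q (a + b) w) has_derivative (%u. d\<Gamma> p u a w + d\<Gamma> p u b w)) (at p)"
   by (rule has_derivative_transform_within_open[OF has_derivative_add[OF d\<Gamma>[OF p] d\<Gamma>[OF p]] open_V p])
    (simp add: bilinear_ladd[OF bilinear_\<Gamma>])
  from fun_cong[OF has_derivative_unique[OF d\<Gamma>[OF p] this]] show ?thesis .
 qed
 have scale: "d\<Gamma> p u (r *R a) w = r *R d\<Gamma> p u a w" for r a w
 proof -
  have "((%q. \<Gamma> q (r *R a) w) has_derivative (%u. r *R d\<Gamma> p u a w)) (at p)"
   by (rule has_derivative_transform_within_open[OF has_derivative_scaleR_right[OF d\<Gamma>[OF p]] open_V p])
    (simp add: bilinear_lmul[OF bilinear_\<Gamma>])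
  from fun_cong[OF has_derivative_unique[OF d\<Gamma>[OF p] this]] show ?thesis .
 qed
 have add2: "d\<Gamma> p u w (a + b) = d\<Gamma> p u w a + d\<Gamma> p u w b" for a b w unfolding d\<Gamma>_sym[OF p, of u w] by (rule add)
 have scale2: "d\<Gamma> p u w (r *R a) = r *R d\<Gamma> p u w a" for r a w unfolding d\<Gamma>_sym[OF p, of u w] by (rule scale)
 show ?thesis unfolding bilinear_def by (intro conjI allI linearI) (simp_all add: add scale add2 scale2)
qed

lemma curvature_eq: "curvature G p u v w = d\<Gamma> p u v w + \<Gamma> p u (\<Gamma> p v w) - d\<Gamma> p v u w - \<Gamma> p v (\<Gamma> p u w)"
 by (simp add: curvature_def d\<Gamma>_def)

lemma ddG_eq:
 assumes p: "p \<in> V"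
 shows "ddG p u v w z = G p (\<Gamma> p u (\<Gamma> p v w)) z + G p (\<Gamma> p v w) (\<Gamma> p u z) + G p (d\<Gamma> p u v w) z
  + (G p (\<Gamma> p u w) (\<Gamma> p v z) + G p w (\<Gamma> p u (\<Gamma> p v z)) + G p w (d\<Gamma> p u v z))"
proof -
 have i: "((%q. q) has_derivative (%h. h)) (at p within V)" by (rule has_derivative_ident)
 have z: "((%q. x) has_derivative (%h. 0)) (at p within V)" for x :: 'e by (rule has_derivative_const)
 have g: "((%q. \<Gamma> q v w) has_derivative (%u. d\<Gamma> p u v w)) (at p within V)" for v w
  by (rule has_derivative_at_withinI[OF d\<Gamma>[OF p]])
 note D = bilinear_field_derivative[OF open_V bilinear_G dG i _ p]
 have "((%q. G q (\<Gamma> q v w) z + G q w (\<Gamma> q v z)) has_derivative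
  (%u. (dG p u (\<Gamma> p v w) z + G p (d\<Gamma> p u v w) z + G p (\<Gamma> p v w) 0)
   + (dG p u w (\<Gamma> p v z) + G p 0 (\<Gamma> p v z) + G p w (d\<Gamma> p u v z)))) (at p within V)" by (intro has_derivative_add D g z) auto
 hence "((%q. dG q v w z) has_derivative (%u. (dG p u (\<Gamma> p v w) z + G p (d\<Gamma> p u v w) z + G p (\<Gamma> p v w) 0)
   + (dG p u w (\<Gamma> p v z) + G p 0 (\<Gamma> p v z) + G p w (d\<Gamma> p u v z)))) (at p within V)"
  by (rule has_derivative_transform[OF p, rotated]) (rule compat)
 hence "((%q. dG q v w z) has_derivative (%u. (dG p u (\<Gamma> p v w) z + G p (d\<Gamma> p u v w) z + G p (\<Gamma> p v w) 0)
   + (dG p u w (\<Gamma> p v z) + G p 0 (\<Gamma> p v z) + G p w (d\<Gamma> p u v z)))) (at p)" unfolding at_within_open[OF p open_V] .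
 from fun_cong[OF has_derivative_unique[OF ddG[OF p] this], of u] show ?thesis by (simp add: compat[OF p] G_simps(9,10)[OF p])
qed

text \<open>\<open>ddG_eq\<close> is antisymmetrised in the first two directions: the left side
  vanishes because second derivatives commute, and the mixed products of Christoffel symbols
  cancel.\<close>

lemma curvature_skew:
 assumes p: "p \<in> V"
 shows "G p (curvature G p u v w) z = - G p w (curvature G p u v z)" using ddG_eq[OF p, of u v w z] ddG_eq[OF p, of v u w z] ddG_sym[OF p, of u v w z]
 unfolding curvature_eq by (simp add: G_simps(1-4)[OF p])

lemma G_Cauchy_Schwarz:
 assumes p: "p \<in> V"
 shows "(G p u v)\<^sup>2 <= G p u u * G p v v" and "(G p u v)\<^sup>2 = G p u u * G p v v ==> v ~= 0 ==> u = (G p u v / G p v v) *R v"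
proof -
 let ?z = "G p v v *R u - G p u v *R v"
 have eq: "G p ?z ?z = G p v v * (G p u u * G p v v - (G p u v)\<^sup>2)"
  using G_sym[OF p, of v u] by (simp add: G_simps[OF p] power2_eq_square algebra_simps)
 show "(G p u v)\<^sup>2 <= G p u u * G p v v"
 proof (cases "v = 0")
  case False
  thus ?thesis using eq G_nonneg[OF p, of ?z] G_pos[OF p, of v] by (simp add: zero_le_mult_iff)
 qed (simp add: G_simps[OF p])
 assume *: "(G p u v)\<^sup>2 = G p u u * G p v v" "v ~= 0"
 hence "?z = 0" using eq G_zero_iff[OF p, of ?z] by simp
 hence "u = (1 / G p v v) *R (G p u v *R v)" using G_pos[OF p *(2)] by (metis eq_iff_diff_eq_0 less_irrefl real_vector_eq_affinity scaleR_scaleR divide_self_if scaleR_one times_divide_eq_left mult_1 one_add_one mult.commute)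
 thus "u = (G p u v / G p v v) *R v" by simp
qed

end

locale negatively_curved_metric = local_metric + assumes negative: "p \<in> V ==> u ~= v ==> independent {u, v} ==> sectional_curvature G p u v < 0"
begin

text \<open>The sign comes from the skew symmetry of the curvature. In this form the term appears in
  the second derivative of the squared norm of a Jacobi field.\<close>

lemma curvature_positive:
 assumes p: "p \<in> V" and i: "u ~= v" "independent {u, v}"
 shows "0 < G p (curvature G p u v u) v"
proof -
 have "v ~= 0" using i(2) dependent_zero[of "{u, v}"] by auto
 have "u \<in> span {v} ==> False" using i by (auto simp: dependent_def dest: spec[of _ u])
 hence "u ~= c *R v" for c using span_scale[OF span_base, of v "{v}" c] by auto
 hence "(G p u v)\<^sup>2 ~= G p u u * G p v v" using G_Cauchy_Schwarz(2)[OF p _ \<open>v ~= 0\<close>] by blast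
 hence "0 < G p u u * G p v v - (G p u v)\<^sup>2" using G_Cauchy_Schwarz(1)[OF p, of u v] by linarith
 moreover have "G p (curvature G p u v v) u / (G p u u * G p v v - (G p u v)\<^sup>2) < 0"
  using negative[OF p i] by (simp add: sectional_curvature_def)
 ultimately have "G p (curvature G p u v v) u < 0" by (simp add: divide_less_0_iff)
 thus ?thesis using curvature_skew[OF p, of u v u v] G_sym[OF p, of u] by simp
qed

lemma curvature_nonneg:
 assumes p: "p \<in> V"
 shows "0 <= G p (curvature G p u v u) v"
proof (cases "u ~= v & independent {u, v}")
 case False
 have "u = 0 \<or> (\<exists>c. v = c *R u)"
 proof (cases "u = v")
  case True
  thus ?thesis by (intro disjI2 exI[of _ 1]) simp
 next case ne: False
  hence "dependent {u, v}" using False by blast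
  thus ?thesis using ne dependent_insertD independent_insert[of v "{u}"] dependent_single[of u] by (auto simp: insert_commute span_singleton)
 qed
 hence "curvature G p u v u = 0" unfolding curvature_eq
  by (auto simp: bilinear_lmul[OF bilinear_\<Gamma>[OF p]] bilinear_rmul[OF bilinear_\<Gamma>[OF p]] bilinear_lzero[OF bilinear_\<Gamma>[OF p]]
    bilinear_rzero[OF bilinear_\<Gamma>[OF p]] bilinear_lmul[OF bilinear_d\<Gamma>[OF p]] bilinear_lzero[OF bilinear_d\<Gamma>[OF p]]
    bilinear_rzero[OF bilinear_d\<Gamma>[OF p]] linear_scale[OF linear_d\<Gamma>[OF p]] linear_0[OF linear_d\<Gamma>[OF p]])
 thus ?thesis by (simp add: G_simps[OF p])
qed (use curvature_positive[OF p] in force)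

end

section \<open>Convexity of square roots\<close>

text \<open>The second derivative of \<open>sqrt \<phi>\<close> is \<open>(2 * \<phi> * \<phi>'' -
  \<phi>'\<^sup>2) / (4 * \<phi> * sqrt \<phi>)\<close>.\<close>

lemma sqrt_chord:
 fixes \<phi> \<phi>' \<phi>'' :: "real => real"
 assumes xyz: "x < y" "y < z" and c: "continuous_on {x..z} \<phi>" and pos: "!!s. s \<in> {x..z} ==> 0 < \<phi> s"
  and d: "!!s. s \<in> {x<..<z} ==> (\<phi> has_real_derivative \<phi>' s) (at s)"
   "!!s. s \<in> {x<..<z} ==> (\<phi>' has_real_derivative \<phi>'' s) (at s)"
 shows "(!!s. s \<in> {x<..<z} ==> (\<phi>' s)\<^sup>2 <= 2 * \<phi> s * \<phi>'' s) ==>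
   (z - x) * sqrt (\<phi> y) <= (z - y) * sqrt (\<phi> x) + (y - x) * sqrt (\<phi> z)"
  and "(!!s. s \<in> {x<..<z} ==> (\<phi>' s)\<^sup>2 < 2 * \<phi> s * \<phi>'' s) ==>
   (z - x) * sqrt (\<phi> y) < (z - y) * sqrt (\<phi> x) + (y - x) * sqrt (\<phi> z)"
proof -
 define g where "g = (%s. sqrt (\<phi> s))"
 define g' where "g' = (%s. \<phi>' s / (2 * g s))"
 have gpos: "0 < g s" "g s * g s = \<phi> s" if "s \<in> {x..z}" for s using pos[OF that] by (auto simp: g_def)
 have gc: "continuous_on {x..z} g" unfolding g_def by (intro continuous_intros c)
 have dg: "(g has_real_derivative g' s) (at s)" if "s \<in> {x<..<z}" for s unfolding g_def g'_def using d(1)[OF that] pos[of s] that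
  by (auto intro!: derivative_eq_intros simp: field_simps)
 have dg': "(g' has_real_derivative (2 * \<phi> s * \<phi>'' s - (\<phi>' s)\<^sup>2) / (4 * \<phi> s * g s)) (at s)" if s: "s \<in> {x<..<z}" for s
 proof -
  have gs: "0 < g s" "g s * g s = \<phi> s" using gpos[of s] s by auto
  have "(g' has_real_derivative (\<phi>'' s * (2 * g s) - \<phi>' s * (2 * g' s)) / (2 * g s * (2 * g s))) (at s)"
   unfolding g'_def using gs(1) by (intro DERIV_divide d(2)[OF s] DERIV_cmult dg[OF s, unfolded g'_def]) auto
  moreover have "(\<phi>'' s * (2 * g s) - \<phi>' s * (2 * g' s)) / (2 * g s * (2 * g s)) = (2 * \<phi> s * \<phi>'' s - (\<phi>' s)\<^sup>2) / (4 * \<phi> s * g s)"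
   unfolding gs(2)[symmetric] g'_def using gs(1) by (simp add: field_simps power2_eq_square)
  ultimately show ?thesis by simp
 qed
 have mvt: "\<exists>\<xi>>u. \<xi> < v & g v - g u = g' \<xi> * (v - u)" if uv: "x <= u" "u < v" "v <= z" for u v
 proof -
  have "continuous_on {u..v} g" by (rule continuous_on_subset[OF gc]) (use uv in auto)
  then obtain \<xi> where "u < \<xi>" "\<xi> < v" "g v - g u = ((*) (g' \<xi>)) (v - u)"
   by (rule mvt[OF uv(2), of g "%s. (*) (g' s)"]) (use dg uv in "auto simp: has_field_derivative_def")
  thus ?thesis by blast
 qed
 obtain \<xi> where \<xi>: "x < \<xi>" "\<xi> < y" "g y - g x = g' \<xi> * (y - x)" using mvt[of x y] xyz by auto
 obtain \<zeta> where \<zeta>: "y < \<zeta>" "\<zeta> < z" "g z - g y = g' \<zeta> * (z - y)" using mvt[of y z] xyz by auto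
 have \<xi>\<zeta>: "\<xi> < \<zeta>" using \<xi> \<zeta> by linarith
 have g4: "0 < 4 * \<phi> s * g s" if "s \<in> {x<..<z}" for s using that gpos[of s] pos[of s] by simp
 have eq: "(z - y) * g x + (y - x) * g z - (z - x) * g y = (y - x) * (z - y) * (g' \<zeta> - g' \<xi>)"
 proof -
  have "(z - y) * g x + (y - x) * g z - (z - x) * g y = (y - x) * (g z - g y) - (z - y) * (g y - g x)" by (simp add: algebra_simps)
  also have "\<dots> = (y - x) * (g' \<zeta> * (z - y)) - (z - y) * (g' \<xi> * (y - x))" by (simp only: \<xi>(3) \<zeta>(3))
  finally show ?thesis by (simp add: algebra_simps)
 qed
 have dpos: "0 < (y - x) * (z - y)" using xyz by simp
 {
  assume *: "!!s. s \<in> {x<..<z} ==> (\<phi>' s)\<^sup>2 <= 2 * \<phi> s * \<phi>'' s"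
  have "g' \<xi> <= g' \<zeta>"
  proof (rule DERIV_nonneg_imp_nondecreasing[of \<xi> \<zeta> g'])
   fix s assume "\<xi> <= s" "s <= \<zeta>"
   hence s: "s \<in> {x<..<z}" using \<xi> \<zeta> by simp
   show "\<exists>y. DERIV g' s :> y & 0 <= y"
    using *[OF s] g4[OF s] by (intro exI[of _ "(2 * \<phi> s * \<phi>'' s - (\<phi>' s)\<^sup>2) / (4 * \<phi> s * g s)"] conjI dg'[OF s] divide_nonneg_pos) auto
  qed (use \<xi>\<zeta> in simp)
  hence "0 <= (y - x) * (z - y) * (g' \<zeta> - g' \<xi>)" by (intro mult_nonneg_nonneg[OF less_imp_le[OF dpos]]) simp
  thus "(z - x) * sqrt (\<phi> y) <= (z - y) * sqrt (\<phi> x) + (y - x) * sqrt (\<phi> z)" using eq unfolding g_def by linarith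
 }
 {
  assume *: "!!s. s \<in> {x<..<z} ==> (\<phi>' s)\<^sup>2 < 2 * \<phi> s * \<phi>'' s"
  have "g' \<xi> < g' \<zeta>"
  proof (rule DERIV_pos_imp_increasing[of \<xi> \<zeta> g'])
   fix s assume "\<xi> <= s" "s <= \<zeta>"
   hence s: "s \<in> {x<..<z}" using \<xi> \<zeta> by simp
   show "\<exists>y. DERIV g' s :> y & 0 < y"
    using *[OF s] g4[OF s] by (intro exI[of _ "(2 * \<phi> s * \<phi>'' s - (\<phi>' s)\<^sup>2) / (4 * \<phi> s * g s)"] conjI dg'[OF s] divide_pos_pos) auto
  qed (use \<xi>\<zeta> in simp)
  hence "0 < (y - x) * (z - y) * (g' \<zeta> - g' \<xi>)" by (intro mult_pos_pos[OF dpos]) simp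
  thus "(z - x) * sqrt (\<phi> y) < (z - y) * sqrt (\<phi> x) + (y - x) * sqrt (\<phi> z)" using eq unfolding g_def by linarith
 }
qed

text \<open>The square root is not differentiable at zeros of \<open>f\<close>; adding \<eta> > 0
  removes them, and the error tends to zero with \<eta>.\<close>

lemma sqrt_convex:
 fixes f f' f'' :: "real => real"
 assumes xyz: "x < y" "y < z" and c: "continuous_on {x..z} f" and nonneg: "!!s. s \<in> {x..z} ==> 0 <= f s"
  and d: "!!s. s \<in> {x<..<z} ==> (f has_real_derivative f' s) (at s)" "!!s. s \<in> {x<..<z} ==> (f' has_real_derivative f'' s) (at s)"
  and le: "!!s. s \<in> {x<..<z} ==> (f' s)\<^sup>2 <= 2 * f s * f'' s" "!!s. s \<in> {x<..<z} ==> 0 <= f'' s"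
 shows "(z - x) * sqrt (f y) <= (z - y) * sqrt (f x) + (y - x) * sqrt (f z)"
proof (rule field_le_epsilon)
 fix e :: real assume e: "0 < e"
 define \<eta> where "\<eta> = (e / (z - x))\<^sup>2"
 have zx: "0 < z - x" using xyz by simp
 have \<eta>: "0 < \<eta>" "sqrt \<eta> = e / (z - x)" using e zx by (auto simp: \<eta>_def)
 have "(z - x) * sqrt (f y + \<eta>) <= (z - y) * sqrt (f x + \<eta>) + (y - x) * sqrt (f z + \<eta>)"
 proof (rule sqrt_chord(1)[OF xyz, where \<phi> = "%s. f s + \<eta>" and \<phi>' = f' and \<phi>'' = f''])
  show "continuous_on {x..z} (%s. f s + \<eta>)" by (intro continuous_intros c)
  show "0 < f s + \<eta>" if "s \<in> {x..z}" for s using nonneg[OF that] \<eta>(1) by simp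
  fix s assume s: "s \<in> {x<..<z}"
  show "((%s. f s + \<eta>) has_real_derivative f' s) (at s)" using DERIV_add[OF d(1)[OF s] DERIV_const] by simp
  show "(f' has_real_derivative f'' s) (at s)" by (rule d(2)[OF s])
  have "0 <= \<eta> * f'' s" using \<eta>(1) le(2)[OF s] by simp
  thus "(f' s)\<^sup>2 <= 2 * (f s + \<eta>) * f'' s" using le(1)[OF s] by (simp add: algebra_simps)
 qed
 moreover have "sqrt (f s + \<eta>) <= sqrt (f s) + e / (z - x)" if "s \<in> {x..z}" for s
  using sqrt_add_le_add_sqrt[OF nonneg[OF that], of \<eta>] \<eta> by simp
 hence "(z - y) * sqrt (f x + \<eta>) <= (z - y) * (sqrt (f x) + e / (z - x))" "(y - x) * sqrt (f z + \<eta>) <= (y - x) * (sqrt (f z) + e / (z - x))"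
  using xyz by (intro mult_left_mono; simp)+
 moreover have "(z - x) * sqrt (f y) <= (z - x) * sqrt (f y + \<eta>)" using zx \<eta>(1) by (intro mult_left_mono) auto
 moreover have "(z - y) * (sqrt (f x) + d) + (y - x) * (sqrt (f z) + d)
   = (z - y) * sqrt (f x) + (y - x) * sqrt (f z) + (z - x) * d" for d by (simp add: algebra_simps)
 from this[of "e / (z - x)"] have "(z - y) * (sqrt (f x) + e / (z - x)) + (y - x) * (sqrt (f z) + e / (z - x))
   = (z - y) * sqrt (f x) + (y - x) * sqrt (f z) + (z - x) * (e / (z - x))" .
 moreover have "(z - x) * (e / (z - x)) = e" using zx by simp
 ultimately show "(z - x) * sqrt (f y) <= (z - y) * sqrt (f x) + (y - x) * sqrt (f z) + e" by linarith
qed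

section \<open>The geodesic spray\<close>

context local_metric
begin

text \<open>The geodesic equation as a first-order system, slowed down by \<tau>. The second
  component is the velocity before slowing down, so the velocity in flow time is \<tau> times
  it.\<close>

definition spray :: "real => 'e \<times> 'e => 'e \<times> 'e"
 where "spray \<tau> z = (\<tau> *R snd z, - (\<tau> *R \<Gamma> (fst z) (snd z) (snd z)))"

definition dspray_fun :: "'e \<times> 'e => 'e \<times> 'e => 'e \<times> 'e"
 where "dspray_fun z h = (snd h, - (d\<Gamma> (fst z) (fst h) (snd z) (snd z) + \<Gamma> (fst z) (snd h) (snd z) + \<Gamma> (fst z) (snd z) (snd h)))"

definition dspray :: "real => 'e \<times> 'e => ('e \<times> 'e) \<Rightarrow>\<^sub>L ('e \<times> 'e)"
 where "dspray \<tau> z = \<tau> *R Blinfun (dspray_fun z)"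

lemma spray_derivative:
 assumes "fst z \<in> V"
 shows "(spray 1 has_derivative dspray_fun z) (at z)"
proof -
 let ?S = "V \<times> (UNIV :: 'e set)"
 have S: "open ?S" "z \<in> ?S" using assms open_V by (auto simp: open_Times mem_Times_iff)
 have "(spray 1 has_derivative dspray_fun z) (at z within ?S)" unfolding spray_def dspray_fun_def scaleR_one
  by (intro has_derivative_Pair has_derivative_minus has_derivative_snd[OF has_derivative_ident]
    bilinear_field_derivative[OF open_V bilinear_\<Gamma> d\<Gamma> has_derivative_fst[OF has_derivative_ident]])
   (use S in auto)
 thus ?thesis using at_within_open[OF S(2,1)] by simp
qed

lemma spray_scaled: "spray \<tau> = (%z. \<tau> *R spray 1 z)" by (auto simp: spray_def fun_eq_iff)

lemma dspray_apply: "fst z \<in> V ==> blinfun_apply (dspray \<tau> z) h = \<tau> *R dspray_fun z h" unfolding dspray_def scaleR_blinfun.rep_eq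
 by (simp add: bounded_linear_Blinfun_apply[OF has_derivative_bounded_linear[OF spray_derivative]])

lemma spray_has_derivative:
 assumes z: "fst z \<in> V"
 shows "(spray \<tau> has_derivative blinfun_apply (dspray \<tau> z)) (at z)"
proof -
 have "((%z. \<tau> *R spray 1 z) has_derivative (%h. \<tau> *R dspray_fun z h)) (at z)"
  by (rule has_derivative_scaleR_right[OF spray_derivative[OF z]])
 moreover have "(%h. \<tau> *R dspray_fun z h) = blinfun_apply (dspray \<tau> z)" by (rule ext) (simp add: dspray_apply z)
 ultimately show ?thesis unfolding spray_scaled[of \<tau>] by simp
qed

lemma dspray_continuous: "continuous_on (V \<times> UNIV) (dspray \<tau>)"
proof (rule continuous_on_blinfun_componentwise)
 fix h :: "'e \<times> 'e"
 let ?S = "V \<times> (UNIV :: 'e set)"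
 have f: "continuous_on ?S fst" "fst ` ?S \<subseteq> V" "continuous_on ?S snd" "continuous_on ?S (%_. snd h)" by (auto intro: continuous_intros)
 have 1: "continuous_on ?S (%z. d\<Gamma> (fst z) (fst h) (snd z) (snd z))"
  by (rule bilinear_field_continuous[where T = "%p. d\<Gamma> p (fst h)", OF bilinear_d\<Gamma> d\<Gamma>_cont f(1,2,3,3)])
 have 2: "continuous_on ?S (%z. \<Gamma> (fst z) (snd h) (snd z))"
  by (rule bilinear_field_continuous[where T = \<Gamma>, OF bilinear_\<Gamma> \<Gamma>_cont f(1,2,4,3)])
 have 3: "continuous_on ?S (%z. \<Gamma> (fst z) (snd z) (snd h))"
  by (rule bilinear_field_continuous[where T = \<Gamma>, OF bilinear_\<Gamma> \<Gamma>_cont f(1,2,3,4)])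
 have "continuous_on ?S (%z. \<tau> *R dspray_fun z h)"
  unfolding dspray_fun_def by (intro continuous_on_scaleR continuous_on_Pair continuous_on_minus continuous_on_add 1 2 3 continuous_on_const)
 thus "continuous_on (V \<times> UNIV) (%z. blinfun_apply (dspray \<tau> z) h)" by (rule continuous_on_eq) (auto simp: dspray_apply)
qed

lemma geodesic_flow_exists:
 assumes "a \<in> V"
 obtains \<tau> \<rho> where "0 < \<tau>" "cball (a, 0 :: 'e) \<rho> \<subseteq> V \<times> UNIV" "small_vector_field (spray \<tau>) (dspray \<tau>) (a, 0) \<rho>"
proof -
 have "open (V \<times> (UNIV :: 'e set))" "(a, 0) \<in> V \<times> (UNIV :: 'e set)" using open_V assms by (auto simp: open_Times)
 then obtain \<rho> where \<rho>: "0 < \<rho>" "cball (a, 0 :: 'e) \<rho> \<subseteq> V \<times> UNIV" using open_contains_cball by metis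
 have "compact (dspray 1 ` cball (a, 0) \<rho>)"
  by (rule compact_continuous_image[OF continuous_on_subset[OF dspray_continuous \<rho>(2)] compact_cball])
 from compact_imp_bounded[OF this] obtain M where M: "!!z. z \<in> cball (a, 0) \<rho> ==> norm (dspray 1 z) <= M" unfolding bounded_iff by blast
 have "0 <= M" using M[of "(a, 0)"] \<rho>(1) norm_ge_zero[of "dspray 1 (a, 0)"] by (simp del: norm_ge_zero)
 define \<tau> where "\<tau> = 1 / (2 * (M + 1))"
 have \<tau>: "0 < \<tau>" "\<tau> * M <= 1 / 2" using \<open>0 <= M\<close> by (auto simp: \<tau>_def field_simps)
 have "small_vector_field (spray \<tau>) (dspray \<tau>) (a, 0) \<rho>"
 proof
  show "0 < \<rho>" by fact
  show "continuous_on (cball (a, 0) \<rho>) (dspray \<tau>)" by (rule continuous_on_subset[OF dspray_continuous \<rho>(2)])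
  show "spray \<tau> (a, 0) = 0" by (simp add: spray_def bilinear_lzero[OF bilinear_\<Gamma>[OF assms]] zero_prod_def)
  fix z :: "'e \<times> 'e" assume z: "z \<in> cball (a, 0) \<rho>"
  hence "fst z \<in> V" using \<rho>(2) by auto
  thus "(spray \<tau> has_derivative blinfun_apply (dspray \<tau> z)) (at z)" by (rule spray_has_derivative)
  have "norm (dspray \<tau> z) = \<tau> * norm (dspray 1 z)" using \<tau>(1) by (simp add: dspray_def)
  also have "\<dots> <= \<tau> * M" using M[OF z] \<tau>(1) by (intro mult_left_mono) auto
  finally show "norm (dspray \<tau> z) <= 1 / 2" using \<tau>(2) by linarith
 qed
 thus ?thesis by (rule that[OF \<tau>(1) \<rho>(2)])
qed

end

section \<open>Geodesics and Jacobi fields\<close>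

locale geodesic_flow = negatively_curved_metric V G + small_vector_field "local_metric.spray G \<tau>" "local_metric.dspray G \<tau>" "(a, 0)" \<rho>
 for V :: "'e::euclidean_space set" and G and \<tau> \<rho> :: real and a :: 'e +
 assumes \<tau>_pos: "0 < \<tau>" and B_in_V: "cball (a, 0 :: 'e) \<rho> \<subseteq> V \<times> UNIV"
begin

abbreviation D where "D \<equiv> cball (a, 0 :: 'e) (\<rho> / 2)"

definition pos where "pos z s = fst (flow z s)"
definition vel where "vel z s = \<tau> *R snd (flow z s)"
text \<open>The Jacobi field with initial data \<open>h\<close>: the derivative of
  \<open>pos\<close> in the initial value. \<open>djac\<close> is its time derivative in coordinates
  and \<open>cov\<close> its covariant derivative along the geodesic.\<close>

definition jac where "jac z h s = fst (blinfun_apply (dflow z s) h)"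
definition djac where "djac z h s = \<tau> *R snd (blinfun_apply (dflow z s) h)"
definition cov where "cov z h s = djac z h s + \<Gamma> (pos z s) (vel z s) (jac z h s)"

lemma pos_in_V: "z \<in> D ==> s \<in> {0..1} ==> pos z s \<in> V"
proof -
 assume "z \<in> D" "s \<in> {0..1}"
 hence "flow z s \<in> V \<times> UNIV" using B_in_V flow_in by blast
 thus ?thesis by (simp add: pos_def mem_Times_iff)
qed

lemma pos_image: "z \<in> D ==> pos z ` {0..1} \<subseteq> V" using pos_in_V by blast

lemma pos_deriv: "z \<in> D ==> s \<in> {0..1} ==> (pos z has_vector_derivative vel z s) (at s within {0..1})"
 using bounded_linear.has_vector_derivative[OF bounded_linear_fst flow_deriv[of z s]] unfolding pos_def[abs_def] vel_def spray_def by simp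

lemma vel_deriv: "z \<in> D ==> s \<in> {0..1} ==> (vel z has_vector_derivative - \<Gamma> (pos z s) (vel z s) (vel z s)) (at s within {0..1})"
 using bounded_linear.has_vector_derivative[OF bounded_linear_scaleR_right
  bounded_linear.has_vector_derivative[OF bounded_linear_snd flow_deriv[of z s]], of \<tau>]
  bilinear_\<Gamma>[OF pos_in_V[of z s]] unfolding pos_def vel_def[abs_def] spray_def by (simp add: bilinear_lmul bilinear_rmul)

lemma jac_deriv: "z \<in> D ==> s \<in> {0..1} ==> (jac z h has_vector_derivative djac z h s) (at s within {0..1})"
 using bounded_linear.has_vector_derivative[OF bounded_linear_fst dflow_deriv[of z s h]] pos_in_V[of z s]
 unfolding jac_def[abs_def] djac_def pos_def by (simp add: dspray_apply dspray_fun_def)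

lemma djac_deriv: "z \<in> D ==> s \<in> {0..1} ==> (djac z h has_vector_derivative
  - (d\<Gamma> (pos z s) (jac z h s) (vel z s) (vel z s) + \<Gamma> (pos z s) (vel z s) (djac z h s) + \<Gamma> (pos z s) (vel z s) (djac z h s))) (at s within {0..1})"
 using bounded_linear.has_vector_derivative[OF bounded_linear_scaleR_right
  bounded_linear.has_vector_derivative[OF bounded_linear_snd dflow_deriv[of z s h]], of \<tau>]
  bilinear_\<Gamma>[OF pos_in_V[of z s]] bilinear_d\<Gamma>[OF pos_in_V[of z s]] pos_in_V[of z s]
  \<Gamma>_sym[OF pos_in_V[of z s], of "snd (blinfun_apply (dflow z s) h)" "snd (flow z s)"] unfolding jac_def djac_def[abs_def] pos_def vel_def
 by (simp add: dspray_apply dspray_fun_def bilinear_lmul bilinear_rmul scaleR_add_right scaleR_diff_right)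

lemma G_curve_derivative:
 assumes "z \<in> D" "s \<in> {0..1}" and v: "(v has_vector_derivative v') (at s within {0..1})"
  and w: "(w has_vector_derivative w') (at s within {0..1})"
 shows "((%s. G (pos z s) (v s) (w s)) has_real_derivative
  G (pos z s) (v' + \<Gamma> (pos z s) (vel z s) (v s)) (w s) + G (pos z s) (v s) (w' + \<Gamma> (pos z s) (vel z s) (w s))) (at s within {0..1})"
proof -
 note p = pos_in_V[OF assms(1,2)]
 show ?thesis using bilinear_field_vector_derivative[OF open_V bilinear_G dG pos_deriv[OF assms(1,2)] pos_image[OF assms(1)] assms(2) v w]
  unfolding has_real_derivative_iff_has_vector_derivative by (simp add: compat[OF p] G_simps[OF p] algebra_simps)
qed

lemma constant_of_zero_derivative:
 fixes f :: "real => real"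
 assumes "!!s. s \<in> {0..1} ==> (f has_real_derivative c) (at s within {0..1})" "s \<in> {0..1}"
 shows "f s = f 0 + s * c"
proof -
 have "f s - s * c = f 0 - 0 * c"
 proof (rule has_derivative_zero_unique[of "{0..1}" "%s. f s - s * c"])
  show "((%s. f s - s * c) has_derivative (%h. 0)) (at s within {0..1})" if "s \<in> {0..1}" for s
   using assms(1)[OF that] unfolding has_field_derivative_def by (auto intro!: derivative_eq_intros)
 qed (use assms(2) in auto)
 thus ?thesis by simp
qed

lemma speed_constant:
 assumes z: "z \<in> D" and s: "s \<in> {0..1}"
 shows "G (pos z s) (vel z s) (vel z s) = \<tau>\<^sup>2 * G (fst z) (snd z) (snd z)"
proof -
 have "((%s. G (pos z s) (vel z s) (vel z s)) has_real_derivative 0) (at s within {0..1})" if "s \<in> {0..1}" for s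
  using G_curve_derivative[OF z that vel_deriv[OF z that] vel_deriv[OF z that]] by (simp add: G_simps(9,10)[OF pos_in_V[OF z that]])
 from constant_of_zero_derivative[OF this s]
 have "G (pos z s) (vel z s) (vel z s) = G (pos z 0) (vel z 0) (vel z 0)" by simp
 thus ?thesis using G_simps(7,8)[OF pos_in_V[OF z, of 0]] by (simp add: pos_def vel_def flow_zero[OF z] power2_eq_square)
qed

definition energy :: "'e \<times> 'e => real" where "energy z = \<tau>\<^sup>2 * G (fst z) (snd z) (snd z) / 2"

text \<open>By \<open>speed_constant\<close> the energy can be computed at any time
  \<open>s\<close>, which gives one formula for the same derivative for each
  \<open>s\<close>.\<close>

lemma energy_derivative:
 assumes z: "z \<in> ball (a, 0) (\<rho> / 2)" and s: "s \<in> {0..1}"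
 shows "(energy has_derivative (%h. G (pos z s) (cov z h s) (vel z s))) (at z)"
proof -
 let ?O = "ball (a, 0 :: 'e) (\<rho> / 2)"
 have zD: "z \<in> D" using z by auto
 note p = pos_in_V[OF zD s]
 have f: "((%z. flow z s) has_derivative dflow z s) (at z within ?O)" by (rule has_derivative_at_withinI[OF flow_has_derivative[OF z s]])
 have 1: "((%z. pos z s) has_derivative (%h. jac z h s)) (at z within ?O)" unfolding pos_def jac_def by (rule has_derivative_fst[OF f])
 have 2: "((%z. vel z s) has_derivative (%h. djac z h s)) (at z within ?O)"
  unfolding vel_def djac_def by (intro has_derivative_scaleR_right has_derivative_snd[OF f])
 have im: "(%z. pos z s) ` ?O \<subseteq> V" using pos_in_V s by (auto simp: less_imp_le)
 have "((%z. G (pos z s) (vel z s) (vel z s) / 2) has_derivative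
  (%h. (dG (pos z s) (jac z h s) (vel z s) (vel z s) + G (pos z s) (djac z h s) (vel z s) + G (pos z s) (vel z s) (djac z h s)) / 2))
  (at z within ?O)" using has_derivative_mult_left[OF bilinear_field_derivative[OF open_V bilinear_G dG 1 im z 2 2], of "1 / 2"] by simp
 moreover have "(dG (pos z s) (jac z h s) (vel z s) (vel z s) + G (pos z s) (djac z h s) (vel z s) + G (pos z s) (vel z s) (djac z h s)) / 2
   = G (pos z s) (cov z h s) (vel z s)" for h
  using G_sym[OF p, of "vel z s" "djac z h s"] G_sym[OF p, of "vel z s" "\<Gamma> (pos z s) (jac z h s) (vel z s)"] \<Gamma>_sym[OF p, of "jac z h s" "vel z s"]
  unfolding compat[OF p] cov_def G_simps(1)[OF p] by simp
 ultimately have d: "((%z. G (pos z s) (vel z s) (vel z s) / 2) has_derivative (%h. G (pos z s) (cov z h s) (vel z s))) (at z)"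
  using at_within_open[OF z open_ball] by simp
 show ?thesis
 proof (rule has_derivative_transform_within_open[OF d open_ball z])
  fix y assume "y \<in> ?O"
  hence "y \<in> D" by auto
  from speed_constant[OF this s] show "G (pos y s) (vel y s) (vel y s) / 2 = energy y" by (simp add: energy_def)
 qed
qed

text \<open>The formulas of \<open>energy_derivative\<close> agree for all \<open>s\<close>, so
  \<open>G (cov, vel)\<close> is constant along the geodesic. It is the time derivative of
  \<open>G (jac, vel)\<close>, whose increment over the unit interval therefore equals it.\<close>

lemma first_variation:
 assumes z: "z \<in> ball (a, 0) (\<rho> / 2)"
 shows "(energy has_derivative (%h. G (pos z 1) (jac z h 1) (vel z 1) - G (pos z 0) (jac z h 0) (vel z 0))) (at z)"
proof -
 have zD: "z \<in> D" using z by auto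
 have "G (pos z 1) (jac z h 1) (vel z 1) - G (pos z 0) (jac z h 0) (vel z 0) = G (pos z 0) (cov z h 0) (vel z 0)" for h
 proof -
  have "((%s. G (pos z s) (jac z h s) (vel z s)) has_real_derivative G (pos z 0) (cov z h 0) (vel z 0)) (at s within {0..1})"
   if s: "s \<in> {0..1}" for s
  proof -
   have "(%h. G (pos z s) (cov z h s) (vel z s)) = (%h. G (pos z 0) (cov z h 0) (vel z 0))"
    by (rule has_derivative_unique[OF energy_derivative[OF z s] energy_derivative[OF z]]) simp
   from fun_cong[OF this, of h] G_curve_derivative[OF zD s jac_deriv[OF zD s] vel_deriv[OF zD s], of h] show ?thesis
    by (simp add: G_simps(9,10)[OF pos_in_V[OF zD s]] cov_def)
  qed
  from constant_of_zero_derivative[OF this, of 1] show ?thesis by simp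
 qed
 thus ?thesis using energy_derivative[OF z, of 0] by simp
qed

definition jac_sq where "jac_sq z h s = G (pos z s) (jac z h s) (jac z h s)"

lemma jac_sq_nonneg: "z \<in> D ==> s \<in> {0..1} ==> 0 <= jac_sq z h s" unfolding jac_sq_def by (rule G_nonneg[OF pos_in_V])

lemma jac_sq_deriv:
 assumes z: "z \<in> D" and s: "s \<in> {0..1}"
 shows "(jac_sq z h has_real_derivative 2 * G (pos z s) (cov z h s) (jac z h s)) (at s within {0..1})"
 using G_curve_derivative[OF z s jac_deriv[OF z s] jac_deriv[OF z s], of h h] G_sym[OF pos_in_V[OF z s], of "jac z h s"]
 unfolding jac_sq_def[abs_def] cov_def by simp

text \<open>This is the Jacobi equation: the terms of the linearised spray assemble to the
  curvature.\<close>

lemma cov_deriv: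
 assumes z: "z \<in> D" and s: "s \<in> {0..1}"
 shows "\<exists>K'. (cov z h has_vector_derivative K') (at s within {0..1}) &
  K' + \<Gamma> (pos z s) (vel z s) (cov z h s) = curvature G (pos z s) (vel z s) (jac z h s) (vel z s)"
proof -
 note p = pos_in_V[OF z s]
 let ?c = "pos z s" and ?S = "vel z s" and ?J = "jac z h s" and ?Y = "djac z h s"
 let ?K = "- (d\<Gamma> ?c ?J ?S ?S + \<Gamma> ?c ?S ?Y + \<Gamma> ?c ?S ?Y) + (d\<Gamma> ?c ?S ?S ?J + \<Gamma> ?c (- \<Gamma> ?c ?S ?S) ?J + \<Gamma> ?c ?S ?Y)"
 have "(cov z h has_vector_derivative ?K) (at s within {0..1})" unfolding cov_def[abs_def] by (intro has_vector_derivative_add djac_deriv z s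
    bilinear_field_vector_derivative[OF open_V bilinear_\<Gamma> d\<Gamma> pos_deriv pos_image] vel_deriv jac_deriv)
 moreover have "?K + \<Gamma> ?c ?S (cov z h s) = curvature G ?c ?S ?J ?S"
  using \<Gamma>_sym[OF p, of ?J "\<Gamma> ?c ?S ?S"] \<Gamma>_sym[OF p, of ?J ?S]
  unfolding curvature_eq cov_def bilinear_radd[OF bilinear_\<Gamma>[OF p]] bilinear_lneg[OF bilinear_\<Gamma>[OF p]]
  using bilinear_d\<Gamma>[OF p] d\<Gamma>_sym[OF p, of ?S ?S ?J] by simp
 ultimately show ?thesis by blast
qed

abbreviation jac_acc where "jac_acc z h s \<equiv> G (pos z s) (cov z h s) (cov z h s) + G (pos z s) (curvature G (pos z s) (vel z s) (jac z h s) (vel z s)) (jac z h s)"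

lemma jac_sq_deriv2:
 assumes z: "z \<in> D" and s: "s \<in> {0..1}"
 shows "((%s. 2 * G (pos z s) (cov z h s) (jac z h s)) has_real_derivative
  2 * jac_acc z h s) (at s within {0..1})"
proof -
 obtain K' where K': "(cov z h has_vector_derivative K') (at s within {0..1})"
  "K' + \<Gamma> (pos z s) (vel z s) (cov z h s) = curvature G (pos z s) (vel z s) (jac z h s) (vel z s)" using cov_deriv[OF z s] by blast
 from DERIV_cmult[OF G_curve_derivative[OF z s K'(1) jac_deriv[OF z s, of h]], of 2] show ?thesis
  unfolding K'(2) cov_def[symmetric] by (simp only: add.commute)
qed

text \<open>Cauchy-Schwarz for \<open>cov\<close> and \<open>jac\<close>, with the curvature term as
  a surplus that is positive unless \<open>jac\<close> and \<open>vel\<close> are parallel. The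
  inequalities are the hypotheses of \<open>sqrt_convex\<close> and
  \<open>sqrt_chord\<close>.\<close>

lemma jac_sq_convexity:
 assumes z: "z \<in> D" and s: "s \<in> {0..1}"
 shows "0 <= 2 * jac_acc z h s" (is ?t1) and "(2 * G (pos z s) (cov z h s) (jac z h s))\<^sup>2 <= 2 * jac_sq z h s * (2 * jac_acc z h s)" (is ?t2)
  and "(G (pos z s) (jac z h s) (vel z s))\<^sup>2 < jac_sq z h s * G (pos z s) (vel z s) (vel z s) ==>
   (2 * G (pos z s) (cov z h s) (jac z h s))\<^sup>2 < 2 * jac_sq z h s *
   (2 * jac_acc z h s)" (is "_ ==> ?t3")
proof -
 note p = pos_in_V[OF z s]
 let ?c = "pos z s" and ?S = "vel z s" and ?J = "jac z h s" and ?K = "cov z h s"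
 let ?R = "G ?c (curvature G ?c ?S ?J ?S) ?J"
 have R: "0 <= ?R" by (rule curvature_nonneg[OF p])
 have cs: "(G ?c ?K ?J)\<^sup>2 <= G ?c ?K ?K * jac_sq z h s" unfolding jac_sq_def by (rule G_Cauchy_Schwarz(1)[OF p])
 show ?t1 using R G_nonneg[OF p, of ?K] by simp
 have f: "0 <= jac_sq z h s" by (rule jac_sq_nonneg[OF z s])
 have eq: "2 * jac_sq z h s * (2 * (G ?c ?K ?K + ?R)) = 4 * (G ?c ?K ?K * jac_sq z h s) + 4 * (jac_sq z h s * ?R)" by (simp add: algebra_simps)
 have eq2: "(2 * G ?c ?K ?J)\<^sup>2 = 4 * (G ?c ?K ?J)\<^sup>2" by (simp add: power2_eq_square)
 show ?t2 unfolding eq eq2 using cs mult_nonneg_nonneg[OF f R] by linarith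
 assume i: "(G ?c ?J ?S)\<^sup>2 < jac_sq z h s * G ?c ?S ?S"
 have J0: "?J ~= 0" "?S ~= 0" using i G_simps(9,10)[OF p] by (auto simp: jac_sq_def)
 have nonpar: "?J ~= k *R ?S" for k
 proof
  assume "?J = k *R ?S"
  hence "(G ?c ?J ?S)\<^sup>2 = jac_sq z h s * G ?c ?S ?S" unfolding jac_sq_def by (simp add: G_simps(7,8)[OF p] power2_eq_square)
  thus False using i by simp
 qed
 have ne: "?S ~= ?J" using nonpar[of 1] by auto
 have "independent {?S, ?J}" using nonpar J0 ne by (subst insert_commute, intro independent_insertI) (auto simp: span_singleton independent_empty)
 hence "0 < ?R" by (rule curvature_positive[OF p ne])
 moreover have "0 < jac_sq z h s" unfolding jac_sq_def by (rule G_pos[OF p J0(1)])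
 ultimately have "0 < jac_sq z h s * ?R" by simp
 thus ?t3 unfolding eq eq2 using cs by linarith
qed

end

context local_metric
begin

lemma G_comparable:
 assumes K: "compact K" "K \<subseteq> V"
 obtains c C where "0 < c" "!!x v. x \<in> K ==> c * norm v <= sqrt (G x v v)" "!!x v. x \<in> K ==> sqrt (G x v v) <= C * norm v"
proof (cases "K = {} \<or> (UNIV :: 'e set) = {0}")
 case True
 hence "norm v = 0 \<or> K = {}" for v :: 'e by auto
 thus ?thesis using K(2) G_simps(9) by (intro that[of 1 0]) (auto simp: subset_iff)
next case False
 let ?S = "K \<times> sphere (0 :: 'e) 1"
 obtain e :: 'e where "e ~= 0" using False by auto
 hence "e /\<^sub>R norm e \<in> sphere 0 1" by simp
 hence S: "compact ?S" "?S ~= {}" using K(1) False by (auto intro: compact_Times)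
 have cont: "continuous_on ?S (%q. sqrt (G (fst q) (snd q) (snd q)))"
  by (intro continuous_on_real_sqrt bilinear_field_continuous[where T = G and V = V, OF bilinear_G G_cont])
   (use K(2) in "auto intro: continuous_intros")
 obtain q where q: "q \<in> ?S" "!!r. r \<in> ?S ==> sqrt (G (fst q) (snd q) (snd q)) <= sqrt (G (fst r) (snd r) (snd r))"
  using continuous_attains_inf[OF S cont] by blast
 obtain q2 where q2: "q2 \<in> ?S" "!!r. r \<in> ?S ==> sqrt (G (fst r) (snd r) (snd r)) <= sqrt (G (fst q2) (snd q2) (snd q2))"
  using continuous_attains_sup[OF S cont] by blast
 have scale: "sqrt (G x v v) = norm v * sqrt (G x (v /\<^sub>R norm v) (v /\<^sub>R norm v))" if "x \<in> K" for x v
 proof -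
  have x: "x \<in> V" using that K(2) by blast
  show ?thesis
  proof (cases "v = 0")
   case False
   have "G x v v = (norm v)\<^sup>2 * G x (v /\<^sub>R norm v) (v /\<^sub>R norm v)"
    using False by (simp add: G_simps(7,8)[OF x] power2_eq_square field_simps)
   thus ?thesis by (simp add: real_sqrt_mult)
  qed (simp add: G_simps[OF x])
 qed
 have pos: "0 < sqrt (G (fst q) (snd q) (snd q))"
 proof -
  have "fst q \<in> V" "snd q ~= 0" using q(1) K(2) by auto
  thus ?thesis using G_pos by simp
 qed
 have b: "sqrt (G (fst q) (snd q) (snd q)) * norm v <= sqrt (G x v v)" "sqrt (G x v v) <= sqrt (G (fst q2) (snd q2) (snd q2)) * norm v"
  if x: "x \<in> K" for x v
 proof -
  have "v = 0 \<or> (x, v /\<^sub>R norm v) \<in> ?S" using x by (cases "v = 0") auto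
  hence "v = 0 \<or> (sqrt (G (fst q) (snd q) (snd q)) <= sqrt (G x (v /\<^sub>R norm v) (v /\<^sub>R norm v))
   & sqrt (G x (v /\<^sub>R norm v) (v /\<^sub>R norm v)) <= sqrt (G (fst q2) (snd q2) (snd q2)))"
   using q(2)[of "(x, v /\<^sub>R norm v)"] q2(2)[of "(x, v /\<^sub>R norm v)"] by auto
  thus "sqrt (G (fst q) (snd q) (snd q)) * norm v <= sqrt (G x v v)" "sqrt (G x v v) <= sqrt (G (fst q2) (snd q2) (snd q2)) * norm v"
   unfolding scale[OF x, of v] mult.commute[of _ "norm v"] by (cases "v = 0"; simp add: mult_left_mono)+
 qed
 show ?thesis by (rule that[OF pos b])
qed

end

section \<open>The exponential map and its inverse\<close>

context geodesic_flow
begin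

lemma a_zero_in: "(a, 0) \<in> ball (a, 0 :: 'e) (\<rho> / 2)" using \<rho>_pos by simp

lemma flow_zero_velocity:
 assumes z: "(x, 0) \<in> D" and s: "s \<in> {0..1}"
 shows "flow (x, 0) s = (x, 0)"
proof -
 have x: "x \<in> V" using pos_in_V[OF z, of 0] flow_zero[OF z] by (simp add: pos_def)
 have "solution (x, 0) (%_. (x, 0))"
 proof -
  have "((%_. (x, 0)) has_vector_derivative spray \<tau> (x, 0)) (at s within {0..1})" for s :: real
   using has_vector_derivative_const[of "(x, 0 :: 'e)"] by (simp add: spray_def bilinear_lzero[OF bilinear_\<Gamma>[OF x]] zero_prod_def)
  moreover have "(x, 0) \<in> B" using z \<rho>_pos by auto
  ultimately show ?thesis using solutionI[of "%_. (x, 0)"] by simp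
 qed
 from solution_unique[OF this z s] show ?thesis by simp
qed

lemma flow_near:
 assumes "z \<in> D" "s \<in> {0..1}"
 shows "norm (flow z s - (a, 0)) <= 2 * norm (z - (a, 0))"
 using flow_lipschitz[OF assms(1) _ assms(2), of "(a, 0)"] flow_zero_velocity[OF _ assms(2), of a] \<rho>_pos by simp

text \<open>Affine changes of the time parameter; negative \<open>\<beta>\<close> reverses the geodesic.\<close>

lemma flow_reparametrize:
 assumes z: "z \<in> D" and r: "!!s. s \<in> {0..1} ==> \<alpha> + \<beta> * s \<in> {0..1}"
  and z': "(pos z \<alpha>, \<beta> *R snd (flow z \<alpha>)) \<in> D" and s: "s \<in> {0..1}"
 shows "flow (pos z \<alpha>, \<beta> *R snd (flow z \<alpha>)) s = (pos z (\<alpha> + \<beta> * s), \<beta> *R snd (flow z (\<alpha> + \<beta> * s)))"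
proof -
 define u where "u = (%s. (pos z (\<alpha> + \<beta> * s), \<beta> *R snd (flow z (\<alpha> + \<beta> * s))))"
 have b: "\<bar>\<beta>\<bar> <= 1" using r[of 0] r[of 1] by auto
 have "(u has_vector_derivative spray \<tau> (u s)) (at s within {0..1})" if s: "s \<in> {0..1}" for s
 proof -
  have im: "(%s. \<alpha> + \<beta> * s) ` {0..1} \<subseteq> {0..1}" using r by auto
  have aff: "((%s. \<alpha> + \<beta> * s) has_vector_derivative \<beta>) (at s within {0..1})" by (auto intro!: derivative_eq_intros)
  have fl: "((%s. flow z (\<alpha> + \<beta> * s)) has_vector_derivative \<beta> *R spray \<tau> (flow z (\<alpha> + \<beta> * s))) (at s within {0..1})"
   using vector_diff_chain_within[OF aff has_vector_derivative_within_subset[OF flow_deriv[OF z r[OF s]] im]] by (simp add: o_def)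
  note v = bilinear_\<Gamma>[OF pos_in_V[OF z r[OF s]]]
  show ?thesis unfolding u_def pos_def using has_vector_derivative_Pair[OF bounded_linear.has_vector_derivative[OF bounded_linear_fst fl]
    bounded_linear.has_vector_derivative[OF bounded_linear_scaleR_right[of \<beta>] bounded_linear.has_vector_derivative[OF bounded_linear_snd fl]]]
    v unfolding pos_def by (simp add: spray_def bilinear_lmul bilinear_rmul algebra_simps)
 qed
 moreover have "u s \<in> B" if s: "s \<in> {0..1}" for s
 proof -
  have "norm (u s - (a, 0)) <= norm (flow z (\<alpha> + \<beta> * s) - (a, 0))"
  proof -
   have "norm (\<beta> *R snd (flow z (\<alpha> + \<beta> * s))) <= norm (snd (flow z (\<alpha> + \<beta> * s)))"
    using b by (simp add: mult_left_le_one_le)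
   thus ?thesis unfolding u_def pos_def norm_prod_def by (intro real_sqrt_le_mono add_mono power_mono) auto
  qed
  thus ?thesis using flow_in[OF z r[OF s]] by (simp add: dist_norm norm_minus_commute)
 qed
 ultimately have "solution (u 0) u" by (rule solutionI)
 from solution_unique[OF this _ s] z' show ?thesis by (simp add: u_def)
qed

text \<open>The exponential map, scaled by \<tau>, paired with the base point, so that its inverse
  yields the initial data of the geodesic joining two given points.\<close>

definition ex where "ex z = (fst z, pos z 1)"
definition dex :: "'e \<times> 'e => ('e \<times> 'e) \<Rightarrow>\<^sub>L ('e \<times> 'e)" where "dex z = Blinfun (%h. (fst h, jac z h 1))"

lemma dex_apply: "blinfun_apply (dex z) h = (fst h, jac z h 1)" unfolding dex_def by (subst bounded_linear_Blinfun_apply)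
  (auto simp: jac_def intro!: bounded_linear_Pair bounded_linear_fst bounded_linear_fst_comp blinfun.bounded_linear_right)

lemma ex_derivative:
 assumes "z \<in> ball (a, 0) (\<rho> / 2)"
 shows "(ex has_derivative blinfun_apply (dex z)) (at z)"
proof -
 have "((%z. (fst z, pos z 1)) has_derivative (%h. (fst h, jac z h 1))) (at z)" unfolding pos_def jac_def
  by (intro has_derivative_Pair has_derivative_fst[OF has_derivative_ident] has_derivative_fst[OF flow_has_derivative[OF assms]]) simp
 moreover have "ex = (%z. (fst z, pos z 1))" "blinfun_apply (dex z) = (%h. (fst h, jac z h 1))" by (auto simp: fun_eq_iff ex_def dex_apply)
 ultimately show ?thesis by simp
qed

lemma jac_continuous:
 assumes "continuous_on S z" "continuous_on S h" "z ` S \<subseteq> D" "s \<in> {0..1}"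
 shows "continuous_on S (%y. jac (z y) (h y) s)"
proof -
 have "continuous_on S (%y. dflow (fst (z y, s)) (snd (z y, s)))" by (rule continuous_on_compose2[OF dflow_jointly_continuous, of S "%y. (z y, s)"])
   (use assms in "auto intro!: continuous_intros")
 thus ?thesis unfolding jac_def by (intro continuous_intros assms) simp
qed

lemma dex_continuous: "continuous_on (ball (a, 0) (\<rho> / 2)) dex"
proof (rule continuous_on_blinfun_componentwise)
 fix h :: "'e \<times> 'e"
 have "continuous_on (ball (a, 0) (\<rho> / 2)) (%z. (fst h, jac z h 1))" by (intro continuous_intros jac_continuous) (auto simp: less_imp_le)
 thus "continuous_on (ball (a, 0) (\<rho> / 2)) (%z. blinfun_apply (dex z) h)" by (simp add: dex_apply)
qed

lemma dex_base: "blinfun_apply (dex (a, 0)) (h, k) = (h, h + \<tau> *R k)"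
proof -
 have z: "(a, 0) \<in> D" using \<rho>_pos by simp
 have v0: "pos (a, 0) s = a" "vel (a, 0) s = 0" if "s \<in> {0..1}" for s using flow_zero_velocity[OF z that] by (auto simp: pos_def vel_def)
 have aV: "a \<in> V" using pos_in_V[OF z, of 0] v0(1)[of 0] by simp
 have Y: "djac (a, 0) (h, k) s = \<tau> *R k" if s: "s \<in> {0..1}" for s
 proof -
  have "(djac (a, 0) (h, k) has_vector_derivative 0) (at s within {0..1})" if "s \<in> {0..1}" for s
   using djac_deriv[OF z that, of "(h, k)"] v0[OF that] bilinear_\<Gamma>[OF aV] bilinear_d\<Gamma>[OF aV] by (simp add: bilinear_lzero)
  from derivative_integral_equation[OF this s] show ?thesis by (simp add: djac_def dflow_zero[OF z])
 qed
 have "(jac (a, 0) (h, k) has_vector_derivative (%_. \<tau> *R k) s) (at s within {0..1})" if "s \<in> {0..1}" for s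
  using jac_deriv[OF z that, of "(h, k)"] Y[OF that] by simp
 from derivative_integral_equation[OF this, of 1] have "jac (a, 0) (h, k) 1 = h + \<tau> *R k" by (simp add: jac_def dflow_zero[OF z])
 thus ?thesis by (simp add: dex_apply)
qed

text \<open>By \<open>dex_base\<close> the derivative of \<open>ex\<close> at \<open>(a, 0)\<close>
  is invertible, and the inverse function theorem applies. Continuity of \<open>g'\<close> follows
  from \<open>linear_solution_continuous\<close>, because \<open>g' y h\<close> solves a linear
  equation with coefficient \<open>dex (g y)\<close>.\<close>

lemma exponential_chart:
 obtains r1 W g g' where "0 < r1" "ball a r1 \<times> ball (0 :: 'e) r1 \<subseteq> ball (a, 0) (\<rho> / 2)" "open W" "(a, a) \<in> W"
  "!!y. y \<in> W ==> g y \<in> ball a r1 \<times> ball 0 r1" "!!y. y \<in> W ==> ex (g y) = y"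
  "!!z. z \<in> ball a r1 \<times> ball 0 r1 ==> ex z \<in> W" "!!z. z \<in> ball a r1 \<times> ball 0 r1 ==> g (ex z) = z"
  "!!y. y \<in> W ==> (g has_derivative g' y) (at y)" "!!h. continuous_on W (%y. g' y h)"
  "!!y h. y \<in> W ==> blinfun_apply (dex (g y)) (g' y h) = h"
proof -
 define invf :: "('e \<times> 'e) \<Rightarrow>\<^sub>L ('e \<times> 'e)" where "invf = Blinfun (%h. (fst h, (1 / \<tau>) *R (snd h - fst h)))"
 have inv: "blinfun_apply invf h = (fst h, (1 / \<tau>) *R (snd h - fst h))" for h unfolding invf_def by (subst bounded_linear_Blinfun_apply)
   (auto intro!: bounded_linear_Pair bounded_linear_fst bounded_linear_const_scaleR bounded_linear_sub bounded_linear_snd)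
 have invf: "invf o\<^sub>L dex (a, 0) = id_blinfun"
 proof (rule blinfun_eqI)
  fix h show "blinfun_apply (invf o\<^sub>L dex (a, 0)) h = blinfun_apply id_blinfun h"
   using \<tau>_pos by (cases h) (simp add: inv dex_base)
 qed
 obtain U' W0 g g' where U: "open U'" "U' \<subseteq> ball (a, 0) (\<rho> / 2)" "(a, 0) \<in> U'" "open W0" "ex (a, 0) \<in> W0"
  "homeomorphism U' W0 ex g" "!!y. y \<in> W0 ==> (g has_derivative g' y) (at y)"
  "!!y. y \<in> W0 ==> g' y = inv (blinfun_apply (dex (g y)))" "!!y. y \<in> W0 ==> bij (blinfun_apply (dex (g y)))"
  by (rule inverse_function_theorem[OF open_ball ex_derivative dex_continuous a_zero_in invf]) blast+
 obtain A C where AC: "open A" "open C" "a \<in> A" "0 \<in> C" "A \<times> C \<subseteq> U'" by (rule open_prod_elim[OF U(1,3)]) auto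
 obtain r2 r3 where r: "0 < r2" "ball a r2 \<subseteq> A" "0 < r3" "ball 0 r3 \<subseteq> C" using AC(1-4) open_contains_ball by metis
 define r1 where "r1 = min r2 r3"
 define N where "N = ball a r1 \<times> ball (0 :: 'e) r1"
 have r1: "0 < r1" using r by (simp add: r1_def)
 have "ball a r1 \<subseteq> A" by (rule order_trans[OF subset_ball r(2)]) (simp add: r1_def)
 moreover have "ball 0 r1 \<subseteq> C" by (rule order_trans[OF subset_ball r(4)]) (simp add: r1_def)
 ultimately have N: "N \<subseteq> U'" "open N" using AC(5) unfolding N_def by (blast, intro open_Times open_ball)
 define W where "W = {y \<in> W0. g y \<in> N}"
 have hom: "continuous_on W0 g" "!!z. z \<in> U' ==> g (ex z) = z" "!!y. y \<in> W0 ==> ex (g y) = y" "ex ` U' = W0" "g ` W0 = U'"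
  using U(6) by (auto simp: homeomorphism_def)
 have W: "open W" unfolding W_def using continuous_open_preimage[OF hom(1) U(4) N(2)] by (simp add: Int_def vimage_def)
 have exa: "ex (a, 0) = (a, a)" using flow_zero_velocity[of a 1] \<rho>_pos by (simp add: ex_def pos_def)
 have Wi: "ex z \<in> W" "g (ex z) = z" if "z \<in> N" for z
 proof -
  have z: "z \<in> U'" using that N(1) by blast
  show "g (ex z) = z" by (rule hom(2)[OF z])
  thus "ex z \<in> W" using that z hom(4) by (auto simp: W_def)
 qed
 have dg: "blinfun_apply (dex (g y)) (g' y h) = h" if "y \<in> W" for y h using U(8,9)[of y] that by (simp add: W_def bij_def surj_f_inv_f)
 have gc: "continuous_on W (%y. g' y h)" for h unfolding continuous_on_eq_continuous_at[OF W]
 proof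
  fix y assume y: "y \<in> W"
  have gW: "continuous_on W g" by (rule continuous_on_subset[OF hom(1)]) (auto simp: W_def)
  have cA: "continuous (at y) (%q. blinfun_apply (dex (g q)) x)" for x
  proof -
   have "continuous_on W (%q. blinfun_apply (dex (g q)) x)" by (intro continuous_intros continuous_on_compose2[OF dex_continuous gW])
     (use U(2) N(1) in "auto simp: W_def")
   thus ?thesis using y continuous_on_eq_continuous_at[OF W] by blast
  qed
  have inj: "x = 0" if "blinfun_apply (dex (g y)) x = 0" for x
  proof -
   have "inj (blinfun_apply (dex (g y)))" using U(9)[of y] y by (simp add: W_def bij_def)
   thus ?thesis using that blinfun.zero_right[of "dex (g y)"] by (metis injD)
  qed
  show "continuous (at y) (%y. g' y h)"
   by (rule linear_solution_continuous[where A = "%q. blinfun_apply (dex (g q))" and k = "%_. h", OF W y _ inj dg cA continuous_const])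
    (simp add: blinfun.bounded_linear_right bounded_linear.linear)
 qed
 show ?thesis
 proof (rule that[OF r1 _ W _ _ _ _ _ _ gc dg])
  show "ball a r1 \<times> ball (0 :: 'e) r1 \<subseteq> ball (a, 0) (\<rho> / 2)" using order_trans[OF N(1) U(2)] unfolding N_def .
  show "(a, a) \<in> W" using Wi(1)[of "(a, 0)"] r1 exa by (simp add: N_def)
  show "g y \<in> ball a r1 \<times> ball 0 r1" "ex (g y) = y" "(g has_derivative g' y) (at y)" if "y \<in> W" for y
   using that hom(3) U(7) by (auto simp: W_def N_def)
  show "ex z \<in> W" "g (ex z) = z" if "z \<in> ball a r1 \<times> ball 0 r1" for z using that Wi unfolding N_def by blast+
 qed
qed

end

section \<open>Convexity of the distance in small balls\<close>

text \<open>\<open>d\<close> is the distance of the manifold read in the chart. It is tied to the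
  metric by two comparisons: curves in the chart bound it from above, and functions of gradient at
  most one bound it from below near \<open>a\<close>.\<close>

locale geodesic_distance = geodesic_flow V G \<tau> \<rho> a
 for V :: "'e::euclidean_space set" and G \<tau> \<rho> a +
 fixes r1 :: real and W :: "('e \<times> 'e) set" and g :: "'e \<times> 'e => 'e \<times> 'e" and g' :: "'e \<times> 'e => 'e \<times> 'e => 'e \<times> 'e"
  and d :: "'e => 'e => real"
 assumes r1_pos: "0 < r1" and N_sub: "ball a r1 \<times> ball (0 :: 'e) r1 \<subseteq> ball (a, 0) (\<rho> / 2)"
  and W_open: "open W" and aa_in_W: "(a, a) \<in> W"
  and g_in: "q \<in> W ==> g q \<in> ball a r1 \<times> ball 0 r1" and ex_g: "q \<in> W ==> ex (g q) = q"
  and g_ex: "z \<in> ball a r1 \<times> ball 0 r1 ==> g (ex z) = z"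
  and g_deriv: "q \<in> W ==> (g has_derivative g' q) (at q)" and g'_cont: "continuous_on W (%q. g' q h)"
  and dex_g': "q \<in> W ==> blinfun_apply (dex (g q)) (g' q h) = h"
  and d_sym: "d x y = d y x" and d_triangle: "d x w <= d x y + d y w" and d_refl: "d x x = 0"
  and d_eq: "x \<in> V ==> y \<in> V ==> d x y = 0 ==> x = y"
  and d_upper: "(!!t. t \<in> {0..1} ==> \<sigma> t \<in> V) ==>
   (!!t. t \<in> {0..1} ==> (\<sigma> has_vector_derivative \<sigma>' t) (at t within {0..1})) ==> continuous_on {0..1} \<sigma>' ==>
   d (\<sigma> 0) (\<sigma> 1) <= integral {0..1} (%t. sqrt (G (\<sigma> t) (\<sigma>' t) (\<sigma>' t)))"
  and d_lower: "0 < R ==> cball a R \<subseteq> V ==> \<exists>R'>0. R' <= R &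
   (\<forall>f f'. (\<forall>x\<in>ball a R. (f has_derivative f' x) (at x) & (\<forall>v. \<bar>f' x v\<bar> <= sqrt (G x v v))) -->
    (\<forall>x\<in>ball a R'. \<forall>y\<in>ball a R'. f y - f x <= d x y))"
begin

abbreviation N where "N \<equiv> ball a r1 \<times> ball (0 :: 'e) r1"

definition len where "len z = \<tau> * sqrt (G (fst z) (snd z) (snd z))"

lemma N_D: "z \<in> N ==> z \<in> ball (a, 0) (\<rho> / 2)" "z \<in> N ==> z \<in> D" using N_sub by auto

lemma D_V: "z \<in> D ==> fst z \<in> V" using pos_in_V[of z 0] flow_zero[of z] by (simp add: pos_def)

lemma d_nonneg: "0 <= d x y" using d_triangle[of x x y] d_refl[of x] d_sym[of x y] by simp

lemma len_nonneg: "fst z \<in> V ==> 0 <= len z" unfolding len_def using \<tau>_pos G_nonneg[of "fst z" "snd z"] by simp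

lemma energy_len: "fst z \<in> V ==> energy z = (len z)\<^sup>2 / 2"
 unfolding len_def energy_def using G_nonneg[of "fst z" "snd z"] by (simp add: power_mult_distrib)

lemma len_scaleR: "x \<in> V ==> len (x, c *R v) = \<bar>c\<bar> * len (x, v)"
 unfolding len_def by (simp add: G_simps real_sqrt_mult flip: mult.assoc)

lemma speed_len:
 assumes "z \<in> D" "s \<in> {0..1}"
 shows "sqrt (G (pos z s) (vel z s) (vel z s)) = len z" unfolding speed_constant[OF assms] len_def using \<tau>_pos by (simp add: real_sqrt_mult)

lemma pos_zero: "z \<in> D ==> pos z 0 = fst z" by (simp add: pos_def flow_zero)

lemma pos_one_g: "y \<in> W ==> pos (g y) 1 = snd y" "y \<in> W ==> fst (g y) = fst y" using ex_g[of y] by (auto simp: ex_def prod_eq_iff)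

lemma segment_upper:
 assumes z: "z \<in> D" and \<alpha>\<beta>: "0 <= \<alpha>" "\<alpha> <= \<beta>" "\<beta> <= 1"
 shows "d (pos z \<alpha>) (pos z \<beta>) <= (\<beta> - \<alpha>) * len z"
proof -
 define e where "e = (%t. \<alpha> + (\<beta> - \<alpha>) * t)"
 have e: "e t \<in> {0..1}" if "t \<in> {0..1}" for t
 proof -
  have "0 <= (\<beta> - \<alpha>) * t" "(\<beta> - \<alpha>) * t <= (\<beta> - \<alpha>) * 1"
   using that \<alpha>\<beta> by (auto intro: mult_left_mono[of t 1 "\<beta> - \<alpha>", simplified])
  thus ?thesis using \<alpha>\<beta> unfolding e_def by auto
 qed
 hence im: "e ` {0..1} \<subseteq> {0..1}" by blast
 have de: "(e has_vector_derivative (\<beta> - \<alpha>)) (at t within {0..1})" for t unfolding e_def by (auto intro!: derivative_eq_intros)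
 have ec: "continuous_on {0..1} e" unfolding e_def by (intro continuous_intros)
 have vc: "continuous_on {0..1} (%t. (\<beta> - \<alpha>) *R vel z (e t))"
  unfolding vel_def by (intro continuous_intros continuous_on_compose2[OF flow_cont[OF z] ec im])
 have sp: "sqrt (G (pos z (e t)) ((\<beta> - \<alpha>) *R vel z (e t)) ((\<beta> - \<alpha>) *R vel z (e t))) = (\<beta> - \<alpha>) * len z" if "t \<in> {0..1}" for t
  using speed_len[OF z e[OF that]] \<alpha>\<beta> G_simps(7,8)[OF pos_in_V[OF z e[OF that]]] by (simp add: real_sqrt_mult flip: mult.assoc)
 have "d (pos z (e 0)) (pos z (e 1)) <= integral {0..1} (%t. sqrt (G (pos z (e t)) ((\<beta> - \<alpha>) *R vel z (e t)) ((\<beta> - \<alpha>) *R vel z (e t))))"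
 proof (rule d_upper[OF _ _ vc])
  show "pos z (e t) \<in> V" if "t \<in> {0..1}" for t by (rule pos_in_V[OF z e[OF that]])
  show "((%t. pos z (e t)) has_vector_derivative (\<beta> - \<alpha>) *R vel z (e t)) (at t within {0..1})" if "t \<in> {0..1}" for t
   using vector_diff_chain_within[OF de has_vector_derivative_within_subset[OF pos_deriv[OF z e[OF that]] im]] by (simp add: o_def)
 qed
 also have "\<dots> = integral {0..1::real} (%t. (\<beta> - \<alpha>) * len z)" by (rule integral_cong) (rule sp)
 finally show ?thesis by (simp add: e_def)
qed

text \<open>A form of the Gauss lemma: when only the end point varies, the Jacobi field vanishes at
  time \<open>0\<close> and equals the variation at time \<open>1\<close>, so
  \<open>first_variation\<close> leaves the term at the end.\<close>

lemma energy_gradient: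
 assumes W: "(x, y) \<in> W"
 shows "((%y. energy (g (x, y))) has_derivative (%\<eta>. G y \<eta> (vel (g (x, y)) 1))) (at y)"
proof -
 note gN = g_in[OF W]
 note fv = first_variation[OF N_D(1)[OF gN]]
 have "((%y. (x, y)) has_derivative (%\<eta>. (0, \<eta>))) (at y)" by (auto intro!: derivative_eq_intros)
 from has_derivative_compose[OF has_derivative_compose[OF this g_deriv[OF W]] fv]
 have "((%y. energy (g (x, y))) has_derivative (%\<eta>. G (pos (g (x, y)) 1) (jac (g (x, y)) (g' (x, y) (0, \<eta>)) 1) (vel (g (x, y)) 1)
   - G (pos (g (x, y)) 0) (jac (g (x, y)) (g' (x, y) (0, \<eta>)) 0) (vel (g (x, y)) 0))) (at y)" .
 moreover have "jac (g (x, y)) (g' (x, y) (0, \<eta>)) 1 = \<eta>" "jac (g (x, y)) (g' (x, y) (0, \<eta>)) 0 = 0" for \<eta>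
  using dex_g'[OF W, of "(0, \<eta>)"] dflow_zero[OF N_D(2)[OF gN]] by (auto simp: dex_apply jac_def)
 ultimately show ?thesis using pos_one_g[OF W] G_simps(9)[OF pos_in_V[OF N_D(2)[OF gN], of 0]] by simp
qed

lemma g_diagonal: "x \<in> ball a r1 ==> g (x, x) = (x, 0)"
 using g_ex[of "(x, 0)"] flow_zero_velocity[of x 1] N_D(2)[of "(x, 0)"] r1_pos by (simp add: ex_def pos_def)

text \<open>The geodesic itself gives the upper bound. The distance from \<open>x\<close> has
  gradient of norm one but is not differentiable at \<open>x\<close>; the regularised
  \<open>sqrt (2 * E + e\<^sup>2)\<close> is differentiable with gradient at most one, and it costs
  only \<open>e\<close>.\<close>

lemma distance_is_length:
 obtains R' where "0 < R'" "R' <= r1" "!!x y. x \<in> ball a R' ==> y \<in> ball a R' ==> (x, y) \<in> W"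
  "!!x y. x \<in> ball a R' ==> y \<in> ball a R' ==> d x y = len (g (x, y))"
proof -
 obtain A1 A2 where A: "open A1" "open A2" "a \<in> A1" "a \<in> A2" "A1 \<times> A2 \<subseteq> W" by (rule open_prod_elim[OF W_open aa_in_W]) auto
 have "open (A1 \<inter> A2 \<inter> ball a r1 \<inter> V)" "a \<in> A1 \<inter> A2 \<inter> ball a r1 \<inter> V"
  using A r1_pos open_V D_V[of "(a, 0)"] \<rho>_pos by auto
 then obtain R where R: "0 < R" "cball a R \<subseteq> A1 \<inter> A2 \<inter> ball a r1 \<inter> V" using open_contains_cball by metis
 have RW: "(x, y) \<in> W" if "x \<in> cball a R" "y \<in> cball a R" for x y using R(2) A(5) that by blast
 obtain R' where R': "0 < R'" "R' <= R"
  "!!q q'. (!!x. x \<in> ball a R ==> (q has_derivative q' x) (at x)) ==> (!!x v. x \<in> ball a R ==> \<bar>q' x v\<bar> <= sqrt (G x v v)) ==>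
   (\<forall>x\<in>ball a R'. \<forall>y\<in>ball a R'. q y - q x <= d x y)" using d_lower[of R] R by (metis le_inf_iff)
 have in_R: "x \<in> cball a R" if "x \<in> ball a R'" for x using that R'(2) by auto
 show ?thesis
 proof (rule that[OF R'(1)])
  show "R' <= r1"
  proof (rule ccontr)
   obtain b :: 'e where "b \<in> Basis" using nonempty_Basis by blast
   assume "\<not> R' <= r1"
   hence "a + r1 *R b \<in> cball a R" using R'(2) r1_pos \<open>b \<in> Basis\<close> by (simp add: dist_norm)
   hence "a + r1 *R b \<in> ball a r1" using R(2) by blast
   thus False using r1_pos \<open>b \<in> Basis\<close> by (simp add: dist_norm)
  qed
  fix x y assume xy: "x \<in> ball a R'" "y \<in> ball a R'"
  show W: "(x, y) \<in> W" using RW in_R xy by blast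
  note gN = g_in[OF W]
  note gD = N_D(2)[OF gN]
  have "d (pos (g (x, y)) 0) (pos (g (x, y)) 1) <= (1 - 0) * len (g (x, y))" by (rule segment_upper[OF gD]) auto
  hence upper: "d x y <= len (g (x, y))" using pos_zero[OF gD] pos_one_g[OF W] by simp
  have "len (g (x, y)) <= d x y + e" if e: "0 < e" for e
  proof -
   let ?E = "%y. energy (g (x, y))"
   define q where "q = (%y. sqrt (2 * ?E y + e\<^sup>2))"
   have E0: "0 <= ?E y" if "y \<in> ball a R" for y
   proof -
    have "(x, y) \<in> W" using RW[OF in_R[OF xy(1)], of y] that by simp
    hence "fst (g (x, y)) \<in> V" by (intro D_V N_D(2) g_in)
    thus ?thesis by (simp add: energy_len)
   qed
   have qpos: "0 < q y" "q y * q y = 2 * ?E y + e\<^sup>2" if "y \<in> ball a R" for y using E0[OF that] e by (auto simp: q_def add_nonneg_pos)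
   have "\<forall>x\<in>ball a R'. \<forall>y\<in>ball a R'. q y - q x <= d x y"
   proof (rule R'(3)[of q "%y \<eta>. G y \<eta> (vel (g (x, y)) 1) / q y"])
    fix y assume y: "y \<in> ball a R"
    hence W: "(x, y) \<in> W" using RW in_R xy(1) by auto
    have yV: "y \<in> V" using y R(2) by auto
    have "((%y. 2 * ?E y + e\<^sup>2) has_derivative (%\<eta>. 2 * G y \<eta> (vel (g (x, y)) 1))) (at y)"
     by (auto intro!: derivative_eq_intros energy_gradient[OF W])
    from DERIV_compose_FDERIV[OF DERIV_real_sqrt this] qpos[OF y]
    show "(q has_derivative (%\<eta>. G y \<eta> (vel (g (x, y)) 1) / q y)) (at y)" by (simp add: q_def[abs_def] inverse_eq_divide)
    fix v
    have "(G y v (vel (g (x, y)) 1))\<^sup>2 <= G y v v * G y (vel (g (x, y)) 1) (vel (g (x, y)) 1)" by (rule G_Cauchy_Schwarz(1)[OF yV])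
    also have "G y (vel (g (x, y)) 1) (vel (g (x, y)) 1) = 2 * ?E y"
     using speed_constant[OF N_D(2)[OF g_in[OF W]], of 1] pos_one_g[OF W] by (simp add: energy_def)
    also have "G y v v * (2 * ?E y) <= G y v v * (q y)\<^sup>2"
     using qpos[OF y] G_nonneg[OF yV, of v] by (intro mult_left_mono) (auto simp: power2_eq_square)
    finally have "(G y v (vel (g (x, y)) 1))\<^sup>2 <= (sqrt (G y v v) * q y)\<^sup>2" using G_nonneg[OF yV, of v] by (simp add: power_mult_distrib)
    moreover have "0 <= sqrt (G y v v) * q y" using qpos(1)[OF y] G_nonneg[OF yV, of v] by simp
    ultimately have "\<bar>G y v (vel (g (x, y)) 1)\<bar> <= sqrt (G y v v) * q y" by (metis abs_le_square_iff abs_of_nonneg)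
    thus "\<bar>G y v (vel (g (x, y)) 1) / q y\<bar> <= sqrt (G y v v)" using qpos(1)[OF y] by (simp add: abs_divide divide_le_eq)
   qed
   hence "q y - q x <= d x y" using xy by blast
   moreover have "q x = e"
   proof -
    have "x \<in> ball a r1" using in_R[OF xy(1)] R(2) by blast
    moreover from this have "x \<in> V" using R(2) in_R[OF xy(1)] by blast
    ultimately show ?thesis using e by (simp add: q_def g_diagonal energy_def G_simps)
   qed
   moreover have "len (g (x, y)) <= q y" unfolding q_def energy_len[OF D_V[OF gD]] by (rule real_le_rsqrt) simp
   ultimately show ?thesis by linarith
  qed
  hence "len (g (x, y)) <= d x y" by (rule field_le_epsilon)
  thus "d x y = len (g (x, y))" using upper by simp
 qed
qed

lemma normal_radii:
 obtains R' \<kappa> r5 \<eta> where "0 < R'" "R' <= r1" "!!x y. x \<in> ball a R' ==> y \<in> ball a R' ==> (x, y) \<in> W"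
  "!!x y. x \<in> ball a R' ==> y \<in> ball a R' ==> d x y = len (g (x, y))"
  "\<kappa> <= R'" "!!z s. fst z \<in> ball a \<kappa> ==> snd z \<in> ball 0 \<kappa> ==> s \<in> {0..1} ==> pos z s \<in> ball a R'"
  "0 < r5" "r5 <= \<kappa>" "0 < \<eta>" "!!x v. x \<in> ball a r5 ==> len (x, v) < \<eta> ==> norm v < \<kappa>"
  "!!x y. x \<in> ball a r5 ==> y \<in> ball a r5 ==> d x y < \<eta> / 2"
proof -
 obtain R' where R': "0 < R'" "R' <= r1" "!!x y. x \<in> ball a R' ==> y \<in> ball a R' ==> (x, y) \<in> W"
  "!!x y. x \<in> ball a R' ==> y \<in> ball a R' ==> d x y = len (g (x, y))" by (rule distance_is_length) blast
 \<comment> \<open>\<open>flow_near\<close> doubles the initial deviation, which is below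
   \<open>2 * \<kappa>\<close>; so geodesics stay within \<open>4 * \<kappa> < R'\<close> of
   \<open>a\<close>.\<close>
 define \<kappa> where "\<kappa> = R' / 5"
 have \<kappa>: "0 < \<kappa>" "\<kappa> <= R'" using R'(1) by (auto simp: \<kappa>_def)
 have norm_proj: "norm (fst q) <= norm q" "norm (snd q) <= norm q" for q :: "'e \<times> 'e" by (cases q; simp add: norm_fst_le norm_snd_le)+
 have near: "pos z s \<in> ball a R'" if z: "fst z \<in> ball a \<kappa>" "snd z \<in> ball 0 \<kappa>" and s: "s \<in> {0..1}" for z s
 proof -
  have "z \<in> N" using z \<kappa>(2) R'(2) by (cases z) auto
  from flow_near[OF N_D(2)[OF this] s] have "norm (flow z s - (a, 0)) <= 2 * norm (z - (a, 0))" .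
  moreover have "norm (z - (a, 0)) <= norm (fst z - a) + norm (snd z)" using norm_Pair_le[of "fst z - a" "snd z"] by (cases z) simp
  moreover have "norm (fst z - a) < \<kappa>" "norm (snd z) < \<kappa>" using z by (auto simp: dist_norm norm_minus_commute)
  moreover have "norm (pos z s - a) <= norm (flow z s - (a, 0))" using norm_proj(1)[of "flow z s - (a, 0)"] by (simp add: pos_def)
  ultimately have "norm (pos z s - a) < R'" unfolding \<kappa>_def using R'(1) by linarith
  thus ?thesis by (simp add: dist_norm norm_minus_commute)
 qed
 have "open V" "a \<in> V" using open_V D_V[of "(a, 0)"] \<rho>_pos by auto
 then obtain r0 where r0: "0 < r0" "cball a r0 \<subseteq> V" using open_contains_cball by blast
 obtain c C where c: "0 < c" "!!x v. x \<in> cball a r0 ==> c * norm v <= sqrt (G x v v)" "!!x v. x \<in> cball a r0 ==> sqrt (G x v v) <= C * norm v"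
  by (rule G_comparable[OF compact_cball r0(2)]) blast
 define \<eta> where "\<eta> = \<tau> * (c * \<kappa>)"
 have \<eta>: "0 < \<eta>" using \<tau>_pos c(1) \<kappa>(1) by (simp add: \<eta>_def)
 have small: "norm v < \<kappa>" if "x \<in> cball a r0" "len (x, v) < \<eta>" for x v
 proof -
  have "\<tau> * (c * norm v) <= len (x, v)" unfolding len_def using c(2)[OF that(1), of v] \<tau>_pos by (intro mult_left_mono) auto
  hence "\<tau> * (c * norm v) < \<tau> * (c * \<kappa>)" using that(2) by (simp add: \<eta>_def)
  thus ?thesis using \<tau>_pos c(1) by simp
 qed
 have gc: "continuous_on W g" by (rule has_derivative_continuous_on) (rule has_derivative_at_withinI[OF g_deriv])
 have "\<exists>e>0. \<forall>q\<in>W. dist q (a, a) < e --> dist (g q) (g (a, a)) < \<eta> / (2 * \<tau> * (\<bar>C\<bar> + 1))"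
  using gc aa_in_W \<eta> \<tau>_pos unfolding continuous_on_iff by (auto intro!: divide_pos_pos)
 then obtain e where e: "0 < e" "!!q. q \<in> W ==> dist q (a, a) < e ==> dist (g q) (g (a, a)) < \<eta> / (2 * \<tau> * (\<bar>C\<bar> + 1))" by blast
 define r5 where "r5 = min (e / 2) (min r0 \<kappa>)"
 have r5: "0 < r5" "r5 <= e / 2" "r5 <= r0" "r5 <= \<kappa>" using e(1) r0(1) \<kappa>(1) by (auto simp: r5_def)
 have dl: "d x y < \<eta> / 2" if xy: "x \<in> ball a r5" "y \<in> ball a r5" for x y
 proof -
  have R: "x \<in> ball a R'" "y \<in> ball a R'" using xy r5(4) \<kappa>(2) by auto
  note W = R'(3)[OF R]
  have "dist (x, y) (a, a) <= dist x a + dist y a" unfolding dist_norm using norm_Pair_le[of "x - a" "y - a"] by simp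
  hence "dist (x, y) (a, a) < e" using xy r5(2) by (simp add: dist_commute)
  from e(2)[OF W this] have "norm (g (x, y) - (a, 0)) < \<eta> / (2 * \<tau> * (\<bar>C\<bar> + 1))"
   using g_diagonal[of a] r1_pos by (simp add: dist_norm)
  moreover have "norm (snd (g (x, y))) <= norm (g (x, y) - (a, 0))" using norm_proj(2)[of "g (x, y) - (a, 0)"] by simp
  ultimately have n: "norm (snd (g (x, y))) < \<eta> / (2 * \<tau> * (\<bar>C\<bar> + 1))" by linarith
  have "sqrt (G x (snd (g (x, y))) (snd (g (x, y)))) <= C * norm (snd (g (x, y)))" using xy(1) r5(3) by (intro c(3)) auto
  also have "\<dots> <= (\<bar>C\<bar> + 1) * norm (snd (g (x, y)))" by (intro mult_right_mono) auto
  also have "\<dots> < (\<bar>C\<bar> + 1) * (\<eta> / (2 * \<tau> * (\<bar>C\<bar> + 1)))" using n by (intro mult_strict_left_mono) auto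
  also have "\<dots> = \<eta> / (2 * \<tau>)"
  proof -
   have "\<bar>C\<bar> + 1 ~= 0" by linarith
   thus ?thesis by simp
  qed
  finally have "\<tau> * sqrt (G x (snd (g (x, y))) (snd (g (x, y)))) < \<tau> * (\<eta> / (2 * \<tau>))"
   using \<tau>_pos by (rule mult_strict_left_mono)
  thus ?thesis using \<tau>_pos R'(4)[OF R] pos_one_g(2)[OF W] by (simp add: len_def)
 qed
 show ?thesis
 proof (rule that[OF R' \<kappa>(2) near r5(1,4) \<eta> _ dl])
  fix x v assume x: "x \<in> ball a r5" "len (x, v) < \<eta>"
  hence "x \<in> cball a r0" using r5(3) by auto
  thus "norm v < \<kappa>" using small x(2) by blast
 qed
qed

end

section \<open>Geodesics in a normal ball\<close>

locale normal_ball = geodesic_distance V G \<tau> \<rho> a r1 W g g' d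
 for V :: "'e::euclidean_space set" and G \<tau> \<rho> a r1 W g g' d +
 fixes R' \<kappa> r5 \<eta> :: real
 assumes R'_pos: "0 < R'" and R'_le: "R' <= r1" and in_W: "x \<in> ball a R' ==> y \<in> ball a R' ==> (x, y) \<in> W"
  and d_len: "x \<in> ball a R' ==> y \<in> ball a R' ==> d x y = len (g (x, y))"
  and \<kappa>_le: "\<kappa> <= R'"
  and pos_in_R': "fst z \<in> ball a \<kappa> ==> snd z \<in> ball 0 \<kappa> ==> s \<in> {0..1} ==> pos z s \<in> ball a R'"
  and r5: "0 < r5" "r5 <= \<kappa>" and \<eta>_pos: "0 < \<eta>"
  and len_small: "x \<in> ball a r5 ==> len (x, v) < \<eta> ==> norm v < \<kappa>"
  and d_small: "x \<in> ball a r5 ==> y \<in> ball a r5 ==> d x y < \<eta> / 2"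
begin

text \<open>Geodesics with such initial data may leave \<open>P\<close>, but they stay in the ball
  of radius \<open>R'\<close>, where distances are lengths of geodesics.\<close>

definition good where "good z \<longleftrightarrow> fst z \<in> ball a r5 & len z < \<eta>"

abbreviation P where "P \<equiv> ball a r5"

lemma P_R': "x \<in> P ==> x \<in> ball a R'" using r5 \<kappa>_le by auto

lemma good_in:
 assumes "good z"
 shows "z \<in> N" "z \<in> D" "s \<in> {0..1} ==> pos z s \<in> ball a R'" "fst z \<in> V"
proof -
 have 1: "fst z \<in> ball a \<kappa>" "snd z \<in> ball 0 \<kappa>" using assms r5 len_small[of "fst z" "snd z"] by (auto simp: good_def)
 thus "z \<in> N" using \<kappa>_le R'_le by (cases z) auto
 thus "z \<in> D" by (rule N_D)
 thus "fst z \<in> V" by (rule D_V)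
 show "s \<in> {0..1} ==> pos z s \<in> ball a R'" by (rule pos_in_R'[OF 1])
qed

lemma good_g:
 assumes "x \<in> P" "y \<in> P"
 shows "good (g (x, y))" "g (x, y) = (x, snd (g (x, y)))" "pos (g (x, y)) 1 = y" "pos (g (x, y)) 0 = x" "len (g (x, y)) = d x y"
proof -
 note W = in_W[OF P_R'[OF assms(1)] P_R'[OF assms(2)]]
 show l: "len (g (x, y)) = d x y" using d_len P_R' assms by simp
 show f: "g (x, y) = (x, snd (g (x, y)))" "pos (g (x, y)) 1 = y" using pos_one_g[OF W] by (auto simp: prod_eq_iff)
 show "good (g (x, y))" unfolding good_def l using d_small[OF assms] \<eta>_pos assms(1) f(1) by (metis (no_types) fst_conv half_gt_zero_iff less_trans field_sum_of_halves add_less_same_cancel1 less_add_same_cancel1)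
 thus "pos (g (x, y)) 0 = x" using pos_zero[OF good_in(2)] f(1) by (metis fst_conv)
qed

lemma good_scale:
 assumes "good (x, v)" "\<bar>c\<bar> <= 1"
 shows "good (x, c *R v)"
proof -
 have "\<bar>c\<bar> * len (x, v) <= 1 * len (x, v)" using assms good_in(4)[OF assms(1)] len_nonneg[of "(x, v)"] by (intro mult_right_mono) auto
 thus ?thesis using assms good_in(4)[OF assms(1)] by (auto simp: good_def len_scaleR)
qed

lemma flow_scale:
 assumes "good (x, v)" "c \<in> {0..1}" "s \<in> {0..1}"
 shows "flow (x, c *R v) s = (pos (x, v) (c * s), c *R snd (flow (x, v) (c * s)))"
proof -
 note z = good_in(2)[OF assms(1)]
 have "flow (pos (x, v) 0, c *R snd (flow (x, v) 0)) s = (pos (x, v) (0 + c * s), c *R snd (flow (x, v) (0 + c * s)))"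
 proof (rule flow_reparametrize[OF z _ _ assms(3)])
  show "0 + c * s \<in> {0..1}" if "s \<in> {0..1}" for s using that assms(2) by (auto intro: mult_le_one)
  show "(pos (x, v) 0, c *R snd (flow (x, v) 0)) \<in> D"
   using good_in(2)[OF good_scale[OF assms(1), of c]] assms(2) by (simp add: pos_zero[OF z] flow_zero[OF z])
 qed
 thus ?thesis by (simp add: pos_zero[OF z] flow_zero[OF z])
qed

lemma pos_scale: "good (x, v) ==> c \<in> {0..1} ==> s \<in> {0..1} ==> pos (x, c *R v) s = pos (x, v) (c * s)"
 using flow_scale[of x v c s] by (simp add: pos_def)

lemma d_pos_zero:
 assumes "good (x, v)" "s \<in> {0..1}"
 shows "d x (pos (x, v) s) = s * len (x, v)"
proof -
 have x: "x \<in> ball a R'" using assms(1) P_R' by (auto simp: good_def)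
 have gs: "good (x, s *R v)" using good_scale[OF assms(1), of s] assms(2) by simp
 have "pos (x, s *R v) 1 = pos (x, v) s" using pos_scale[OF assms, of 1] by simp
 hence "g (x, pos (x, v) s) = (x, s *R v)" using g_ex[OF good_in(1)[OF gs]] by (simp add: ex_def)
 thus ?thesis using d_len[OF x good_in(3)[OF assms]] len_scaleR good_in(4)[OF assms(1)] assms(2) by simp
qed

text \<open>Distances from the starting point are exact by \<open>d_pos_zero\<close>; the triangle
  inequality and \<open>segment_upper\<close> then leave no room for the other distances along the
  geodesic.\<close>

lemma geodesic_distance:
 assumes "good z" "0 <= \<alpha>" "\<alpha> <= \<beta>" "\<beta> <= 1"
 shows "d (pos z \<alpha>) (pos z \<beta>) = (\<beta> - \<alpha>) * len z"
proof -
 obtain x v where z: "z = (x, v)" by (cases z)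
 have "d x (pos z \<beta>) <= d x (pos z \<alpha>) + d (pos z \<alpha>) (pos z \<beta>)" by (rule d_triangle)
 hence "\<beta> * len z <= \<alpha> * len z + d (pos z \<alpha>) (pos z \<beta>)" using d_pos_zero[of x v] assms unfolding z by simp
 thus ?thesis using segment_upper[OF good_in(2)[OF assms(1)] assms(2-4)] by (simp add: algebra_simps)
qed

text \<open>Nothing is glued: the geodesic with initial velocity \<open>(1 + \<beta>) *R w\<close>
  is split at time \<open>1 / (1 + \<beta>)\<close>, and \<open>flow_reparametrize\<close>
  identifies both parts.\<close>

lemma geodesic_concat:
 assumes z1: "good (x, w)" and \<beta>: "0 <= \<beta>" and l: "(1 + \<beta>) * len (x, w) < \<eta>"
  and D: "(pos (x, w) 1, \<beta> *R snd (flow (x, w) 1)) \<in> D"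
 shows "good (x, (1 + \<beta>) *R w)" "pos (x, (1 + \<beta>) *R w) (1 / (1 + \<beta>)) = pos (x, w) 1"
  "pos (pos (x, w) 1, \<beta> *R snd (flow (x, w) 1)) 1 = pos (x, (1 + \<beta>) *R w) 1"
proof -
 let ?z = "(x, (1 + \<beta>) *R w)" and ?s = "1 / (1 + \<beta>)"
 have x: "x \<in> V" using good_in(4)[OF z1] by simp
 show z: "good ?z" using z1 l \<beta> x by (auto simp: good_def len_scaleR)
 have s: "?s \<in> {0..1}" "?s * (1 + \<beta>) = 1" "\<beta> * ?s = 1 - ?s" using \<beta> by (auto simp: field_simps)
 have "?s *R (1 + \<beta>) *R w = w" using \<beta> by simp
 with flow_scale[OF z s(1), of 1] have f: "flow (x, w) 1 = (pos ?z ?s, ?s *R snd (flow ?z ?s))" by simp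
 thus p: "pos ?z ?s = pos (x, w) 1" by (simp add: pos_def)
 have u: "\<beta> *R snd (flow (x, w) 1) = (1 - ?s) *R snd (flow ?z ?s)" unfolding f s(3)[symmetric] by simp
 have "flow (pos ?z ?s, (1 - ?s) *R snd (flow ?z ?s)) 1 = (pos ?z (?s + (1 - ?s) * 1), (1 - ?s) *R snd (flow ?z (?s + (1 - ?s) * 1)))"
 proof (rule flow_reparametrize[OF good_in(2)[OF z]])
  show "?s + (1 - ?s) * s \<in> {0..1}" if "s \<in> {0..1}" for s
  proof -
   have "0 <= (1 - ?s) * s" "(1 - ?s) * s <= (1 - ?s) * 1" using that s(1) by (auto intro!: mult_left_mono[of s 1 "1 - ?s"] simp del: mult_1_right)
   thus ?thesis using s(1) by auto
  qed
  show "(pos ?z ?s, (1 - ?s) *R snd (flow ?z ?s)) \<in> D" using D unfolding p u .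
 qed simp
 thus "pos (pos (x, w) 1, \<beta> *R snd (flow (x, w) 1)) 1 = pos ?z 1" unfolding u p[symmetric] by (simp add: pos_def)
qed

lemma d_zero_iff: "x \<in> ball a R' ==> y \<in> ball a R' ==> d x y = 0 \<longleftrightarrow> x = y"
 using d_eq[of x y] d_refl pos_one_g(2)[OF in_W] D_V[OF N_D(2)[OF g_in[OF in_W]]] by (metis fst_conv)

text \<open>If \<open>z\<close> lies between \<open>p\<close> and \<open>q\<close>, then the distance from \<open>p\<close> grows along the geodesic from
 \<open>z\<close> to \<open>q\<close> at full speed, so by the equality case of Cauchy-Schwarz there is no corner at \<open>z\<close>.\<close>

lemma between_unique:
 assumes P: "p \<in> P" "z \<in> P" "q \<in> P" and b: "d p z = s * L" "d z q = (1 - s) * L" "L = d p q" "0 < s" "s < 1" "0 < L"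
 shows "g (p, q) = (p, (1 / s) *R snd (g (p, z)))"
proof -
 define \<sigma> where "\<sigma> = pos (g (z, q))"
 define w where "w = snd (g (p, z))"
 note gz = good_g[OF P(2,3)] and gp = good_g[OF P(1,2)]
 have gw: "g (p, z) = (p, w)" using gp(2) by (simp add: w_def)
 have zV: "z \<in> V" using good_in(4)[OF gz(1)] gz(2) by (metis fst_conv)
 have \<sigma>R: "\<sigma> t \<in> ball a R'" if "t \<in> {0..1}" for t unfolding \<sigma>_def by (rule good_in(3)[OF gz(1) that])
 have h: "d p (\<sigma> t) = s * L + t * ((1 - s) * L)" if t: "t \<in> {0..1}" for t
 proof -
  have "d z (\<sigma> t) = t * ((1 - s) * L)" "d (\<sigma> t) q = (1 - t) * ((1 - s) * L)"
   using geodesic_distance[OF gz(1), of 0 t] geodesic_distance[OF gz(1), of t 1] t gz(3-5) b(2) by (auto simp: \<sigma>_def)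
  thus ?thesis using d_triangle[of p "\<sigma> t" z] d_triangle[of p q "\<sigma> t"] b by (simp add: algebra_simps)
 qed
 \<comment> \<open>The energy of the geodesic from \<open>p\<close> to \<open>\<sigma> t\<close> is
   differentiated at \<open>t = 0\<close> twice: by its gradient, and by the explicit formula that
   holds because the distances add up.\<close>
 have 1: "((%t. energy (g (p, \<sigma> t))) has_vector_derivative G z (vel (g (z, q)) 0) (vel (g (p, z)) 1)) (at 0 within {0..1})"
 proof -
  have \<sigma>': "(\<sigma> has_vector_derivative vel (g (z, q)) 0) (at 0 within {0..1})"
   unfolding \<sigma>_def by (rule pos_deriv[OF good_in(2)[OF gz(1)]]) simp
  have "\<sigma> 0 = z" using gz(4) by (simp add: \<sigma>_def)
  hence eg: "((%y. energy (g (p, y))) has_derivative (%\<eta>. G z \<eta> (vel (g (p, z)) 1))) (at (\<sigma> 0))"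
   using energy_gradient[OF in_W[OF P_R'[OF P(1)] P_R'[OF P(2)]]] by simp
  from has_derivative_compose[OF \<sigma>'[unfolded has_vector_derivative_def] eg] show ?thesis
   unfolding has_vector_derivative_def by (simp add: G_simps(7)[OF zV])
 qed
 have 2: "((%t. energy (g (p, \<sigma> t))) has_vector_derivative (s * L) * ((1 - s) * L)) (at 0 within {0..1})"
 proof -
  have "((%t. (s * L + t * ((1 - s) * L))\<^sup>2 / 2) has_vector_derivative (s * L) * ((1 - s) * L)) (at 0 within {0..1})"
   by (auto intro!: derivative_eq_intros simp: has_real_derivative_iff_has_vector_derivative[symmetric])
  thus ?thesis
  proof (rule has_vector_derivative_transform[rotated 2])
   fix t :: real assume t: "t \<in> {0..1}"
   note W = in_W[OF P_R'[OF P(1)] \<sigma>R[OF t]]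
   show "energy (g (p, \<sigma> t)) = (s * L + t * ((1 - s) * L))\<^sup>2 / 2"
    unfolding energy_len[OF D_V[OF N_D(2)[OF g_in[OF W]]]] d_len[OF P_R'[OF P(1)] \<sigma>R[OF t], symmetric] h[OF t] ..
  qed simp
 qed
 have eq: "G z (vel (g (z, q)) 0) (vel (g (p, z)) 1) = (s * L) * ((1 - s) * L)"
  by (rule vector_derivative_unique_within[OF _ 1 2]) (simp add: trivial_limit_within islimpt_Icc)
 let ?A = "vel (g (z, q)) 0" and ?B = "vel (g (p, z)) 1"
 have sp: "sqrt (G z ?A ?A) = (1 - s) * L" "sqrt (G z ?B ?B) = s * L"
  using speed_len[OF good_in(2)[OF gz(1)], of 0] speed_len[OF good_in(2)[OF gp(1)], of 1] gz(4,5) gp(3,5) b(1,2) by simp_all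
 hence sq: "G z ?A ?A = ((1 - s) * L)\<^sup>2" "G z ?B ?B = (s * L)\<^sup>2" using G_nonneg[OF zV] by (metis real_sqrt_pow2)+
 have "s * L ~= 0" using b by simp
 have "?B ~= 0" using sq(2) \<open>s * L ~= 0\<close> G_simps(9)[OF zV] by auto
 have "?A = (G z ?A ?B / G z ?B ?B) *R ?B"
  by (rule G_Cauchy_Schwarz(2)[OF zV _ \<open>?B ~= 0\<close>]) (simp add: eq sq power_mult_distrib power2_eq_square)
 also have "G z ?A ?B / G z ?B ?B = (1 - s) / s" unfolding eq sq using b(4,6) by (simp add: power2_eq_square field_simps)
 finally have "\<tau> *R snd (g (z, q)) = \<tau> *R ((1 - s) / s) *R snd (flow (p, w) 1)"
  unfolding vel_def gw flow_zero[OF good_in(2)[OF gz(1)]] by simp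
 hence v: "snd (g (z, q)) = ((1 - s) / s) *R snd (flow (p, w) 1)" by (rule scaleR_left_imp_eq[rotated]) (use \<tau>_pos in simp)
 define \<beta> where "\<beta> = (1 - s) / s"
 have \<beta>: "0 <= \<beta>" "1 + \<beta> = 1 / s" using b(4,5) by (auto simp: \<beta>_def field_simps)
 have pw: "good (p, w)" "pos (p, w) 1 = z" "len (p, w) = s * L" using gp gw b(1) by auto
 have zq: "(pos (p, w) 1, \<beta> *R snd (flow (p, w) 1)) = g (z, q)" using gz(2) v pw(2) by (simp add: \<beta>_def)
 have l: "(1 + \<beta>) * len (p, w) < \<eta>" using d_small[OF P(1,3)] \<eta>_pos b(3,4) unfolding \<beta>(2) pw(3) by simp
 note c = geodesic_concat[OF pw(1) \<beta>(1) l, unfolded zq, OF good_in(2)[OF gz(1)]]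
 have "ex (p, (1 + \<beta>) *R w) = (p, q)" using c(3) gz(3) by (simp add: ex_def)
 hence "g (p, q) = (p, (1 + \<beta>) *R w)" using g_ex[OF good_in(1)[OF c(1)]] by simp
 thus ?thesis by (simp add: \<beta>(2) w_def)
qed

lemma frac_point_pos:
 assumes P: "p \<in> P" "z \<in> P" "q \<in> P" and b: "d p z = s * d p q" "d z q = (1 - s) * d p q" "0 <= s" "s <= 1"
 shows "z = pos (g (p, q)) s"
proof -
 note gq = good_g[OF P(1,3)]
 consider "d p q = 0 \<or> s = 0" | "s = 1" | "0 < d p q" "0 < s" "s < 1" using b(3,4) d_nonneg[of p q] by linarith
 thus ?thesis
 proof cases
  case 1
  hence "d p z = 0" "d p (pos (g (p, q)) s) = 0" using b geodesic_distance[OF gq(1), of 0 s] gq(4,5) by auto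
  thus ?thesis using d_zero_iff[OF P_R'[OF P(1)] P_R'[OF P(2)]] d_zero_iff[OF P_R'[OF P(1)] good_in(3)[OF gq(1), of s]] b(3,4) by auto
 next case 2
  hence "d z q = 0" using b by simp
  thus ?thesis using d_zero_iff[OF P_R'[OF P(2)] P_R'[OF P(3)]] gq(3) 2 by simp
 next case 3
  have e: "g (p, q) = (p, (1 / s) *R snd (g (p, z)))" by (rule between_unique[OF P b(1,2) refl 3(2,3,1)])
  hence "good (p, (1 / s) *R snd (g (p, z)))" using gq(1) by simp
  from pos_scale[OF this, of s 1] have "pos (p, snd (g (p, z))) 1 = pos (g (p, q)) s" using 3 e by simp
  thus ?thesis using good_g(2,3)[OF P(1,2)] by simp
 qed
qed

text \<open>\<open>q\<close> lies between \<open>p\<close> and each of \<open>z\<close>,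
  \<open>z'\<close>, so \<open>between_unique\<close> expresses both geodesics from \<open>p\<close>
  by the one to \<open>q\<close>.\<close>

lemma extension_unique:
 assumes P: "p \<in> P" "q \<in> P" "z \<in> P" "z' \<in> P" and ne: "p ~= q" and z: "d q z = t" "d p z = d p q + t" "d q z' = t" "d p z' = d p q + t"
 shows "z = z'"
proof (cases "t = 0")
 case True
 thus ?thesis using d_zero_iff[OF P_R'[OF P(2)] P_R'[OF P(3)]] d_zero_iff[OF P_R'[OF P(2)] P_R'[OF P(4)]] z by simp
next case False
 have D: "0 < d p q" using d_zero_iff[OF P_R'[OF P(1)] P_R'[OF P(2)]] ne d_nonneg[of p q] by linarith
 have t: "0 < t" using False z(1) d_nonneg[of q z] by linarith
 define s where "s = d p q / (d p q + t)"
 have s: "0 < s" "s < 1" "d p q = s * (d p q + t)" "t = (1 - s) * (d p q + t)" using D t by (auto simp: s_def field_simps)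
 have key: "g (p, y) = (p, (1 / s) *R snd (g (p, q)))" if "y \<in> P" "d q y = t" "d p y = d p q + t" for y
  by (rule between_unique[OF P(1,2) that(1), where L = "d p q + t"]) (use s that D t in auto)
 have "g (p, z) = g (p, z')" unfolding key[OF P(3) z(1,2)] key[OF P(4) z(3,4)] ..
 from arg_cong[OF this, of "%w. pos w 1"] show ?thesis unfolding good_g(3)[OF P(1,3)] good_g(3)[OF P(1,4)] .
qed

lemma extension_exists:
 assumes P: "p \<in> P" "q \<in> P" and ne: "p ~= q" and t: "0 <= t" "t < \<eta> / 2"
 shows "\<exists>z\<in>ball a R'. d q z = t & d p z = d p q + t"
proof -
 note gq = good_g[OF P]
 define w where "w = snd (g (p, q))"
 have gw: "g (p, q) = (p, w)" using gq(2) by (simp add: w_def)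
 have D: "0 < d p q" using d_zero_iff[OF P_R'[OF P(1)] P_R'[OF P(2)]] ne d_nonneg[of p q] by linarith
 define \<beta> where "\<beta> = t / d p q"
 have \<beta>: "0 <= \<beta>" "(1 + \<beta>) * d p q = d p q + t" using D t by (auto simp: \<beta>_def field_simps)
 have pV: "p \<in> V" using good_in(4)[OF gq(1)] gw by simp
 have l: "len (p, (1 + \<beta>) *R w) = d p q + t" using len_scaleR[OF pV, of "1 + \<beta>" w] gq(5) gw \<beta> by simp
 have gd: "good (p, (1 + \<beta>) *R w)" using P(1) l d_small[OF P] t(2) by (simp add: good_def)
 define s where "s = 1 / (1 + \<beta>)"
 have s: "0 <= s" "s <= 1" "s * (d p q + t) = d p q" using \<beta> by (auto simp: s_def field_simps)
 have "pos (p, s *R (1 + \<beta>) *R w) 1 = pos (p, (1 + \<beta>) *R w) s" using pos_scale[OF gd, of s 1] s by simp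
 moreover have "s *R (1 + \<beta>) *R w = w" using \<beta>(1) by (simp add: s_def)
 ultimately have q: "pos (p, (1 + \<beta>) *R w) s = q" using gq(3) gw by simp
 have "d q (pos (p, (1 + \<beta>) *R w) 1) = t" using geodesic_distance[OF gd s(1,2)] q l s(3) by (simp add: algebra_simps)
 moreover have "d p (pos (p, (1 + \<beta>) *R w) 1) = d p q + t" using d_pos_zero[OF gd, of 1] l by simp
 ultimately show ?thesis using good_in(3)[OF gd, of 1] by auto
qed

text \<open>The geodesic from \<open>p\<close> to \<open>p'\<close> is reversed and continued beyond
  \<open>p\<close>, where it runs to \<open>q\<close> without a corner.\<close>

lemma opposite_collinear:
 assumes P: "p \<in> P" "p' \<in> P" "q \<in> P" and k: "0 <= k" "snd (g (p, q)) = - k *R snd (g (p, p'))" and ne: "p ~= p'"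
 shows "d p' p + d p q = d p' q"
proof -
 note gp = good_g[OF P(1,2)] and gq = good_g[OF P(1,3)]
 let ?u = "snd (flow (g (p, p')) 1)"
 have reversed: "flow (p', - ?u) s = (pos (g (p, p')) (1 - s), - snd (flow (g (p, p')) (1 - s)))" if s: "s \<in> {0..1}" "(p', - ?u) \<in> D" for s
  using flow_reparametrize[OF good_in(2)[OF gp(1)], of 1 "-1" s] s gp(3) by simp
 have p'V: "p' \<in> V" using gp(3) pos_in_V[OF good_in(2)[OF gp(1)], of 1] by simp
 have lu: "len (p', - ?u) = d p p'"
 proof -
  have "len (p', - ?u) = sqrt (G (pos (g (p, p')) 1) (vel (g (p, p')) 1) (vel (g (p, p')) 1))"
   unfolding len_def vel_def gp(3) using \<tau>_pos by (simp add: G_simps[OF p'V] real_sqrt_mult)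
  thus ?thesis using speed_len[OF good_in(2)[OF gp(1)], of 1] gp(5) by simp
 qed
 have gu: "good (p', - ?u)" using P(2) lu d_small[OF P(1,2)] \<eta>_pos by (simp add: good_def)
 note reversed = reversed[OF _ good_in(2)[OF gu]]
 have pu: "pos (p', - ?u) 1 = p" "snd (flow (p', - ?u) 1) = - snd (g (p, p'))"
  using reversed[of 1] gp(4) flow_zero[OF good_in(2)[OF gp(1)]] by (auto simp: pos_def)
 have pV: "p \<in> V" using gp(4) pos_in_V[OF good_in(2)[OF gp(1)], of 0] by simp
 have dk: "d p q = k * d p p'" using len_scaleR[OF pV, of "- k" "snd (g (p, p'))"] k gp(2,5) gq(2,5) by simp
 have l: "(1 + k) * len (p', - ?u) < \<eta>" using d_small[OF P(1,2)] d_small[OF P(1,3)] dk lu by (simp add: algebra_simps)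
 have zq: "(pos (p', - ?u) 1, k *R snd (flow (p', - ?u) 1)) = g (p, q)" using gq(2) k(2) pu by simp
 note c = geodesic_concat[OF gu k(1) l, unfolded zq, OF good_in(2)[OF gq(1)]]
 have "d p' q = (1 + k) * d p p'" using d_pos_zero[OF c(1), of 1] c(3) gq(3) len_scaleR[OF p'V, of "1 + k" "- ?u"] lu k(1) by simp
 thus ?thesis using dk by (simp add: d_sym[of p' p] algebra_simps)
qed

end

section \<open>Convexity of Jacobi fields and of the distance\<close>

context geodesic_flow
begin

lemma sqrt_jac_sq_chord:
 assumes z: "z \<in> D" and xyz: "0 <= x" "x < y" "y < w" "w <= 1"
 shows "(w - x) * sqrt (jac_sq z h y) <= (w - y) * sqrt (jac_sq z h x) + (y - x) * sqrt (jac_sq z h w)"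
  and "(!!s. s \<in> {x..w} ==> (G (pos z s) (jac z h s) (vel z s))\<^sup>2 < jac_sq z h s * G (pos z s) (vel z s) (vel z s)) ==>
   (w - x) * sqrt (jac_sq z h y) < (w - y) * sqrt (jac_sq z h x) + (y - x) * sqrt (jac_sq z h w)"
proof -
 have in01: "s \<in> {0..1}" if "s \<in> {x..w}" for s using that xyz by auto
 have int: "s \<in> {0..1}" "at s within {0..1} = at s" if "s \<in> {x<..<w}" for s using that xyz at_within_Icc_at[of 0 s 1] by auto
 have c: "continuous_on {x..w} (jac_sq z h)"
 proof (rule continuous_on_subset)
  show "continuous_on {0..1} (jac_sq z h)" by (rule has_derivative_continuous_on) (rule jac_sq_deriv[OF z, unfolded has_field_derivative_def])
 qed (use in01 in auto)
 note d1 = jac_sq_deriv[OF z, of _ h] and d2 = jac_sq_deriv2[OF z, of _ h]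
 have D1: "(jac_sq z h has_real_derivative 2 * G (pos z s) (cov z h s) (jac z h s)) (at s)" if "s \<in> {x<..<w}" for s
  using d1[OF int(1)[OF that]] int(2)[OF that] by simp
 have D2: "((%s. 2 * G (pos z s) (cov z h s) (jac z h s)) has_real_derivative
  2 * (G (pos z s) (cov z h s) (cov z h s) + G (pos z s) (curvature G (pos z s) (vel z s) (jac z h s) (vel z s)) (jac z h s))) (at s)"
  if "s \<in> {x<..<w}" for s using d2[OF int(1)[OF that]] int(2)[OF that] by simp
 show "(w - x) * sqrt (jac_sq z h y) <= (w - y) * sqrt (jac_sq z h x) + (y - x) * sqrt (jac_sq z h w)"
  by (rule sqrt_convex[OF xyz(2,3) c _ D1 D2]) (use jac_sq_nonneg[OF z] in01 jac_sq_convexity(1,2)[OF z int(1)] in auto)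
 assume i: "!!s. s \<in> {x..w} ==> (G (pos z s) (jac z h s) (vel z s))\<^sup>2 < jac_sq z h s * G (pos z s) (vel z s) (vel z s)"
 show "(w - x) * sqrt (jac_sq z h y) < (w - y) * sqrt (jac_sq z h x) + (y - x) * sqrt (jac_sq z h w)"
 proof (rule sqrt_chord(2)[OF xyz(2,3) c _ D1 D2])
  show "0 < jac_sq z h s" if s: "s \<in> {x..w}" for s
  proof -
   have "0 < jac_sq z h s * G (pos z s) (vel z s) (vel z s)" using i[OF s] zero_le_power2[of "G (pos z s) (jac z h s) (vel z s)"] by linarith
   thus ?thesis using jac_sq_nonneg[OF z in01[OF s], of h] by (auto simp: zero_less_mult_iff)
  qed
  fix s assume "s \<in> {x<..<w}"
  thus "(2 * G (pos z s) (cov z h s) (jac z h s))\<^sup>2 < 2 * jac_sq z h s *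
   (2 * (G (pos z s) (cov z h s) (cov z h s) + G (pos z s) (curvature G (pos z s) (vel z s) (jac z h s) (vel z s)) (jac z h s)))"
   using int(1) i[of s] by (intro jac_sq_convexity(3)[OF z]) auto
 qed
qed

lemma sqrt_jac_sq_convex:
 assumes z: "z \<in> D" and s: "s \<in> {0..1}"
 shows "sqrt (jac_sq z h s) <= (1 - s) * sqrt (jac_sq z h 0) + s * sqrt (jac_sq z h 1)"
proof -
 consider "s = 0" | "s = 1" | "0 < s" "s < 1" using s by force
 thus ?thesis using sqrt_jac_sq_chord(1)[OF z, of 0 s 1 h] by cases auto
qed

text \<open>Jacobi field and velocity are known not to be parallel at time \<open>0\<close> only,
  hence by continuity on a short interval up to \<open>m\<close>. The strict inequality at
  \<open>m / 2\<close> is carried to \<open>s\<close> by two non-strict chords.\<close>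

lemma sqrt_jac_sq_strictly_convex:
 assumes z: "z \<in> D" and s: "0 < s" "s < 1" and i: "(G (pos z 0) (jac z h 0) (vel z 0))\<^sup>2 < jac_sq z h 0 * G (pos z 0) (vel z 0) (vel z 0)"
 shows "sqrt (jac_sq z h s) < (1 - s) * sqrt (jac_sq z h 0) + s * sqrt (jac_sq z h 1)"
proof -
 define F where "F = (%s. jac_sq z h s * G (pos z s) (vel z s) (vel z s) - (G (pos z s) (jac z h s) (vel z s))\<^sup>2)"
 have c: "continuous_on {0..1} (pos z)" "continuous_on {0..1} (vel z)" "continuous_on {0..1} (jac z h)"
  unfolding pos_def[abs_def] vel_def[abs_def] jac_def[abs_def] by (intro continuous_intros flow_cont dflow_cont z)+
 note G = bilinear_field_continuous[where T = G and V = V, OF bilinear_G G_cont c(1) pos_image[OF z]]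
 have "continuous_on {0..1} F" unfolding F_def jac_sq_def by (intro continuous_intros G c)
 then obtain \<delta> where \<delta>: "0 < \<delta>" "!!t. t \<in> {0..1} ==> dist t 0 < \<delta> ==> dist (F t) (F 0) < F 0"
  using i unfolding continuous_on_iff F_def by (metis atLeastAtMost_iff diff_gt_0_iff_gt order_refl zero_le_one)
 have Fpos: "0 < F t" if "0 <= t" "t < \<delta>" "t <= 1" for t using \<delta>(2)[of t] that by (simp add: dist_real_def abs_less_iff)
 define m where "m = min (\<delta> / 2) s"
 have m: "0 < m" "m < \<delta>" "m <= s" using \<delta>(1) s by (auto simp: m_def)
 let ?r = "%t. sqrt (jac_sq z h t)"
 have "(m - 0) * ?r (m / 2) < (m - m / 2) * ?r 0 + (m / 2 - 0) * ?r m"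
 proof (rule sqrt_jac_sq_chord(2)[OF z])
  fix t assume t: "t \<in> {0..m}"
  hence "0 < F t" using m s by (intro Fpos) auto
  thus "(G (pos z t) (jac z h t) (vel z t))\<^sup>2 < jac_sq z h t * G (pos z t) (vel z t) (vel z t)" by (simp add: F_def)
 qed (use m s in auto)
 hence "m * ?r (m / 2) < m * ((?r 0 + ?r m) / 2)" by (simp add: field_simps)
 hence half: "?r (m / 2) < (?r 0 + ?r m) / 2" using m(1) by simp
 have rm: "?r m <= (1 - m) * ?r 0 + m * ?r 1" using m s by (intro sqrt_jac_sq_convex[OF z]) auto
 have \<sigma>: "?r (m / 2) < (1 - m / 2) * ?r 0 + m / 2 * ?r 1" using half rm by (simp add: algebra_simps)
 have "(1 - m / 2) * ?r s <= (1 - s) * ?r (m / 2) + (s - m / 2) * ?r 1" using m s by (intro sqrt_jac_sq_chord(1)[OF z]) auto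
 also have "\<dots> < (1 - s) * ((1 - m / 2) * ?r 0 + m / 2 * ?r 1) + (s - m / 2) * ?r 1"
  using \<sigma> s by (intro add_strict_right_mono mult_strict_left_mono) auto
 also have "\<dots> = (1 - m / 2) * ((1 - s) * ?r 0 + s * ?r 1)"
 proof -
  have "(1 - s) * ((1 - c) * x + c * y) + (s - c) * y = (1 - c) * ((1 - s) * x + s * y)" for c x y :: real by (simp add: algebra_simps)
  thus ?thesis .
 qed
 finally show ?thesis using m s by simp
qed

end

context normal_ball
begin

definition dcollinear where "dcollinear x y w \<longleftrightarrow> d x y + d y w = d x w \<or> d y x + d x w = d y w \<or> d x w + d w y = d x y"

lemma parallel_collinear:
 assumes P: "p \<in> P" "p' \<in> P" "q \<in> P" and ne: "p ~= p'" and k: "snd (g (p, q)) = k *R snd (g (p, p'))"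
 shows "dcollinear p p' q"
proof -
 note gp = good_g[OF P(1,2)] and gq = good_g[OF P(1,3)]
 consider "k < 0" | "0 <= k" "k <= 1" | "1 < k" by linarith
 thus ?thesis
 proof cases
  case 1
  hence "d p' p + d p q = d p' q" using k by (intro opposite_collinear[OF P, of "- k"] ne) auto
  thus ?thesis by (simp add: dcollinear_def)
 next case 2
  have "good (p, snd (g (p, p')))" using gp(1,2) by simp
  from pos_scale[OF this, of k 1] have "q = pos (g (p, p')) k" using 2 gp(2) gq(2,3) k by simp
  hence "d p q + d q p' = d p p'" using geodesic_distance[OF gp(1), of 0 k] geodesic_distance[OF gp(1), of k 1] gp(3-5) 2 by (simp add: algebra_simps)
  thus ?thesis by (simp add: dcollinear_def)
 next case 3
  have "good (p, snd (g (p, q)))" using gq(1,2) by simp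
  from pos_scale[OF this, of "1 / k" 1] have "p' = pos (g (p, q)) (1 / k)" using 3 gq(2) gp(2,3) k by simp
  hence "d p p' + d p' q = d p q"
   using geodesic_distance[OF gq(1), of 0 "1 / k"] geodesic_distance[OF gq(1), of "1 / k" 1] gq(3-5) 3 by (simp add: algebra_simps)
  thus ?thesis by (simp add: dcollinear_def)
 qed
qed

text \<open>For each \<open>t\<close> the points at time \<open>t\<close> of the geodesics from
  \<open>p\<close> to \<open>q\<close> and from \<open>p'\<close> to \<open>q'\<close> are joined by
  a short geodesic \<open>Z t\<close>. The points with parameter \<open>s\<close> on these trace a
  curve whose velocity is a Jacobi field along \<open>Z t\<close>; at the two ends this field has
  the constant norms \<open>d p q\<close> and \<open>d p' q'\<close>, and in between convexity of
  its norm applies. The length of the curve bounds the distance, and strictness at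
  \<open>t = 0\<close> survives integration by continuity.\<close>

lemma convexity_pos:
 assumes P: "p \<in> P" "p' \<in> P" "q \<in> P" "q' \<in> P" and s: "s \<in> {0..1}"
 shows "d (pos (g (p, p')) s) (pos (g (q, q')) s) <= (1 - s) * d p q + s * d p' q'" and "0 < s ==> s < 1 ==> p ~= p' ==> \<not> dcollinear p p' q ==>
   d (pos (g (p, p')) s) (pos (g (q, q')) s) < (1 - s) * d p q + s * d p' q'"
proof -
 note g0 = good_g[OF P(1,3)] and g1 = good_g[OF P(2,4)]
 note D0 = good_in(2)[OF g0(1)] and D1 = good_in(2)[OF g1(1)]
 define y where "y = (%t. (pos (g (p, q)) t, pos (g (p', q')) t))"
 define \<theta> where "\<theta> = (%t. (vel (g (p, q)) t, vel (g (p', q')) t))"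
 define \<zeta> where "\<zeta> = (%t. g' (y t) (\<theta> t))"
 define Z where "Z = (%t. g (y t))"
 have yW: "y t \<in> W" if "t \<in> {0..1}" for t unfolding y_def by (rule in_W[OF good_in(3)[OF g0(1) that] good_in(3)[OF g1(1) that]])
 have ZN: "Z t \<in> ball (a, 0) (\<rho> / 2)" "Z t \<in> D" if "t \<in> {0..1}" for t unfolding Z_def using N_D[OF g_in[OF yW[OF that]]] by auto
 have dy: "(y has_vector_derivative \<theta> t) (at t within {0..1})" if "t \<in> {0..1}" for t
  unfolding y_def \<theta>_def by (intro has_vector_derivative_Pair pos_deriv D0 D1 that)
 have lin: "linear (g' q)" if "q \<in> W" for q by (rule has_derivative_linear[OF g_deriv[OF that]])
 have dZ: "(Z has_vector_derivative \<zeta> t) (at t within {0..1})" if t: "t \<in> {0..1}" for t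
  using has_derivative_compose[OF dy[OF t, unfolded has_vector_derivative_def] g_deriv[OF yW[OF t]]]
  unfolding has_vector_derivative_def Z_def \<zeta>_def by (simp add: linear_scale[OF lin[OF yW[OF t]]])
 have dH: "((%t. pos (Z t) s) has_vector_derivative jac (Z t) (\<zeta> t) s) (at t within {0..1})" if t: "t \<in> {0..1}" for t
  using has_derivative_fst[OF has_derivative_compose[OF dZ[OF t, unfolded has_vector_derivative_def] flow_has_derivative[OF ZN(1)[OF t] s]]]
  unfolding has_vector_derivative_def pos_def jac_def by (simp add: blinfun.scaleR_right)
 have yc: "continuous_on {0..1} y" "continuous_on {0..1} Z" "continuous_on {0..1} (%t. pos (Z t) s)"
  using has_vector_derivative_continuous[OF dy] has_vector_derivative_continuous[OF dZ] has_vector_derivative_continuous[OF dH]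
  by (auto simp: continuous_on_eq_continuous_within)
 have \<theta>c: "continuous_on {0..1} \<theta>" unfolding \<theta>_def vel_def by (intro continuous_intros flow_cont D0 D1)
 have g'_sum: "g' (y t) (\<theta> t) = (\<Sum>b\<in>Basis. (\<theta> t \<bullet> b) *R g' (y t) b)" if "t \<in> {0..1}" for t
  using linear_sum[OF lin[OF yW[OF that]], of "%b. (\<theta> t \<bullet> b) *R b" Basis] linear_scale[OF lin[OF yW[OF that]]]
  by (simp add: euclidean_representation)
 have g'_sum_cont: "continuous_on {0..1} (%t. \<Sum>b\<in>Basis. (\<theta> t \<bullet> b) *R g' (y t) b)"
  by (intro continuous_intros \<theta>c continuous_on_compose2[OF g'_cont yc(1)]) (use yW in auto)
 have \<zeta>c: "continuous_on {0..1} \<zeta>" unfolding \<zeta>_def by (rule continuous_on_eq[OF g'_sum_cont]) (rule g'_sum[symmetric])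
 have jc: "continuous_on {0..1} (%t. jac (Z t) (\<zeta> t) s)" by (rule jac_continuous[OF yc(2) \<zeta>c _ s]) (use ZN(2) in blast)
 have im: "(%t. pos (Z t) s) ` {0..1} \<subseteq> V" using pos_in_V[OF ZN(2) s] by blast
 define \<phi> where "\<phi> = (%t. sqrt (jac_sq (Z t) (\<zeta> t) s))"
 have \<phi>c: "continuous_on {0..1} \<phi>"
  unfolding \<phi>_def jac_sq_def by (intro continuous_on_real_sqrt bilinear_field_continuous[where T = G, OF bilinear_G G_cont yc(3) im jc jc])
 have ends: "Z 0 = g (p, p')" "Z 1 = g (q, q')" using g0(3,4) g1(3,4) by (auto simp: Z_def y_def)
 have "d (pos (Z 0) s) (pos (Z 1) s) <= integral {0..1} (%t. sqrt (G (pos (Z t) s) (jac (Z t) (\<zeta> t) s) (jac (Z t) (\<zeta> t) s)))"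
  by (rule d_upper[OF _ dH jc]) (use im in auto)
 hence le: "d (pos (g (p, p')) s) (pos (g (q, q')) s) <= integral {0..1} \<phi>" by (simp add: ends \<phi>_def jac_sq_def)
 have j: "jac (Z t) (\<zeta> t) 0 = vel (g (p, q)) t" "jac (Z t) (\<zeta> t) 1 = vel (g (p', q')) t"
  "pos (Z t) 0 = pos (g (p, q)) t" "pos (Z t) 1 = pos (g (p', q')) t" if t: "t \<in> {0..1}" for t
  using dex_g'[OF yW[OF t], of "\<theta> t"] pos_one_g[OF yW[OF t]] pos_zero[OF ZN(2)[OF t]] dflow_zero[OF ZN(2)[OF t]]
  by (auto simp: dex_apply jac_def Z_def \<zeta>_def \<theta>_def y_def)
 have r0: "sqrt (jac_sq (Z t) (\<zeta> t) 0) = d p q" "sqrt (jac_sq (Z t) (\<zeta> t) 1) = d p' q'" if t: "t \<in> {0..1}" for t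
  unfolding jac_sq_def j[OF t] speed_len[OF D0 t] speed_len[OF D1 t] g0(5) g1(5) by (rule refl)+
 define c where "c = (1 - s) * d p q + s * d p' q'"
 have \<phi>_le: "\<phi> t <= c" if t: "t \<in> {0..1}" for t
  using sqrt_jac_sq_convex[OF ZN(2)[OF t] s, of "\<zeta> t"] unfolding r0[OF t] \<phi>_def c_def .
 have int: "\<phi> integrable_on {0..1}" "(%_. c) integrable_on {0..1::real}" "integral {0..1::real} (%_. c) = c"
  using integrable_continuous_real[OF \<phi>c] by auto
 have "integral {0..1} \<phi> <= c" using integral_le[OF int(1,2)] \<phi>_le int(3) by simp
 thus "d (pos (g (p, p')) s) (pos (g (q, q')) s) <= (1 - s) * d p q + s * d p' q'" using le c_def by linarith
 assume strict: "0 < s" "s < 1" "p ~= p'" "\<not> dcollinear p p' q"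
 have "\<phi> 0 < c"
 proof -
  note gp = good_g[OF P(1,2)]
  have z: "Z 0 \<in> D" using ZN by simp
  have j0: "jac (Z 0) (\<zeta> 0) 0 = \<tau> *R snd (g (p, q))" "pos (Z 0) 0 = p" "vel (Z 0) 0 = \<tau> *R snd (g (p, p'))"
   using j[of 0] g0(4) flow_zero[OF D0] flow_zero[OF z] by (auto simp: vel_def ends)
  have pV: "p \<in> V" using pos_in_V[OF z, of 0] j0 by simp
  have nz: "\<tau> *R snd (g (p, p')) ~= 0"
  proof
   assume "\<tau> *R snd (g (p, p')) = 0"
   hence "len (g (p, p')) = 0" using \<tau>_pos gp(2) by (simp add: len_def G_simps[OF pV])
   thus False using gp(5) d_zero_iff[OF P_R'[OF P(1)] P_R'[OF P(2)]] strict(3) by simp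
  qed
  have "(G p (\<tau> *R snd (g (p, q))) (\<tau> *R snd (g (p, p'))))\<^sup>2 ~=
    G p (\<tau> *R snd (g (p, q))) (\<tau> *R snd (g (p, q))) * G p (\<tau> *R snd (g (p, p'))) (\<tau> *R snd (g (p, p')))"
  proof
   assume "(G p (\<tau> *R snd (g (p, q))) (\<tau> *R snd (g (p, p'))))\<^sup>2 =
    G p (\<tau> *R snd (g (p, q))) (\<tau> *R snd (g (p, q))) * G p (\<tau> *R snd (g (p, p'))) (\<tau> *R snd (g (p, p')))"
   from G_Cauchy_Schwarz(2)[OF pV this nz] obtain k where "\<tau> *R snd (g (p, q)) = k *R \<tau> *R snd (g (p, p'))" by blast
   hence "\<tau> *R snd (g (p, q)) = \<tau> *R k *R snd (g (p, p'))" by (simp add: mult.commute)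
   hence "snd (g (p, q)) = k *R snd (g (p, p'))" by (rule scaleR_left_imp_eq[rotated]) (use \<tau>_pos in simp)
   thus False using parallel_collinear[OF P(1-3) strict(3)] strict(4) by blast
  qed
  hence "sqrt (jac_sq (Z 0) (\<zeta> 0) s) < (1 - s) * sqrt (jac_sq (Z 0) (\<zeta> 0) 0) + s * sqrt (jac_sq (Z 0) (\<zeta> 0) 1)"
   by (intro sqrt_jac_sq_strictly_convex[OF z strict(1,2)])
    (use G_Cauchy_Schwarz(1)[OF pV, of "\<tau> *R snd (g (p, q))" "\<tau> *R snd (g (p, p'))"] in "simp add: j0 jac_sq_def")
  thus ?thesis using r0[of 0] by (simp add: \<phi>_def c_def)
 qed
 have "integral {0..1} \<phi> ~= c"
 proof
  assume "integral {0..1} \<phi> = c"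
  hence "integral {0..1} (%t. c - \<phi> t) = 0" using integral_diff[OF int(2,1)] int(3) by simp
  moreover have "continuous_on {0..1} (%t. c - \<phi> t)" by (intro continuous_intros \<phi>c)
  ultimately have "\<forall>t\<in>{0..1}. c - \<phi> t = 0" using integral_eq_0_iff[of 0 1 "%t. c - \<phi> t"] \<phi>_le by simp
  hence "c - \<phi> 0 = 0" by (rule bspec) simp
  thus False using \<open>\<phi> 0 < c\<close> by simp
 qed
 thus "d (pos (g (p, p')) s) (pos (g (q, q')) s) < (1 - s) * d p q + s * d p' q'"
  using \<open>integral {0..1} \<phi> <= c\<close> le c_def by linarith
qed

text \<open>A small sphere about \<open>p\<close> contains at most two points collinear with
  \<open>p\<close> and \<open>q\<close>, one between them and one beyond \<open>p\<close>. In
  dimension at least two it contains three distinct points, in the directions of \<open>i\<close>,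
  \<open>- i\<close> and \<open>j\<close>.\<close>

lemma noncollinear_exists:
 assumes dim: "2 <= DIM('e)" and P: "p \<in> ball a (r5 / 2)" "q \<in> P" and ne: "p ~= q" and e: "0 < e"
 shows "\<exists>w\<in>P. d p w < e & \<not> dcollinear p q w"
proof -
 have pP: "p \<in> P" using P(1) r5(1) by auto
 have D: "0 < d p q" using d_zero_iff[OF P_R'[OF pP] P_R'[OF P(2)]] ne d_nonneg[of p q] by linarith
 have \<kappa>: "0 < \<kappa>" using r5 by linarith
 \<comment> \<open>The term with \<open>r5\<close> keeps the sphere of radius \<delta> about
   \<open>p\<close> inside \<open>P\<close>; \<open>\<delta> < d p q\<close> excludes that
   \<open>q\<close> lies between \<open>p\<close> and a point of the sphere.\<close>
 define \<delta> where "\<delta> = min (min (e / 2) (d p q / 2)) (min (\<eta> / 2) (\<eta> * r5 / (8 * \<kappa>)))"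
 have \<delta>: "0 < \<delta>" "\<delta> < e" "\<delta> < d p q" "\<delta> < \<eta>" "\<delta> <= \<eta> * r5 / (8 * \<kappa>)"
  using e D \<eta>_pos r5(1) \<kappa> by (auto simp: \<delta>_def min_def)
 have pV: "p \<in> V" using good_in(4)[OF good_g(1)[OF pP P(2)]] good_g(2)[OF pP P(2)] by (metis fst_conv)
 have zero: "good (p, 0)" using pP \<eta>_pos by (simp add: good_def len_def G_simps[OF pV])
 have sphere: "good (p, v)" "pos (p, v) 1 \<in> P" "d p (pos (p, v) 1) = \<delta>" if l: "len (p, v) = \<delta>" for v
 proof -
  show gd: "good (p, v)" using pP l \<delta>(4) by (simp add: good_def)
  show "d p (pos (p, v) 1) = \<delta>" using d_pos_zero[OF gd, of 1] l by simp
  have "len (p, (\<eta> / (2 * \<delta>)) *R v) < \<eta>" using len_scaleR[OF pV] l \<delta>(1) \<eta>_pos by simp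
  hence "norm ((\<eta> / (2 * \<delta>)) *R v) < \<kappa>" by (rule len_small[OF pP])
  hence "\<eta> * norm v < \<kappa> * (2 * \<delta>)" using \<delta>(1) \<eta>_pos by (simp add: field_simps)
  also have "\<dots> <= \<kappa> * (2 * (\<eta> * r5 / (8 * \<kappa>)))" using \<delta>(5) \<kappa> by (intro mult_left_mono) auto
  also have "\<dots> = \<eta> * (r5 / 4)" using \<kappa> by simp
  finally have v: "norm v < r5 / 4" using \<eta>_pos by simp
  have "norm (flow (p, v) 1 - flow (p, 0) 1) <= 2 * norm ((p, v) - (p, 0))" by (rule flow_lipschitz[OF good_in(2)[OF gd] good_in(2)[OF zero]]) simp
  hence "norm (flow (p, v) 1 - (p, 0)) <= 2 * norm v" using flow_zero_velocity[OF good_in(2)[OF zero], of 1] by (simp add: norm_prod_def)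
  moreover have "norm (pos (p, v) 1 - p) <= norm (flow (p, v) 1 - (p, 0))" unfolding pos_def by (cases "flow (p, v) 1") (simp add: norm_fst_le)
  ultimately have "dist p (pos (p, v) 1) < r5 / 2" using v by (simp add: dist_norm norm_minus_commute)
  thus "pos (p, v) 1 \<in> P" using P(1) dist_triangle[of a "pos (p, v) 1" p] by simp
 qed
 have inj: "v = v'" if "len (p, v) = \<delta>" "len (p, v') = \<delta>" "pos (p, v) 1 = pos (p, v') 1" for v v'
 proof -
  have "ex (p, v) = ex (p, v')" using that(3) by (simp add: ex_def)
  from arg_cong[OF this, of g] show ?thesis
   unfolding g_ex[OF good_in(1)[OF sphere(1)[OF that(1)]]] g_ex[OF good_in(1)[OF sphere(1)[OF that(2)]]] by simp
 qed
 have far: "pos (p, v) 1 = pos (p, v') 1" if "len (p, v) = \<delta>" "len (p, v') = \<delta>"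
  "d q p + d p (pos (p, v) 1) = d q (pos (p, v) 1)" "d q p + d p (pos (p, v') 1) = d q (pos (p, v') 1)" for v v'
  by (rule extension_unique[OF P(2) pP sphere(2)[OF that(1)] sphere(2)[OF that(2)]])
   (use ne that(3,4) sphere(3)[OF that(1)] sphere(3)[OF that(2)] in auto)
 have between: "pos (p, v) 1 = pos (p, v') 1" if l: "len (p, v) = \<delta>" "len (p, v') = \<delta>"
  "d p (pos (p, v) 1) + d (pos (p, v) 1) q = d p q" "d p (pos (p, v') 1) + d (pos (p, v') 1) q = d p q" for v v'
 proof -
  have "pos (p, v) 1 = pos (g (p, q)) (\<delta> / d p q)" if "len (p, v) = \<delta>" "d p (pos (p, v) 1) + d (pos (p, v) 1) q = d p q" for v
   by (rule frac_point_pos[OF pP sphere(2)[OF that(1)] P(2)]) (use sphere(3)[OF that(1)] that(2) \<delta> D in "auto simp: left_diff_distrib")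
  thus ?thesis using l by metis
 qed
 obtain i j :: 'e where ij: "i \<in> Basis" "j \<in> Basis" "i ~= j"
 proof -
  have "\<not> (Basis :: 'e set) \<subseteq> {i}" for i
  proof
   assume "(Basis :: 'e set) \<subseteq> {i}"
   hence "card (Basis :: 'e set) <= card {i}" by (intro card_mono) auto
   thus False using dim by simp
  qed
  moreover obtain i :: 'e where "i \<in> Basis" using nonempty_Basis by blast
  ultimately show ?thesis using that by blast
 qed
 define u where "u = (%b :: 'e. (\<delta> / len (p, b)) *R b)"
 have lb: "0 < len (p, b)" if "b \<in> Basis" for b unfolding len_def using \<tau>_pos G_pos[OF pV, of b] nonzero_Basis[OF that] by simp
 have lu: "len (p, u b) = \<delta>" "len (p, - u b) = \<delta>" if "b \<in> Basis" for b
  using lb[OF that] \<delta>(1) len_scaleR[OF pV, of "\<delta> / len (p, b)" b] len_scaleR[OF pV, of "- (\<delta> / len (p, b))" b]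
  by (auto simp: u_def)
 have ui: "u i \<bullet> i ~= 0" "u j \<bullet> i = 0" using ij lb[OF ij(1)] \<delta>(1) by (auto simp: u_def inner_Basis)
 have neI: "w ~= w'" if "w \<bullet> i ~= w' \<bullet> i" for w w' :: 'e using that by blast
 have ne3: "u i ~= - u i" "u j ~= u i" "u j ~= - u i" by (rule neI, use ui in simp)+
 have ne3': "u i ~= u j" "- u i ~= u j" by (rule not_sym[OF ne3(2)], rule not_sym[OF ne3(3)])
 have cases: "d q p + d p (pos (p, v) 1) = d q (pos (p, v) 1) \<or> d p (pos (p, v) 1) + d (pos (p, v) 1) q = d p q"
  if "len (p, v) = \<delta>" "dcollinear p q (pos (p, v) 1)" for v
  using that(2) sphere(3)[OF that(1)] \<delta>(3) d_nonneg[of q "pos (p, v) 1"] unfolding dcollinear_def by auto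
 have "\<not> (dcollinear p q (pos (p, u i) 1) & dcollinear p q (pos (p, - u i) 1) & dcollinear p q (pos (p, u j) 1))"
  using cases[OF lu(1)[OF ij(1)]] cases[OF lu(2)[OF ij(1)]] cases[OF lu(1)[OF ij(2)]]
   far[OF lu(1)[OF ij(1)] lu(2)[OF ij(1)]] far[OF lu(1)[OF ij(1)] lu(1)[OF ij(2)]] far[OF lu(2)[OF ij(1)] lu(1)[OF ij(2)]]
   between[OF lu(1)[OF ij(1)] lu(2)[OF ij(1)]] between[OF lu(1)[OF ij(1)] lu(1)[OF ij(2)]] between[OF lu(2)[OF ij(1)] lu(1)[OF ij(2)]]
   inj[OF lu(1)[OF ij(1)] lu(2)[OF ij(1)]] inj[OF lu(1)[OF ij(1)] lu(1)[OF ij(2)]] inj[OF lu(2)[OF ij(1)] lu(1)[OF ij(2)]] ne3 ne3' by argo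
 then obtain v where "len (p, v) = \<delta>" "\<not> dcollinear p q (pos (p, v) 1)" using lu ij by blast
 thus ?thesis using sphere(2,3)[of v] \<delta>(2) by (intro bexI[of _ "pos (p, v) 1"]) auto
qed

end

section \<open>The geodesic distance in a chart\<close>

context riemannian_manifold
begin

abbreviation dom where "dom c \<equiv> chart_domain c"
abbreviation \<phi> where "\<phi> c \<equiv> chart_map c"
abbreviation \<psi> where "\<psi> c \<equiv> chart_inv c"
abbreviation img where "img c \<equiv> chart_map c ` chart_domain c"

lemma chart_facts:
 assumes "c \<in> atlas"
 shows "open (dom c)" "open (img c)" "continuous_on (dom c) (\<phi> c)" "continuous_on (img c) (\<psi> c)"
  "x \<in> dom c ==> \<psi> c (\<phi> c x) = x" "p \<in> img c ==> \<phi> c (\<psi> c p) = p" "p \<in> img c ==> \<psi> c p \<in> dom c" "\<psi> c ` img c = dom c"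
 using charts[OF assms] unfolding is_chart_def homeomorphism_def by auto

lemma chart_metric: "c \<in> atlas ==> local_metric (img c) (g c)"
 by unfold_locales (use chart_facts metric_bilinear metric_symmetric metric_positive metric_smooth in auto)

lemma transition_derivative:
 assumes c: "c \<in> atlas" "c' \<in> atlas" and p: "p \<in> \<phi> c ` (dom c \<inter> dom c')"
 shows "(transition c c' has_derivative frechet_derivative (transition c c') (at p)) (at p)"
proof -
 have "Ck_on (Suc 0) (\<phi> c ` (dom c \<inter> dom c')) (transition c c')" using compatible[OF c] unfolding smooth_on_def by blast
 hence "transition c c' differentiable (at p)" using p unfolding Ck_on.simps by blast
 thus ?thesis by (simp add: frechet_derivative_works[symmetric])
qed

lemma transition_derivative_continuous:
 assumes c: "c \<in> atlas" "c' \<in> atlas"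
 shows "continuous_on (\<phi> c ` (dom c \<inter> dom c')) (%p. frechet_derivative (transition c c') (at p) v)"
proof -
 have "Ck_on (Suc 0) (\<phi> c ` (dom c \<inter> dom c')) (transition c c')" using compatible[OF c] unfolding smooth_on_def by blast
 thus ?thesis by simp
qed

text \<open>The chart chosen in \<open>speed\<close> differs from \<open>c\<close> by a transition
  map, and by \<open>metric_compatible\<close> the squared norm of the velocity is
  unaffected.\<close>

lemma speed_eq:
 assumes c: "c \<in> atlas" "\<gamma> t \<in> dom c" and d: "((\<phi> c \<circ> \<gamma>) has_vector_derivative v) (at t)" and \<gamma>: "isCont \<gamma> t"
 shows "speed atlas g \<gamma> t = sqrt (g c (\<phi> c (\<gamma> t)) v v)"
proof -
 define c' where "c' = (SOME c. c \<in> atlas & \<gamma> t \<in> dom c)"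
 have c': "c' \<in> atlas" "\<gamma> t \<in> dom c'" unfolding c'_def using someI[of "%c. c \<in> atlas & \<gamma> t \<in> dom c" c] c by auto
 define D where "D = frechet_derivative (transition c c') (at (\<phi> c (\<gamma> t)))"
 have p: "\<phi> c (\<gamma> t) \<in> \<phi> c ` (dom c \<inter> dom c')" using c c' by blast
 have T: "(transition c c' has_derivative D) (at ((\<phi> c \<circ> \<gamma>) t))"
  unfolding D_def using transition_derivative[OF c(1) c'(1) p] by simp
 have "((%s. transition c c' ((\<phi> c \<circ> \<gamma>) s)) has_derivative (%h. D (h *R v))) (at t)"
  by (rule has_derivative_compose[OF d[unfolded has_vector_derivative_def] T])
 hence "((%s. transition c c' ((\<phi> c \<circ> \<gamma>) s)) has_vector_derivative D v) (at t)"
  unfolding has_vector_derivative_def by (simp add: linear_scale[OF has_derivative_linear[OF T]])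
 moreover have "\<forall>\<^sub>F s in nhds t. \<gamma> s \<in> dom c"
 proof -
  have "\<gamma> \<midarrow>t\<rightarrow> \<gamma> t" using \<gamma> by (simp add: isCont_def)
  hence "\<forall>\<^sub>F s in at t. \<gamma> s \<in> dom c" using topological_tendstoD[OF _ chart_facts(1)[OF c(1)] c(2)] by blast
  hence "\<forall>\<^sub>F s in nhds t. s ~= t --> \<gamma> s \<in> dom c" by (simp add: eventually_at_filter)
  thus ?thesis by (rule eventually_mono) (use c(2) in auto)
 qed
 hence ev: "\<forall>\<^sub>F s in nhds t. transition c c' ((\<phi> c \<circ> \<gamma>) s) = (\<phi> c' \<circ> \<gamma>) s"
  by eventually_elim (simp add: transition_def chart_facts(5)[OF c(1)])
 ultimately have "((\<phi> c' \<circ> \<gamma>) has_vector_derivative D v) (at t)"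
  using has_vector_derivative_cong_ev[of UNIV "%s. transition c c' ((\<phi> c \<circ> \<gamma>) s)" "\<phi> c' \<circ> \<gamma>" t "D v"] eventually_nhds_x_imp_x[OF ev] by simp
 hence "vector_derivative (\<phi> c' \<circ> \<gamma>) (at t) = D v" by (rule vector_derivative_at)
 hence "speed atlas g \<gamma> t = sqrt (g c' (\<phi> c' (\<gamma> t)) (D v) (D v))" unfolding speed_def c'_def[symmetric] Let_def by simp
 also have "g c' (\<phi> c' (\<gamma> t)) (D v) (D v) = g c (\<phi> c (\<gamma> t)) v v"
  using metric_compatible[OF c(1) c'(1) _ D_def] c(2) c'(2) by simp
 finally show ?thesis .
qed

lemma speed_nonneg: "0 <= speed atlas g \<gamma> t"
proof -
 define c' where "c' = (SOME c. c \<in> atlas & \<gamma> t \<in> dom c)"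
 have "\<exists>c. c \<in> atlas & \<gamma> t \<in> dom c" using covering by (metis UNIV_I UN_E)
 hence "c' \<in> atlas & \<gamma> t \<in> dom c'" unfolding c'_def by (rule someI_ex)
 hence "0 <= g c' (\<phi> c' (\<gamma> t)) v v" for v using local_metric.G_nonneg[OF chart_metric, of c'] by blast
 thus ?thesis unfolding speed_def c'_def[symmetric] Let_def by simp
qed

lemma curve_length_nonneg: "0 <= curve_length atlas g \<gamma>"
proof (cases "speed atlas g \<gamma> integrable_on {0..1}")
 case True
 thus ?thesis unfolding curve_length_def by (rule integral_nonneg) (rule speed_nonneg)
qed (simp add: curve_length_def not_integrable_integral)

lemma geodesic_dist_le:
 assumes "piecewise_C1_curve atlas \<gamma>"
 shows "geodesic_dist atlas g (\<gamma> 0) (\<gamma> 1) <= curve_length atlas g \<gamma>" unfolding geodesic_dist_def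
 by (rule cInf_lower) (use assms curve_length_nonneg in "auto simp: pathstart_def pathfinish_def intro!: bdd_belowI")

lemma chart_curve:
 assumes c: "c \<in> atlas" and \<sigma>: "!!t. t \<in> {0..1} ==> \<sigma> t \<in> img c"
  "!!t. t \<in> {0..1} ==> (\<sigma> has_vector_derivative \<sigma>' t) (at t within {0..1})" "continuous_on {0..1} \<sigma>'"
 shows "piecewise_C1_curve atlas (\<psi> c \<circ> \<sigma>)"
  and "curve_length atlas g (\<psi> c \<circ> \<sigma>) = integral {0..1} (%t. sqrt (g c (\<sigma> t) (\<sigma>' t) (\<sigma>' t)))"
proof -
 let ?\<gamma> = "\<psi> c \<circ> \<sigma>"
 have \<sigma>c: "continuous_on {0..1} \<sigma>"
  using has_vector_derivative_continuous[OF \<sigma>(2)] by (simp add: continuous_on_eq_continuous_within)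
 have im: "\<sigma> ` {0..1} \<subseteq> img c" using \<sigma>(1) by blast
 have \<gamma>c: "continuous_on {0..1} ?\<gamma>" unfolding o_def by (rule continuous_on_compose2[OF chart_facts(4)[OF c] \<sigma>c im])
 show "piecewise_C1_curve atlas ?\<gamma>" unfolding piecewise_C1_curve_def path_def
 proof (intro conjI \<gamma>c exI[of _ "{}"] ballI allI impI)
  fix c' s t assume c': "c' \<in> atlas" and st: "0 <= s & s < t & t <= 1 & {s<..<t} \<inter> {} = {} & ?\<gamma> ` {s..t} \<subseteq> dom c'"
  have sub: "{s..t} \<subseteq> {0..1}" using st by auto
  have p: "\<sigma> r \<in> \<phi> c ` (dom c \<inter> dom c')" if "r \<in> {s..t}" for r
  proof -
   have "\<sigma> r = \<phi> c (?\<gamma> r)" "?\<gamma> r \<in> dom c" using chart_facts(6,7)[OF c \<sigma>(1)] sub that by auto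
   thus ?thesis using st that by blast
  qed
  let ?T = "%r. frechet_derivative (transition c c') (at (\<sigma> r))"
  note T = transition_derivative[OF c c' p]
  have eq: "?T r (\<sigma>' r) = (\<Sum>b\<in>Basis. (\<sigma>' r \<bullet> b) *R ?T r b)" if "r \<in> {s..t}" for r
   using linear_sum[OF has_derivative_linear[OF T[OF that]], of "%b. (\<sigma>' r \<bullet> b) *R b" Basis]
    linear_scale[OF has_derivative_linear[OF T[OF that]]] by (simp add: euclidean_representation)
  have "continuous_on {s..t} (%r. \<Sum>b\<in>Basis. (\<sigma>' r \<bullet> b) *R ?T r b)"
   by (intro continuous_intros continuous_on_subset[OF \<sigma>(3) sub]
     continuous_on_compose2[OF transition_derivative_continuous[OF c c'] continuous_on_subset[OF \<sigma>c sub]]) (use p in blast)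
  hence "continuous_on {s..t} (%r. ?T r (\<sigma>' r))" by (rule continuous_on_eq) (rule eq[symmetric])
  moreover have "((\<phi> c' \<circ> ?\<gamma>) has_vector_derivative ?T r (\<sigma>' r)) (at r within {s..t})" if r: "r \<in> {s..t}" for r
  proof -
   have "(\<sigma> has_vector_derivative \<sigma>' r) (at r within {s..t})"
    by (rule has_vector_derivative_within_subset[OF \<sigma>(2) sub]) (use r sub in blast)
   from has_derivative_compose[OF this[unfolded has_vector_derivative_def] T[OF r]] show ?thesis
    unfolding has_vector_derivative_def transition_def o_def
    by (simp add: linear_scale[OF has_derivative_linear[OF T[OF r], unfolded transition_def o_def]])
  qed
  ultimately show "\<exists>D. continuous_on {s..t} D & (\<forall>r\<in>{s..t}. ((\<phi> c' \<circ> ?\<gamma>) has_vector_derivative D r) (at r within {s..t}))"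
   by blast
 qed simp
 show "curve_length atlas g ?\<gamma> = integral {0..1} (%t. sqrt (g c (\<sigma> t) (\<sigma>' t) (\<sigma>' t)))" unfolding curve_length_def
 \<comment> \<open>At the end points of the interval the two-sided derivative in
   \<open>speed\<close> need not exist.\<close>
 proof (rule integral_spike[of "{0, 1}"])
  fix t :: real assume t: "t \<in> {0..1} - {0, 1}"
  hence t': "t \<in> {0..1}" "at t within {0..1} = at t" using at_within_Icc_at[of 0 t 1] by auto
  have in_img: "\<forall>\<^sub>F s in nhds t. s \<in> {0<..<1}" using t by (intro eventually_nhds_in_open) auto
  have "((\<phi> c \<circ> ?\<gamma>) has_vector_derivative \<sigma>' t) (at t)"
  proof -
   have ev: "\<forall>\<^sub>F s in nhds t. \<sigma> s = (\<phi> c \<circ> ?\<gamma>) s"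
    using in_img by eventually_elim (use chart_facts(6)[OF c \<sigma>(1)] in auto)
   have "(\<sigma> has_vector_derivative \<sigma>' t) (at t)" using \<sigma>(2)[OF t'(1)] unfolding t'(2) .
   thus ?thesis
   proof (rule iffD1[OF has_vector_derivative_cong_ev, rotated 2])
    show "\<forall>\<^sub>F s in nhds t. s \<in> UNIV --> \<sigma> s = (\<phi> c \<circ> ?\<gamma>) s" by (rule eventually_mono[OF ev]) (rule impI)
    show "\<sigma> t = (\<phi> c \<circ> ?\<gamma>) t" by (rule eventually_nhds_x_imp_x[OF ev])
   qed
  qed
  moreover have "isCont ?\<gamma> t" using \<gamma>c t by (intro continuous_on_interior[OF \<gamma>c]) auto
  ultimately have "speed atlas g ?\<gamma> t = sqrt (g c (\<phi> c (?\<gamma> t)) (\<sigma>' t) (\<sigma>' t))"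
   by (intro speed_eq[OF c]) (use chart_facts(7)[OF c \<sigma>(1)[OF t'(1)]] in auto)
  thus "sqrt (g c (\<sigma> t) (\<sigma>' t) (\<sigma>' t)) = speed atlas g ?\<gamma> t" using chart_facts(6)[OF c \<sigma>(1)[OF t'(1)]] by simp
 qed simp
qed

lemma piece:
 assumes c: "c \<in> atlas" and \<gamma>: "continuous_on {0..1} \<gamma>" and st: "0 <= s" "s < t" "t <= 1" "\<gamma> ` {s..t} \<subseteq> dom c"
  and D: "continuous_on {s..t} D" "!!r. r \<in> {s..t} ==> ((\<phi> c \<circ> \<gamma>) has_vector_derivative D r) (at r within {s..t})"
 shows "continuous_on {s..t} (%r. sqrt (g c (\<phi> c (\<gamma> r)) (D r) (D r)))"
  and "(speed atlas g \<gamma> has_integral integral {s..t} (%r. sqrt (g c (\<phi> c (\<gamma> r)) (D r) (D r)))) {s..t}"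
proof -
 interpret L: local_metric "img c" "g c" by (rule chart_metric[OF c])
 have \<gamma>c: "continuous_on {s..t} \<gamma>" by (rule continuous_on_subset[OF \<gamma>]) (use st in auto)
 have uc: "continuous_on {s..t} (%r. \<phi> c (\<gamma> r))" by (rule continuous_on_compose2[OF chart_facts(3)[OF c] \<gamma>c st(4)])
 show cont: "continuous_on {s..t} (%r. sqrt (g c (\<phi> c (\<gamma> r)) (D r) (D r)))"
  by (intro continuous_on_real_sqrt bilinear_field_continuous[where T = "g c" and V = "img c", OF L.bilinear_G L.G_cont uc _ D(1) D(1)])
   (use st(4) in auto)
 have "speed atlas g \<gamma> r = sqrt (g c (\<phi> c (\<gamma> r)) (D r) (D r))" if r: "r \<in> {s..t} - {s, t}" for r
 proof (rule speed_eq[OF c])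
  show "\<gamma> r \<in> dom c" using st(4) r by blast
  show "((\<phi> c \<circ> \<gamma>) has_vector_derivative D r) (at r)" using D(2)[of r] r at_within_Icc_at[of s r t] by auto
  show "isCont \<gamma> r" using r by (intro continuous_on_interior[OF \<gamma>c]) auto
 qed
 thus "(speed atlas g \<gamma> has_integral integral {s..t} (%r. sqrt (g c (\<phi> c (\<gamma> r)) (D r) (D r)))) {s..t}"
  by (intro has_integral_spike[OF _ _ integrable_integral[OF integrable_continuous_real[OF cont]], of "{s, t}"]) auto
qed

definition smooth_piece where "smooth_piece c \<gamma> s t \<longleftrightarrow> \<gamma> ` {s..t} \<subseteq> dom c &
  (\<exists>D. continuous_on {s..t} D & (\<forall>r\<in>{s..t}. ((\<phi> c \<circ> \<gamma>) has_vector_derivative D r) (at r within {s..t})))"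

text \<open>\<open>x\<close> may be a break point, so smoothness near \<open>x\<close> can be
  claimed only for intervals that have \<open>x\<close> as an end point.\<close>

lemma piecewise_near:
 assumes \<gamma>: "piecewise_C1_curve atlas \<gamma>" and c: "c \<in> atlas" "\<gamma> x \<in> dom c" and x: "x \<in> {0..1}"
 shows "\<exists>\<delta>>0. \<forall>s t. 0 <= s & s < t & t <= 1 & (s = x \<or> t = x) & t - s < \<delta> --> smooth_piece c \<gamma> s t"
proof -
 have \<gamma>c: "continuous_on {0..1} \<gamma>" using \<gamma> by (simp add: piecewise_C1_curve_def path_def)
 obtain P where P: "finite P" "!!c s t. c \<in> atlas ==> 0 <= s & s < t & t <= 1 & {s<..<t} \<inter> P = {} & \<gamma> ` {s..t} \<subseteq> dom c ==>
   \<exists>D. continuous_on {s..t} D & (\<forall>r\<in>{s..t}. ((\<phi> c \<circ> \<gamma>) has_vector_derivative D r) (at r within {s..t}))"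
 proof -
  from \<gamma> obtain P where "finite P" "\<forall>c\<in>atlas. \<forall>s t. 0 <= s & s < t & t <= 1 & {s<..<t} \<inter> P = {} & \<gamma> ` {s..t} \<subseteq> dom c -->
    (\<exists>D. continuous_on {s..t} D & (\<forall>r\<in>{s..t}. ((\<phi> c \<circ> \<gamma>) has_vector_derivative D r) (at r within {s..t})))"
   unfolding piecewise_C1_curve_def by (elim conjE exE)
  thus ?thesis by (intro that[of P]) simp_all
 qed
 have "open (- (P - {x}))" by (rule open_Compl[OF finite_imp_closed]) (use P(1) in simp)
 moreover have "x \<in> - (P - {x})" by simp
 ultimately obtain d1 where d1: "0 < d1" "ball x d1 \<subseteq> - (P - {x})" using open_contains_ball by blast
 obtain d2 where d2: "0 < d2" "!!y. y \<in> {0..1} ==> dist y x < d2 ==> \<gamma> y \<in> dom c"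
 proof -
  obtain e where e: "0 < e" "ball (\<gamma> x) e \<subseteq> dom c" using chart_facts(1)[OF c(1)] c(2) open_contains_ball by blast
  have "\<exists>d>0. \<forall>y\<in>{0..1}. dist y x < d --> dist (\<gamma> y) (\<gamma> x) < e" using \<gamma>c x e(1) unfolding continuous_on_iff by blast
  then obtain d where "0 < d" "!!y. y \<in> {0..1} ==> dist y x < d ==> dist (\<gamma> y) (\<gamma> x) < e" by blast
  thus ?thesis using e(2) by (intro that[of d]) (auto simp: dist_commute subset_iff)
 qed
 show ?thesis unfolding smooth_piece_def
 proof (intro exI[of _ "min d1 d2"] conjI allI impI)
  fix s t assume st: "0 <= s & s < t & t <= 1 & (s = x \<or> t = x) & t - s < min d1 d2"
  have near: "dist y x < min d1 d2" if "y \<in> {s..t}" for y using that st by (auto simp: dist_real_def)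
  show sub: "\<gamma> ` {s..t} \<subseteq> dom c"
  proof
   fix z assume "z \<in> \<gamma> ` {s..t}"
   then obtain y where y: "y \<in> {s..t}" "z = \<gamma> y" by blast
   thus "z \<in> dom c" using near[OF y(1)] st by (auto intro!: d2(2))
  qed
  have "{s<..<t} \<inter> P = {}"
  proof (rule ccontr)
   assume "{s<..<t} \<inter> P ~= {}"
   then obtain y where y: "y \<in> {s<..<t}" "y \<in> P" by blast
   hence "y \<in> ball x d1" "y ~= x" using near[of y] st by (auto simp: dist_commute)
   thus False using d1(2) y(2) by blast
  qed
  thus "\<exists>D. continuous_on {s..t} D & (\<forall>r\<in>{s..t}. ((\<phi> c \<circ> \<gamma>) has_vector_derivative D r) (at r within {s..t}))"
   using P(2)[OF c(1)] st sub by blast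
 qed (use d1 d2 in auto)
qed

text \<open>Bisection for additive properties of intervals. The local hypothesis concerns only
  intervals ending or starting at \<open>x\<close>, in accordance with
  \<open>piecewise_near\<close>; an interval around \<open>x\<close> is split there.\<close>

lemma local_to_interval:
 fixes Q :: "real => real => bool"
 assumes ab: "0 <= a" "a <= b" "b <= 1" and refl: "!!s. Q s s"
  and trans: "!!r s t. a <= r ==> r <= s ==> s <= t ==> t <= b ==> Q r s ==> Q s t ==> Q r t"
  and near: "!!x. x \<in> {a..b} ==> \<exists>\<delta>>0. \<forall>s t. a <= s & s < t & t <= b & (s = x \<or> t = x) & t - s < \<delta> --> Q s t"
 shows "Q a b"
proof -
 have "a <= a --> b <= b --> Q a b"
 proof (rule Bolzano[where P = "%s t. a <= s --> t <= b --> Q s t", OF ab(2)])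
  fix r s t assume "a <= r --> s <= b --> Q r s" "a <= s --> t <= b --> Q s t" "r <= s" "s <= t"
  thus "a <= r --> t <= b --> Q r t" using trans[of r s t] by auto
 next
  fix x assume "a <= x" "x <= b"
  then obtain \<delta> where \<delta>: "0 < \<delta>" "!!s t. a <= s & s < t & t <= b & (s = x \<or> t = x) & t - s < \<delta> ==> Q s t"
   using near[of x] by auto
  show "\<exists>d>0. \<forall>s t. s <= x & x <= t & t - s < d --> (a <= s --> t <= b --> Q s t)"
  proof (intro exI[of _ \<delta>] conjI allI impI \<delta>(1))
   fix s t assume st: "s <= x & x <= t & t - s < \<delta>" "a <= s" "t <= b"
   have "Q s x" using refl \<delta>(2)[of s x] st by (cases "s = x") auto
   moreover have "Q x t" using refl \<delta>(2)[of x t] st by (cases "x = t") auto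
   ultimately show "Q s t" using trans[of s x t] st by auto
  qed
 qed
 thus ?thesis by simp
qed

lemma speed_integrable:
 assumes \<gamma>: "piecewise_C1_curve atlas \<gamma>"
 shows "speed atlas g \<gamma> integrable_on {0..1}"
proof (rule local_to_interval[where Q = "%s t. speed atlas g \<gamma> integrable_on {s..t}"])
 have \<gamma>c: "continuous_on {0..1} \<gamma>" using \<gamma> by (simp add: piecewise_C1_curve_def path_def)
 show "speed atlas g \<gamma> integrable_on {r..t}" if "r <= s" "s <= t" "speed atlas g \<gamma> integrable_on {r..s}" "speed atlas g \<gamma> integrable_on {s..t}" for r s t
  by (rule Henstock_Kurzweil_Integration.integrable_combine[OF that])
 fix x :: real assume x: "x \<in> {0..1}"
 obtain c where c: "c \<in> atlas" "\<gamma> x \<in> dom c" using covering by (metis UNIV_I UN_E)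
 obtain \<delta> where \<delta>: "0 < \<delta>" "!!s t. 0 <= s & s < t & t <= 1 & (s = x \<or> t = x) & t - s < \<delta> ==> smooth_piece c \<gamma> s t"
  using piecewise_near[OF \<gamma> c x] by blast
 show "\<exists>\<delta>>0. \<forall>s t. 0 <= s & s < t & t <= 1 & (s = x \<or> t = x) & t - s < \<delta> --> speed atlas g \<gamma> integrable_on {s..t}"
 proof (intro exI[of _ \<delta>] conjI allI impI \<delta>(1))
  fix s t assume st: "0 <= s & s < t & t <= 1 & (s = x \<or> t = x) & t - s < \<delta>"
  obtain D where D: "\<gamma> ` {s..t} \<subseteq> dom c" "continuous_on {s..t} D"
   "!!r. r \<in> {s..t} ==> ((\<phi> c \<circ> \<gamma>) has_vector_derivative D r) (at r within {s..t})"
   using \<delta>(2)[OF st] unfolding smooth_piece_def by blast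
  show "speed atlas g \<gamma> integrable_on {s..t}" using piece(2)[OF c(1) \<gamma>c _ _ _ D(1,2)] D(3) st by (auto simp: integrable_on_def)
 qed
next
 show "speed atlas g \<gamma> integrable_on {s..s}" for s using integrable_on_refl[of "speed atlas g \<gamma>" s] by simp
qed auto

lemma lipschitz_along_curve:
 assumes \<gamma>: "piecewise_C1_curve atlas \<gamma>" and c: "c \<in> atlas" and T: "0 <= T" "T <= 1"
  and S: "S \<subseteq> img c" and in_S: "!!t. t \<in> {0..T} ==> \<gamma> t \<in> dom c & \<phi> c (\<gamma> t) \<in> S"
  and f: "!!p. p \<in> S ==> (f has_derivative f' p) (at p)" "!!p v. p \<in> S ==> \<bar>f' p v\<bar> <= sqrt (g c p v v)"
 shows "f (\<phi> c (\<gamma> T)) - f (\<phi> c (\<gamma> 0)) <= curve_length atlas g \<gamma>"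
proof -
 have \<gamma>c: "continuous_on {0..1} \<gamma>" using \<gamma> by (simp add: piecewise_C1_curve_def path_def)
 note int = speed_integrable[OF \<gamma>]
 have int': "speed atlas g \<gamma> integrable_on {s..t}" if "0 <= s" "t <= 1" for s t by (rule integrable_on_subinterval[OF int]) (use that in auto)
 have "f (\<phi> c (\<gamma> T)) - f (\<phi> c (\<gamma> 0)) <= integral {0..T} (speed atlas g \<gamma>)"
 proof (rule local_to_interval[where Q = "%s t. f (\<phi> c (\<gamma> t)) - f (\<phi> c (\<gamma> s)) <= integral {s..t} (speed atlas g \<gamma>)"])
  fix r s t assume *: "0 <= r" "r <= s" "s <= t" "t <= T"
   "f (\<phi> c (\<gamma> s)) - f (\<phi> c (\<gamma> r)) <= integral {r..s} (speed atlas g \<gamma>)"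
   "f (\<phi> c (\<gamma> t)) - f (\<phi> c (\<gamma> s)) <= integral {s..t} (speed atlas g \<gamma>)"
  thus "f (\<phi> c (\<gamma> t)) - f (\<phi> c (\<gamma> r)) <= integral {r..t} (speed atlas g \<gamma>)"
   using Henstock_Kurzweil_Integration.integral_combine[OF *(2,3) int'[of r t]] T by simp
 next
  fix x assume x: "x \<in> {0..T}"
  hence x': "x \<in> {0..1}" using T by auto
  obtain \<delta> where \<delta>: "0 < \<delta>" "!!s t. 0 <= s & s < t & t <= 1 & (s = x \<or> t = x) & t - s < \<delta> ==> smooth_piece c \<gamma> s t"
   using piecewise_near[OF \<gamma> c _ x'] in_S[OF x] by blast
  show "\<exists>\<delta>>0. \<forall>s t. 0 <= s & s < t & t <= T & (s = x \<or> t = x) & t - s < \<delta> -->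
   f (\<phi> c (\<gamma> t)) - f (\<phi> c (\<gamma> s)) <= integral {s..t} (speed atlas g \<gamma>)"
  proof (intro exI[of _ \<delta>] conjI allI impI \<delta>(1))
   fix s t assume st: "0 <= s & s < t & t <= T & (s = x \<or> t = x) & t - s < \<delta>"
   hence st': "0 <= s" "s < t" "t <= 1" "{s..t} \<subseteq> {0..T}" using T by auto
   obtain D where D: "\<gamma> ` {s..t} \<subseteq> dom c" "continuous_on {s..t} D"
    "!!r. r \<in> {s..t} ==> ((\<phi> c \<circ> \<gamma>) has_vector_derivative D r) (at r within {s..t})"
    using \<delta>(2)[of s t] st st' unfolding smooth_piece_def by blast
   note pc = piece[OF c \<gamma>c st'(1-3) D]
   have fu: "((%r. f (\<phi> c (\<gamma> r))) has_vector_derivative f' (\<phi> c (\<gamma> r)) (D r)) (at r within {s..t})" if r: "r \<in> {s..t}" for r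
   proof -
    have "\<phi> c (\<gamma> r) \<in> S" using in_S st'(4) r by blast
    note fd = f(1)[OF this]
    have fd': "(f has_derivative f' (\<phi> c (\<gamma> r))) (at ((\<phi> c \<circ> \<gamma>) r))" using fd by simp
    from has_derivative_compose[OF D(3)[OF r, unfolded has_vector_derivative_def] fd'] show ?thesis
     unfolding has_vector_derivative_def by (simp add: linear_scale[OF has_derivative_linear[OF fd]])
   qed
   have "((%r. f' (\<phi> c (\<gamma> r)) (D r)) has_integral f (\<phi> c (\<gamma> t)) - f (\<phi> c (\<gamma> s))) {s..t}"
    by (rule fundamental_theorem_of_calculus[OF _ fu]) (use st' in auto)
   moreover have "((%r. sqrt (g c (\<phi> c (\<gamma> r)) (D r) (D r))) has_integral integral {s..t} (%r. sqrt (g c (\<phi> c (\<gamma> r)) (D r) (D r)))) {s..t}"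
    by (rule integrable_integral[OF integrable_continuous_real[OF pc(1)]])
   ultimately have "f (\<phi> c (\<gamma> t)) - f (\<phi> c (\<gamma> s)) <= integral {s..t} (%r. sqrt (g c (\<phi> c (\<gamma> r)) (D r) (D r)))"
   proof (rule has_integral_le)
    fix r assume "r \<in> {s..t}"
    hence "\<phi> c (\<gamma> r) \<in> S" using in_S st'(4) by blast
    from f(2)[OF this, of "D r"] show "f' (\<phi> c (\<gamma> r)) (D r) <= sqrt (g c (\<phi> c (\<gamma> r)) (D r) (D r))" by linarith
   qed
   also have "\<dots> = integral {s..t} (speed atlas g \<gamma>)" using pc(2) by (simp add: integral_unique)
   finally show "f (\<phi> c (\<gamma> t)) - f (\<phi> c (\<gamma> s)) <= integral {s..t} (speed atlas g \<gamma>)" .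
  qed
 qed (use T in auto)
 also have "\<dots> <= curve_length atlas g \<gamma>"
  unfolding curve_length_def by (rule integral_subset_le[OF _ int' int]) (use T speed_nonneg in auto)
 finally show ?thesis .
qed

end

locale riemannian_distance = riemannian_manifold atlas g
 for atlas :: "('x::metric_space, 'e::euclidean_space) chart set" and g :: "('x, 'e) local_form" +
 assumes dist_eq: "dist x y = geodesic_dist atlas g x y"
begin

lemma chart_upper:
 assumes "c \<in> atlas" "!!t. t \<in> {0..1} ==> \<sigma> t \<in> img c"
  "!!t. t \<in> {0..1} ==> (\<sigma> has_vector_derivative \<sigma>' t) (at t within {0..1})" "continuous_on {0..1} \<sigma>'"
 shows "dist (\<psi> c (\<sigma> 0)) (\<psi> c (\<sigma> 1)) <= integral {0..1} (%t. sqrt (g c (\<sigma> t) (\<sigma>' t) (\<sigma>' t)))"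
proof -
 have "piecewise_C1_curve atlas (\<psi> c \<circ> \<sigma>)"
  and len: "curve_length atlas g (\<psi> c \<circ> \<sigma>) = integral {0..1} (%t. sqrt (g c (\<sigma> t) (\<sigma>' t) (\<sigma>' t)))"
  by (rule chart_curve[OF assms]; assumption)+
 from geodesic_dist_le[OF this(1)] show ?thesis unfolding len dist_eq by simp
qed

text \<open>Up to its first exit time \<open>T\<close> the curve stays in the chart. There
  \<open>m\<close> times the coordinate in the direction \<open>e\<close> of the displacement has
  gradient at most one, so \<open>lipschitz_along_curve\<close> bounds the length from
  below.\<close>

lemma length_ge_radius:
 assumes c: "c \<in> atlas" and R: "0 < R" "cball a R \<subseteq> img c" and m: "!!p v. p \<in> cball a R ==> m * norm v <= sqrt (g c p v v)" "0 <= m"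
  and \<gamma>: "piecewise_C1_curve atlas \<gamma>" and start: "\<gamma> 0 \<in> \<psi> c ` ball a R"
  and exit: "t \<in> {0..1}" "\<gamma> t \<notin> \<psi> c ` ball a R"
 shows "m * (R - dist a (\<phi> c (\<gamma> 0))) <= curve_length atlas g \<gamma>"
proof -
 note cf = chart_facts[OF c]
 have \<gamma>c: "continuous_on {0..1} \<gamma>" using \<gamma> by (simp add: piecewise_C1_curve_def path_def)
 let ?U = "\<psi> c ` ball a R"
 have "?U = dom c \<inter> \<phi> c -` ball a R"
 proof (intro equalityI subsetI)
  fix y assume "y \<in> ?U"
  then obtain p where p: "p \<in> ball a R" "y = \<psi> c p" by blast
  hence "p \<in> img c" using R(2) by auto
  thus "y \<in> dom c \<inter> \<phi> c -` ball a R" using cf(6,7) p by auto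
 next
  fix y assume y: "y \<in> dom c \<inter> \<phi> c -` ball a R"
  hence "y = \<psi> c (\<phi> c y)" using cf(5) by auto
  thus "y \<in> ?U" using y by blast
 qed
 hence open_U: "open ?U" using continuous_open_preimage[OF cf(3,1) open_ball] by simp
 define E where "E = {0..1} \<inter> \<gamma> -` (- ?U)"
 have "closed E" unfolding E_def using open_U by (intro continuous_closed_preimage[OF \<gamma>c]) auto
 moreover have "bounded E" unfolding E_def by (rule bounded_subset[of "{0..1}"]) auto
 ultimately have "compact E" by (simp add: compact_eq_bounded_closed)
 moreover have "E ~= {}" using exit unfolding E_def by blast
 ultimately obtain T where T: "T \<in> E" "!!s. s \<in> E ==> T <= s" using compact_attains_inf by metis
 have T01: "0 <= T" "T <= 1" and TU: "\<gamma> T \<notin> ?U" using T(1) unfolding E_def by auto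
 have "T ~= 0" using TU start by auto
 have "{0..<T} \<subseteq> {0..T} \<inter> \<gamma> -` (\<psi> c ` cball a R)"
 proof
  fix s assume s: "s \<in> {0..<T}"
  hence "s \<notin> E" using T(2)[of s] by auto
  hence "\<gamma> s \<in> ?U" using s T01 unfolding E_def by auto
  thus "s \<in> {0..T} \<inter> \<gamma> -` (\<psi> c ` cball a R)" using s by auto
 qed
 moreover have "closed ({0..T} \<inter> \<gamma> -` (\<psi> c ` cball a R))"
 proof (rule continuous_closed_preimage)
  show "continuous_on {0..T} \<gamma>" by (rule continuous_on_subset[OF \<gamma>c]) (use T01 in auto)
  have "compact (\<psi> c ` cball a R)" by (rule compact_continuous_image[OF continuous_on_subset[OF cf(4) R(2)] compact_cball])
  thus "closed (\<psi> c ` cball a R)" by (rule compact_imp_closed)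
 qed simp
 ultimately have "closure {0..<T} \<subseteq> {0..T} \<inter> \<gamma> -` (\<psi> c ` cball a R)" by (rule closure_minimal)
 moreover have "closure {0..<T} = {0..T}" using T01 \<open>T ~= 0\<close> by simp
 ultimately have in_cball: "\<gamma> s \<in> \<psi> c ` cball a R" if "s \<in> {0..T}" for s using that by auto
 have in_dom: "\<gamma> s \<in> dom c & \<phi> c (\<gamma> s) \<in> cball a R" if s: "s \<in> {0..T}" for s
 proof -
  obtain p where p: "p \<in> cball a R" "\<gamma> s = \<psi> c p" using in_cball[OF s] by blast
  thus ?thesis using cf(6,7)[of p] R(2) by auto
 qed
 have far: "R <= dist a (\<phi> c (\<gamma> T))"
 proof (rule ccontr)
  assume "\<not> R <= dist a (\<phi> c (\<gamma> T))"
  hence "\<phi> c (\<gamma> T) \<in> ball a R" by simp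
  moreover have "\<gamma> T = \<psi> c (\<phi> c (\<gamma> T))" using cf(5) in_dom[of T] T01 by auto
  ultimately show False using TU by blast
 qed
 define e where "e = sgn (\<phi> c (\<gamma> T) - \<phi> c (\<gamma> 0))"
 have e: "norm e <= 1" by (simp add: e_def norm_sgn)
 have "m * (\<phi> c (\<gamma> T) \<bullet> e) - m * (\<phi> c (\<gamma> 0) \<bullet> e) <= curve_length atlas g \<gamma>"
 proof (rule lipschitz_along_curve[OF \<gamma> c T01 R(2) in_dom, where f = "%p. m * (p \<bullet> e)" and f' = "%p v. m * (v \<bullet> e)"])
  show "((%p. m * (p \<bullet> e)) has_derivative (%v. m * (v \<bullet> e))) (at p)" for p by (auto intro!: derivative_eq_intros)
  fix p v assume p: "p \<in> cball a R"
  have "\<bar>v \<bullet> e\<bar> <= norm v * norm e" by (rule Cauchy_Schwarz_ineq2)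
  also have "\<dots> <= norm v * 1" by (rule mult_left_mono[OF e]) simp
  finally have "\<bar>m * (v \<bullet> e)\<bar> <= m * norm v" using m(2) by (simp add: abs_mult mult_left_mono)
  thus "\<bar>m * (v \<bullet> e)\<bar> <= sqrt (g c p v v)" using m(1)[OF p, of v] by linarith
 qed
 moreover have "m * (\<phi> c (\<gamma> T) \<bullet> e) - m * (\<phi> c (\<gamma> 0) \<bullet> e) = m * norm (\<phi> c (\<gamma> T) - \<phi> c (\<gamma> 0))"
 proof -
  have "(\<phi> c (\<gamma> T) - \<phi> c (\<gamma> 0)) \<bullet> e = norm (\<phi> c (\<gamma> T) - \<phi> c (\<gamma> 0))"
   by (cases "\<phi> c (\<gamma> T) = \<phi> c (\<gamma> 0)") (simp_all add: e_def sgn_div_norm dot_square_norm power2_eq_square)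
  thus ?thesis by (simp add: inner_diff_left right_diff_distrib flip: right_diff_distrib)
 qed
 moreover have "R - dist a (\<phi> c (\<gamma> 0)) <= norm (\<phi> c (\<gamma> T) - \<phi> c (\<gamma> 0))"
  using far dist_triangle[of a "\<phi> c (\<gamma> T)" "\<phi> c (\<gamma> 0)"] by (simp add: dist_norm norm_minus_commute)
 hence "m * (R - dist a (\<phi> c (\<gamma> 0))) <= m * norm (\<phi> c (\<gamma> T) - \<phi> c (\<gamma> 0))" by (rule mult_left_mono[OF _ m(2)])
 ultimately show ?thesis by linarith
qed

text \<open>\<open>f\<close> is controlled on the ball only. A curve that leaves the half ball has
  length at least \<open>m * R / 4\<close>, and \<open>R'\<close> is so small that
  \<open>f y - f x\<close> cannot exceed this.\<close>

lemma chart_lower: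
 assumes c: "c \<in> atlas" and R: "0 < R" "cball a R \<subseteq> img c"
 shows "\<exists>R'>0. R' <= R & (\<forall>f f'. (\<forall>x\<in>ball a R. (f has_derivative f' x) (at x) & (\<forall>v. \<bar>f' x v\<bar> <= sqrt (g c x v v))) -->
  (\<forall>x\<in>ball a R'. \<forall>y\<in>ball a R'. f y - f x <= dist (\<psi> c x) (\<psi> c y)))"
proof -
 note cf = chart_facts[OF c]
 obtain m C where m: "0 < m" "!!x v. x \<in> cball a R ==> m * norm v <= sqrt (g c x v v)"
  "!!x v. x \<in> cball a R ==> sqrt (g c x v v) <= C * norm v" by (rule local_metric.G_comparable[OF chart_metric[OF c] compact_cball R(2)]) blast
 define M where "M = \<bar>C\<bar> + 1"
 have M: "0 < M" "sqrt (g c x v v) <= M * norm v" if "x \<in> cball a R" for x v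
 proof -
  have "C * norm v <= M * norm v" by (rule mult_right_mono) (auto simp: M_def)
  thus "sqrt (g c x v v) <= M * norm v" using m(3)[OF that, of v] by linarith
 qed (simp add: M_def)
 have M0: "0 < M" by (simp add: M_def)
 define R' where "R' = min (R / 4) (m * R / (8 * M))"
 have R': "0 < R'" "R' <= R / 4" "2 * M * R' <= m * R / 4"
 proof -
  have "2 * M * R' <= 2 * M * (m * R / (8 * M))" by (rule mult_left_mono) (use M0 in "auto simp: R'_def")
  thus "2 * M * R' <= m * R / 4" using M0 by (simp add: field_simps)
 qed (use R(1) m(1) M0 in "auto simp: R'_def")
 show ?thesis
 proof (intro exI[of _ R'] conjI allI impI ballI R'(1))
  show "R' <= R" using R'(2) R(1) by linarith
  fix f :: "'e => real" and f' x y
  assume "\<forall>x\<in>ball a R. (f has_derivative f' x) (at x) & (\<forall>v. \<bar>f' x v\<bar> <= sqrt (g c x v v))"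
  hence f: "!!x. x \<in> ball a R ==> (f has_derivative f' x) (at x)" "!!x v. x \<in> ball a R ==> \<bar>f' x v\<bar> <= sqrt (g c x v v)" by blast+
  assume xy: "x \<in> ball a R'" "y \<in> ball a R'"
  hence xyR: "x \<in> ball a R" "y \<in> ball a R" using R' R(1) by auto
  have "norm (f y - f x) <= M * norm (y - x)"
  proof (rule differentiable_bound[of "ball a R" f f' M, OF convex_ball _ _ xyR(2,1)])
   show "(f has_derivative f' z) (at z within ball a R)" if "z \<in> ball a R" for z by (rule has_derivative_at_withinI[OF f(1)[OF that]])
   show "onorm (f' z) <= M" if z: "z \<in> ball a R" for z
   proof (rule onorm_le)
    show "norm (f' z v) <= M * norm v" for v using f(2)[OF z, of v] M(2)[of z v] z by auto
   qed
  qed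
  also have "\<dots> <= M * (2 * R')"
  proof (rule mult_left_mono)
   show "norm (y - x) <= 2 * R'" using xy dist_triangle_less_add[of y a R' x R'] by (simp add: dist_norm norm_minus_commute)
  qed (use M0 in simp)
  finally have small: "f y - f x <= m * R / 4" using R'(3) by (simp add: mult.assoc mult.left_commute)
  have seg: "(1 - t) *R x + t *R y \<in> img c" if "t \<in> {0..1}" for t
  proof -
   have "(1 - t) *R x + t *R y \<in> ball a R" by (rule convexD_alt[OF convex_ball xyR]) (use that in auto)
   thus ?thesis using R(2) by auto
  qed
  have dv: "((%t. (1 - t) *R x + t *R y) has_vector_derivative (y - x)) (at t within {0..1})" for t by (auto intro!: derivative_eq_intros)
  have curve: "piecewise_C1_curve atlas (\<psi> c \<circ> (%t. (1 - t) *R x + t *R y))" by (rule chart_curve(1)[OF c seg dv]) auto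
  show "f y - f x <= dist (\<psi> c x) (\<psi> c y)" unfolding dist_eq geodesic_dist_def
  proof (rule cInf_greatest)
   have "pathstart (\<psi> c \<circ> (%t. (1 - t) *R x + t *R y)) = \<psi> c x" "pathfinish (\<psi> c \<circ> (%t. (1 - t) *R x + t *R y)) = \<psi> c y"
    by (auto simp: pathstart_def pathfinish_def)
   thus "{curve_length atlas g \<gamma> |\<gamma>. piecewise_C1_curve atlas \<gamma> & pathstart \<gamma> = \<psi> c x & pathfinish \<gamma> = \<psi> c y} ~= {}"
    using curve by blast
   fix l assume "l \<in> {curve_length atlas g \<gamma> |\<gamma>. piecewise_C1_curve atlas \<gamma> & pathstart \<gamma> = \<psi> c x & pathfinish \<gamma> = \<psi> c y}"
   then obtain \<gamma> where \<gamma>: "piecewise_C1_curve atlas \<gamma>" "\<gamma> 0 = \<psi> c x" "\<gamma> 1 = \<psi> c y" and l: "l = curve_length atlas g \<gamma>"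
    by (auto simp: pathstart_def pathfinish_def)
   have "x \<in> img c" "y \<in> img c" using xyR ball_subset_cball R(2) by blast+
   hence \<phi>xy: "\<phi> c (\<gamma> 0) = x" "\<phi> c (\<gamma> 1) = y" using \<gamma>(2,3) cf(6) by simp_all
   show "f y - f x <= l"
   proof (cases "\<forall>t\<in>{0..1}. \<gamma> t \<in> \<psi> c ` ball a (R / 2)")
    case True
    have in_dom: "\<gamma> t \<in> dom c & \<phi> c (\<gamma> t) \<in> ball a R" if t: "t \<in> {0..1}" for t
    proof -
     obtain p where p: "p \<in> ball a (R / 2)" "\<gamma> t = \<psi> c p" using True t by blast
     hence pR: "p \<in> ball a R" using R(1) by auto
     hence "p \<in> img c" using ball_subset_cball R(2) by blast
     thus ?thesis using cf(6,7) p(2) pR by simp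
    qed
    have sub: "ball a R \<subseteq> img c" using R(2) by auto
    show ?thesis using lipschitz_along_curve[OF \<gamma>(1) c zero_le_one order_refl sub in_dom f] unfolding l \<phi>xy by simp
   next case False
    then obtain t where t: "t \<in> {0..1}" "\<gamma> t \<notin> \<psi> c ` ball a (R / 2)" by blast
    have "x \<in> ball a (R / 2)" using xy R' R(1) by auto
    hence start: "\<gamma> 0 \<in> \<psi> c ` ball a (R / 2)" using \<gamma>(2) by blast
    have h: "0 < R / 2" "cball a (R / 2) \<subseteq> img c" using R by auto
    have "m * (R / 2 - dist a (\<phi> c (\<gamma> 0))) <= l"
     unfolding l by (rule length_ge_radius[OF c h m(2) _ \<gamma>(1) start t]) (use m(1) R(1) in auto)
    moreover have "m * (R / 4) <= m * (R / 2 - dist a (\<phi> c (\<gamma> 0)))" by (rule mult_left_mono) (use m(1) xy(1) R' \<phi>xy in auto)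
    ultimately show ?thesis using small by simp
   qed
  qed
 qed
qed

end

section \<open>From charts to the whole manifold\<close>

text \<open>The axioms of a convex geodesic space, for points of a region. The witnesses may lie outside.\<close>

locale convex_region =
 fixes B :: "'x::metric_space set" and r :: real
 assumes region_frac: "p \<in> B ==> q \<in> B ==> 0 <= s ==> s <= 1 ==> \<exists>z. frac_point s p q z"
  and region_extension: "p \<in> B ==> q \<in> B ==> p ~= q ==> 0 <= t ==> t < r ==>
   \<exists>z. dist q z = t & dist p z = dist p q + t"
  and region_unique: "{p, q, z, z'} \<subseteq> B ==> p ~= q ==> dist q z = t ==> dist p z = dist p q + t ==>
   dist q z' = t ==> dist p z' = dist p q + t ==> z = z'"
  and region_convex: "{p, p', q, q', m, n} \<subseteq> B ==> 0 <= s ==> s <= 1 ==> frac_point s p p' m ==> frac_point s q q' n ==>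
   dist m n <= (1 - s) * dist p q + s * dist p' q'"
  and region_strict: "{p, p', q, q', m, n} \<subseteq> B ==> 0 < s ==> s < 1 ==> frac_point s p p' m ==> frac_point s q q' n ==>
   \<not> collinear3 p p' q ==> dist m n < (1 - s) * dist p q + s * dist p' q'"
  and region_noncollinear: "p \<in> B ==> q \<in> B ==> p ~= q ==> 0 < e ==> \<exists>z. dist p z < e & \<not> collinear3 p q z"

text \<open>A Lebesgue number argument. All points in an instance of the axioms lie within
  \<open>4 * r\<close> of \<open>p\<close>, and the factor \<open>8\<close> makes
  \<open>4 * r\<close> at most half of the radius of a region whose half ball contains
  \<open>p\<close>.\<close>

lemma convex_geodesic_spaceI:
 assumes comp: "compact (UNIV :: 'x::metric_space set)" and conn: "connected (UNIV :: 'x set)"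
  and loc: "!!x :: 'x. \<exists>r>0. convex_region (ball x r) r"
 shows "\<exists>r. convex_geodesic_space TYPE('x) r"
proof -
 obtain \<delta> where \<delta>: "!!x :: 'x. 0 < \<delta> x" "!!x :: 'x. convex_region (ball x (\<delta> x)) (\<delta> x)" using loc by metis
 have cover: "UNIV \<subseteq> (\<Union>x\<in>UNIV. ball x (\<delta> x / 2))" using \<delta>(1) by (auto intro: centre_in_ball[THEN iffD2])
 obtain C where C: "C \<subseteq> UNIV" "finite C" "UNIV \<subseteq> (\<Union>x\<in>C. ball x (\<delta> x / 2))"
  by (rule compactE_image[OF comp _ cover]) auto
 hence "C ~= {}" by auto
 define r where "r = Min (\<delta> ` C) / 8"
 have r: "0 < r" using C \<delta>(1) \<open>C ~= {}\<close> by (simp add: r_def)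
 have reg: "\<exists>B t. convex_region B t & ball p (4 * r) \<subseteq> B & r <= t" for p :: 'x
 proof -
  obtain x where x: "x \<in> C" "p \<in> ball x (\<delta> x / 2)" using C(3) by blast
  have "Min (\<delta> ` C) <= \<delta> x" using x(1) C(2) by (intro Min_le) auto
  hence le: "4 * r <= \<delta> x / 2" "r <= \<delta> x" using \<delta>(1)[of x] by (auto simp: r_def)
  have "ball p (4 * r) \<subseteq> ball x (\<delta> x)"
  proof
   fix y assume "y \<in> ball p (4 * r)"
   thus "y \<in> ball x (\<delta> x)" using x(2) le dist_triangle[of x y p] by simp
  qed
  thus ?thesis using \<delta>(2) le(2) by blast
 qed
 have frac: "dist p z <= dist p q" if "frac_point s p q z" "0 <= s" "s <= 1" for s and p q z :: 'x
  using that mult_right_mono[of s 1 "dist p q"] by (simp add: frac_point_def)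
 have near: "{p, p', q, q', m, n} \<subseteq> ball p (4 * r)"
  if "dist p p' < r" "dist p q < r" "dist p q' < r" "0 <= s" "s <= 1" "frac_point s p p' m" "frac_point s q q' n" for p p' q q' m n :: 'x and s
  using that(1-3) frac[OF that(6,4,5)] frac[OF that(7,4,5)] r dist_triangle[of p n q] dist_triangle3[of q q' p] by auto
 have "convex_geodesic_space TYPE('x) r"
 proof (rule convex_geodesic_space.intro[OF r comp conn])
  fix p q :: 'x and s t e :: real assume pq: "dist p q < r"
  obtain B t' where B: "convex_region B t'" "ball p (4 * r) \<subseteq> B" "r <= t'" using reg by blast
  have pB: "p \<in> B" "q \<in> B" using B(2) pq r by auto
  show "0 <= s ==> s <= 1 ==> \<exists>z. frac_point s p q z" by (rule convex_region.region_frac[OF B(1) pB])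
  assume ne: "p ~= q"
  show "0 < e ==> \<exists>z. dist p z < e & \<not> collinear3 p q z" by (rule convex_region.region_noncollinear[OF B(1) pB ne])
  assume t: "t < r"
  thus "0 <= t ==> \<exists>z. dist q z = t & dist p z = dist p q + t" using convex_region.region_extension[OF B(1) pB ne, of t] B(3) by simp
  fix z z' assume z: "dist q z = t" "dist p z = dist p q + t" "dist q z' = t" "dist p z' = dist p q + t"
  hence "{p, q, z, z'} \<subseteq> ball p (4 * r)" using pq t r by auto
  thus "z = z'" by (rule convex_region.region_unique[OF B(1) subset_trans[OF _ B(2)] ne z])
 next
  fix p p' q q' m n :: 'x and s :: real
  assume *: "dist p p' < r" "dist p q < r" "dist p q' < r" and f: "frac_point s p p' m" "frac_point s q q' n"
  obtain B t' where B: "convex_region B t'" "ball p (4 * r) \<subseteq> B" "r <= t'" using reg by blast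
  have inB: "{p, p', q, q', m, n} \<subseteq> B" if "0 <= s" "s <= 1" using near[OF * that f] B(2) by blast
  show "0 <= s ==> s <= 1 ==> dist m n <= (1 - s) * dist p q + s * dist p' q'" using convex_region.region_convex[OF B(1) inB _ _ f] by blast
  show "0 < s ==> s < 1 ==> \<not> collinear3 p p' q ==> dist m n < (1 - s) * dist p q + s * dist p' q'"
   using convex_region.region_strict[OF B(1) inB _ _ f] by simp
 qed
 thus ?thesis ..
qed

context riemannian_distance
begin

lemma convex_region_exists:
 fixes x0 :: 'x
 assumes neg: "negative_sectional_curvature atlas g" and dim: "2 <= DIM('e)"
 shows "\<exists>r>0. convex_region (ball x0 r) r"
proof -
 obtain c where c: "c \<in> atlas" "x0 \<in> dom c" using covering by (metis UNIV_I UN_E)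
 note cf = chart_facts[OF c(1)]
 define a where "a = \<phi> c x0"
 have a: "a \<in> img c" using c(2) by (simp add: a_def)
 have ncm: "negatively_curved_metric (img c) (g c)" by (rule negatively_curved_metric.intro[OF chart_metric[OF c(1)]], unfold_locales)
   (use neg c(1) in "unfold negative_sectional_curvature_def, blast")
 obtain \<tau> \<rho> where \<tau>\<rho>: "0 < \<tau>" "cball (a, 0 :: 'e) \<rho> \<subseteq> img c \<times> UNIV"
  "small_vector_field (local_metric.spray (g c) \<tau>) (local_metric.dspray (g c) \<tau>) (a, 0) \<rho>"
  by (rule local_metric.geodesic_flow_exists[OF chart_metric[OF c(1)] a]) blast
 interpret F: geodesic_flow "img c" "g c" \<tau> \<rho> a
  by (rule geodesic_flow.intro[OF ncm \<tau>\<rho>(3)], unfold_locales) (use \<tau>\<rho> in auto)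
 obtain r1 W h h' where chart: "0 < r1" "ball a r1 \<times> ball (0 :: 'e) r1 \<subseteq> ball (a, 0) (\<rho> / 2)" "open W" "(a, a) \<in> W"
  "!!y. y \<in> W ==> h y \<in> ball a r1 \<times> ball 0 r1" "!!y. y \<in> W ==> F.ex (h y) = y"
  "!!z. z \<in> ball a r1 \<times> ball 0 r1 ==> F.ex z \<in> W" "!!z. z \<in> ball a r1 \<times> ball 0 r1 ==> h (F.ex z) = z"
  "!!y. y \<in> W ==> (h has_derivative h' y) (at y)" "!!k. continuous_on W (%y. h' y k)"
  "!!y k. y \<in> W ==> blinfun_apply (F.dex (h y)) (h' y k) = k"
 proof (rule F.exponential_chart, goal_cases)
  case (1 r1 W h h')
  show ?case by (rule 1(1)[OF 1(2-)])
 qed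
 define d where "d = (%p q. dist (\<psi> c p) (\<psi> c q))"
 have d_axioms: "d x y = d y x" "d x w <= d x y + d y w" "d x x = 0" for x y w unfolding d_def by (rule dist_commute dist_triangle dist_self)+
 have d_eq: "p = q" if "p \<in> img c" "q \<in> img c" "d p q = 0" for p q
 proof -
  have "\<psi> c p = \<psi> c q" using that(3) by (simp add: d_def)
  from arg_cong[OF this, of "\<phi> c"] show ?thesis unfolding cf(6)[OF that(1)] cf(6)[OF that(2)] .
 qed
 interpret D: geodesic_distance "img c" "g c" \<tau> \<rho> a r1 W h h' d
  by (rule geodesic_distance.intro[OF F.geodesic_flow_axioms geodesic_distance_axioms.intro])
   (fact chart d_axioms d_eq | (unfold d_def)?, (rule chart_upper[OF c(1)] chart_lower[OF c(1)]; assumption))+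
 obtain R' \<kappa> r5 \<eta> where rad: "0 < R'" "R' <= r1" "!!x y. x \<in> ball a R' ==> y \<in> ball a R' ==> (x, y) \<in> W"
  "!!x y. x \<in> ball a R' ==> y \<in> ball a R' ==> d x y = D.len (h (x, y))"
  "\<kappa> <= R'" "!!z s. fst z \<in> ball a \<kappa> ==> snd z \<in> ball 0 \<kappa> ==> s \<in> {0..1} ==> F.pos z s \<in> ball a R'"
  "0 < r5" "r5 <= \<kappa>" "0 < \<eta>" "!!x v. x \<in> ball a r5 ==> D.len (x, v) < \<eta> ==> norm v < \<kappa>"
  "!!x y. x \<in> ball a r5 ==> y \<in> ball a r5 ==> d x y < \<eta> / 2"
 proof (rule D.normal_radii, goal_cases)
  case (1 R' \<kappa> r5 \<eta>)
  show ?case by (rule 1(1)[OF 1(2-)])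
 qed
 interpret B: normal_ball "img c" "g c" \<tau> \<rho> a r1 W h h' d R' \<kappa> r5 \<eta>
  by (rule normal_ball.intro[OF D.geodesic_distance_axioms normal_ball_axioms.intro]) (fact rad)+
 let ?U = "dom c \<inter> \<phi> c -` ball a (r5 / 2)"
 have "open ?U" by (rule continuous_open_preimage[OF cf(3,1) open_ball])
 moreover have "x0 \<in> ?U" using c(2) rad(7) by (simp add: a_def)
 ultimately obtain r0 where r0: "0 < r0" "ball x0 r0 \<subseteq> ?U" using open_contains_ball by blast
 \<comment> \<open>\<open>r \<le> \<eta> / 2\<close> is what \<open>B.extension_exists\<close>
   requires of the length of an extension.\<close>
 define r where "r = min r0 (\<eta> / 2)"
 have r: "0 < r" "r <= \<eta> / 2" using r0(1) rad(9) by (auto simp: r_def)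
 have coord: "\<psi> c (\<phi> c y) = y" "\<phi> c y \<in> ball a (r5 / 2)" "\<phi> c y \<in> ball a r5" if "y \<in> ball x0 r" for y
 proof -
  have "y \<in> ball x0 r0" using that by (simp add: r_def)
  hence "y \<in> ?U" using r0(2) by blast
  thus "\<psi> c (\<phi> c y) = y" "\<phi> c y \<in> ball a (r5 / 2)" using cf(5) by auto
  thus "\<phi> c y \<in> ball a r5" using rad(7) by simp
 qed
 have dist_d: "dist y z = d (\<phi> c y) (\<phi> c z)" if "y \<in> ball x0 r" "z \<in> ball x0 r" for y z using coord(1) that by (simp add: d_def)
 have dist_\<psi>: "dist y (\<psi> c w) = d (\<phi> c y) w" if "y \<in> ball x0 r" for y w using coord(1) that by (simp add: d_def)
 have inj: "y = z" if "y \<in> ball x0 r" "z \<in> ball x0 r" "\<phi> c y = \<phi> c z" for y z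
  using arg_cong[OF that(3), of "\<psi> c"] unfolding coord(1)[OF that(1)] coord(1)[OF that(2)] .
 have frac: "\<phi> c m = F.pos (h (\<phi> c p, \<phi> c q)) s"
  if "p \<in> ball x0 r" "q \<in> ball x0 r" "m \<in> ball x0 r" "0 <= s" "s <= 1" "frac_point s p q m" for p q m s
  by (rule B.frac_point_pos[OF coord(3)[OF that(1)] coord(3)[OF that(3)] coord(3)[OF that(2)]]) (use that in "auto simp: frac_point_def dist_d")
 have "convex_region (ball x0 r) r"
 proof
  fix p q s assume pq: "p \<in> ball x0 r" "q \<in> ball x0 r" and s: "0 <= s" "s <= (1 :: real)"
  note gg = B.good_g[OF coord(3)[OF pq(1)] coord(3)[OF pq(2)]]
  let ?w = "F.pos (h (\<phi> c p, \<phi> c q)) s"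
  have "d (\<phi> c p) ?w = s * d (\<phi> c p) (\<phi> c q)" "d ?w (\<phi> c q) = (1 - s) * d (\<phi> c p) (\<phi> c q)"
   using B.geodesic_distance[OF gg(1), of 0 s] B.geodesic_distance[OF gg(1), of s 1] s gg(3-5) by simp_all
  hence "frac_point s p q (\<psi> c ?w)"
   using dist_\<psi>[OF pq(1)] dist_\<psi>[OF pq(2)] dist_d[OF pq] D.d_sym by (simp add: frac_point_def dist_commute)
  thus "\<exists>z. frac_point s p q z" ..
 next
  fix p q t assume pq: "p \<in> ball x0 r" "q \<in> ball x0 r" and ne: "p ~= q" and t: "0 <= t" "t < r"
  have "\<phi> c p ~= \<phi> c q" using inj[OF pq] ne by blast
  moreover have "t < \<eta> / 2" using t r by linarith
  ultimately obtain w where "d (\<phi> c q) w = t" "d (\<phi> c p) w = d (\<phi> c p) (\<phi> c q) + t"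
   using B.extension_exists[OF coord(3)[OF pq(1)] coord(3)[OF pq(2)] _ t(1)] by blast
  hence "dist q (\<psi> c w) = t & dist p (\<psi> c w) = dist p q + t" using dist_\<psi> dist_d pq by simp
  thus "\<exists>z. dist q z = t & dist p z = dist p q + t" ..
 next
  fix p q z z' t assume sub: "{p, q, z, z'} \<subseteq> ball x0 r" and ne: "p ~= q"
   and *: "dist q z = t" "dist p z = dist p q + t" "dist q z' = t" "dist p z' = dist p q + t"
  have B: "p \<in> ball x0 r" "q \<in> ball x0 r" "z \<in> ball x0 r" "z' \<in> ball x0 r" using sub by blast+
  have "\<phi> c p ~= \<phi> c q" using inj[OF B(1,2)] ne by blast
  hence "\<phi> c z = \<phi> c z'"
   using B.extension_unique[OF coord(3)[OF B(1)] coord(3)[OF B(2)] coord(3)[OF B(3)] coord(3)[OF B(4)]] * B dist_d by simp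
  thus "z = z'" by (rule inj[OF B(3,4)])
 next
  fix p p' q q' m n and s :: real
  assume sub: "{p, p', q, q', m, n} \<subseteq> ball x0 r" and fp: "frac_point s p p' m" "frac_point s q q' n"
  have B: "p \<in> ball x0 r" "p' \<in> ball x0 r" "q \<in> ball x0 r" "q' \<in> ball x0 r" "m \<in> ball x0 r" "n \<in> ball x0 r"
   using sub by blast+
  note mn = frac[OF B(1,2,5) _ _ fp(1)] frac[OF B(3,4,6) _ _ fp(2)]
  note cv = B.convexity_pos[OF coord(3)[OF B(1)] coord(3)[OF B(2)] coord(3)[OF B(3)] coord(3)[OF B(4)], of s]
  show "0 <= s ==> s <= 1 ==> dist m n <= (1 - s) * dist p q + s * dist p' q'" using cv(1) B dist_d mn by simp
  assume s: "0 < s" "s < 1" and nc: "\<not> collinear3 p p' q"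
  have "\<not> B.dcollinear (\<phi> c p) (\<phi> c p') (\<phi> c q)" using nc B dist_d by (simp add: collinear3_def B.dcollinear_def)
  moreover have "\<phi> c p ~= \<phi> c p'"
  proof
   assume "\<phi> c p = \<phi> c p'"
   hence "p = p'" by (rule inj[OF B(1,2)])
   thus False using nc by (simp add: collinear3_def)
  qed
  ultimately show "dist m n < (1 - s) * dist p q + s * dist p' q'" using cv(2) s B dist_d mn by simp
 next
  fix p q and e :: real assume pq: "p \<in> ball x0 r" "q \<in> ball x0 r" and e: "0 < e" and ne: "p ~= q"
  have "\<phi> c p ~= \<phi> c q" using inj[OF pq] ne by blast
  then obtain w where w: "d (\<phi> c p) w < e" "\<not> B.dcollinear (\<phi> c p) (\<phi> c q) w"
   using B.noncollinear_exists[OF dim coord(2)[OF pq(1)] coord(3)[OF pq(2)] _ e] by blast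
  have "dist p (\<psi> c w) < e & \<not> collinear3 p q (\<psi> c w)"
   using w dist_\<psi>[OF pq(1)] dist_\<psi>[OF pq(2)] dist_d[OF pq] dist_d[OF pq(2,1)] D.d_sym
   by (simp add: collinear3_def B.dcollinear_def dist_commute[of "\<psi> c w"])
  thus "\<exists>z. dist p z < e & \<not> collinear3 p q z" ..
 qed
 thus ?thesis using r(1) by blast
qed

end

text \<open>In dimension one the curvature condition is vacuous, and the rotations of a circle have
  infinite orbits; hence the bound on the dimension.\<close>

theorem theorem5p1:
  fixes atlas :: "('x::metric_space, 'e::euclidean_space) chart set"
    and g :: "('x, 'e) local_form"
    and \<Delta> :: "'a::cstar_algebra \<Rightarrow> ('a, 'a) min_tensor"
    and \<rho> :: "'x cfun \<Rightarrow> ('x cfun, 'a) min_tensor"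
  assumes "riemannian_manifold atlas g"
    and "compact (UNIV :: 'x set)" and "connected (UNIV :: 'x set)"
    and "2 \<le> DIM('e)"
    and "\<And>x y. dist x y = geodesic_dist atlas g x y"
    and "compact_quantum_group \<Delta>" and "reduced_quantum_group \<Delta>"
    and "quantum_action \<Delta> \<rho>" and "faithful_action \<rho>" and "isometric_action \<Delta> \<rho>"
    and "negative_sectional_curvature atlas g"
  shows "\<forall>x. finite (orbit \<Delta> \<rho> x)"
proof
  fix x
  interpret riemannian_distance atlas g
    by (intro riemannian_distance.intro riemannian_distance_axioms.intro assms)
  obtain r where "convex_geodesic_space TYPE('x) r"
    using convex_geodesic_spaceI[OF assms(2,3) convex_region_exists[OF assms(11,4)]] by blast
  then show "finite (orbit \<Delta> \<rho> x)"
    by (rule finite_orbit_of_convex_geodesic_space[OF _ assms(7,8,10)])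
qed

end
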